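(* Let $\Omega\subset\mathbb R^n$ be a bounded domain, $T>0$, $Q=\Omega\times(0,T)$, $N\ge1$. Assume $\boldsymbol f\in L^2(Q)^N$ (independent of the unknown) and $\boldsymbol u_0\in\mathbb K$. Then the variational inequality: $\boldsymbol u(t)\in\mathbb K$ for a.e. $t\in(0,T)$, $\boldsymbol u(0)=\boldsymbol u_0$, and for a.e. $t\in(0,T)$ $$\int_\Omega\partial_t\boldsymbol u(t)\cdot(\boldsymbol v-\boldsymbol u(t))+\int_\Omega\nabla\boldsymbol u(t)\cdot\nabla(\boldsymbol v-\boldsymbol u(t))\ge\int_\Omega\boldsymbol f(t)\cdot(\boldsymbol v-\boldsymbol u(t))\qquad\forall\,\boldsymbol v\in\mathbb K,$$ has a unique solution $\boldsymbol u$, and it satisfies $\boldsymbol u\in H^1(0,T;L^2(\Omega)^N)\cap L^\infty(0,T;H^1(\Omega)^N)$ and $P\boldsymbol u\in L^2(Q)^N$.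
   Context: $\mathbb K=\{\boldsymbol v\in H^1(\Omega)^N:\ \sum_{j=1}^N v_j\le 1,\ v_i\ge0\ (i=1,\dots,N)\ \text{a.e. in }\Omega\}$. $P\boldsymbol u=\partial_t\boldsymbol u-\Delta\boldsymbol u$, taken componentwise. *)

theory Defs
  imports "HOL-Analysis.Analysis"
begin

coinductive smooth :: "('a::euclidean_space \<Rightarrow> real) \<Rightarrow> bool" where
  "(\<And>x. \<phi> differentiable (at x)) \<Longrightarrow>
   (\<And>b. b \<in> Basis \<Longrightarrow> smooth (\<lambda>x. frechet_derivative \<phi> (at x) b)) \<Longrightarrow> smooth \<phi>"

definition pd :: "('a::euclidean_space \<Rightarrow> real) \<Rightarrow> 'a \<Rightarrow> 'a \<Rightarrow> real" where
  "pd \<phi> d x = frechet_derivative \<phi> (at x) d"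

definition tsupp :: "('a::euclidean_space \<Rightarrow> real) \<Rightarrow> 'a set" where
  "tsupp \<phi> = closure {x. \<phi> x \<noteq> 0}"

definition test_fun :: "'a::euclidean_space set \<Rightarrow> ('a \<Rightarrow> real) \<Rightarrow> bool" where
  "test_fun U \<phi> \<longleftrightarrow> smooth \<phi> \<and> compact (tsupp \<phi>) \<and> tsupp \<phi> \<subseteq> U"

definition L2 :: "'a::euclidean_space set \<Rightarrow> ('a \<Rightarrow> real) \<Rightarrow> bool" where
  "L2 S g \<longleftrightarrow> g \<in> borel_measurable (lebesgue_on S) \<and> integrable (lebesgue_on S) (\<lambda>x. (g x)^2)"

definition weak_pd :: "'a::euclidean_space set \<Rightarrow> 'a \<Rightarrow> ('a \<Rightarrow> real) \<Rightarrow> ('a \<Rightarrow> real) \<Rightarrow> bool" where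
  "weak_pd S d g G \<longleftrightarrow>
     (\<forall>\<phi>. test_fun S \<phi> \<longrightarrow>
        (LINT x|lebesgue_on S. g x * pd \<phi> d x) = - (LINT x|lebesgue_on S. G x * \<phi> x))"

text \<open>The (a.e. unique) square-integrable weak derivative.\<close>
definition wpd :: "'a::euclidean_space set \<Rightarrow> 'a \<Rightarrow> ('a \<Rightarrow> real) \<Rightarrow> 'a \<Rightarrow> real" where
  "wpd S d g = (SOME G. L2 S G \<and> weak_pd S d g G)"

definition H1 :: "'a::euclidean_space set \<Rightarrow> ('a \<Rightarrow> real) \<Rightarrow> bool" where
  "H1 S g \<longleftrightarrow> L2 S g \<and> (\<forall>b\<in>Basis. \<exists>G. L2 S G \<and> weak_pd S b g G)"

definition H1norm2 :: "'a::euclidean_space set \<Rightarrow> ('a \<Rightarrow> real) \<Rightarrow> real" where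
  "H1norm2 S g = (LINT x|lebesgue_on S. (g x)^2) + (\<Sum>b\<in>Basis. LINT x|lebesgue_on S. (wpd S b g x)^2)"

definition simplexK :: "'a::euclidean_space set \<Rightarrow> ('a \<Rightarrow> real^'m) set" where
  "simplexK \<Omega> = {v. (\<forall>i. H1 \<Omega> (\<lambda>x. v x $ i)) \<and>
      (AE x in lebesgue_on \<Omega>. (\<Sum>i\<in>UNIV. v x $ i) \<le> 1 \<and> (\<forall>i. 0 \<le> v x $ i))}"

definition dirichlet :: "'a::euclidean_space set \<Rightarrow> ('a \<Rightarrow> real^'m) \<Rightarrow> ('a \<Rightarrow> real^'m) \<Rightarrow> real" where
  "dirichlet \<Omega> w1 w2 = (\<Sum>i\<in>UNIV. \<Sum>b\<in>Basis.
      LINT x|lebesgue_on \<Omega>. wpd \<Omega> b (\<lambda>x. w1 x $ i) x * wpd \<Omega> b (\<lambda>x. w2 x $ i) x)"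

definition cyl :: "'a::euclidean_space set \<Rightarrow> real \<Rightarrow> ('a \<times> real) set" where
  "cyl \<Omega> T = \<Omega> \<times> {0<..<T}"

definition dt :: "'a::euclidean_space set \<Rightarrow> real \<Rightarrow> ('a \<times> real \<Rightarrow> real^'m) \<Rightarrow> 'a \<times> real \<Rightarrow> real^'m" where
  "dt \<Omega> T u z = (\<chi> i. wpd (cyl \<Omega> T) (0, 1) (\<lambda>z. u z $ i) z)"

text \<open>H^1(0,T; L^2(Omega)^N), identified with: u in L^2(Q)^N with weak time derivative in L^2(Q)^N.\<close>
definition H1_L2 :: "'a::euclidean_space set \<Rightarrow> real \<Rightarrow> ('a \<times> real \<Rightarrow> real^'m) \<Rightarrow> bool" where
  "H1_L2 \<Omega> T u \<longleftrightarrow> (\<forall>i. L2 (cyl \<Omega> T) (\<lambda>z. u z $ i) \<and>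
      (\<exists>D. L2 (cyl \<Omega> T) D \<and> weak_pd (cyl \<Omega> T) (0, 1) (\<lambda>z. u z $ i) D))"

text \<open>L^infinity(0,T; H^1(Omega)^N): spatial weak gradient in L^2(Q) (measurability) and
  essentially bounded H^1-norm of the time slices.\<close>
definition Linf_H1 :: "'a::euclidean_space set \<Rightarrow> real \<Rightarrow> ('a \<times> real \<Rightarrow> real^'m) \<Rightarrow> bool" where
  "Linf_H1 \<Omega> T u \<longleftrightarrow>
     (\<forall>i. L2 (cyl \<Omega> T) (\<lambda>z. u z $ i) \<and>
        (\<forall>b\<in>Basis. \<exists>G. L2 (cyl \<Omega> T) G \<and> weak_pd (cyl \<Omega> T) (b, 0) (\<lambda>z. u z $ i) G)) \<and>
     (\<exists>C. AE t in lebesgue_on {0<..<T}.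
        \<forall>i. H1 \<Omega> (\<lambda>x. u (x, t) $ i) \<and> H1norm2 \<Omega> (\<lambda>x. u (x, t) $ i) \<le> C)"

text \<open>P u = u_t - Laplace u (distributional on Q, componentwise) belongs to L^2(Q)^N.\<close>
definition heat_L2 :: "'a::euclidean_space set \<Rightarrow> real \<Rightarrow> ('a \<times> real \<Rightarrow> real^'m) \<Rightarrow> bool" where
  "heat_L2 \<Omega> T u \<longleftrightarrow> (\<forall>i. \<exists>F. L2 (cyl \<Omega> T) F \<and>
      (\<forall>\<phi>. test_fun (cyl \<Omega> T) \<phi> \<longrightarrow>
         (LINT z|lebesgue_on (cyl \<Omega> T). u z $ i *
             (- pd \<phi> (0, 1) z - (\<Sum>b\<in>Basis. pd (\<lambda>w. pd \<phi> (b, 0) w) (b, 0) z)))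
         = (LINT z|lebesgue_on (cyl \<Omega> T). F z * \<phi> z)))"

definition vi_solution ::
  "'a::euclidean_space set \<Rightarrow> real \<Rightarrow> ('a \<times> real \<Rightarrow> real^'m) \<Rightarrow> ('a \<Rightarrow> real^'m)
     \<Rightarrow> ('a \<times> real \<Rightarrow> real^'m) \<Rightarrow> bool" where
  "vi_solution \<Omega> T f u0 u \<longleftrightarrow>
     H1_L2 \<Omega> T u \<and>
     (AE t in lebesgue_on {0<..<T}. (\<lambda>x. u (x, t)) \<in> simplexK \<Omega>) \<and>
     (\<forall>\<epsilon>>0. \<exists>\<delta>>0. AE t in lebesgue_on {0<..<T}.
        t < \<delta> \<longrightarrow> (LINT x|lebesgue_on \<Omega>. (norm (u (x, t) - u0 x))^2) < \<epsilon>) \<and>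
     (AE t in lebesgue_on {0<..<T}. \<forall>v\<in>simplexK \<Omega>.
        (LINT x|lebesgue_on \<Omega>. dt \<Omega> T u (x, t) \<bullet> (v x - u (x, t)))
          + dirichlet \<Omega> (\<lambda>x. u (x, t)) (\<lambda>x. v x - u (x, t))
        \<ge> (LINT x|lebesgue_on \<Omega>. f (x, t) \<bullet> (v x - u (x, t))))"

end

(*
  The variational inequality is read in the Hilbert space L2(Omega)^N and solved by the implicit
  Euler method on dyadic time grids. Each step minimises a strictly convex energy over the pairs
  (v, grad v) with v in K; testing a step with the previous one bounds the difference quotients in
  L2(Q) and the gradients uniformly in time. Comparing two nested grids, where the boundedness of K
  controls the error of the right-hand side, shows that the approximations and their gradients form
  Cauchy sequences in L2(Q). The difference quotients converge only weakly, so the time derivative is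
  obtained as a strong limit of convex combinations, along which the inequality, being affine in
  them, survives for almost every time.

  Uniqueness: for the difference z of two solutions, <z(t), z'(t)> <= 0 for a.e. t and z(0) = 0, so
  the norm of z vanishes.

  Regularity of u' - Laplace u: the resolvent of the Neumann Laplacian maps K into itself, because
  the projection onto the simplex is 1-Lipschitz and fixes 0. Testing with the resolvent of u and
  letting its parameter tend to 0 bounds the Laplacian of u(t) in L2 by f(t) - u'(t), and the Riesz
  theorem represents it.
*)
theory Submission
  imports Defs
begin

section \<open>Hilbert space preliminaries\<close>

text \<open>The boundary of \<Omega> is arbitrary, so neither a compact embedding of H1 into L2 nor
  density of functions smooth up to the boundary is at hand. Compactness therefore gives way to a
  quantitative comparison of grids, and weak limits to convex combinations. A function and its
  gradient form one point of a closed graph in a product of L2 spaces, so that minimising needs no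
  more than the projection theorem. All functions are extended by zero to the whole space;
  translation is then an isometry, and weak derivatives are handled by translating test functions.
  Functions of time with values in L2 are L2 functions on space-time together with their slices,
  known at almost every time. The norm of the difference of two solutions is not known to be
  differentiable in time: its square is compared over a time window and over the same window shifted
  back by h, with an error of order h^2. The Neumann condition is never written down; it is implicit
  in derivatives being tested inside the domain only.\<close>

lemma min_norm_exists:
  fixes S :: "'h::{real_inner,complete_space} set"
  assumes S: "closed S" "convex S" "S \<noteq> {}"
  shows "\<exists>x\<in>S. \<forall>y\<in>S. norm x \<le> norm y"
proof -
  define d where "d = Inf (norm ` S)"
  have bdd: "bdd_below (norm ` S)" by (rule bdd_belowI[of _ 0]) auto
  have dle: "d \<le> norm y" if "y \<in> S" for y
    unfolding d_def using bdd that by (auto intro: cInf_lower)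
  have d0: "0 \<le> d" unfolding d_def using S by (auto intro!: cInf_greatest)
  have "\<exists>y\<in>S. (norm y)\<^sup>2 < d\<^sup>2 + 1 / real (Suc n)" for n
  proof -
    have "d < sqrt (d\<^sup>2 + 1 / real (Suc n))" using d0 by (intro real_less_rsqrt) simp
    then have "\<exists>y\<in>S. norm y < sqrt (d\<^sup>2 + 1 / real (Suc n))"
      unfolding d_def using cInf_lessD[of "norm ` S" "sqrt (d\<^sup>2 + 1 / real (Suc n))"] S d_def by auto
    then obtain y where y: "y \<in> S" "norm y < sqrt (d\<^sup>2 + 1 / real (Suc n))" by blast
    have "(norm y)\<^sup>2 < (sqrt (d\<^sup>2 + 1 / real (Suc n)))\<^sup>2"
      using y by (intro power_strict_mono) auto
    then show ?thesis using y(1) by (auto simp: add_nonneg_nonneg)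
  qed
  then obtain Y where Y: "\<And>n. Y n \<in> S" "\<And>n. (norm (Y n))\<^sup>2 < d\<^sup>2 + 1 / real (Suc n)" by metis
  \<comment> \<open>Parallelogram law: the midpoint lies in the convex set \<open>S\<close> and so
    has norm at least \<open>d\<close>, which forces near-minimal points to be close to each
    other.\<close>
  have par: "(norm (Y n - Y m))\<^sup>2 \<le> 2 / real (Suc n) + 2 / real (Suc m)" for n m
  proof -
    have "(1/2) *\<^sub>R Y n + (1/2) *\<^sub>R Y m \<in> S" using S(2) Y(1) by (intro convexD) auto
    then have "d \<le> norm ((1/2) *\<^sub>R Y n + (1/2) *\<^sub>R Y m)" by (rule dle)
    then have "d\<^sup>2 \<le> (norm ((1/2) *\<^sub>R Y n + (1/2) *\<^sub>R Y m))\<^sup>2" using d0 by (simp add: power_mono)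
    then have "4 * d\<^sup>2 \<le> (norm (Y n + Y m))\<^sup>2"
      by (simp add: power2_norm_eq_inner algebra_simps inner_simps)
    moreover have "(norm (Y n - Y m))\<^sup>2 + (norm (Y n + Y m))\<^sup>2 = 2 * (norm (Y n))\<^sup>2 + 2 * (norm (Y m))\<^sup>2"
      by (simp add: power2_norm_eq_inner algebra_simps inner_simps)
    moreover have "2 / real (Suc k) = 2 * (1 / real (Suc k))" for k by simp
    ultimately show ?thesis using Y(2)[of n] Y(2)[of m] by (smt (verit))
  qed
  have "Cauchy Y"
  proof (rule metric_CauchyI)
    fix e :: real assume e: "0 < e"
    then obtain N where N: "4 / e\<^sup>2 < real N" using reals_Archimedean2 by blast
    have "dist (Y m) (Y n) < e" if "m \<ge> N" "n \<ge> N" for m n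
    proof -
      have "4 / real (Suc N) < e\<^sup>2" 
        using N e by (simp add: field_simps add_pos_pos) (smt (verit) zero_less_power)
      moreover have "2 / real (Suc n) + 2 / real (Suc m) \<le> 2 / real (Suc N) + 2 / real (Suc N)"
        using that by (intro add_mono divide_left_mono) auto
      ultimately have "(norm (Y m - Y n))\<^sup>2 < e\<^sup>2" using par[of m n] by simp
      then show ?thesis using e by (metis dist_norm power_less_imp_less_base less_imp_le)
    qed
    then show "\<exists>M. \<forall>m\<ge>M. \<forall>n\<ge>M. dist (Y m) (Y n) < e" by blast
  qed
  then obtain x where x: "Y \<longlonglongrightarrow> x" using Cauchy_convergent convergent_def by blast
  have xS: "x \<in> S" using closed_sequentially[OF S(1)] Y(1) x by blast
  have "(\<lambda>n. (norm (Y n))\<^sup>2) \<longlonglongrightarrow> (norm x)\<^sup>2" by (intro tendsto_intros x)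
  moreover have "(\<lambda>n. d\<^sup>2 + 1 / real (Suc n)) \<longlonglongrightarrow> d\<^sup>2 + 0"
    by (intro tendsto_intros LIMSEQ_Suc[OF lim_1_over_n])
  ultimately have "(norm x)\<^sup>2 \<le> d\<^sup>2 + 0"
    using Y(2) by (intro LIMSEQ_le[of _ _ "\<lambda>n. d\<^sup>2 + 1 / real (Suc n)"]) (auto intro: less_imp_le)
  then have "norm x \<le> d" using d0 power2_le_imp_le[of "norm x" d] by simp
  then show ?thesis using xS dle order_trans by blast
qed

lemma hilbert_projection:
  fixes S :: "'h::{real_inner,complete_space} set"
  assumes S: "closed S" "convex S" "S \<noteq> {}"
  shows "\<exists>x\<in>S. \<forall>y\<in>S. inner (z - x) (y - x) \<le> 0"
proof -
  have "closed ((\<lambda>y. y - z) ` S)" "convex ((\<lambda>y. y - z) ` S)"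
    using closed_translation_subtract[OF S(1)] convex_translation_subtract[OF S(2)] by auto
  from min_norm_exists[OF this] S(3) obtain x where x: "x \<in> S" "\<And>y. y \<in> S \<Longrightarrow> norm (x - z) \<le> norm (y - z)"
    by auto
  have "inner (z - x) (y - x) \<le> 0" if y: "y \<in> S" for y
  proof (rule ccontr)
    assume "\<not> ?thesis"
    then have pos: "inner (z - x) (y - x) > 0" by simp
    define a where "a = inner (z - x) (y - x)"
    define b where "b = (norm (y - x))\<^sup>2"
    have b0: "b > 0" using pos unfolding b_def by auto
    \<comment> \<open>\<open>a / b\<close> is the vertex of the parabola s^2 b - 2 s a by which the
      squared distance changes along the segment; the cap 1 keeps the point on the segment.\<close>
    define s where "s = min 1 (a / b)"
    have s: "0 < s" "s \<le> 1" "s * b \<le> a" using pos b0 unfolding s_def a_def[symmetric] by (auto simp: min_def field_simps)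
    have "(1 - s) *\<^sub>R x + s *\<^sub>R y \<in> S" using S(2) x(1) y s by (intro convexD) auto
    then have "norm (x - z) \<le> norm ((1 - s) *\<^sub>R x + s *\<^sub>R y - z)" by (rule x(2))
    then have "(norm (x - z))\<^sup>2 \<le> (norm ((x - z) + s *\<^sub>R (y - x)))\<^sup>2"
      by (intro power_mono) (auto simp: algebra_simps)
    also have "\<dots> = (norm (x - z))\<^sup>2 - 2 * s * a + s\<^sup>2 * b"
      unfolding a_def b_def power2_norm_eq_inner
      by (simp add: algebra_simps inner_simps power2_eq_square inner_commute)
    finally have "2 * a \<le> s * b" using s(1) by (simp add: power2_eq_square)
    then show False using s pos a_def by simp
  qed
  then show ?thesis using x(1) by blast
qed

lemma subspace_projection:
  fixes S :: "'h::{real_inner,complete_space} set"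
  assumes S: "closed S" "subspace S"
  shows "\<exists>x\<in>S. \<forall>y\<in>S. inner (z - x) y = 0"
proof -
  obtain x where x: "x \<in> S" "\<And>y. y \<in> S \<Longrightarrow> inner (z - x) (y - x) \<le> 0"
    using hilbert_projection[OF S(1) subspace_imp_convex[OF S(2)], of z] subspace_0[OF S(2)] by auto
  have "inner (z - x) y = 0" if y: "y \<in> S" for y
    using x(2)[OF subspace_add[OF S(2) x(1) y]] x(2)[OF subspace_diff[OF S(2) x(1) y]] by simp
  then show ?thesis using x(1) by blast
qed

lemma subspace_closure_Hilbert:
  fixes S :: "'h::real_normed_vector set"
  assumes "subspace S" shows "subspace (closure S)"
proof -
  have 1: "x + y \<in> closure S" if xy: "x \<in> closure S" "y \<in> closure S" for x y
  proof -
    obtain a b where "\<forall>n::nat. a n \<in> S" "a \<longlonglongrightarrow> x" "\<forall>n::nat. b n \<in> S" "b \<longlonglongrightarrow> y"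
      using xy[unfolded closure_sequential] by blast
    then show ?thesis unfolding closure_sequential using assms
      by (intro exI[of _ "\<lambda>n. a n + b n"]) (auto intro: subspace_add tendsto_add)
  qed
  have 2: "c *\<^sub>R x \<in> closure S" if x: "x \<in> closure S" for x c
  proof -
    obtain a where "\<forall>n::nat. a n \<in> S" "a \<longlonglongrightarrow> x"
      using x unfolding closure_sequential by blast
    then show ?thesis unfolding closure_sequential using assms
      by (intro exI[of _ "\<lambda>n. c *\<^sub>R a n"]) (auto intro: subspace_scale tendsto_scaleR)
  qed
  have "0 \<in> closure S" using subspace_0[OF assms] closure_subset by blast
  then show ?thesis unfolding subspace_def using 1 2 by blast
qed

text \<open>A bounded linear functional enters through its graph, so that well-definedness on a
  subspace need not be checked separately.\<close>
lemma riesz_graph: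
  fixes R :: "('h::{real_inner,complete_space} \<times> real) set"
  assumes R: "subspace R" and bd: "\<And>x y. (x, y) \<in> R \<Longrightarrow> \<bar>y\<bar> \<le> C * norm x" and C: "C \<ge> 0"
  shows "\<exists>F. norm F \<le> C \<and> (\<forall>(x, y)\<in>R. y = inner F x)"
proof -
  define M where "M = closure R"
  have M: "closed M" "subspace M" unfolding M_def using subspace_closure_Hilbert[OF R] by auto
  have bdM: "\<bar>y\<bar> \<le> C * norm x" if "(x, y) \<in> M" for x y
  proof -
    have "closed {z. \<bar>snd z\<bar> \<le> C * norm (fst z :: 'h)}"
      by (intro closed_Collect_le continuous_intros)
    moreover have "R \<subseteq> {z. \<bar>snd z\<bar> \<le> C * norm (fst z)}" using bd by auto
    ultimately have "M \<subseteq> {z. \<bar>snd z\<bar> \<le> C * norm (fst z)}" unfolding M_def by (rule closure_minimal[rotated])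
    then show ?thesis using that by auto
  qed
  \<comment> \<open>For the graph of x -> <F, x> the normal direction is (-F, 1). Projecting (0, 1)
    onto the closed graph leaves the residual (-a, 1 - c), hence F = a / (1 - c). If c were 1, the
    point (0, 1) itself would lie in the graph, against the bound.\<close>
  obtain a c where ac: "(a, c) \<in> M" "\<And>x y. (x, y) \<in> M \<Longrightarrow> inner ((0, 1) - (a, c)) (x, y) = 0"
    using subspace_projection[OF M, of "(0,1)"] by (metis surj_pair)
  have eq: "(1 - c) * y = inner a x" if "(x, y) \<in> M" for x y
    using ac(2)[OF that] by (simp add: inner_prod_def)
  have c1: "c \<noteq> 1"
  proof
    assume "c = 1"
    then have "inner a a = 0" using eq[OF ac(1)] by simp
    then show False using bdM[OF ac(1)] \<open>c = 1\<close> by simp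
  qed
  define F where "F = (1 / (1 - c)) *\<^sub>R a"
  have F: "y = inner F x" if "(x, y) \<in> M" for x y
    using eq[OF that] c1 unfolding F_def by (simp add: field_simps)
  have "norm F \<le> C"
  proof (cases "a = 0")
    case True then show ?thesis using C by (simp add: F_def)
  next
    case False
    have "(1 / (1 - c)) *\<^sub>R (a, c) \<in> M" using M(2) ac(1) by (rule subspace_scale)
    then have "(F, c / (1 - c)) \<in> M" by (simp add: F_def)
    from bdM[OF this] F[OF this] have "norm F * norm F \<le> C * norm F"
      by (simp add: power2_norm_eq_inner[symmetric] power2_eq_square)
    moreover have "norm F > 0" using False c1 by (simp add: F_def)
    ultimately show ?thesis by simp
  qed
  moreover have "R \<subseteq> M" unfolding M_def by (rule closure_subset)
  ultimately show ?thesis using F by blast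
qed

text \<open>The substitute for weak compactness combined with Mazur's lemma. The points of least
  norm in the closed hulls of the tails have increasing bounded norms, and the parallelogram law
  turns convergence of these norms into convergence of the points.\<close>

lemma bounded_convex_combinations_converge:
  fixes X :: "nat \<Rightarrow> 'h::{real_inner,complete_space}"
  assumes bd: "\<And>n. norm (X n) \<le> B"
  shows "\<exists>Y y. (\<forall>n. Y n \<in> convex hull (X ` {n..})) \<and> Y \<longlonglongrightarrow> y"
proof -
  define C where "C n = closure (convex hull (X ` {n..}))" for n
  have "closed (C n)" "convex (C n)" "C n \<noteq> {}" for n
    unfolding C_def by (auto intro: convex_closure)
  from min_norm_exists[OF this] obtain m where
    m: "\<And>n. m n \<in> C n" "\<And>n y. y \<in> C n \<Longrightarrow> norm (m n) \<le> norm y" by metis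
  have mono: "C k \<subseteq> C n" if "n \<le> k" for n k
    unfolding C_def using that by (intro closure_mono hull_mono) auto
  have mle: "norm (m n) \<le> norm (m k)" if "n \<le> k" for n k using m mono[OF that] by blast
  have mB: "norm (m n) \<le> B" for n
  proof -
    have "X n \<in> C n" unfolding C_def using closure_subset hull_inc by (metis atLeast_iff imageI order_refl subsetD)
    then show ?thesis using m(2) bd order_trans by blast
  qed
  have par: "(norm (m n - m k))\<^sup>2 \<le> 2 * (norm (m k))\<^sup>2 - 2 * (norm (m n))\<^sup>2" if "n \<le> k" for n k
  proof -
    have "(1/2) *\<^sub>R m n + (1/2) *\<^sub>R m k \<in> C n"
      using m(1) mono[OF that] convex_closure[of "convex hull (X ` {n..})"] unfolding C_def[symmetric]
      by (intro convexD) (auto simp: C_def intro: convex_closure)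
    then have "norm (m n) \<le> norm ((1/2) *\<^sub>R m n + (1/2) *\<^sub>R m k)" by (rule m(2))
    then have "(norm (m n))\<^sup>2 \<le> (norm ((1/2) *\<^sub>R m n + (1/2) *\<^sub>R m k))\<^sup>2" by (simp add: power_mono)
    then show ?thesis by (simp add: power2_norm_eq_inner algebra_simps inner_simps)
  qed
  have "incseq (\<lambda>n. (norm (m n))\<^sup>2)" by (intro monoI power_mono mle) auto
  moreover have "\<forall>n. (norm (m n))\<^sup>2 \<le> B\<^sup>2" using mB by (auto intro: power_mono)
  ultimately have "Cauchy (\<lambda>n. (norm (m n))\<^sup>2)"
    by (meson incseq_convergent LIMSEQ_imp_Cauchy)
  then have "Cauchy m"
  proof -
    assume ca: "Cauchy (\<lambda>n. (norm (m n))\<^sup>2)"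
    show ?thesis
    proof (rule metric_CauchyI)
      fix e :: real assume e: "0 < e"
      then obtain N where N: "\<And>i j. i \<ge> N \<Longrightarrow> j \<ge> N \<Longrightarrow> dist ((norm (m i))\<^sup>2) ((norm (m j))\<^sup>2) < e\<^sup>2 / 2"
        using metric_CauchyD[OF ca, of "e\<^sup>2/2"] by auto
      have *: "dist (m i) (m j) < e" if "N \<le> i" "i \<le> j" for i j
      proof -
        have "(norm (m i - m j))\<^sup>2 < e\<^sup>2" 
          using par[OF that(2)] N[of i j] that unfolding dist_real_def by linarith
        then show ?thesis using e by (metis dist_norm power_less_imp_less_base less_imp_le)
      qed
      have "dist (m i) (m j) < e" if "i \<ge> N" "j \<ge> N" for i j
        using *[of i j] *[of j i] that by (cases "i \<le> j") (auto simp: dist_commute)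
      then show "\<exists>M. \<forall>i\<ge>M. \<forall>j\<ge>M. dist (m i) (m j) < e" by blast
    qed
  qed
  then obtain y where y: "m \<longlonglongrightarrow> y" using Cauchy_convergent convergent_def by blast
  have "\<exists>z\<in>convex hull (X ` {n..}). dist z (m n) < 1 / real (Suc n)" for n
    using m(1)[of n] unfolding C_def closure_approachable by simp
  then obtain Y where Y: "\<And>n. Y n \<in> convex hull (X ` {n..})" "\<And>n. dist (Y n) (m n) < 1 / real (Suc n)"
    by metis
  have "(\<lambda>n. Y n - m n) \<longlonglongrightarrow> 0"
    by (rule Lim_null_comparison[OF _ LIMSEQ_Suc[OF lim_1_over_n]])
      (use Y(2) in \<open>auto simp: dist_norm intro!: eventually_sequentiallyI less_imp_le\<close>)
  from tendsto_add[OF this y] have "Y \<longlonglongrightarrow> y" by simp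
  then show ?thesis using Y(1) by blast
qed

text \<open>Half-spaces are convex, so a lower bound along a tail of \<open>X\<close> passes to
  convex combinations of that tail and then to their limit. Inequalities that are affine in
  \<open>X\<close> survive in this way although \<open>X\<close> itself need not converge.\<close>

lemma convex_combinations_inner_ge:
  fixes X :: "nat \<Rightarrow> 'h::real_inner"
  assumes Y: "\<And>n. Y n \<in> convex hull (X ` {n..})" and y: "Y \<longlonglongrightarrow> y"
    and c: "\<And>n. c n \<le> inner (X n) a" "c \<longlonglongrightarrow> l"
  shows "l \<le> inner y a"
proof (rule field_le_epsilon)
  fix e :: real assume "e > 0"
  then have "eventually (\<lambda>n. l - e < c n) sequentially" using c(2) by (intro order_tendstoD) auto
  then obtain N where N: "\<And>n. n \<ge> N \<Longrightarrow> l - e < c n" by (auto simp: eventually_sequentially)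
  have "l - e \<le> inner (Y n) a" if "n \<ge> N" for n
  proof -
    have "convex hull (X ` {n..}) \<subseteq> {z. inner a z \<ge> l - e}"
    proof (rule hull_minimal)
      show "X ` {n..} \<subseteq> {z. inner a z \<ge> l - e}"
      proof clarify
        fix k assume "k \<ge> n"
        then show "l - e \<le> inner a (X k)" using N[of k] c(1)[of k] that by (simp add: inner_commute)
      qed
    qed (rule convex_halfspace_ge)
    then show ?thesis using Y[of n] by (auto simp: inner_commute)
  qed
  moreover have "(\<lambda>n. inner (Y n) a) \<longlonglongrightarrow> inner y a" by (intro tendsto_intros y)
  ultimately have "l - e \<le> inner y a" by (intro LIMSEQ_le_const) auto
  then show "l \<le> inner y a + e" by simp
qed

section \<open>The Hilbert space of square-integrable functions\<close>

definition sq_int :: "('a::euclidean_space \<Rightarrow> 'b::euclidean_space) \<Rightarrow> bool" where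
  "sq_int f \<longleftrightarrow> f \<in> borel_measurable borel \<and> integrable lborel (\<lambda>x. (norm (f x))\<^sup>2)"

lemma sq_int_measurable[measurable_dest]: "sq_int f \<Longrightarrow> f \<in> borel_measurable borel"
  by (simp add: sq_int_def)

lemma sq_int_integrable: "sq_int f \<Longrightarrow> integrable lborel (\<lambda>x. (norm (f x))\<^sup>2)"
  by (simp add: sq_int_def)

lemma sq_int_zero[simp]: "sq_int (\<lambda>_. 0)" by (simp add: sq_int_def)

lemma sq_int_scaleR: "sq_int f \<Longrightarrow> sq_int (\<lambda>x. c *\<^sub>R f x)"
  by (auto simp: sq_int_def power_mult_distrib intro!: borel_measurable_scaleR)

lemma sq_int_bound:
  assumes f: "f \<in> borel_measurable borel" and g: "sq_int g"
    and le: "AE x in lborel. norm (f x) \<le> norm (g x)"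
  shows "sq_int f"
proof -
  have "integrable lborel (\<lambda>x. (norm (f x))\<^sup>2)"
    by (rule Bochner_Integration.integrable_bound[OF sq_int_integrable[OF g]])
      (use f le in \<open>auto elim!: eventually_mono intro!: power_mono\<close>)
  then show ?thesis using f by (simp add: sq_int_def)
qed

lemma sq_int_add: assumes f: "sq_int f" and g: "sq_int g" shows "sq_int (\<lambda>x. f x + g x)"
proof -
  have [measurable]: "f \<in> borel_measurable borel" "g \<in> borel_measurable borel"
    using f g by (auto simp: sq_int_def)
  have le: "(norm (a + b))\<^sup>2 \<le> 2 * (norm a)\<^sup>2 + 2 * (norm b)\<^sup>2" for a b :: 'b
  proof -
    have "0 \<le> (norm (a - b))\<^sup>2" by simp
    then show ?thesis by (simp add: power2_norm_eq_inner algebra_simps inner_simps inner_commute)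
  qed
  have "integrable lborel (\<lambda>x. (norm (f x + g x))\<^sup>2)"
    by (rule Bochner_Integration.integrable_bound[where f="\<lambda>x. 2 * (norm (f x))\<^sup>2 + 2 * (norm (g x))\<^sup>2"])
      (use f g le in \<open>auto simp: sq_int_def\<close>)
  then show ?thesis by (simp add: sq_int_def)
qed

lemma sq_int_uminus: "sq_int f \<Longrightarrow> sq_int (\<lambda>x. - f x)"
  by (simp add: sq_int_def)

lemma sq_int_diff: "sq_int f \<Longrightarrow> sq_int g \<Longrightarrow> sq_int (\<lambda>x. f x - g x)"
  using sq_int_add[of f "\<lambda>x. - g x"] sq_int_uminus[of g] by simp

lemma sq_int_sum: "(\<And>i. i \<in> I \<Longrightarrow> sq_int (f i)) \<Longrightarrow> sq_int (\<lambda>x. \<Sum>i\<in>I. f i x)"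
  by (induction I rule: infinite_finite_induct) (auto intro: sq_int_add)

lemma sq_int_indicator:
  assumes "sq_int f" "A \<in> sets borel" shows "sq_int (\<lambda>x. indicator A x *\<^sub>R f x)"
  using assms by (intro sq_int_bound[OF _ assms(1)]) (auto simp: sq_int_def indicator_def)

lemma sq_int_inner:
  assumes f: "sq_int f" and g: "sq_int g" shows "integrable lborel (\<lambda>x. inner (f x) (g x))"
proof -
  have [measurable]: "f \<in> borel_measurable borel" "g \<in> borel_measurable borel"
    using f g by (auto simp: sq_int_def)
  have le: "\<bar>inner a b\<bar> \<le> (norm a)\<^sup>2 + (norm b)\<^sup>2" for a b :: 'b
  proof -
    have "\<bar>inner a b\<bar> \<le> norm a * norm b" by (rule Cauchy_Schwarz_ineq2)
    also have "\<dots> \<le> (norm a)\<^sup>2 + (norm b)\<^sup>2"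
      using sum_squares_bound[of "norm a" "norm b"] mult_nonneg_nonneg[OF norm_ge_zero norm_ge_zero, of a b] by linarith
    finally show ?thesis .
  qed
  show ?thesis
    by (rule Bochner_Integration.integrable_bound[where f="\<lambda>x. (norm (f x))\<^sup>2 + (norm (g x))\<^sup>2"])
      (use f g le in \<open>auto simp: sq_int_def\<close>)
qed

definition canon :: "('a::euclidean_space \<Rightarrow> 'b::euclidean_space) \<Rightarrow> 'a \<Rightarrow> 'b" where
  "canon f = (SOME h. sq_int h \<and> (AE x in lborel. h x = f x))"

lemma canon: assumes "sq_int f" shows "sq_int (canon f)" "AE x in lborel. canon f x = f x"
proof -
  have "sq_int (canon f) \<and> (AE x in lborel. canon f x = f x)"
    unfolding canon_def by (rule someI[of _ f]) (use assms in auto)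
  then show "sq_int (canon f)" "AE x in lborel. canon f x = f x" by auto
qed

text \<open>The choice sees \<open>f\<close> only through the predicate under SOME, and functions
  equal almost everywhere give the same predicate. Hence exactly one representative is selected in
  each class.\<close>

lemma canon_cong: assumes "AE x in lborel. f x = g x" shows "canon f = canon g"
proof -
  have "(\<lambda>h. sq_int h \<and> (AE x in lborel. h x = f x)) = (\<lambda>h. sq_int h \<and> (AE x in lborel. h x = g x))"
    (is "?P = ?Q")
  proof
    fix h
    have "(AE x in lborel. h x = f x) \<longleftrightarrow> (AE x in lborel. h x = g x)"
      using assms by (auto elim: AE_mp)
    then show "?P h = ?Q h" by blast
  qed
  then show ?thesis unfolding canon_def by presburger
qed

text \<open>Square-integrable functions modulo equality almost everywhere, with one Borel
  representative chosen in each class.\<close>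
typedef (overloaded) ('a::euclidean_space, 'b::euclidean_space) l2 =
    "{f :: 'a \<Rightarrow> 'b. sq_int f \<and> canon f = f}"
  morphisms fn Abs_l2
  by (rule exI[of _ "canon (\<lambda>_. 0)"]) (use canon[OF sq_int_zero] canon_cong in auto)

definition mk :: "('a::euclidean_space \<Rightarrow> 'b::euclidean_space) \<Rightarrow> ('a, 'b) l2" where
  "mk f = Abs_l2 (canon f)"

lemma sq_int_fn[simp, intro]: "sq_int (fn u)" using fn[of u] by simp

lemma fn_borel[measurable]: "fn u \<in> borel_measurable borel" using sq_int_fn[of u] by (simp add: sq_int_def)

lemma fn_mk: assumes "sq_int f" shows "AE x in lborel. fn (mk f) x = f x"
proof -
  have "fn (mk f) = canon f" unfolding mk_def
    by (rule Abs_l2_inverse) (use canon[OF assms] canon_cong in auto)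
  then show ?thesis using canon[OF assms] by simp
qed

lemma l2_eqI: assumes "AE x in lborel. fn u x = fn v x" shows "u = v"
proof -
  have "fn u = fn v" using canon_cong[OF assms] fn[of u] fn[of v] by simp
  then show ?thesis by (simp add: fn_inject)
qed

lemma mk_fn[simp]: "mk (fn u) = u"
  by (rule l2_eqI) (simp add: fn_mk)

instantiation l2 :: (euclidean_space, euclidean_space) real_inner
begin
definition "0 = mk (\<lambda>_. 0)"
definition "u + v = mk (\<lambda>x. fn u x + fn v x)"
definition "u - v = mk (\<lambda>x. fn u x - fn v x)"
definition "- u = mk (\<lambda>x. - fn u x)"
definition "c *\<^sub>R u = mk (\<lambda>x. c *\<^sub>R fn u x)"
definition "inner u v = (LINT x|lborel. inner (fn u x) (fn v x))"
definition "norm (u::('a,'b) l2) = sqrt (inner u u)"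
definition "dist (u::('a,'b) l2) v = norm (u - v)"
definition "sgn (u::('a,'b) l2) = inverse (norm u) *\<^sub>R u"
definition [code del]: "(uniformity :: (('a,'b) l2 \<times> ('a,'b) l2) filter) = (INF e\<in>{0 <..}. principal {(x, y). dist x y < e})"
definition [code del]: "open (U :: ('a,'b) l2 set) \<longleftrightarrow> (\<forall>x\<in>U. eventually (\<lambda>(x', y). x' = x \<longrightarrow> y \<in> U) uniformity)"

lemma fn_zero: "AE x in lborel. fn 0 x = 0"
  unfolding zero_l2_def by (rule fn_mk) simp
lemma fn_add: "AE x in lborel. fn (u + v) x = fn u x + fn v x"
  unfolding plus_l2_def by (rule fn_mk) (intro sq_int_add sq_int_fn)
lemma fn_diff: "AE x in lborel. fn (u - v) x = fn u x - fn v x"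
  unfolding minus_l2_def by (rule fn_mk) (intro sq_int_diff sq_int_fn)
lemma fn_uminus: "AE x in lborel. fn (- u) x = - fn u x"
  unfolding uminus_l2_def by (rule fn_mk) (intro sq_int_uminus sq_int_fn)
lemma fn_scaleR: "AE x in lborel. fn (c *\<^sub>R u) x = c *\<^sub>R fn u x"
  unfolding scaleR_l2_def by (rule fn_mk) (intro sq_int_scaleR sq_int_fn)

instance
proof
  fix u v w :: "('a,'b) l2" and a b :: real
  show "u + v + w = u + (v + w)"
    by (rule l2_eqI)
      (use fn_add[of "u+v" w] fn_add[of u v] fn_add[of u "v+w"] fn_add[of v w] in eventually_elim, simp)
  show "u + v = v + u"
    by (rule l2_eqI) (use fn_add[of u v] fn_add[of v u] in eventually_elim, simp)
  show "0 + u = u"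
    by (rule l2_eqI) (use fn_add[of 0 u] fn_zero in eventually_elim, simp)
  show "- u + u = 0"
    by (rule l2_eqI) (use fn_add[of "-u" u] fn_zero fn_uminus[of u] in eventually_elim, simp)
  show "u - v = u + - v"
    by (rule l2_eqI) (use fn_add[of u "-v"] fn_diff[of u v] fn_uminus[of v] in eventually_elim, simp)
  show "a *\<^sub>R (u + v) = a *\<^sub>R u + a *\<^sub>R v"
    by (rule l2_eqI)
      (use fn_scaleR[of a "u+v"] fn_add[of u v] fn_add[of "a *\<^sub>R u" "a *\<^sub>R v"]
        fn_scaleR[of a u] fn_scaleR[of a v] in eventually_elim, simp add: scaleR_right_distrib)
  show "(a + b) *\<^sub>R u = a *\<^sub>R u + b *\<^sub>R u"
    by (rule l2_eqI)
      (use fn_scaleR[of "a+b" u] fn_add[of "a *\<^sub>R u" "b *\<^sub>R u"]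
        fn_scaleR[of a u] fn_scaleR[of b u] in eventually_elim, simp add: scaleR_left_distrib)
  show "a *\<^sub>R b *\<^sub>R u = (a * b) *\<^sub>R u"
    by (rule l2_eqI)
      (use fn_scaleR[of b u] fn_scaleR[of a "b *\<^sub>R u"] fn_scaleR[of "a*b" u] in eventually_elim, simp)
  show "1 *\<^sub>R u = u"
    by (rule l2_eqI) (use fn_scaleR[of 1 u] in eventually_elim, simp)
  show "dist u v = norm (u - v)" "sgn u = inverse (norm u) *\<^sub>R u" "norm u = sqrt (inner u u)"
    by (simp_all add: dist_l2_def sgn_l2_def norm_l2_def)
  show "(uniformity :: (('a,'b) l2 \<times> ('a,'b) l2) filter) = (INF e\<in>{0 <..}. principal {(x, y). dist x y < e})"
    by (rule uniformity_l2_def)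
  show "open U \<longleftrightarrow> (\<forall>x\<in>U. eventually (\<lambda>(x', y). x' = x \<longrightarrow> y \<in> U) uniformity)" for U :: "('a,'b) l2 set"
    by (rule open_l2_def)
  show "inner u v = inner v u" by (simp add: inner_l2_def inner_commute)
  show "inner (u + v) w = inner u w + inner v w"
  proof -
    have "inner (u + v) w = (LINT x|lborel. inner (fn u x) (fn w x) + inner (fn v x) (fn w x))"
      unfolding inner_l2_def using fn_add[of u v]
      by (intro integral_cong_AE) (auto elim!: eventually_mono simp: inner_add_left)
    then show ?thesis unfolding inner_l2_def by (simp add: sq_int_inner)
  qed
  show "inner (a *\<^sub>R u) v = a * inner u v"
  proof -
    have "inner (a *\<^sub>R u) v = (LINT x|lborel. a * inner (fn u x) (fn v x))"
      unfolding inner_l2_def using fn_scaleR[of a u]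
      by (intro integral_cong_AE) (auto elim!: eventually_mono)
    then show ?thesis unfolding inner_l2_def by (simp add: sq_int_inner)
  qed
  show "0 \<le> inner u u" unfolding inner_l2_def by (intro integral_nonneg_AE) auto
  show "(inner u u = 0) \<longleftrightarrow> (u = 0)"
  proof -
    have "(inner u u = 0) \<longleftrightarrow> (AE x in lborel. inner (fn u x) (fn u x) = 0)"
      unfolding inner_l2_def by (rule integral_nonneg_eq_0_iff_AE) (auto intro: sq_int_inner)
    also have "\<dots> \<longleftrightarrow> (AE x in lborel. fn u x = fn 0 x)"
      using fn_zero by (auto elim!: AE_mp)
    also have "\<dots> \<longleftrightarrow> u = 0" using l2_eqI by auto
    finally show ?thesis .
  qed
qed
end

lemma norm_l2_sq: "(norm u)\<^sup>2 = (LINT x|lborel. (norm (fn u x))\<^sup>2)"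
  by (simp add: power2_norm_eq_inner inner_l2_def)

lemma nn_norm_l2_sq: "(\<integral>\<^sup>+x. ennreal ((norm (fn u x))\<^sup>2) \<partial>lborel) = ennreal ((norm u)\<^sup>2)"
  unfolding norm_l2_sq by (rule nn_integral_eq_integral) (auto intro: sq_int_integrable)

lemma inner_mk:
  assumes "sq_int f" "sq_int g" shows "inner (mk f) (mk g) = (LINT x|lborel. inner (f x) (g x))"
proof -
  have [measurable]: "f \<in> borel_measurable borel" "g \<in> borel_measurable borel"
    using assms by (auto simp: sq_int_def)
  show ?thesis unfolding inner_l2_def
    by (intro integral_cong_AE) (use fn_mk[OF assms(1)] fn_mk[OF assms(2)] in \<open>auto elim!: eventually_elim2\<close>)
qed

lemma inner_mk_right:
  assumes "sq_int g" shows "inner u (mk g) = (LINT x|lborel. inner (fn u x) (g x))"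
  using inner_mk[OF sq_int_fn[of u] assms] by simp

lemma norm_mk_sq: "sq_int f \<Longrightarrow> (norm (mk f))\<^sup>2 = (LINT x|lborel. (norm (f x))\<^sup>2)"
  using inner_mk[of f f] by (simp add: power2_norm_eq_inner)

lemma mk_add: assumes "sq_int f" "sq_int g" shows "mk (\<lambda>x. f x + g x) = mk f + mk g"
  by (rule l2_eqI)
    (use fn_mk[OF sq_int_add[OF assms]] fn_mk[OF assms(1)] fn_mk[OF assms(2)] fn_add[of "mk f" "mk g"]
      in eventually_elim, simp)

lemma mk_scaleR: assumes "sq_int f" shows "mk (\<lambda>x. c *\<^sub>R f x) = c *\<^sub>R mk f"
  by (rule l2_eqI)
    (use fn_mk[OF sq_int_scaleR[OF assms]] fn_mk[OF assms(1)] fn_scaleR[of c "mk f"]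
      in eventually_elim, simp)

lemma mk_diff: assumes "sq_int f" "sq_int g" shows "mk (\<lambda>x. f x - g x) = mk f - mk g"
  using mk_add[OF assms(1) sq_int_scaleR[OF assms(2), of "-1"]] mk_scaleR[OF assms(2), of "-1"] by simp

lemma mk_sum: "finite I \<Longrightarrow> (\<And>i. i \<in> I \<Longrightarrow> sq_int (f i)) \<Longrightarrow> mk (\<lambda>x. \<Sum>i\<in>I. f i x) = (\<Sum>i\<in>I. mk (f i))"
  by (induction I rule: finite_induct) (auto simp: zero_l2_def[symmetric] mk_add sq_int_sum)

lemma norm_mk_le:
  assumes f: "sq_int f" and le: "AE x in lborel. norm (f x) \<le> norm (fn u x)"
  shows "norm (mk f) \<le> norm u"
proof -
  have "(norm (mk f))\<^sup>2 \<le> (norm u)\<^sup>2"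
    unfolding norm_mk_sq[OF f] unfolding norm_l2_sq
    by (intro integral_mono_AE) (use f le in \<open>auto intro: sq_int_integrable power_mono elim!: eventually_mono\<close>)
  then show ?thesis by (simp add: power2_le_iff_abs_le)
qed

lemma l2_tendsto_AE_subseq:
  assumes "X \<longlonglongrightarrow> u"
  shows "\<exists>r. strict_mono r \<and> (AE x in lborel. (\<lambda>n. fn (X (r n)) x) \<longlonglongrightarrow> fn u x)"
proof -
  have "(\<lambda>n. (norm (X n - u))\<^sup>2) \<longlonglongrightarrow> 0\<^sup>2"
    using assms by (intro tendsto_power) (simp add: tendsto_norm_zero_iff LIM_zero_iff)
  then have "(\<lambda>n. LINT x|lborel. norm ((norm (fn (X n - u) x))\<^sup>2)) \<longlonglongrightarrow> 0"
    unfolding norm_l2_sq by simp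
  from tendsto_L1_AE_subseq[OF sq_int_integrable[OF sq_int_fn] this]
  obtain r where r: "strict_mono r" "AE x in lborel. (\<lambda>n. (norm (fn (X (r n) - u) x))\<^sup>2) \<longlonglongrightarrow> 0" by blast
  have "AE x in lborel. \<forall>n. fn (X n - u) x = fn (X n) x - fn u x"
    by (subst AE_all_countable) (auto intro: fn_diff)
  with r(2) have "AE x in lborel. (\<lambda>n. fn (X (r n)) x) \<longlonglongrightarrow> fn u x"
  proof eventually_elim
    fix x assume h: "(\<lambda>n. (norm (fn (X (r n) - u) x))\<^sup>2) \<longlonglongrightarrow> 0" "\<forall>n. fn (X n - u) x = fn (X n) x - fn u x"
    have "(\<lambda>n. sqrt ((norm (fn (X (r n) - u) x))\<^sup>2)) \<longlonglongrightarrow> sqrt 0"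
      by (intro tendsto_real_sqrt h(1))
    then have "(\<lambda>n. fn (X (r n)) x - fn u x) \<longlonglongrightarrow> 0" using h(2) by (simp add: tendsto_norm_zero_iff)
    then show "(\<lambda>n. fn (X (r n)) x) \<longlonglongrightarrow> fn u x" by (simp add: LIM_zero_iff)
  qed
  then show ?thesis using r(1) by blast
qed

text \<open>Convergence in norm gives an almost everywhere convergent subsequence, along which
  closed pointwise constraints persist.\<close>

lemma closed_AE_l2:
  assumes "\<And>x. closed (C x)"
  shows "closed {u. AE x in lborel. fn u x \<in> C x}"
proof -
  have "u \<in> {u. AE x in lborel. fn u x \<in> C x}"
    if X: "\<And>n. X n \<in> {u. AE x in lborel. fn u x \<in> C x}" "X \<longlonglongrightarrow> u" for X u
  proof -
    obtain r where r: "AE x in lborel. (\<lambda>n. fn (X (r n)) x) \<longlonglongrightarrow> fn u x"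
      using l2_tendsto_AE_subseq[OF X(2)] by blast
    have "AE x in lborel. \<forall>n. fn (X (r n)) x \<in> C x"
      using X(1) by (subst AE_all_countable) auto
    with r have "AE x in lborel. fn u x \<in> C x"
      by eventually_elim (rule closed_sequentially[OF assms], auto)
    then show ?thesis by simp
  qed
  then show ?thesis unfolding closed_sequential_limits by blast
qed

text \<open>The weight \<open>2 ^ n\<close> dominates the increments by a geometric series of ratio
  \<open>1 / sqrt 2\<close>. It is applied at points where a weighted sum of squared increments is
  finite.\<close>

lemma geometric_increments_convergent:
  fixes F :: "nat \<Rightarrow> 'b::banach"
  assumes "\<And>n. 2 ^ n * (norm (F (Suc n) - F n))\<^sup>2 \<le> B"
  shows "convergent F"
proof -
  have le: "norm (F (Suc n) - F n) \<le> sqrt B * (1 / sqrt 2) ^ n" for n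
  proof -
    have "(norm (F (Suc n) - F n))\<^sup>2 \<le> B / 2 ^ n" using assms[of n] by (simp add: field_simps)
    then have "norm (F (Suc n) - F n) \<le> sqrt (B / 2 ^ n)" by (rule real_le_rsqrt)
    also have "\<dots> = sqrt B * (1 / sqrt 2) ^ n" by (simp add: real_sqrt_divide real_sqrt_power power_one_over field_simps)
    finally show ?thesis .
  qed
  have "summable (\<lambda>n. sqrt B * (1 / sqrt 2) ^ n)"
    by (intro summable_mult summable_geometric) auto
  then have "summable (\<lambda>n. F (Suc n) - F n)"
    by (rule summable_comparison_test'[of _ 0]) (use le in auto)
  then have "convergent (\<lambda>n. (\<Sum>i<n. F (Suc i) - F i))" by (simp add: summable_iff_convergent)
  then have "convergent (\<lambda>n. (F n - F 0) + F 0)"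
    by (intro convergent_add convergent_const) (simp add: sum_lessThan_telescope)
  then show ?thesis by simp
qed

text \<open>Riesz-Fischer theorem: a fast subsequence converges almost everywhere, and Fatou's lemma
  carries the norm estimates over to the pointwise limit.\<close>

instance l2 :: (euclidean_space, euclidean_space) complete_space
proof
  fix X :: "nat \<Rightarrow> ('a,'b) l2" assume ca: "Cauchy X"
  \<comment> \<open>The rate \<open>(1/8)^n\<close> remains summable after squaring and
    multiplication by the weight \<open>2^n\<close>: what is left is at most
    \<open>(1/4)^n\<close>.\<close>
  have "\<exists>N. \<forall>i\<ge>N. \<forall>j\<ge>N. norm (X i - X j) < (1/8)^n" for n
    using ca unfolding Cauchy_def dist_norm by (meson zero_less_power divide_pos_pos zero_less_one zero_less_numeral)
  then obtain N where N: "\<And>n i j. N n \<le> i \<Longrightarrow> N n \<le> j \<Longrightarrow> norm (X i - X j) < (1/8)^n" by metis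
  define r where "r n = n + (\<Sum>k\<le>n. N k)" for n
  have rN: "N n \<le> r n" for n unfolding r_def by (intro trans_le_add2 member_le_sum) auto
  have rS: "r n \<le> r (Suc n)" for n by (simp add: r_def)
  have rn: "n \<le> r n" for n by (simp add: r_def)
  define F where "F n = fn (X (r n))" for n
  have [measurable]: "F n \<in> borel_measurable borel" for n unfolding F_def by simp
  define g where "g n x = 2 ^ n * (norm (F (Suc n) x - F n x))\<^sup>2" for n x
  have g: "(\<integral>\<^sup>+x. ennreal (g n x) \<partial>lborel) \<le> ennreal ((1/4)^n)" for n
  proof -
    have "(\<integral>\<^sup>+x. ennreal (g n x) \<partial>lborel) = (\<integral>\<^sup>+x. ennreal (2^n) * ennreal ((norm (fn (X (r (Suc n)) - X (r n)) x))\<^sup>2) \<partial>lborel)"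
      unfolding g_def F_def
      by (intro nn_integral_cong_AE) (use fn_diff[of "X (r (Suc n))" "X (r n)"] in \<open>auto elim!: eventually_mono simp: ennreal_mult'\<close>)
    also have "\<dots> = ennreal (2^n) * ennreal ((norm (X (r (Suc n)) - X (r n)))\<^sup>2)"
      by (subst nn_integral_cmult) (auto simp: nn_norm_l2_sq)
    also have "\<dots> = ennreal (2^n * (norm (X (r (Suc n)) - X (r n)))\<^sup>2)" by (simp add: ennreal_mult')
    also have "\<dots> \<le> ennreal ((1/4)^n)"
    proof (rule ennreal_leI)
      have "(norm (X (r (Suc n)) - X (r n)))\<^sup>2 \<le> ((1/8)^n)\<^sup>2"
        using N[of n "r (Suc n)" "r n"] rN[of n] rS[of n] by (intro power_mono) auto
      also have "\<dots> \<le> (1/8)^n" by (auto simp: power2_eq_square power_le_one intro!: mult_left_le)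
      finally have "2^n * (norm (X (r (Suc n)) - X (r n)))\<^sup>2 \<le> 2^n * (1/8)^n" by simp
      also have "\<dots> = (1/4)^n" by (simp add: power_mult_distrib[symmetric])
      finally show "2^n * (norm (X (r (Suc n)) - X (r n)))\<^sup>2 \<le> (1/4)^n" .
    qed
    finally show ?thesis .
  qed
  have "(\<integral>\<^sup>+x. (\<Sum>n. ennreal (g n x)) \<partial>lborel) = (\<Sum>n. \<integral>\<^sup>+x. ennreal (g n x) \<partial>lborel)"
    by (rule nn_integral_suminf) (simp add: g_def)
  also have "\<dots> \<le> (\<Sum>n. ennreal ((1/4)^n))" by (intro suminf_le g) auto
  also have "\<dots> = ennreal (\<Sum>n. (1/4)^n)" by (rule suminf_ennreal2) (auto intro: summable_geometric)
  also have "\<dots> < \<infinity>" by simp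
  finally have "AE x in lborel. (\<Sum>n. ennreal (g n x)) \<noteq> \<infinity>"
    by (intro nn_integral_PInf_AE) (auto simp: g_def)
  then have conv: "AE x in lborel. convergent (\<lambda>n. F n x)"
  proof eventually_elim
    fix x assume fin: "(\<Sum>n. ennreal (g n x)) \<noteq> \<infinity>"
    then obtain B where B: "(\<Sum>n. ennreal (g n x)) = ennreal B" "0 \<le> B" by (metis ennreal_cases infinity_ennreal_def)
    have "g n x \<le> B" for n
    proof -
      have "ennreal (g n x) \<le> (\<Sum>n. ennreal (g n x))"
        using sum_le_suminf[of "\<lambda>n. ennreal (g n x)" "{n}"] by simp
      then show ?thesis using B by (simp add: ennreal_le_iff)
    qed
    then show "convergent (\<lambda>n. F n x)" unfolding g_def by (rule geometric_increments_convergent)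
  qed
  define G where "G x = lim (\<lambda>n. F n x)" for x
  have [measurable]: "G \<in> borel_measurable borel" unfolding G_def by measurable
  have lim: "AE x in lborel. (\<lambda>n. F n x) \<longlonglongrightarrow> G x"
    using conv by eventually_elim (simp add: G_def convergent_LIMSEQ_iff)
  have fat: "(\<integral>\<^sup>+x. ennreal ((norm (G x - F n x))\<^sup>2) \<partial>lborel) \<le> ennreal (e\<^sup>2)"
    if "\<And>m. m \<ge> n \<Longrightarrow> norm (X (r m) - X (r n)) \<le> e" for n e
  proof -
    have "(\<integral>\<^sup>+x. ennreal ((norm (G x - F n x))\<^sup>2) \<partial>lborel)
        = (\<integral>\<^sup>+x. liminf (\<lambda>m. ennreal ((norm (F m x - F n x))\<^sup>2)) \<partial>lborel)"
    proof (intro nn_integral_cong_AE, use lim in eventually_elim)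
      fix x assume "(\<lambda>n. F n x) \<longlonglongrightarrow> G x"
      then have "(\<lambda>m. ennreal ((norm (F m x - F n x))\<^sup>2)) \<longlonglongrightarrow> ennreal ((norm (G x - F n x))\<^sup>2)"
        by (intro tendsto_intros)
      then show "ennreal ((norm (G x - F n x))\<^sup>2) = liminf (\<lambda>m. ennreal ((norm (F m x - F n x))\<^sup>2))"
        by (rule lim_imp_Liminf[OF trivial_limit_sequentially, symmetric])
    qed
    also have "\<dots> \<le> liminf (\<lambda>m. \<integral>\<^sup>+x. ennreal ((norm (F m x - F n x))\<^sup>2) \<partial>lborel)"
      by (rule nn_integral_liminf) simp
    also have "\<dots> \<le> ennreal (e\<^sup>2)"
    proof (rule Liminf_le)
      have "(\<integral>\<^sup>+x. ennreal ((norm (F m x - F n x))\<^sup>2) \<partial>lborel) \<le> ennreal (e\<^sup>2)" if "m \<ge> n" for m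
      proof -
        have "(\<integral>\<^sup>+x. ennreal ((norm (F m x - F n x))\<^sup>2) \<partial>lborel)
            = (\<integral>\<^sup>+x. ennreal ((norm (fn (X (r m) - X (r n)) x))\<^sup>2) \<partial>lborel)"
          unfolding F_def using fn_diff[of "X (r m)" "X (r n)"]
          by (intro nn_integral_cong_AE) (auto elim!: eventually_mono)
        then show ?thesis unfolding nn_norm_l2_sq using \<open>\<And>m. m \<ge> n \<Longrightarrow> norm (X (r m) - X (r n)) \<le> e\<close>[OF that]
          by (auto intro!: ennreal_leI power_mono)
      qed
      then show "\<forall>\<^sub>F m in sequentially. (\<integral>\<^sup>+x. ennreal ((norm (F m x - F n x))\<^sup>2) \<partial>lborel) \<le> ennreal (e\<^sup>2)"
        by (auto simp: eventually_sequentially)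
    qed simp
    finally show ?thesis .
  qed
  have sqd: "sq_int (\<lambda>x. G x - F n x)"
    if "\<And>m. m \<ge> n \<Longrightarrow> norm (X (r m) - X (r n)) \<le> e" for n e
    unfolding sq_int_def using fat[OF that] le_less_trans[OF fat[OF that] ennreal_less_top]
    by (auto simp: integrable_iff_bounded)
  have sm: "norm (X (r m) - X (r n)) \<le> (1/8)^k" if "k \<le> n" "n \<le> m" for k n m
  proof -
    have "r k \<le> r j" if "k \<le> j" for j using that rS lift_Suc_mono_le[of r] by blast
    then show ?thesis using N[of k "r m" "r n"] rN[of k] that by (meson less_imp_le order_trans)
  qed
  have sqG: "sq_int G"
  proof -
    have "sq_int (\<lambda>x. G x - F 0 x)" using sqd[of 0 1] sm[of 0 0] by simp
    from sq_int_add[OF this, of "F 0"] show ?thesis by (simp add: F_def)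
  qed
  have nle: "norm (X (r n) - mk G) \<le> (1/8)^n" for n
  proof -
    have m: "\<And>m. m \<ge> n \<Longrightarrow> norm (X (r m) - X (r n)) \<le> (1/8)^n" using sm[of n n] by simp
    have "mk (\<lambda>x. G x - F n x) = mk G - X (r n)" using mk_diff[OF sqG, of "F n"] by (simp add: F_def)
    then have "(norm (mk G - X (r n)))\<^sup>2 = (LINT x|lborel. (norm (G x - F n x))\<^sup>2)"
      using norm_mk_sq[OF sqd[OF m]] by simp
    moreover have "ennreal (LINT x|lborel. (norm (G x - F n x))\<^sup>2) \<le> ennreal (((1/8)^n)\<^sup>2)"
      using fat[OF m] nn_integral_eq_integral[OF sq_int_integrable[OF sqd[OF m]]] by simp
    ultimately have "(norm (mk G - X (r n)))\<^sup>2 \<le> ((1/8)^n)\<^sup>2" by (simp add: ennreal_le_iff)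
    then show ?thesis by (metis norm_minus_commute power2_le_imp_le zero_le_power zero_le_divide_1_iff zero_le_numeral)
  qed
  have "X \<longlonglongrightarrow> mk G"
  proof (rule metric_LIMSEQ_I)
    fix e :: real assume e: "0 < e"
    obtain n where n: "(1/8)^n < e / 2" using real_arch_pow_inv[of "e/2" "1/8"] e by auto
    have "dist (X i) (mk G) < e" if "i \<ge> r n" for i
    proof -
      have "norm (X i - X (r n)) < (1/8)^n" using N[of n i "r n"] rN[of n] that by auto
      then show ?thesis using nle[of n] n norm_triangle_ineq[of "X i - X (r n)" "X (r n) - mk G"]
        by (simp add: dist_norm)
    qed
    then show "\<exists>no. \<forall>n\<ge>no. dist (X n) (mk G) < e" by blast
  qed
  then show "convergent X" by (auto simp: convergent_def)
qed

section \<open>Smooth functions and test functions\<close>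

lemma pd_eqI: "(f has_derivative f') (at x) \<Longrightarrow> pd f d x = f' d"
  unfolding pd_def using frechet_derivative_at by metis

lemma pd_has_derivative: "f differentiable (at x) \<Longrightarrow> (f has_derivative (\<lambda>d. pd f d x)) (at x)"
  unfolding pd_def using frechet_derivative_works by metis

text \<open>Plain coinduction does not fit a product, whose derivative is a sum of products.
  Counting the orders of differentiability turns every closure property into an induction for which
  Leibniz' rule is enough.\<close>

primrec smooth_upto :: "nat \<Rightarrow> ('a::euclidean_space \<Rightarrow> real) \<Rightarrow> bool" where
  "smooth_upto 0 \<phi> \<longleftrightarrow> True"
| "smooth_upto (Suc n) \<phi> \<longleftrightarrow> (\<forall>x. \<phi> differentiable (at x)) \<and> (\<forall>b\<in>Basis. smooth_upto n (pd \<phi> b))"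

lemma smooth_iff_upto: "smooth \<phi> \<longleftrightarrow> (\<forall>n. smooth_upto n \<phi>)"
proof
  have "smooth \<phi> \<Longrightarrow> smooth_upto n \<phi>" for n
  proof (induction n arbitrary: \<phi>)
    case (Suc n)
    from Suc.prems show ?case
      by (cases rule: smooth.cases) (auto simp: pd_def[abs_def] intro: Suc.IH)
  qed simp
  then show "smooth \<phi> \<Longrightarrow> \<forall>n. smooth_upto n \<phi>" by blast
next
  assume "\<forall>n. smooth_upto n \<phi>"
  then show "smooth \<phi>"
  proof (coinduction arbitrary: \<phi>)
    case smooth
    have "\<forall>x. \<phi> differentiable (at x)" using smooth[rule_format, of 1] by simp
    moreover have "\<forall>n. smooth_upto n (\<lambda>x. frechet_derivative \<phi> (at x) b)" if "b \<in> Basis" for b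
      using smooth[rule_format, of "Suc _"] that by (auto simp: pd_def[abs_def])
    ultimately show ?case by blast
  qed
qed

lemma smooth_upto_Suc: "smooth_upto (Suc n) \<phi> \<Longrightarrow> smooth_upto n \<phi>"
  by (induction n arbitrary: \<phi>) auto

lemma pd_const: "pd (\<lambda>_. c) d = (\<lambda>_. 0)" by (simp add: pd_def[abs_def])

lemma smooth_upto_const: "smooth_upto n (\<lambda>_. c)"
  by (induction n arbitrary: c) (auto simp: pd_const)

lemma pd_add: "f differentiable (at x) \<Longrightarrow> g differentiable (at x) \<Longrightarrow> pd (\<lambda>x. f x + g x) d x = pd f d x + pd g d x"
  using pd_eqI[OF has_derivative_add[OF pd_has_derivative pd_has_derivative]] by blast

lemma pd_mult: "f differentiable (at x) \<Longrightarrow> g differentiable (at x) \<Longrightarrow>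
    pd (\<lambda>x. f x * g x) d x = f x * pd g d x + pd f d x * g x"
  using pd_eqI[OF has_derivative_mult[OF pd_has_derivative pd_has_derivative]] by blast

lemma pd_cmult: "f differentiable (at x) \<Longrightarrow> pd (\<lambda>x. c * f x) d x = c * pd f d x"
  by (simp add: pd_mult pd_const)

lemma smooth_upto_add: "smooth_upto n f \<Longrightarrow> smooth_upto n g \<Longrightarrow> smooth_upto n (\<lambda>x. f x + g x)"
proof (induction n arbitrary: f g)
  case (Suc n)
  then have d: "\<And>x. f differentiable (at x)" "\<And>x. g differentiable (at x)" by auto
  have "pd (\<lambda>x. f x + g x) b = (\<lambda>x. pd f b x + pd g b x)" for b by (rule ext) (simp add: pd_add d)
  then show ?case using Suc by (auto intro!: differentiable_add d)
qed simp

lemma smooth_upto_mult: "smooth_upto n f \<Longrightarrow> smooth_upto n g \<Longrightarrow> smooth_upto n (\<lambda>x. f x * g x)"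
proof (induction n arbitrary: f g)
  case (Suc n)
  then have d: "\<And>x. f differentiable (at x)" "\<And>x. g differentiable (at x)" by auto
  have "pd (\<lambda>x. f x * g x) b = (\<lambda>x. f x * pd g b x + pd f b x * g x)" for b by (rule ext) (simp add: pd_mult d)
  then show ?case using Suc smooth_upto_Suc[OF Suc.prems(1)] smooth_upto_Suc[OF Suc.prems(2)]
    by (auto intro!: differentiable_mult smooth_upto_add d)
qed simp

lemma smooth_upto_sum: "(\<And>i. i \<in> I \<Longrightarrow> smooth_upto n (f i)) \<Longrightarrow> smooth_upto n (\<lambda>x. \<Sum>i\<in>I. f i x)"
  by (induction I rule: infinite_finite_induct) (auto intro: smooth_upto_add smooth_upto_const)

lemma smooth_upto_prod: "(\<And>i. i \<in> I \<Longrightarrow> smooth_upto n (f i)) \<Longrightarrow> smooth_upto n (\<lambda>x. \<Prod>i\<in>I. f i x)"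
  by (induction I rule: infinite_finite_induct) (auto intro: smooth_upto_mult smooth_upto_const)

lemma pd_basis:
  assumes "f differentiable (at x)" shows "pd f d x = (\<Sum>b\<in>Basis. inner d b * pd f b x)"
proof -
  have lin: "linear (\<lambda>d. pd f d x)" using has_derivative_linear[OF pd_has_derivative[OF assms]] .
  have "pd f d x = pd f (\<Sum>b\<in>Basis. inner d b *\<^sub>R b) x" by (simp add: euclidean_representation)
  also have "\<dots> = (\<Sum>b\<in>Basis. inner d b * pd f b x)"
    using linear_sum[OF lin, of "\<lambda>b. inner d b *\<^sub>R b" Basis] linear_cmul[OF lin] by simp
  finally show ?thesis .
qed

lemma pd_affine:
  fixes L :: "'b::euclidean_space \<Rightarrow> 'a::euclidean_space"
  assumes f: "f differentiable (at (c + L x))" and L: "linear L"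
  shows "pd (\<lambda>x. f (c + L x)) d x = pd f (L d) (c + L x)"
    and "(\<lambda>x. f (c + L x)) differentiable (at x)"
proof -
  have "((\<lambda>x. c + L x) has_derivative L) (at x)"
    using has_derivative_add[OF has_derivative_const linear_imp_has_derivative[OF L]] by simp
  from has_derivative_compose[OF this pd_has_derivative[OF f]]
  have h: "((\<lambda>x. f (c + L x)) has_derivative (\<lambda>d. pd f (L d) (c + L x))) (at x)" .
  show "pd (\<lambda>x. f (c + L x)) d x = pd f (L d) (c + L x)" by (rule pd_eqI[OF h])
  show "(\<lambda>x. f (c + L x)) differentiable (at x)" using h by (auto simp: differentiable_def)
qed

lemma smooth_upto_affine:
  fixes L :: "'b::euclidean_space \<Rightarrow> 'a::euclidean_space"
  assumes L: "linear L" shows "smooth_upto n f \<Longrightarrow> smooth_upto n (\<lambda>x. f (c + L x))"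
proof (induction n arbitrary: f)
  case (Suc n)
  then have d: "\<And>x. f differentiable (at x)" by auto
  have "pd (\<lambda>x. f (c + L x)) b = (\<lambda>x. \<Sum>i\<in>Basis. inner (L b) i * pd f i (c + L x))" for b
    unfolding pd_affine(1)[OF d L] by (rule ext) (rule pd_basis[OF d])
  then show ?case using Suc
    by (auto intro!: pd_affine(2)[OF d L] smooth_upto_sum smooth_upto_mult smooth_upto_const)
qed simp

lemma smooth_differentiable: "smooth f \<Longrightarrow> f differentiable (at x)"
  using smooth_iff_upto[of f] smooth_upto.simps(2)[of 0 f] by blast

lemma smooth_pd: assumes "smooth f" shows "smooth (pd f d)"
proof -
  have "smooth_upto n (pd f d)" for n
  proof -
    have "smooth_upto (Suc n) f" using assms smooth_iff_upto by blast
    then have "smooth_upto n (\<lambda>x. \<Sum>b\<in>Basis. inner d b * pd f b x)"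
      by (intro smooth_upto_sum smooth_upto_mult smooth_upto_const) auto
    then show ?thesis using pd_basis[OF smooth_differentiable[OF assms], of d] by presburger
  qed
  then show ?thesis using smooth_iff_upto by blast
qed

lemma smooth_const: "smooth (\<lambda>_. c)" using smooth_iff_upto smooth_upto_const by blast
lemma smooth_add: "smooth f \<Longrightarrow> smooth g \<Longrightarrow> smooth (\<lambda>x. f x + g x)"
  using smooth_iff_upto smooth_upto_add by blast
lemma smooth_mult: "smooth f \<Longrightarrow> smooth g \<Longrightarrow> smooth (\<lambda>x. f x * g x)"
  using smooth_iff_upto smooth_upto_mult by blast
lemma smooth_affine: "linear L \<Longrightarrow> smooth f \<Longrightarrow> smooth (\<lambda>x. f (c + L x))"
  by (simp add: smooth_iff_upto smooth_upto_affine)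

lemma smooth_continuous: "smooth f \<Longrightarrow> continuous_on UNIV f"
  by (rule continuous_at_imp_continuous_on)
    (auto intro: differentiable_imp_continuous_within smooth_differentiable)

section \<open>Smooth bump functions on boxes\<close>

definition flat_exp :: "nat \<Rightarrow> real \<Rightarrow> real" where
  "flat_exp k x = (if x > 0 then (1 / x) ^ k * exp (- (1 / x)) else 0)"

lemma flat_exp_at_0: "(flat_exp k \<longlongrightarrow> 0) (at 0)"
proof -
  have "(flat_exp k \<longlongrightarrow> 0) (at_left 0)"
    by (rule tendsto_eventually)
      (auto simp: eventually_at_filter flat_exp_def)
  moreover have "(flat_exp k \<longlongrightarrow> 0) (at_right 0)"
  proof -
    have "((\<lambda>x. (inverse x) ^ k / exp (inverse x)) \<longlongrightarrow> (0::real)) (at_right 0)"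
      by (rule filterlim_compose[OF tendsto_power_div_exp_0 filterlim_inverse_at_top_right])
    then show ?thesis
      by (rule Lim_transform_eventually)
        (auto simp: eventually_at_filter flat_exp_def exp_minus field_simps)
  qed
  ultimately show ?thesis by (simp add: filterlim_split_at)
qed

text \<open>The powers of \<open>1 / x\<close> are included so that derivatives stay in the span of
  the family; smoothness of every order then follows by one induction. At 0 the difference quotient
  of \<open>flat_exp k\<close> is \<open>flat_exp (Suc k)\<close>, which tends to 0.\<close>

lemma flat_exp_deriv:
  "(flat_exp k has_real_derivative (- real k * flat_exp (Suc k) x + flat_exp (Suc (Suc k)) x)) (at x)"
proof -
  consider "x > 0" | "x < 0" | "x = 0" by linarith
  then show ?thesis
  proof cases
    case 1
    have "((\<lambda>x. (1 / x) ^ k * exp (- (1 / x))) has_real_derivative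
        (- real k * flat_exp (Suc k) x + flat_exp (Suc (Suc k)) x)) (at x)"
    proof (cases k)
      case 0
      show ?thesis using 1 unfolding 0
        by (auto intro!: derivative_eq_intros simp: flat_exp_def power2_eq_square field_simps)
    next
      case (Suc m)
      show ?thesis using 1 unfolding Suc
        by (auto intro!: derivative_eq_intros simp: flat_exp_def power2_eq_square field_simps) (cases m, auto)
    qed
    then show ?thesis
      by (rule DERIV_cong_ev[THEN iffD1, rotated -1, OF _ refl])
        (use 1 in \<open>auto simp: flat_exp_def intro: eventually_mono[OF eventually_nhds_in_open[of "{0<..}"]]\<close>)
  next
    case 2
    have "((\<lambda>x. 0) has_real_derivative 0) (at x)" by simp
    then have "(flat_exp k has_real_derivative 0) (at x)"
      by (rule DERIV_cong_ev[THEN iffD1, rotated -1, OF _ refl])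
        (use 2 in \<open>auto simp: flat_exp_def intro: eventually_mono[OF eventually_nhds_in_open[of "{..<0}"]]\<close>)
    then show ?thesis using 2 by (simp add: flat_exp_def)
  next
    case 3
    have "((\<lambda>h. (flat_exp k (0 + h) - flat_exp k 0) / h) \<longlongrightarrow> 0) (at 0)"
      by (rule Lim_transform_eventually[OF flat_exp_at_0[of "Suc k"]])
        (auto simp: eventually_at_filter flat_exp_def)
    then show ?thesis using 3 by (simp add: DERIV_def flat_exp_def)
  qed
qed

lemma smooth_flat_exp: "smooth (flat_exp k)"
proof -
  have pd1: "pd (flat_exp k) 1 = (\<lambda>x. - real k * flat_exp (Suc k) x + flat_exp (Suc (Suc k)) x)" for k
  proof
    fix x show "pd (flat_exp k) 1 x = - real k * flat_exp (Suc k) x + flat_exp (Suc (Suc k)) x"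
      using pd_eqI[OF flat_exp_deriv[of k x, unfolded has_field_derivative_def], of 1] by simp
  qed
  have "smooth_upto n (flat_exp k)" for n
  proof (induction n arbitrary: k)
    case (Suc n)
    have "flat_exp k differentiable (at x)" for x
      using flat_exp_deriv real_differentiable_def by blast
    moreover have "smooth_upto n (pd (flat_exp k) 1)"
      unfolding pd1 by (intro smooth_upto_add smooth_upto_mult smooth_upto_const Suc)
    ultimately show ?case by simp
  qed simp
  then show ?thesis using smooth_iff_upto by blast
qed

text \<open>As \<open>n\<close> grows these increase to the indicator function of the open box.\<close>
definition box_bump :: "'a::euclidean_space \<Rightarrow> 'a \<Rightarrow> nat \<Rightarrow> 'a \<Rightarrow> real" where
  "box_bump a b n x = (\<Prod>i\<in>Basis. flat_exp 0 (real (Suc n) * (inner x i - inner a i))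
      * flat_exp 0 (real (Suc n) * (inner b i - inner x i)))"

lemma smooth_box_bump: "smooth (box_bump a b n)"
proof -
  have "smooth_upto m (\<lambda>x. flat_exp 0 (real (Suc n) * (inner x i - inner a i)))" for m i
  proof -
    have "linear (\<lambda>x. real (Suc n) * inner x i)"
      by (intro linearI) (auto simp: inner_simps algebra_simps)
    from smooth_upto_affine[OF this, of m "flat_exp 0" "- (real (Suc n) * inner a i)"]
    show ?thesis using smooth_flat_exp smooth_iff_upto by (auto simp: algebra_simps)
  qed
  moreover have "smooth_upto m (\<lambda>x. flat_exp 0 (real (Suc n) * (inner b i - inner x i)))" for m i
  proof -
    have "linear (\<lambda>x. - (real (Suc n) * inner x i))"
      by (intro linearI) (auto simp: inner_simps algebra_simps)
    from smooth_upto_affine[OF this, of m "flat_exp 0" "real (Suc n) * inner b i"]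
    show ?thesis using smooth_flat_exp smooth_iff_upto by (auto simp: algebra_simps)
  qed
  ultimately have "smooth_upto m (\<lambda>x. box_bump a b n x)" for m
    unfolding box_bump_def by (intro smooth_upto_prod smooth_upto_mult)
  then show ?thesis using smooth_iff_upto by blast
qed

lemma flat_exp_0_bounds: "0 \<le> flat_exp 0 x" "flat_exp 0 x \<le> 1"
  by (auto simp: flat_exp_def)

lemma box_bump_bounds: "0 \<le> box_bump a b n x" "box_bump a b n x \<le> 1"
  unfolding box_bump_def
  by (auto intro!: prod_nonneg prod_le_1 mult_le_one flat_exp_0_bounds mult_nonneg_nonneg)

lemma box_bump_outside: "x \<notin> box a b \<Longrightarrow> box_bump a b n x = 0"
proof -
  assume "x \<notin> box a b"
  then obtain i where i: "i \<in> Basis" "\<not> (inner a i < inner x i \<and> inner x i < inner b i)"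
    by (auto simp: mem_box)
  then have "flat_exp 0 (real (Suc n) * (inner x i - inner a i))
      * flat_exp 0 (real (Suc n) * (inner b i - inner x i)) = 0"
    by (auto simp: flat_exp_def zero_less_mult_iff)
  then show ?thesis unfolding box_bump_def using i(1) by (intro prod_zero) auto
qed

lemma box_bump_tendsto: "(\<lambda>n. box_bump a b n x) \<longlonglongrightarrow> indicator (box a b) x"
proof (cases "x \<in> box a b")
  case True
  have fl: "(\<lambda>n. flat_exp 0 (real (Suc n) * c)) \<longlonglongrightarrow> 1" if "c > 0" for c
  proof -
    have "(\<lambda>n. (1/c) * (1 / real (Suc n))) \<longlonglongrightarrow> (1/c) * 0"
      by (intro tendsto_intros LIMSEQ_Suc[OF lim_1_over_n])
    then have "(\<lambda>n. exp (- ((1/c) * (1 / real (Suc n))))) \<longlonglongrightarrow> exp (- ((1/c) * 0))"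
      by (intro tendsto_exp tendsto_minus)
    moreover have "flat_exp 0 (real (Suc n) * c) = exp (- ((1/c) * (1 / real (Suc n))))" for n
    proof -
      have "0 < real (Suc n) * c" using that by (intro mult_pos_pos) auto
      then show ?thesis by (simp add: flat_exp_def mult.commute del: of_nat_Suc)
    qed
    ultimately show ?thesis by simp
  qed
  have "(\<lambda>n. box_bump a b n x) \<longlonglongrightarrow> (\<Prod>i\<in>(Basis::'a set). 1 * 1)"
    unfolding box_bump_def using True by (intro tendsto_prod tendsto_mult fl) (auto simp: mem_box)
  then show ?thesis using True by simp
qed (simp add: box_bump_outside)

lemma test_fun_box_bump:
  assumes "cbox a b \<subseteq> S" shows "test_fun S (box_bump a b n)"
proof -
  have "{x. box_bump a b n x \<noteq> 0} \<subseteq> cbox a b"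
    using box_bump_outside[of _ a b n] box_subset_cbox[of a b] by blast
  then have sub: "tsupp (box_bump a b n) \<subseteq> cbox a b" unfolding tsupp_def by (rule closure_minimal) (rule closed_cbox)
  have "compact (tsupp (box_bump a b n))"
    using sub bounded_subset[OF bounded_cbox sub] by (auto simp: tsupp_def compact_eq_bounded_closed)
  then show ?thesis unfolding test_fun_def using smooth_box_bump sub assms by blast
qed

section \<open>Closure properties of test functions\<close>

lemma test_fun_const0: "test_fun S (\<lambda>_. 0)"
  by (auto simp: test_fun_def smooth_const tsupp_def)

lemma compact_closed_subset: "compact K \<Longrightarrow> closed C \<Longrightarrow> C \<subseteq> K \<Longrightarrow> compact (C :: 'a::t2_space set)"
  using compact_Int_closed[of K C] by (simp add: Int_absorb1)

lemma tsupp_outside: "x \<notin> tsupp f \<Longrightarrow> f x = 0"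
  unfolding tsupp_def using closure_subset[of "{x. f x \<noteq> 0}"] by auto

lemma test_fun_add: assumes "test_fun S f" "test_fun S g" shows "test_fun S (\<lambda>x. f x + g x)"
proof -
  have "{x. f x + g x \<noteq> 0} \<subseteq> tsupp f \<union> tsupp g" 
  proof (rule subsetI, rule ccontr)
    fix x assume "x \<in> {x. f x + g x \<noteq> 0}" "x \<notin> tsupp f \<union> tsupp g"
    then show False using tsupp_outside[of x f] tsupp_outside[of x g] by simp
  qed
  then have sub: "tsupp (\<lambda>x. f x + g x) \<subseteq> tsupp f \<union> tsupp g" unfolding tsupp_def by (intro closure_minimal) auto
  moreover have "compact (tsupp f \<union> tsupp g)" using assms by (auto simp: test_fun_def)
  ultimately have "compact (tsupp (\<lambda>x. f x + g x))"
    using compact_closed_subset[OF _ _ sub] by (simp add: tsupp_def)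
  then show ?thesis using assms sub unfolding test_fun_def by (auto intro: smooth_add)
qed

lemma test_fun_mult:
  assumes "test_fun S f" "smooth g" shows "test_fun S (\<lambda>x. g x * f x)"
proof -
  have sub: "tsupp (\<lambda>x. g x * f x) \<subseteq> tsupp f" unfolding tsupp_def by (intro closure_mono) auto
  have "compact (tsupp f)" using assms by (simp add: test_fun_def)
  then have "compact (tsupp (\<lambda>x. g x * f x))"
    by (rule compact_closed_subset[OF _ _ sub]) (simp add: tsupp_def)
  then show ?thesis using assms sub unfolding test_fun_def by (auto intro: smooth_mult)
qed

lemma test_fun_cmult: "test_fun S f \<Longrightarrow> test_fun S (\<lambda>x. c * f x)"
  using test_fun_mult smooth_const by blast

lemma test_fun_outside: "test_fun S f \<Longrightarrow> x \<notin> S \<Longrightarrow> f x = 0"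
  using tsupp_outside[of x f] by (auto simp: test_fun_def)

lemma test_fun_differentiable: "test_fun S f \<Longrightarrow> f differentiable (at x)"
  by (simp add: test_fun_def smooth_differentiable)

lemma tsupp_pd: "tsupp (pd f d) \<subseteq> tsupp f"
proof -
  have "pd f d x = 0" if "x \<notin> tsupp f" for x
  proof -
    have ev: "eventually (\<lambda>y. f y = 0) (nhds x)"
    proof -
      have "open (- tsupp f)" "x \<in> - tsupp f" using that by (auto simp: tsupp_def)
      then have "eventually (\<lambda>y. y \<in> - tsupp f) (nhds x)" by (rule eventually_nhds_in_open)
      then show ?thesis
      proof eventually_elim
        fix y assume "y \<in> - tsupp f" then show "f y = 0" by (intro tsupp_outside) simp
      qed
    qed
    have "(f has_derivative (\<lambda>_. 0)) (at x)"
    proof (rule has_derivative_transform_eventually[of "\<lambda>_. 0"])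
      show "eventually (\<lambda>y. 0 = f y) (at x)"
        unfolding eventually_at_filter using ev by eventually_elim simp
      show "0 = f x" using eventually_nhds_x_imp_x[OF ev] by simp
    qed auto
    then show ?thesis by (rule pd_eqI)
  qed
  then have "{x. pd f d x \<noteq> 0} \<subseteq> tsupp f" by blast
  then show ?thesis unfolding tsupp_def by (metis closed_closure closure_minimal)
qed

lemma test_fun_pd: assumes "test_fun S f" shows "test_fun S (pd f d)"
proof -
  have "compact (tsupp f)" using assms by (simp add: test_fun_def)
  then have "compact (tsupp (pd f d))"
    by (rule compact_closed_subset[OF _ _ tsupp_pd]) (simp add: tsupp_def)
  then show ?thesis using assms tsupp_pd[of f d] smooth_pd unfolding test_fun_def by blast
qed

lemma test_fun_continuous: "test_fun S f \<Longrightarrow> continuous_on UNIV f"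
  by (simp add: test_fun_def smooth_continuous)

lemma test_fun_measurable[measurable_dest]: "test_fun S f \<Longrightarrow> f \<in> borel_measurable borel"
  using test_fun_continuous borel_measurable_continuous_onI by blast

lemma test_fun_bounded: assumes "test_fun S f" shows "\<exists>B>0. \<forall>x. \<bar>f x\<bar> \<le> B"
proof -
  have "compact (f ` tsupp f)"
  proof (rule compact_continuous_image)
    show "continuous_on (tsupp f) f" by (rule continuous_on_subset[OF test_fun_continuous[OF assms]]) simp
    show "compact (tsupp f)" using assms by (simp add: test_fun_def)
  qed
  then obtain B where B: "B > 0" "\<And>x. x \<in> tsupp f \<Longrightarrow> \<bar>f x\<bar> \<le> B"
    using bounded_pos[of "f ` tsupp f"] compact_imp_bounded by auto
  have "\<bar>f x\<bar> \<le> B" for x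
  proof (cases "x \<in> tsupp f")
    case False
    then have "f x = 0" by (rule tsupp_outside)
    then show ?thesis using B(1) by simp
  qed (use B in auto)
  then show ?thesis using B(1) by blast
qed

lemma sq_int_bounded_support:
  assumes f: "f \<in> borel_measurable borel" and b: "\<And>x. norm (f x) \<le> B" and K: "bounded K" "\<And>x. x \<notin> K \<Longrightarrow> f x = 0"
  shows "sq_int f"
proof -
  obtain c d where cd: "K \<subseteq> cbox c d" using K(1) bounded_subset_cbox_symmetric by blast
  have "integrable lborel (\<lambda>x. (norm (f x))\<^sup>2)"
  proof (rule Bochner_Integration.integrable_bound)
    show "integrable lborel (\<lambda>x. B\<^sup>2 * indicator (cbox c d) x)" 
      by (intro integrable_mult_right integrable_real_indicator) (use emeasure_lborel_cbox_finite[of c d] in auto)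
    have "norm ((norm (f x))\<^sup>2) \<le> norm (B\<^sup>2 * indicator (cbox c d) x :: real)" for x
      using b[of x] K(2)[of x] cd by (cases "x \<in> cbox c d") (auto intro!: power_mono)
    then show "AE x in lborel. norm ((norm (f x))\<^sup>2) \<le> norm (B\<^sup>2 * indicator (cbox c d) x :: real)" by simp
  qed (use f in measurable)
  then show ?thesis using f by (simp add: sq_int_def)
qed

lemma test_fun_sq_int: assumes "test_fun S f" shows "sq_int f"
proof -
  obtain B where B: "\<And>x. \<bar>f x\<bar> \<le> B" using test_fun_bounded[OF assms] by blast
  have "f x = 0" if "x \<notin> tsupp f" for x using that by (rule tsupp_outside)
  moreover have "bounded (tsupp f)" using assms by (simp add: test_fun_def compact_imp_bounded)
  ultimately show ?thesis
    using sq_int_bounded_support[OF test_fun_measurable[OF assms], of B "tsupp f"] B by simp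
qed

section \<open>The fundamental lemma of the calculus of variations\<close>

lemma AE_zero_if_box_integrals_zero:
  fixes k :: "'a::euclidean_space \<Rightarrow> real"
  assumes k: "integrable lborel k" and z: "\<And>a b. (LINT x|lborel. k x * indicator (box a b) x) = 0"
  shows "AE x in lborel. k x = 0"
proof -
  have [measurable]: "k \<in> borel_measurable borel" using k by auto
  \<comment> \<open>The positive and the negative part of \<open>k\<close> are densities of two
    finite measures. They agree on boxes, an intersection-stable generator, and hence on all Borel
    sets.\<close>
  define P where "P = density lborel (\<lambda>x. ennreal (max 0 (k x)))"
  define Q where "Q = density lborel (\<lambda>x. ennreal (max 0 (- k x)))"
  have i1: "integrable lborel (\<lambda>x. max 0 (k x) * indicator A x)" if "A \<in> sets borel" for A
    by (rule Bochner_Integration.integrable_bound[OF k]) (use that in \<open>auto simp: indicator_def\<close>)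
  have i2: "integrable lborel (\<lambda>x. max 0 (- k x) * indicator A x)" if "A \<in> sets borel" for A
    by (rule Bochner_Integration.integrable_bound[OF k]) (use that in \<open>auto simp: indicator_def\<close>)
  have P: "emeasure P A = ennreal (LINT x|lborel. max 0 (k x) * indicator A x)" if [measurable]: "A \<in> sets borel" for A
  proof -
    have "emeasure P A = (\<integral>\<^sup>+x. ennreal (max 0 (k x)) * indicator A x \<partial>lborel)"
      unfolding P_def by (subst emeasure_density) auto
    also have "\<dots> = (\<integral>\<^sup>+x. ennreal (max 0 (k x) * indicator A x) \<partial>lborel)"
      by (intro nn_integral_cong) (auto simp: indicator_def)
    also have "\<dots> = ennreal (LINT x|lborel. max 0 (k x) * indicator A x)"
      by (rule nn_integral_eq_integral[OF i1]) auto
    finally show ?thesis .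
  qed
  have Q: "emeasure Q A = ennreal (LINT x|lborel. max 0 (- k x) * indicator A x)" if [measurable]: "A \<in> sets borel" for A
  proof -
    have "emeasure Q A = (\<integral>\<^sup>+x. ennreal (max 0 (- k x)) * indicator A x \<partial>lborel)"
      unfolding Q_def by (subst emeasure_density) auto
    also have "\<dots> = (\<integral>\<^sup>+x. ennreal (max 0 (- k x) * indicator A x) \<partial>lborel)"
      by (intro nn_integral_cong) (auto simp: indicator_def)
    also have "\<dots> = ennreal (LINT x|lborel. max 0 (- k x) * indicator A x)"
      by (rule nn_integral_eq_integral[OF i2]) auto
    finally show ?thesis .
  qed
  have "P = Q"
  proof (rule measure_eqI_generator_eq)
    let ?E = "range (\<lambda>(a, b). box a b :: 'a set)"
    show "Int_stable ?E" by (auto simp: Int_stable_def box_Int_box)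
    show "?E \<subseteq> Pow UNIV" by simp
    show "sets P = sigma_sets UNIV ?E" "sets Q = sigma_sets UNIV ?E"
      by (simp_all add: P_def Q_def borel_eq_box)
    let ?A = "\<lambda>n::nat. box (- (real n *\<^sub>R One)) (real n *\<^sub>R One) :: 'a set"
    show "range ?A \<subseteq> ?E" "(\<Union>i. ?A i) = UNIV" unfolding UN_box_eq_UNIV by auto
    show "emeasure P (?A i) \<noteq> \<infinity>" for i using P by simp
    fix X assume "X \<in> ?E"
    then obtain a b where X: "X = box a b" by auto
    have "(LINT x|lborel. max 0 (k x) * indicator X x) - (LINT x|lborel. max 0 (- k x) * indicator X x)
      = (LINT x|lborel. max 0 (k x) * indicator X x - max 0 (- k x) * indicator X x)"
      unfolding X by (subst Bochner_Integration.integral_diff) (auto intro!: i1 i2)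
    also have "\<dots> = (LINT x|lborel. k x * indicator X x)"
      by (intro Bochner_Integration.integral_cong) (auto simp: max_def indicator_def)
    also have "\<dots> = 0" using z X by simp
    finally show "emeasure P X = emeasure Q X" using P[of X] Q[of X] X by simp
  qed
  then have "AE x in lborel. ennreal (max 0 (k x)) = ennreal (max 0 (- k x))"
    unfolding P_def Q_def by (intro sigma_finite_measure.density_unique[OF sigma_finite_lborel]) auto
  then show ?thesis
  proof eventually_elim
    fix x assume "ennreal (max 0 (k x)) = ennreal (max 0 (- k x))"
    then have "max 0 (k x) = max 0 (- k x)" by (subst (asm) ennreal_inj) auto
    then show "k x = 0" by (auto simp: max_def split: if_splits)
  qed
qed

lemma AE_not_box_boundary: "AE x in lborel. x \<in> cbox a b \<longrightarrow> x \<in> box a b"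
proof -
  have "cbox a b - box a b \<in> null_sets lebesgue"
    using negligible_frontier_interval[of a b] by (simp add: negligible_iff_null_sets)
  then have "AE x in lebesgue. x \<notin> cbox a b - box a b" by (rule AE_not_in)
  then show ?thesis by (auto simp: AE_completion_iff elim: eventually_mono)
qed

text \<open>Bump functions converge boundedly to the indicator of an open box, so \<open>h\<close>
  integrates to zero over every box whose closure lies in \<open>S\<close>. Countably many closed
  boxes exhaust \<open>S\<close>, and their boundaries are null sets.\<close>

lemma du_Bois_Reymond:
  fixes h :: "'a::euclidean_space \<Rightarrow> real"
  assumes h: "sq_int h" and S: "open S"
    and z: "\<And>\<phi>. test_fun S \<phi> \<Longrightarrow> (LINT x|lborel. h x * \<phi> x) = 0"
  shows "AE x in lborel. x \<in> S \<longrightarrow> h x = 0"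
proof -
  have [measurable]: "h \<in> borel_measurable borel" using h by (simp add: sq_int_def)
  have int: "integrable lborel (\<lambda>x. h x * indicator (box a b) x)" for a b
  proof -
    have "sq_int (indicator (box a b) :: 'a \<Rightarrow> real)"
      by (rule sq_int_bounded_support[of _ 1 "box a b"]) (auto simp: indicator_def)
    from sq_int_inner[OF h this] show ?thesis by simp
  qed
  have box0: "(LINT x|lborel. h x * indicator (box a b) x) = 0" if "cbox a b \<subseteq> S" for a b
  proof -
    have "(\<lambda>n. LINT x|lborel. h x * box_bump a b n x) \<longlonglongrightarrow> (LINT x|lborel. h x * indicator (box a b) x)"
    proof (rule integral_dominated_convergence[where w="\<lambda>x. \<bar>h x * indicator (box a b) x\<bar>"])
      have [measurable]: "box_bump a b n \<in> borel_measurable borel" for n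
        by (rule test_fun_measurable[OF test_fun_box_bump[OF that]])
      show "(\<lambda>x. h x * box_bump a b n x) \<in> borel_measurable lborel" for n by simp
      show "AE x in lborel. (\<lambda>n. h x * box_bump a b n x) \<longlonglongrightarrow> h x * indicator (box a b) x"
        by (intro AE_I2 tendsto_intros box_bump_tendsto)
      have "\<bar>h x * box_bump a b n x\<bar> \<le> \<bar>h x * indicator (box a b) x\<bar>" for n x
        using box_bump_bounds[of a b n x] box_bump_outside[of x a b n]
        by (cases "x \<in> box a b") (auto simp: abs_mult intro!: mult_left_le)
      then show "AE x in lborel. norm (h x * box_bump a b n x) \<le> \<bar>h x * indicator (box a b) x\<bar>" for n by simp
    qed (use int in auto)
    moreover have "(LINT x|lborel. h x * box_bump a b n x) = 0" for n
      by (rule z[OF test_fun_box_bump[OF that]])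
    ultimately show ?thesis by (simp add: LIMSEQ_const_iff)
  qed
  have AEbox: "AE x in lborel. x \<in> cbox a b \<longrightarrow> h x = 0" if ab: "cbox a b \<subseteq> S" for a b
  proof -
    have "AE x in lborel. h x * indicator (box a b) x = 0"
    proof (rule AE_zero_if_box_integrals_zero[OF int])
      fix c d
      obtain e f where ef: "box a b \<inter> box c d = box e f" using box_Int_box by blast
      have "(LINT x|lborel. h x * indicator (box a b) x * indicator (box c d) x) = (LINT x|lborel. h x * indicator (box e f) x)"
        unfolding ef[symmetric] by (intro Bochner_Integration.integral_cong) (auto simp: indicator_def)
      also have "\<dots> = 0"
      proof (cases "box e f = {}")
        case False
        then have "cbox e f \<subseteq> cbox a b"
          using ef box_subset_cbox[of a b] closure_box[OF False] closure_minimal[of "box e f" "cbox a b"] by auto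
        then show ?thesis using ab by (intro box0) auto
      qed simp
      finally show "(LINT x|lborel. h x * indicator (box a b) x * indicator (box c d) x) = 0" .
    qed
    with AE_not_box_boundary[of a b] show ?thesis by eventually_elim auto
  qed
  obtain D where D: "countable D" "D \<subseteq> Pow S" "\<And>X. X \<in> D \<Longrightarrow> \<exists>a b. X = cbox a b" "\<Union>D = S"
    using open_countable_Union_open_cbox[OF S] by metis
  have "AE x in lborel. \<forall>X\<in>D. x \<in> X \<longrightarrow> h x = 0"
    unfolding AE_ball_countable[OF D(1)]
  proof
    fix X assume X: "X \<in> D"
    then obtain a b where "X = cbox a b" using D(3) by blast
    then show "AE x in lborel. x \<in> X \<longrightarrow> h x = 0" using AEbox X D(2) by blast
  qed
  then show ?thesis by eventually_elim (use D(4) in blast)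
qed

section \<open>Restriction, translation and weak derivatives\<close>

lemma bounded_linear_l2I:
  assumes "\<And>u v. T (u + v) = T u + T v" "\<And>c u. T (c *\<^sub>R u) = c *\<^sub>R T u" "\<And>u. norm (T u) \<le> C * norm u"
  shows "bounded_linear T"
  by (rule bounded_linear_intro[where K=C]) (use assms in \<open>auto simp: mult.commute\<close>)

definition cut :: "'a set \<Rightarrow> ('a::euclidean_space, 'b::euclidean_space) l2 \<Rightarrow> ('a, 'b) l2" where
  "cut A u = mk (\<lambda>x. indicator A x *\<^sub>R fn u x)"

lemma fn_cut: "A \<in> sets borel \<Longrightarrow> AE x in lborel. fn (cut A u) x = indicator A x *\<^sub>R fn u x"
  unfolding cut_def by (intro fn_mk sq_int_indicator sq_int_fn)

lemma bounded_linear_cut: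
  assumes A: "A \<in> sets borel" shows "bounded_linear (cut A)"
proof (rule bounded_linear_l2I[where C=1])
  show "cut A (u + v) = cut A u + cut A v" for u v
    by (rule l2_eqI)
      (use fn_cut[OF A, of "u+v"] fn_cut[OF A, of u] fn_cut[OF A, of v] fn_add[of u v] fn_add[of "cut A u" "cut A v"]
       in eventually_elim, simp add: scaleR_right_distrib)
  show "cut A (c *\<^sub>R u) = c *\<^sub>R cut A u" for c u
    by (rule l2_eqI)
      (use fn_cut[OF A, of "c *\<^sub>R u"] fn_cut[OF A, of u] fn_scaleR[of c u] fn_scaleR[of c "cut A u"]
       in eventually_elim, simp)
  show "norm (cut A u) \<le> 1 * norm u" for u
    unfolding cut_def mult_1
    by (rule norm_mk_le[OF sq_int_indicator[OF sq_int_fn A]]) (auto simp: indicator_def)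
qed

lemma norm_cut_le: "A \<in> sets borel \<Longrightarrow> norm (cut A u) \<le> norm u"
  unfolding cut_def
  by (rule norm_mk_le[OF sq_int_indicator[OF sq_int_fn]]) (auto simp: indicator_def)

lemma inner_cut:
  assumes A: "A \<in> sets borel" shows "inner (cut A u) v = (LINT x|lborel. indicator A x * inner (fn u x) (fn v x))"
  unfolding inner_l2_def
  by (intro integral_cong_AE) (use A fn_cut[OF A, of u] in \<open>auto elim!: eventually_mono\<close>)

lemma inner_cut_commute: "A \<in> sets borel \<Longrightarrow> inner (cut A u) v = inner u (cut A v)"
  using inner_cut[of A u v] inner_cut[of A v u] by (simp add: inner_commute)

lemma cut_eq_self: "A \<in> sets borel \<Longrightarrow> (AE x in lborel. x \<notin> A \<longrightarrow> fn u x = 0) \<Longrightarrow> cut A u = u"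
  by (rule l2_eqI) (use fn_cut[of A u] in \<open>auto elim!: eventually_elim2 simp: indicator_def\<close>)

lemma cut_support: "A \<in> sets borel \<Longrightarrow> AE x in lborel. x \<notin> A \<longrightarrow> fn (cut A u) x = 0"
  by (rule eventually_mono[OF fn_cut]) auto

lemma cut_cut: "A \<in> sets borel \<Longrightarrow> cut A (cut A u) = cut A u"
  by (intro cut_eq_self cut_support)

lemma AE_shift:
  fixes h :: "'a::euclidean_space"
  assumes "AE x in lborel. P x" shows "AE x in lborel. P (x + h)"
proof -
  obtain N where N: "{x \<in> space lborel. \<not> P x} \<subseteq> N" "N \<in> null_sets lborel"
    using assms unfolding eventually_ae_filter by blast
  have [measurable]: "N \<in> sets borel" using N(2) by auto
  have "AE x in distr lborel borel ((+) h). x \<notin> N"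
    unfolding lborel_distr_plus by (rule AE_not_in[OF N(2)])
  then have "AE x in lborel. h + x \<notin> N" by (subst (asm) AE_distr_iff) auto
  then show ?thesis by eventually_elim (use N(1) in \<open>auto simp: add.commute\<close>)
qed

lemma lborel_integral_shift:
  fixes f :: "'a::euclidean_space \<Rightarrow> real" assumes "f \<in> borel_measurable borel"
  shows "(LINT x|lborel. f (x + h)) = (LINT x|lborel. f x)"
proof -
  have "(LINT x|lborel. f x) = (LINT x|distr lborel borel ((+) h). f x)" unfolding lborel_distr_plus by simp
  also have "\<dots> = (LINT x|lborel. f (h + x))" by (rule integral_distr) (use assms in auto)
  finally show ?thesis by (simp add: add.commute)
qed

lemma sq_int_shift:
  assumes "sq_int f" shows "sq_int (\<lambda>x. f (x + h))"
proof -
  have [measurable]: "f \<in> borel_measurable borel" using assms by (simp add: sq_int_def)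
  have "integrable (distr lborel borel ((+) h)) (\<lambda>x. (norm (f x))\<^sup>2)"
    unfolding lborel_distr_plus by (rule sq_int_integrable[OF assms])
  then have "integrable lborel (\<lambda>x. (norm (f (h + x)))\<^sup>2)"
    by (subst (asm) integrable_distr_eq) auto
  then show ?thesis unfolding sq_int_def by (simp add: add.commute)
qed

definition tr :: "'a \<Rightarrow> ('a::euclidean_space, 'b::euclidean_space) l2 \<Rightarrow> ('a, 'b) l2" where
  "tr h u = mk (\<lambda>x. fn u (x + h))"

lemma fn_tr: "AE x in lborel. fn (tr h u) x = fn u (x + h)"
  unfolding tr_def by (intro fn_mk sq_int_shift sq_int_fn)

lemma tr_mk: assumes "sq_int f" shows "tr h (mk f) = mk (\<lambda>x. f (x + h))"
  by (rule l2_eqI)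
    (use fn_tr[of h "mk f"] AE_shift[OF fn_mk[OF assms], of h] fn_mk[OF sq_int_shift[OF assms], of h] in eventually_elim, simp)

lemma inner_tr: "inner (tr h u) (tr h v) = inner u v"
proof -
  have "inner (tr h u) (tr h v) = (LINT x|lborel. inner (fn u (x + h)) (fn v (x + h)))"
    unfolding tr_def by (intro inner_mk sq_int_shift sq_int_fn)
  also have "\<dots> = inner u v"
    unfolding inner_l2_def by (rule lborel_integral_shift[of "\<lambda>x. inner (fn u x) (fn v x)"]) simp
  finally show ?thesis .
qed

lemma norm_tr: "norm (tr h u) = norm u"
  by (simp add: norm_eq_sqrt_inner inner_tr)

lemma tr_tr: "tr h (tr k u) = tr (h + k) u"
  by (rule l2_eqI)
    (use fn_tr[of h "tr k u"] AE_shift[OF fn_tr[of k u], of h] fn_tr[of "h+k" u] in eventually_elim, simp add: add.assoc)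

lemma tr_0: "tr 0 u = u" by (simp add: tr_def)

lemma tr_add: "tr h (u + v) = tr h u + tr h v"
  by (rule l2_eqI)
    (use fn_tr[of h u] fn_tr[of h v] fn_tr[of h "u+v"] AE_shift[OF fn_add[of u v], of h] fn_add[of "tr h u" "tr h v"]
     in eventually_elim, simp)

lemma tr_diff: "tr h (u - v) = tr h u - tr h v"
  by (metis tr_add diff_add_cancel add_diff_cancel)

lemma inner_tr_left: "inner (tr h u) v = inner u (tr (- h) v)"
  using inner_tr[of h u "tr (- h) v"] by (simp add: tr_tr tr_0)

definition app :: "('b \<Rightarrow> 'c) \<Rightarrow> ('a::euclidean_space, 'b::euclidean_space) l2 \<Rightarrow> ('a, 'c::euclidean_space) l2" where
  "app L u = mk (\<lambda>x. L (fn u x))"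

lemma sq_int_compose_linear:
  assumes L: "bounded_linear L" and f: "sq_int f" shows "sq_int (\<lambda>x. L (f x))"
proof -
  have [measurable]: "f \<in> borel_measurable borel" using f by (simp add: sq_int_def)
  have [measurable]: "L \<in> borel_measurable borel"
    by (rule borel_measurable_continuous_onI) (rule bounded_linear.continuous_on[OF L continuous_on_id])
  obtain K where K: "\<And>x. norm (L x) \<le> norm x * K" using bounded_linear.bounded[OF L] by blast
  have "sq_int (\<lambda>x. K *\<^sub>R f x)" by (rule sq_int_scaleR[OF f])
  from sq_int_integrable[OF this] have "integrable lborel (\<lambda>x. (norm (L (f x)))\<^sup>2)"
  proof (rule Bochner_Integration.integrable_bound)
    have "(norm (L (f x)))\<^sup>2 \<le> (norm (K *\<^sub>R f x))\<^sup>2" for x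
    proof (rule power_mono)
      have "norm (f x) * K \<le> norm (f x) * \<bar>K\<bar>" by (intro mult_left_mono) auto
      then show "norm (L (f x)) \<le> norm (K *\<^sub>R f x)" using K[of "f x"] by (simp add: mult.commute)
    qed simp
    then show "AE x in lborel. norm ((norm (L (f x)))\<^sup>2) \<le> norm ((norm (K *\<^sub>R f x))\<^sup>2)" by simp
  qed simp
  then show ?thesis by (simp add: sq_int_def)
qed

lemma fn_app: "bounded_linear L \<Longrightarrow> AE x in lborel. fn (app L u) x = L (fn u x)"
  unfolding app_def by (rule fn_mk[OF sq_int_compose_linear[OF _ sq_int_fn]])

lemma bounded_linear_app:
  assumes L: "bounded_linear L" shows "bounded_linear (app L)"
proof -
  obtain K where K: "\<And>x. norm (L x) \<le> norm x * K" "0 < K" using bounded_linear.pos_bounded[OF L] by blast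
  show ?thesis
  proof (rule bounded_linear_l2I[where C=K])
    show "app L (u + v) = app L u + app L v" for u v
      by (rule l2_eqI)
        (use fn_app[OF L, of "u+v"] fn_app[OF L, of u] fn_app[OF L, of v] fn_add[of u v] fn_add[of "app L u" "app L v"]
         in eventually_elim, simp add: linear_add[OF bounded_linear.linear[OF L]])
    show "app L (c *\<^sub>R u) = c *\<^sub>R app L u" for c u
      by (rule l2_eqI)
        (use fn_app[OF L, of "c *\<^sub>R u"] fn_app[OF L, of u] fn_scaleR[of c u] fn_scaleR[of c "app L u"]
         in eventually_elim, simp add: linear_cmul[OF bounded_linear.linear[OF L]])
    fix u
    have "norm (app L u) \<le> norm (K *\<^sub>R u)"
      unfolding app_def
    proof (rule norm_mk_le[OF sq_int_compose_linear[OF L sq_int_fn]])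
      show "AE x in lborel. norm (L (fn u x)) \<le> norm (fn (K *\<^sub>R u) x)"
        using fn_scaleR[of K u] by eventually_elim (use K in \<open>simp add: mult.commute\<close>)
    qed
    then show "norm (app L u) \<le> K * norm u" using K(2) by simp
  qed
qed

section \<open>Vector-valued test functions and weak directional derivatives\<close>

definition vtest :: "'a::euclidean_space set \<Rightarrow> ('a \<Rightarrow> 'b::euclidean_space) \<Rightarrow> bool" where
  "vtest S \<Phi> \<longleftrightarrow> (\<forall>e\<in>Basis. test_fun S (\<lambda>x. inner (\<Phi> x) e))"

definition vpd :: "('a::euclidean_space \<Rightarrow> 'b::euclidean_space) \<Rightarrow> 'a \<Rightarrow> 'a \<Rightarrow> 'b" where
  "vpd \<Phi> d x = (\<Sum>e\<in>Basis. pd (\<lambda>x. inner (\<Phi> x) e) d x *\<^sub>R e)"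

lemma vpd_inner: "e \<in> Basis \<Longrightarrow> inner (vpd \<Phi> d x) e = pd (\<lambda>x. inner (\<Phi> x) e) d x"
  unfolding vpd_def by simp

lemma vtest_sq_int: assumes "vtest S \<Phi>" shows "sq_int \<Phi>"
proof -
  have "sq_int (\<lambda>x. inner (\<Phi> x) e *\<^sub>R e)" if "e \<in> Basis" for e
  proof -
    have "test_fun S (\<lambda>x. inner (\<Phi> x) e)" using assms that by (simp add: vtest_def)
    then show ?thesis
      by (rule sq_int_compose_linear[OF bounded_linear_scaleR_left test_fun_sq_int])
  qed
  then have "sq_int (\<lambda>x. \<Sum>e\<in>Basis. inner (\<Phi> x) e *\<^sub>R e)" by (rule sq_int_sum)
  then show ?thesis by (simp add: euclidean_representation)
qed

lemma vtest_vpd: "vtest S \<Phi> \<Longrightarrow> vtest S (vpd \<Phi> d)"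
  unfolding vtest_def by (simp add: vpd_inner test_fun_pd)

lemma vtest_add: "vtest S \<Phi> \<Longrightarrow> vtest S \<Psi> \<Longrightarrow> vtest S (\<lambda>x. \<Phi> x + \<Psi> x)"
  unfolding vtest_def by (auto simp: inner_add_left intro: test_fun_add)

lemma vtest_scaleR: "vtest S \<Phi> \<Longrightarrow> vtest S (\<lambda>x. c *\<^sub>R \<Phi> x)"
  unfolding vtest_def by (auto intro: test_fun_cmult)

lemma vtest_0: "vtest S (\<lambda>_. 0)"
  unfolding vtest_def by (simp add: test_fun_const0)

lemma vpd_add: "vtest S \<Phi> \<Longrightarrow> vtest S \<Psi> \<Longrightarrow> vpd (\<lambda>x. \<Phi> x + \<Psi> x) d = (\<lambda>x. vpd \<Phi> d x + vpd \<Psi> d x)"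
  unfolding vpd_def vtest_def
  by (intro ext) (simp add: inner_add_left pd_add test_fun_differentiable[of S] scaleR_left_distrib sum.distrib)

lemma vpd_scaleR: "vtest S \<Phi> \<Longrightarrow> vpd (\<lambda>x. c *\<^sub>R \<Phi> x) d = (\<lambda>x. c *\<^sub>R vpd \<Phi> d x)"
  unfolding vpd_def vtest_def
  by (intro ext) (simp add: pd_cmult test_fun_differentiable[of S] scaleR_sum_right)

lemma vtest_outside: assumes "vtest S \<Phi>" "x \<notin> S" shows "\<Phi> x = 0"
proof (rule euclidean_eqI)
  fix e :: 'b assume "e \<in> Basis"
  then show "inner (\<Phi> x) e = inner 0 e" using assms test_fun_outside unfolding vtest_def by fastforce
qed

lemma vtest_axis: assumes "test_fun S \<phi>" "e \<in> Basis"
  shows "vtest S (\<lambda>x. \<phi> x *\<^sub>R e)" "vpd (\<lambda>x. \<phi> x *\<^sub>R e) d = (\<lambda>x. pd \<phi> d x *\<^sub>R e)"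
proof -
  have c: "(\<lambda>x. inner (\<phi> x *\<^sub>R e) e') = (if e = e' then \<phi> else (\<lambda>_. 0))" if "e' \<in> Basis" for e'
    using assms(2) that by (auto simp: inner_Basis)
  show "vtest S (\<lambda>x. \<phi> x *\<^sub>R e)" unfolding vtest_def using assms(1) c by (simp add: test_fun_const0)
  show "vpd (\<lambda>x. \<phi> x *\<^sub>R e) d = (\<lambda>x. pd \<phi> d x *\<^sub>R e)"
  proof (rule ext, rule euclidean_eqI)
    fix x :: 'a and e' :: 'b assume e': "e' \<in> Basis"
    show "inner (vpd (\<lambda>x. \<phi> x *\<^sub>R e) d x) e' = inner (pd \<phi> d x *\<^sub>R e) e'"
      unfolding vpd_inner[OF e'] c[OF e'] using assms(2) e'
      by (cases "e = e'") (auto simp: pd_const inner_Basis)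
  qed
qed

text \<open>A relation instead of an operator: it is linear and closed in the pair of
  \<open>g\<close> and \<open>G\<close>, and it pins down \<open>G\<close> on \<open>S\<close> only.
  Being stated through inner products, it passes to norm limits without further argument.\<close>

definition weakd :: "'a::euclidean_space set \<Rightarrow> 'a \<Rightarrow> ('a, 'b::euclidean_space) l2 \<Rightarrow> ('a, 'b) l2 \<Rightarrow> bool" where
  "weakd S d g G \<longleftrightarrow> (\<forall>\<Phi>. vtest S \<Phi> \<longrightarrow> inner g (mk (vpd \<Phi> d)) = - inner G (mk \<Phi>))"

lemma inner_mk_components:
  assumes "sq_int \<Phi>"
  shows "inner g (mk \<Phi>) = (\<Sum>e\<in>Basis. LINT x|lborel. inner (fn g x) e * inner (\<Phi> x) e)"
proof -
  have i: "integrable lborel (\<lambda>x. inner (fn g x) e * inner (\<Phi> x) e)" for e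
  proof -
    have "sq_int (\<lambda>x. inner (fn g x) e)" "sq_int (\<lambda>x. inner (\<Phi> x) e)"
      using sq_int_compose_linear[OF bounded_linear_inner_left sq_int_fn]
        sq_int_compose_linear[OF bounded_linear_inner_left assms] by auto
    from sq_int_inner[OF this] show ?thesis by simp
  qed
  have "inner g (mk \<Phi>) = (LINT x|lborel. (\<Sum>e\<in>Basis. inner (fn g x) e * inner (\<Phi> x) e))"
    unfolding inner_mk_right[OF assms] by (subst euclidean_inner) simp
  also have "\<dots> = (\<Sum>e\<in>Basis. LINT x|lborel. inner (fn g x) e * inner (\<Phi> x) e)"
    by (rule Bochner_Integration.integral_sum) (rule i)
  finally show ?thesis .
qed

lemma weakd_components:
  "weakd S d g G \<longleftrightarrow> (\<forall>e\<in>Basis. \<forall>\<phi>. test_fun S \<phi> \<longrightarrow>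
     (LINT x|lborel. inner (fn g x) e * pd \<phi> d x) = - (LINT x|lborel. inner (fn G x) e * \<phi> x))"
proof (intro iffI ballI allI impI)
  fix e \<phi> assume w: "weakd S d g G" and e: "(e::'b) \<in> Basis" and t: "test_fun S \<phi>"
  have s: "sq_int (\<lambda>x. \<phi> x *\<^sub>R e)" "sq_int (\<lambda>x. pd \<phi> d x *\<^sub>R e)"
    using vtest_sq_int[OF vtest_axis(1)[OF t e]] vtest_sq_int[OF vtest_axis(1)[OF test_fun_pd[OF t] e]] by auto
  have "inner g (mk (\<lambda>x. pd \<phi> d x *\<^sub>R e)) = - inner G (mk (\<lambda>x. \<phi> x *\<^sub>R e))"
    using w vtest_axis[OF t e] unfolding weakd_def by metis
  then show "(LINT x|lborel. inner (fn g x) e * pd \<phi> d x) = - (LINT x|lborel. inner (fn G x) e * \<phi> x)"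
    unfolding inner_mk_right[OF s(1)] inner_mk_right[OF s(2)] by (simp add: mult.commute)
next
  assume h: "\<forall>e\<in>Basis. \<forall>\<phi>. test_fun S \<phi> \<longrightarrow>
     (LINT x|lborel. inner (fn g x) e * pd \<phi> d x) = - (LINT x|lborel. inner (fn G x) e * \<phi> x)"
  show "weakd S d g G" unfolding weakd_def
  proof (intro allI impI)
    fix \<Phi> :: "'a \<Rightarrow> 'b" assume t: "vtest S \<Phi>"
    show "inner g (mk (vpd \<Phi> d)) = - inner G (mk \<Phi>)"
      unfolding inner_mk_components[OF vtest_sq_int[OF t]] inner_mk_components[OF vtest_sq_int[OF vtest_vpd[OF t]]]
        sum_negf[symmetric]
      by (intro sum.cong refl) (use h t in \<open>simp add: vpd_inner vtest_def\<close>)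
  qed
qed

lemma subspace_vtests: "subspace {mk \<Phi> |\<Phi>. vtest S \<Phi>}"
proof (rule subspaceI)
  show "0 \<in> {mk \<Phi> |\<Phi>. vtest S \<Phi>}" unfolding zero_l2_def using vtest_0 by blast
  show "x + y \<in> {mk \<Phi> |\<Phi>. vtest S \<Phi>}" if "x \<in> {mk \<Phi> |\<Phi>. vtest S \<Phi>}" "y \<in> {mk \<Phi> |\<Phi>. vtest S \<Phi>}" for x y
    using that by (auto simp: mk_add[symmetric] vtest_sq_int intro: vtest_add)
  show "c *\<^sub>R x \<in> {mk \<Phi> |\<Phi>. vtest S \<Phi>}" if "x \<in> {mk \<Phi> |\<Phi>. vtest S \<Phi>}" for c x
    using that by (auto simp: mk_scaleR[symmetric] vtest_sq_int intro: vtest_scaleR)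
qed

lemma vtest_orthogonal_zero:
  fixes u :: "('a::euclidean_space, 'b::euclidean_space) l2"
  assumes S: "open S" and z: "\<And>\<Phi>. vtest S \<Phi> \<Longrightarrow> inner u (mk \<Phi>) = 0"
  shows "AE x in lborel. x \<in> S \<longrightarrow> fn u x = 0"
proof -
  have "AE x in lborel. x \<in> S \<longrightarrow> inner (fn u x) e = 0" if e: "e \<in> Basis" for e :: 'b
  proof (rule du_Bois_Reymond[OF sq_int_compose_linear[OF bounded_linear_inner_left sq_int_fn] S])
    fix \<phi> :: "'a \<Rightarrow> real" assume t: "test_fun S \<phi>"
    show "(LINT x|lborel. inner (fn u x) e * \<phi> x) = 0"
      using z[OF vtest_axis(1)[OF t e]] unfolding inner_mk_right[OF vtest_sq_int[OF vtest_axis(1)[OF t e]]]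
      by (simp add: mult.commute)
  qed
  then have "AE x in lborel. \<forall>e\<in>Basis. x \<in> S \<longrightarrow> inner (fn u x) e = 0"
    by (intro AE_finite_allI) auto
  then show ?thesis
  proof eventually_elim
    fix x assume "\<forall>e\<in>Basis. x \<in> S \<longrightarrow> inner (fn u x) e = 0"
    then show "x \<in> S \<longrightarrow> fn u x = 0" by (auto intro: euclidean_eqI)
  qed
qed

text \<open>By the fundamental lemma, the residual of the projection onto the closed span of test
  functions vanishes on \<open>S\<close>. It vanishes off \<open>S\<close> as well, because
  \<open>u\<close> does and every limit of test functions does.\<close>

lemma vtests_dense:
  fixes u :: "('a::euclidean_space, 'b::euclidean_space) l2"
  assumes S: "open S" and u: "AE x in lborel. x \<notin> S \<longrightarrow> fn u x = 0"
  shows "u \<in> closure {mk \<Phi> |\<Phi>. vtest S \<Phi>}"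
proof -
  let ?M = "{mk \<Phi> |\<Phi>. vtest S \<Phi>} :: ('a,'b) l2 set"
  have "\<exists>p\<in>closure ?M. \<forall>y\<in>closure ?M. inner (u - p) y = 0"
    by (rule subspace_projection[OF closed_closure subspace_closure_Hilbert[OF subspace_vtests]])
  then obtain p where p: "p \<in> closure ?M" "\<And>y. y \<in> closure ?M \<Longrightarrow> inner (u - p) y = 0" by blast
  have "inner (u - p) (mk \<Phi>) = 0" if "vtest S \<Phi>" for \<Phi>
    using that closure_subset[of ?M] by (intro p(2)) auto
  from vtest_orthogonal_zero[OF S this] have 1: "AE x in lborel. x \<in> S \<longrightarrow> fn (u - p) x = 0" .
  have "closed {w::('a,'b) l2. AE x in lborel. fn w x \<in> (if x \<in> S then UNIV else {0})}"
    by (rule closed_AE_l2) auto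
  moreover have "?M \<subseteq> {w. AE x in lborel. fn w x \<in> (if x \<in> S then UNIV else {0})}"
  proof clarify
    fix \<Phi> :: "'a \<Rightarrow> 'b" assume t: "vtest S \<Phi>"
    show "AE x in lborel. fn (mk \<Phi>) x \<in> (if x \<in> S then UNIV else {0})"
      using fn_mk[OF vtest_sq_int[OF t]] by eventually_elim (use vtest_outside[OF t] in auto)
  qed
  ultimately have "closure ?M \<subseteq> {w. AE x in lborel. fn w x \<in> (if x \<in> S then UNIV else {0})}"
    by (rule closure_minimal[rotated])
  then have 2: "AE x in lborel. fn p x \<in> (if x \<in> S then UNIV else {0})" using p(1) by blast
  have "u = p"
    by (rule l2_eqI) (use 1 2 u fn_diff[of u p] in eventually_elim, auto split: if_splits)
  then show ?thesis using p(1) by simp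
qed

text \<open>The class \<open>cut S u\<close> is a limit of test functions, so the bound extends to
  it; there the pairing with \<open>u\<close> is its own squared norm.\<close>

lemma norm_cut_le_vtests:
  assumes S: "open S" and le: "\<And>\<Phi>. vtest S \<Phi> \<Longrightarrow> \<bar>inner u (mk \<Phi>)\<bar> \<le> C * norm (mk \<Phi>)" and C: "C \<ge> 0"
  shows "norm (cut S u) \<le> C"
proof -
  have Sb: "S \<in> sets borel" using S by simp
  have "cut S u \<in> closure {mk \<Phi> |\<Phi>. vtest S \<Phi>}"
    by (rule vtests_dense[OF S cut_support[OF Sb]])
  moreover have "closed {w. \<bar>inner u w\<bar> \<le> C * norm w}"
    by (intro closed_Collect_le continuous_intros)
  then have "closure {mk \<Phi> |\<Phi>. vtest S \<Phi>} \<subseteq> {w. \<bar>inner u w\<bar> \<le> C * norm w}"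
    by (intro closure_minimal) (use le in auto)
  ultimately have "\<bar>inner u (cut S u)\<bar> \<le> C * norm (cut S u)" by blast
  moreover have "inner u (cut S u) = (norm (cut S u))\<^sup>2"
    using inner_cut_commute[OF Sb, of u "cut S u"] by (simp add: cut_cut[OF Sb] power2_norm_eq_inner)
  ultimately have "norm (cut S u) * norm (cut S u) \<le> C * norm (cut S u)" by (simp add: power2_eq_square)
  then show ?thesis using C by (cases "norm (cut S u) = 0") auto
qed

lemma weakd_unique:
  assumes S: "open S" and "weakd S d g G" "weakd S d g G'" shows "cut S G = cut S G'"
proof -
  have Sb: "S \<in> sets borel" using S by simp
  have "norm (cut S (G - G')) \<le> 0"
    by (rule norm_cut_le_vtests[OF S]) (use assms(2,3) in \<open>auto simp: weakd_def inner_diff_left\<close>)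
  then show ?thesis using linear_diff[OF bounded_linear.linear[OF bounded_linear_cut[OF Sb]], of G G'] by simp
qed

section \<open>Translates of test functions and increments of weakly differentiable
  functions\<close>

lemma test_fun_shift:
  assumes t: "test_fun S \<phi>" and sub: "\<And>x. x \<in> S \<Longrightarrow> x + h \<in> S'"
  shows "test_fun S' (\<lambda>x. \<phi> (x - h))" "pd (\<lambda>x. \<phi> (x - h)) d = (\<lambda>x. pd \<phi> d (x - h))"
proof -
  have eq: "(\<lambda>x. \<phi> (x - h)) = (\<lambda>x. \<phi> (- h + x))" by (simp add: algebra_simps)
  have lid: "linear (\<lambda>x::'a. x)" by (intro linearI) auto
  have "{x. \<phi> (x - h) \<noteq> 0} = (+) h ` {x. \<phi> x \<noteq> 0}"
    by (auto simp: image_iff) (metis add_diff_cancel_left' add.commute diff_add_cancel)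
  then have ts: "tsupp (\<lambda>x. \<phi> (x - h)) = (+) h ` tsupp \<phi>"
    unfolding tsupp_def by (simp add: closure_translation)
  have "smooth (\<lambda>x. \<phi> (x - h))" unfolding eq using t by (intro smooth_affine[OF lid]) (simp add: test_fun_def)
  moreover have "compact (tsupp (\<lambda>x. \<phi> (x - h)))"
    unfolding ts using t by (intro compact_translation) (simp add: test_fun_def)
  moreover have "tsupp (\<lambda>x. \<phi> (x - h)) \<subseteq> S'"
    unfolding ts using t sub by (auto simp: test_fun_def add.commute)
  ultimately show "test_fun S' (\<lambda>x. \<phi> (x - h))" by (simp add: test_fun_def)
  show "pd (\<lambda>x. \<phi> (x - h)) d = (\<lambda>x. pd \<phi> d (x - h))"
  proof
    fix x
    show "pd (\<lambda>x. \<phi> (x - h)) d x = pd \<phi> d (x - h)"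
      unfolding eq using pd_affine(1)[OF test_fun_differentiable[OF t] lid, where c="- h" and x=x and d=d]
      by (simp add: algebra_simps)
  qed
qed

lemma test_fun_line_derivative:
  assumes "test_fun S \<phi>"
  shows "((\<lambda>s. \<phi> (x - s *\<^sub>R d)) has_real_derivative - pd \<phi> d (x - s *\<^sub>R d)) (at s)"
proof -
  have "linear (\<lambda>s::real. - s *\<^sub>R d)" by (intro linearI) (auto simp: algebra_simps)
  from pd_affine(1)[OF test_fun_differentiable[OF assms] this, where c=x and x=s and d=1]
    pd_affine(2)[OF test_fun_differentiable[OF assms] this, where c=x and x=s]
  have "pd (\<lambda>s. \<phi> (x + - s *\<^sub>R d)) 1 s = pd \<phi> (- d) (x - s *\<^sub>R d)"
    and df: "(\<lambda>s. \<phi> (x + - s *\<^sub>R d)) differentiable (at s)" by auto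
  moreover have "pd \<phi> (- d) y = - pd \<phi> d y" for y
    using linear_neg[OF has_derivative_linear[OF pd_has_derivative[OF test_fun_differentiable[OF assms]]]] by blast
  moreover have lin: "linear (\<lambda>e. pd (\<lambda>s. \<phi> (x + - s *\<^sub>R d)) e s)"
    by (rule has_derivative_linear[OF pd_has_derivative[OF df]])
  moreover have "pd (\<lambda>s. \<phi> (x + - s *\<^sub>R d)) e s = pd (\<lambda>s. \<phi> (x + - s *\<^sub>R d)) 1 s * e" for e
    using linear_cmul[OF lin, of e 1] by (simp add: mult.commute)
  ultimately have eq: "(\<lambda>e. pd (\<lambda>s. \<phi> (x + - s *\<^sub>R d)) e s) = (*) (- pd \<phi> d (x - s *\<^sub>R d))" by (simp add: fun_eq_iff)
  show ?thesis
    using pd_has_derivative[OF df] unfolding has_field_derivative_def eq by simp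
qed

text \<open>The translation acts on the smooth factor, so square integrability of \<open>h\<close>
  suffices. Difference quotients of \<phi> are dominated by its Lipschitz constant along
  \<open>d\<close> on one ball that contains all translated supports.\<close>

lemma translated_test_integral_derivative:
  fixes h :: "'a::euclidean_space \<Rightarrow> real"
  assumes h: "sq_int h" and t: "test_fun S \<phi>"
  shows "((\<lambda>s. LINT x|lborel. h x * \<phi> (x - s *\<^sub>R d)) has_real_derivative
     - (LINT x|lborel. h x * pd \<phi> d (x - s *\<^sub>R d))) (at s)"
proof -
  have [measurable]: "h \<in> borel_measurable borel" "\<phi> \<in> borel_measurable borel" "pd \<phi> d \<in> borel_measurable borel"
    using h t by (auto simp: sq_int_def test_fun_measurable intro: test_fun_measurable[OF test_fun_pd])
  obtain C where C: "C > 0" "\<And>x. \<bar>pd \<phi> d x\<bar> \<le> C" using test_fun_bounded[OF test_fun_pd[OF t]] by blast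
  have int: "integrable lborel (\<lambda>x. h x * \<phi> (x - k))" for k
    using sq_int_inner[OF h sq_int_shift[OF test_fun_sq_int[OF t], of "- k"]] by simp
  have lip: "\<bar>\<phi> (x - a *\<^sub>R d) - \<phi> (x - b *\<^sub>R d)\<bar> \<le> C * \<bar>a - b\<bar>" for x a b
    using field_differentiable_bound[of UNIV "\<lambda>s. \<phi> (x - s *\<^sub>R d)" "\<lambda>s. - pd \<phi> d (x - s *\<^sub>R d)" C a b]
      test_fun_line_derivative[OF t] C(2) by auto
  obtain R where R: "\<And>y. y \<in> tsupp \<phi> \<Longrightarrow> norm y \<le> R"
    using t unfolding test_fun_def by (meson bounded_iff compact_imp_bounded)
  have "((\<lambda>k. ((LINT x|lborel. h x * \<phi> (x - (s + k) *\<^sub>R d)) - (LINT x|lborel. h x * \<phi> (x - s *\<^sub>R d))) / k)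
      \<longlongrightarrow> - (LINT x|lborel. h x * pd \<phi> d (x - s *\<^sub>R d))) (at 0)"
  proof (subst tendsto_at_iff_sequentially, intro allI impI)
    fix X :: "nat \<Rightarrow> real" assume X: "\<forall>i. X i \<in> UNIV - {0}" "X \<longlonglongrightarrow> 0"
    obtain M where M: "\<And>n. \<bar>X n\<bar> \<le> M" using Bseq_def convergent_imp_Bseq[of X] X(2) convergent_def
      by (metis real_norm_def)
    \<comment> \<open>Radius of a ball containing the supports of all translates along the sequence:
      \<open>R\<close> bounds the support of \<phi>, and \<open>\<bar>s\<bar> + M\<close> bounds the
      parameters.\<close>
    define B where "B = R + (\<bar>s\<bar> + M) * norm d"
    have zero: "\<phi> (x - a *\<^sub>R d) = 0" if "x \<notin> cball 0 B" "\<bar>a\<bar> \<le> \<bar>s\<bar> + M" for x a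
    proof (rule tsupp_outside[of _ \<phi>], rule notI)
      assume "x - a *\<^sub>R d \<in> tsupp \<phi>"
      then have "norm (x - a *\<^sub>R d) \<le> R" by (rule R)
      moreover have "norm x \<le> norm (x - a *\<^sub>R d) + norm (a *\<^sub>R d)" by (metis diff_add_cancel norm_triangle_ineq)
      moreover have "norm (a *\<^sub>R d) \<le> (\<bar>s\<bar> + M) * norm d" using that(2) by (simp add: mult_right_mono)
      ultimately show False using that(1) by (simp add: B_def)
    qed
    have "(\<lambda>n. LINT x|lborel. h x * ((\<phi> (x - (s + X n) *\<^sub>R d) - \<phi> (x - s *\<^sub>R d)) / X n))
       \<longlonglongrightarrow> (LINT x|lborel. h x * (- pd \<phi> d (x - s *\<^sub>R d)))"
    proof (rule integral_dominated_convergence[where w="\<lambda>x. C * \<bar>h x * indicator (cball 0 B) x\<bar>"])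
      have "sq_int (indicator (cball 0 B) :: 'a \<Rightarrow> real)"
        by (rule sq_int_bounded_support[of _ 1 "cball 0 B"])
          (auto intro: borel_measurable_indicator split: split_indicator)
      from sq_int_inner[OF h this] show "integrable lborel (\<lambda>x. C * \<bar>h x * indicator (cball 0 B) x\<bar>)" by simp
      show "AE x in lborel. (\<lambda>n. h x * ((\<phi> (x - (s + X n) *\<^sub>R d) - \<phi> (x - s *\<^sub>R d)) / X n)) \<longlonglongrightarrow> h x * (- pd \<phi> d (x - s *\<^sub>R d))"
      proof (intro AE_I2 tendsto_mult tendsto_const)
        fix x
        have "((\<lambda>k. (\<phi> (x - (s + k) *\<^sub>R d) - \<phi> (x - s *\<^sub>R d)) / k) \<longlongrightarrow> - pd \<phi> d (x - s *\<^sub>R d)) (at 0)"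
          using test_fun_line_derivative[OF t, of x d s] by (simp add: DERIV_def)
        then show "(\<lambda>n. (\<phi> (x - (s + X n) *\<^sub>R d) - \<phi> (x - s *\<^sub>R d)) / X n) \<longlonglongrightarrow> - pd \<phi> d (x - s *\<^sub>R d)"
          using X by (subst (asm) tendsto_at_iff_sequentially) (auto simp: comp_def)
      qed
      have "\<bar>h x * ((\<phi> (x - (s + X n) *\<^sub>R d) - \<phi> (x - s *\<^sub>R d)) / X n)\<bar> \<le> C * \<bar>h x * indicator (cball 0 B) x\<bar>" for x n
      proof (cases "x \<in> cball 0 B")
        case True
        have "X n \<noteq> 0" using X(1) by auto
        then have "\<bar>(\<phi> (x - (s + X n) *\<^sub>R d) - \<phi> (x - s *\<^sub>R d)) / X n\<bar> \<le> C"
          using lip[of x "s + X n" s] by (simp add: abs_divide divide_le_eq)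
        then have "\<bar>h x\<bar> * \<bar>(\<phi> (x - (s + X n) *\<^sub>R d) - \<phi> (x - s *\<^sub>R d)) / X n\<bar> \<le> \<bar>h x\<bar> * C"
          by (intro mult_left_mono) auto
        then show ?thesis using True by (simp add: abs_mult mult.commute)
      next
        case False
        have "\<bar>s + X n\<bar> \<le> \<bar>s\<bar> + M" "\<bar>s\<bar> \<le> \<bar>s\<bar> + M" using M[of n] by linarith+
        then show ?thesis using zero[OF False] False by simp
      qed
      then show "AE x in lborel. norm (h x * ((\<phi> (x - (s + X n) *\<^sub>R d) - \<phi> (x - s *\<^sub>R d)) / X n))
          \<le> C * \<bar>h x * indicator (cball 0 B) x\<bar>" for n by simp
    qed auto
    moreover have "(LINT x|lborel. h x * ((\<phi> (x - (s + X n) *\<^sub>R d) - \<phi> (x - s *\<^sub>R d)) / X n))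
       = ((LINT x|lborel. h x * \<phi> (x - (s + X n) *\<^sub>R d)) - (LINT x|lborel. h x * \<phi> (x - s *\<^sub>R d))) / X n" for n
    proof -
      have "(LINT x|lborel. h x * ((\<phi> (x - (s + X n) *\<^sub>R d) - \<phi> (x - s *\<^sub>R d)) / X n))
        = (LINT x|lborel. (h x * \<phi> (x - (s + X n) *\<^sub>R d) - h x * \<phi> (x - s *\<^sub>R d)) / X n)"
        by (intro Bochner_Integration.integral_cong) (auto simp: field_simps)
      then show ?thesis using int by simp
    qed
    ultimately show "((\<lambda>k. ((LINT x|lborel. h x * \<phi> (x - (s + k) *\<^sub>R d)) - (LINT x|lborel. h x * \<phi> (x - s *\<^sub>R d))) / k) \<circ> X)
       \<longlonglongrightarrow> - (LINT x|lborel. h x * pd \<phi> d (x - s *\<^sub>R d))"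
      by (simp only: comp_def mult_minus_right Bochner_Integration.integral_minus)
  qed
  then show ?thesis by (simp add: DERIV_def)
qed

lemma vtest_shift:
  assumes t: "vtest S \<Phi>" and sub: "\<And>x. x \<in> S \<Longrightarrow> x + h \<in> S'"
  shows "vtest S' (\<lambda>x. \<Phi> (x - h))" "vpd (\<lambda>x. \<Phi> (x - h)) d = (\<lambda>x. vpd \<Phi> d (x - h))"
proof -
  show "vtest S' (\<lambda>x. \<Phi> (x - h))" using t sub unfolding vtest_def by (auto intro: test_fun_shift(1))
  show "vpd (\<lambda>x. \<Phi> (x - h)) d = (\<lambda>x. vpd \<Phi> d (x - h))"
    unfolding vpd_def
  proof (intro ext sum.cong refl)
    fix x and e :: 'b assume "e \<in> Basis"
    then have "test_fun S (\<lambda>x. inner (\<Phi> x) e)" using t by (simp add: vtest_def)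
    from test_fun_shift(2)[OF this sub, of d]
    show "pd (\<lambda>x. inner (\<Phi> (x - h)) e) d x *\<^sub>R e = pd (\<lambda>x. inner (\<Phi> x) e) d (x - h) *\<^sub>R e" by simp
  qed
qed

lemma inner_tr_test_derivative:
  assumes t: "vtest S \<Phi>"
  shows "((\<lambda>s. inner w (tr (- (s *\<^sub>R d)) (mk \<Phi>))) has_real_derivative
      - inner w (tr (- (s *\<^sub>R d)) (mk (vpd \<Phi> d)))) (at s)"
proof -
  have eq: "inner w (tr (- (s *\<^sub>R d)) (mk \<Psi>)) = (\<Sum>e\<in>Basis. LINT x|lborel. inner (fn w x) e * inner (\<Psi> (x - s *\<^sub>R d)) e)"
    if "vtest S \<Psi>" for s \<Psi>
    using inner_mk_components[OF sq_int_shift[OF vtest_sq_int[OF that], of "- (s *\<^sub>R d)"], of w]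
    by (simp add: tr_mk[OF vtest_sq_int[OF that]])
  show ?thesis
    unfolding eq[OF t] eq[OF vtest_vpd[OF t]] sum_negf[symmetric]
  proof (intro DERIV_sum)
    fix e :: 'b assume e: "e \<in> Basis"
    then have "test_fun S (\<lambda>x. inner (\<Phi> x) e)" using t by (simp add: vtest_def)
    moreover have "sq_int (\<lambda>x. inner (fn w x) e)"
      by (rule sq_int_compose_linear[OF bounded_linear_inner_left sq_int_fn])
    ultimately have "((\<lambda>s. LINT x|lborel. inner (fn w x) e * inner (\<Phi> (x - s *\<^sub>R d)) e) has_real_derivative
         - (LINT x|lborel. inner (fn w x) e * pd (\<lambda>x. inner (\<Phi> x) e) d (x - s *\<^sub>R d))) (at s)"
      by (intro translated_test_integral_derivative)
    then
    show "((\<lambda>s. LINT x|lborel. inner (fn w x) e * inner (\<Phi> (x - s *\<^sub>R d)) e) has_real_derivative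
         - (LINT x|lborel. inner (fn w x) e * inner (vpd \<Phi> d (x - s *\<^sub>R d)) e)) (at s)"
      by (simp add: vpd_inner[OF e])
  qed
qed

text \<open>Translating \<open>w\<close> amounts to translating \<Phi> the other way, and while the
  translate remains a test function on \<open>S\<close> the derivative can be moved onto
  \<open>w\<close>. The mean value theorem for this scalar function of \<open>s\<close> replaces a
  fundamental theorem of calculus along lines. The intermediate point depends on \<Phi>.\<close>

lemma weakd_mean_value:
  assumes w: "weakd S d w W" and h: "0 < h"
    and sub: "\<And>x s. x \<in> U \<Longrightarrow> 0 \<le> s \<Longrightarrow> s \<le> h \<Longrightarrow> x + s *\<^sub>R d \<in> S"
    and t: "vtest U \<Phi>"
  shows "\<exists>s. 0 < s \<and> s < h \<and> inner (tr (h *\<^sub>R d) w - w) (mk \<Phi>) = h * inner (tr (s *\<^sub>R d) W) (mk \<Phi>)"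
proof -
  define F where "F s = inner w (tr (- (s *\<^sub>R d)) (mk \<Phi>))" for s
  have "(F has_real_derivative inner (tr (s *\<^sub>R d) W) (mk \<Phi>)) (at s)" if s: "0 \<le> s" "s \<le> h" for s
  proof -
    have vt: "vtest S (\<lambda>x. \<Phi> (x - s *\<^sub>R d))" "vpd (\<lambda>x. \<Phi> (x - s *\<^sub>R d)) d = (\<lambda>x. vpd \<Phi> d (x - s *\<^sub>R d))"
      using vtest_shift[OF t, of "s *\<^sub>R d" S] sub s by auto
    have "- inner w (tr (- (s *\<^sub>R d)) (mk (vpd \<Phi> d))) = - inner w (mk (vpd (\<lambda>x. \<Phi> (x - s *\<^sub>R d)) d))"
      using vt(2) by (simp add: tr_mk[OF vtest_sq_int[OF vtest_vpd[OF t]]])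
    also have "\<dots> = inner W (mk (\<lambda>x. \<Phi> (x - s *\<^sub>R d)))" using w vt(1) by (simp add: weakd_def)
    also have "\<dots> = inner (tr (s *\<^sub>R d) W) (mk \<Phi>)"
      unfolding inner_tr_left by (simp add: tr_mk[OF vtest_sq_int[OF t]])
    finally show ?thesis unfolding F_def using inner_tr_test_derivative[OF t, of w d s] by simp
  qed
  from MVT2[OF h this] obtain s where s: "0 < s" "s < h" "F h - F 0 = (h - 0) * inner (tr (s *\<^sub>R d) W) (mk \<Phi>)"
    by blast
  moreover have "F h - F 0 = inner (tr (h *\<^sub>R d) w - w) (mk \<Phi>)"
    unfolding F_def by (simp add: inner_tr_left[symmetric] inner_diff_left tr_0)
  ultimately show ?thesis by auto
qed

text \<open>All translates of \<open>W\<close> have the same norm, so it does no harm that the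
  intermediate point varies with the test function; duality then gives a bound in norm.\<close>

lemma norm_translation_increment_le:
  assumes w: "weakd S d w W" and h: "0 < h" and U: "open U"
    and sub: "\<And>x s. x \<in> U \<Longrightarrow> 0 \<le> s \<Longrightarrow> s \<le> h \<Longrightarrow> x + s *\<^sub>R d \<in> S"
  shows "norm (cut U (tr (h *\<^sub>R d) w - w)) \<le> h * norm W"
proof (rule norm_cut_le_vtests[OF U])
  fix \<Phi> :: "'a \<Rightarrow> 'b" assume t: "vtest U \<Phi>"
  obtain s where s: "inner (tr (h *\<^sub>R d) w - w) (mk \<Phi>) = h * inner (tr (s *\<^sub>R d) W) (mk \<Phi>)"
    using weakd_mean_value[OF w h sub t] by blast
  have "\<bar>inner (tr (s *\<^sub>R d) W) (mk \<Phi>)\<bar> \<le> norm W * norm (mk \<Phi>)"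
    using Cauchy_Schwarz_ineq2[of "tr (s *\<^sub>R d) W" "mk \<Phi>"] by (simp add: norm_tr)
  then show "\<bar>inner (tr (h *\<^sub>R d) w - w) (mk \<Phi>)\<bar> \<le> h * norm W * norm (mk \<Phi>)"
    unfolding s using h by (simp add: abs_mult mult.assoc)
qed (use h in simp)

section \<open>Time slices and step functions\<close>

lemma AE_lborel_slices:
  fixes P :: "'a::euclidean_space \<times> real \<Rightarrow> bool"
  assumes "AE z in lborel. P z" shows "AE t in lborel. AE x in lborel. P (x, t)"
proof -
  obtain N where N: "{z \<in> space lborel. \<not> P z} \<subseteq> N" "N \<in> null_sets lborel"
    using assms unfolding eventually_ae_filter by blast
  have Nm: "N \<in> sets (lborel \<Otimes>\<^sub>M lborel)" using N(2) unfolding lborel_prod by auto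
  have "AE z in lborel \<Otimes>\<^sub>M lborel. z \<notin> N" unfolding lborel_prod by (rule AE_not_in[OF N(2)])
  then have "AE x in lborel. AE t in lborel. (x, t) \<notin> N" by (rule lborel_pair.AE_pair)
  \<comment> \<open>Exchanging the two almost everywhere quantifiers requires a measurable set,
    which is why the null set \<open>N\<close> stands in for the set where \<open>P\<close>
    fails.\<close>
  moreover have "{z \<in> space (lborel \<Otimes>\<^sub>M lborel). (fst z, snd z) \<notin> N} \<in> sets (lborel \<Otimes>\<^sub>M lborel)"
  proof -
    have eq: "{z \<in> space (lborel \<Otimes>\<^sub>M lborel). (fst z, snd z) \<notin> N} = space (lborel \<Otimes>\<^sub>M lborel) - N" by auto
    show ?thesis unfolding eq by (rule sets.compl_sets[OF Nm])
  qed
  ultimately have "AE t in lborel. AE x in lborel. (x, t) \<notin> N"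
    using lborel_pair.AE_commute[of "\<lambda>x t. (x, t) \<notin> N"] by simp
  then show ?thesis
  proof eventually_elim
    fix t assume "AE x in lborel. (x, t) \<notin> N"
    then show "AE x in lborel. P (x, t)" by eventually_elim (use N(1) in auto)
  qed
qed

lemma lborel_Fubini:
  fixes h :: "'a::euclidean_space \<times> real \<Rightarrow> real"
  assumes "integrable lborel h"
  shows "AE t in lborel. integrable lborel (\<lambda>x. h (x, t))"
    and "integrable lborel (\<lambda>t. LINT x|lborel. h (x, t))"
    and "(LINT t|lborel. LINT x|lborel. h (x, t)) = (LINT z|lborel. h z)"
proof -
  have i: "integrable (lborel \<Otimes>\<^sub>M lborel) (case_prod (\<lambda>x t. h (x, t)))"
    using assms by (simp add: lborel_prod)
  show "AE t in lborel. integrable lborel (\<lambda>x. h (x, t))" by (rule lborel_pair.AE_integrable_snd[OF i])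
  show "integrable lborel (\<lambda>t. LINT x|lborel. h (x, t))" by (rule lborel_pair.integrable_snd[OF i])
  show "(LINT t|lborel. LINT x|lborel. h (x, t)) = (LINT z|lborel. h z)"
    using lborel_pair.integral_snd[OF i] by (simp add: lborel_prod)
qed

lemma slice_borel:
  fixes f :: "'a::euclidean_space \<times> real \<Rightarrow> 'b::euclidean_space"
  assumes "f \<in> borel_measurable borel" shows "(\<lambda>x. f (x, t)) \<in> borel_measurable borel"
proof -
  have "(\<lambda>x::'a. (x, t)) \<in> borel_measurable borel"
    by (rule borel_measurable_continuous_onI) (intro continuous_intros)
  from measurable_compose[OF this assms] show ?thesis .
qed

text \<open>The default 0 concerns a null set of times only. It makes slicing total, at the price
  that linearity of slices holds at almost every time and not at every time.\<close>

definition sl :: "('a::euclidean_space \<times> real, 'b::euclidean_space) l2 \<Rightarrow> real \<Rightarrow> ('a, 'b) l2" where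
  "sl g t = (if sq_int (\<lambda>x. fn g (x, t)) then mk (\<lambda>x. fn g (x, t)) else 0)"

lemma AE_slice_sq_int:
  fixes g :: "('a::euclidean_space \<times> real, 'b::euclidean_space) l2"
  shows "AE t in lborel. sq_int (\<lambda>x. fn g (x, t))"
  using lborel_Fubini(1)[OF sq_int_integrable[OF sq_int_fn[of g]]]
  by eventually_elim (simp add: sq_int_def slice_borel)

lemma fn_sl: "AE t in lborel. AE x in lborel. fn (sl g t) x = fn g (x, t)"
  using AE_slice_sq_int[of g] by eventually_elim (simp add: sl_def fn_mk)

lemma sl_AE_eqI:
  assumes "AE t in lborel. AE x in lborel. fn g (x, t) = fn (h t) x"
  shows "AE t in lborel. sl g t = h t"
  using assms fn_sl[of g]
proof eventually_elim
  fix t assume "AE x in lborel. fn g (x, t) = fn (h t) x" "AE x in lborel. fn (sl g t) x = fn g (x, t)"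
  then have "AE x in lborel. fn (sl g t) x = fn (h t) x" by eventually_elim simp
  then show "sl g t = h t" by (rule l2_eqI)
qed

lemma sl_mk:
  assumes f: "sq_int f" and h: "\<And>t. AE x in lborel. fn (h t) x = f (x, t)"
  shows "AE t in lborel. sl (mk f) t = h t"
proof (rule sl_AE_eqI)
  show "AE t in lborel. AE x in lborel. fn (mk f) (x, t) = fn (h t) x"
    using AE_lborel_slices[OF fn_mk[OF f]]
  proof eventually_elim
    fix t assume "AE x in lborel. fn (mk f) (x, t) = f (x, t)"
    with h[of t] show "AE x in lborel. fn (mk f) (x, t) = fn (h t) x" by eventually_elim simp
  qed
qed

lemma sl_add: "AE t in lborel. sl (g + h) t = sl g t + sl h t"
proof (rule sl_AE_eqI)
  show "AE t in lborel. AE x in lborel. fn (g + h) (x, t) = fn (sl g t + sl h t) x"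
    using AE_lborel_slices[OF fn_add[of g h]] fn_sl[of g] fn_sl[of h]
  proof eventually_elim
    fix t assume "AE x in lborel. fn (g + h) (x, t) = fn g (x, t) + fn h (x, t)"
      "AE x in lborel. fn (sl g t) x = fn g (x, t)" "AE x in lborel. fn (sl h t) x = fn h (x, t)"
    with fn_add[of "sl g t" "sl h t"]
    show "AE x in lborel. fn (g + h) (x, t) = fn (sl g t + sl h t) x" by eventually_elim simp
  qed
qed

lemma sl_scaleR: "AE t in lborel. sl (c *\<^sub>R g) t = c *\<^sub>R sl g t"
proof (rule sl_AE_eqI)
  show "AE t in lborel. AE x in lborel. fn (c *\<^sub>R g) (x, t) = fn (c *\<^sub>R sl g t) x"
    using AE_lborel_slices[OF fn_scaleR[of c g]] fn_sl[of g]
  proof eventually_elim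
    fix t assume "AE x in lborel. fn (c *\<^sub>R g) (x, t) = c *\<^sub>R fn g (x, t)"
      "AE x in lborel. fn (sl g t) x = fn g (x, t)"
    with fn_scaleR[of c "sl g t"]
    show "AE x in lborel. fn (c *\<^sub>R g) (x, t) = fn (c *\<^sub>R sl g t) x" by eventually_elim simp
  qed
qed

lemma sl_diff: "AE t in lborel. sl (g - h) t = sl g t - sl h t"
  using sl_add[of g "(-1) *\<^sub>R h"] sl_scaleR[of "-1" h] by eventually_elim simp

lemma sl_zero: "AE t in lborel. sl 0 t = 0"
  using sl_scaleR[of 0 0] by simp

lemma sl_app: assumes L: "bounded_linear L" shows "AE t in lborel. sl (app L g) t = app L (sl g t)"
proof (rule sl_AE_eqI)
  show "AE t in lborel. AE x in lborel. fn (app L g) (x, t) = fn (app L (sl g t)) x"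
    using AE_lborel_slices[OF fn_app[OF L, of g]] fn_sl[of g]
  proof eventually_elim
    fix t assume "AE x in lborel. fn (app L g) (x, t) = L (fn g (x, t))"
      "AE x in lborel. fn (sl g t) x = fn g (x, t)"
    with fn_app[OF L, of "sl g t"]
    show "AE x in lborel. fn (app L g) (x, t) = fn (app L (sl g t)) x" by eventually_elim simp
  qed
qed

lemma borel_swap:
  fixes F :: "'a::euclidean_space \<times> real \<Rightarrow> 'c::topological_space"
  assumes "F \<in> borel_measurable borel"
  shows "(\<lambda>(t, x). F (x, t)) \<in> borel_measurable (borel \<Otimes>\<^sub>M lborel)"
proof -
  have "(\<lambda>z::real \<times> 'a. (snd z, fst z)) \<in> borel_measurable borel"
    by (rule borel_measurable_continuous_onI) (intro continuous_intros)
  from measurable_compose[OF this assms]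
  have "(\<lambda>(t, x). F (x, t)) \<in> borel_measurable borel" by (simp add: case_prod_beta')
  moreover have "sets (borel \<Otimes>\<^sub>M lborel :: (real \<times> 'a) measure) = sets borel"
    unfolding borel_prod[symmetric] by (rule sets_pair_measure_cong) simp_all
  ultimately show ?thesis by (subst measurable_cong_sets[of _ borel]) auto
qed

lemma measurable_slice_sq_int:
  fixes g :: "('a::euclidean_space \<times> real, 'b::euclidean_space) l2"
  shows "Measurable.pred borel (\<lambda>t. sq_int (\<lambda>x. fn g (x, t)))"
proof -
  have "(\<lambda>z. ennreal ((norm (fn g z))\<^sup>2)) \<in> borel_measurable borel" by simp
  from borel_swap[OF this]
  have "(\<lambda>t. \<integral>\<^sup>+x. ennreal ((norm (fn g (x, t)))\<^sup>2) \<partial>lborel) \<in> borel_measurable borel"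
    by (rule sigma_finite_measure.borel_measurable_nn_integral[OF sigma_finite_lborel])
  then have "Measurable.pred borel (\<lambda>t. (\<integral>\<^sup>+x. ennreal ((norm (fn g (x, t)))\<^sup>2) \<partial>lborel) < \<infinity>)" by measurable
  moreover have "sq_int (\<lambda>x. fn g (x, t)) \<longleftrightarrow> (\<integral>\<^sup>+x. ennreal ((norm (fn g (x, t)))\<^sup>2) \<partial>lborel) < \<infinity>" for t
    using slice_borel[OF fn_borel, of g t] by (simp add: sq_int_def integrable_iff_bounded)
  ultimately show ?thesis by simp
qed

lemma measurable_inner_sl:
  fixes g :: "('a::euclidean_space \<times> real, 'b::euclidean_space) l2"
  shows "(\<lambda>t. inner (sl g t) v) \<in> borel_measurable borel"
proof -
  have "(\<lambda>z::'a \<times> real. fn v (fst z)) \<in> borel_measurable borel"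
    by (rule measurable_compose[OF borel_measurable_continuous_onI[OF continuous_on_fst[OF continuous_on_id]] fn_borel])
  then have "(\<lambda>z. inner (fn g z) (fn v (fst z))) \<in> borel_measurable borel" by simp
  from borel_swap[OF this]
  have [measurable]: "(\<lambda>t. LINT x|lborel. inner (fn g (x, t)) (fn v x)) \<in> borel_measurable borel"
    by (intro sigma_finite_measure.borel_measurable_lebesgue_integral[OF sigma_finite_lborel]) simp
  note [measurable] = measurable_slice_sq_int[of g]
  have "inner (sl g t) v = (if sq_int (\<lambda>x. fn g (x, t)) then (LINT x|lborel. inner (fn g (x, t)) (fn v x)) else 0)" for t
    using inner_mk_right[of "\<lambda>x. fn g (x, t)" v] by (simp add: sl_def inner_commute)
  then show ?thesis by simp
qed

text \<open>Fubini's theorem, read as an isometry between L2 on space-time and square-integrable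
  functions of time with values in L2. It takes the place of Bochner integration.\<close>

lemma inner_slices:
  shows "integrable lborel (\<lambda>t. inner (sl g t) (sl h t))"
    and "(LINT t|lborel. inner (sl g t) (sl h t)) = inner g h"
proof -
  define q where "q t = (LINT x|lborel. inner (fn g (x, t)) (fn h (x, t)))" for t
  have i: "integrable lborel (\<lambda>z. inner (fn g z) (fn h z))" by (rule sq_int_inner) auto
  have q: "integrable lborel q" "(LINT t|lborel. q t) = inner g h"
    unfolding q_def inner_l2_def using lborel_Fubini(2,3)[OF i] by auto
  have eq: "inner (sl g t) (sl h t) = (if sq_int (\<lambda>x. fn g (x, t)) \<and> sq_int (\<lambda>x. fn h (x, t)) then q t else 0)" for t
    by (auto simp: sl_def q_def inner_mk)
  note [measurable] = measurable_slice_sq_int[of g] measurable_slice_sq_int[of h]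
  have [measurable]: "q \<in> borel_measurable borel" using q(1) by auto
  have meas: "(\<lambda>t. inner (sl g t) (sl h t)) \<in> borel_measurable borel"
    unfolding eq by measurable
  have AEq: "AE t in lborel. inner (sl g t) (sl h t) = q t"
    using AE_slice_sq_int[of g] AE_slice_sq_int[of h] by eventually_elim (simp add: eq)
  show "integrable lborel (\<lambda>t. inner (sl g t) (sl h t))"
    using q(1) by (rule integrable_cong_AE_imp) (use meas AEq in auto)
  show "(LINT t|lborel. inner (sl g t) (sl h t)) = inner g h"
    unfolding q(2)[symmetric] by (rule integral_cong_AE) (use meas AEq in auto)
qed

lemma norm_slices:
  shows "integrable lborel (\<lambda>t. (norm (sl g t))\<^sup>2)" and "(LINT t|lborel. (norm (sl g t))\<^sup>2) = (norm g)\<^sup>2"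
  using inner_slices[of g g] by (simp_all add: power2_norm_eq_inner)

lemma l2_eq_slicesI:
  assumes "AE t in lborel. sl g t = sl h t" shows "g = h"
proof -
  have "AE t in lborel. (norm (sl (g - h) t))\<^sup>2 = 0"
    using assms sl_diff[of g h] by eventually_elim simp
  then have "(LINT t|lborel. (norm (sl (g - h) t))\<^sup>2) = 0" by (simp add: integral_eq_zero_AE)
  then show ?thesis unfolding norm_slices(2) by simp
qed

lemma sl_tendsto_subseq:
  assumes "X \<longlonglongrightarrow> g"
  shows "\<exists>r. strict_mono r \<and> (AE t in lborel. (\<lambda>n. sl (X (r n)) t) \<longlonglongrightarrow> sl g t)"
proof -
  have "(\<lambda>n. (norm (X n - g))\<^sup>2) \<longlonglongrightarrow> 0\<^sup>2"
    using assms by (intro tendsto_power) (simp add: tendsto_norm_zero_iff LIM_zero_iff)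
  then have "(\<lambda>n. LINT t|lborel. norm ((norm (sl (X n - g) t))\<^sup>2)) \<longlonglongrightarrow> 0"
    unfolding norm_slices(2)[symmetric] by simp
  from tendsto_L1_AE_subseq[OF norm_slices(1) this]
  obtain r where r: "strict_mono r" "AE t in lborel. (\<lambda>n. (norm (sl (X (r n) - g) t))\<^sup>2) \<longlonglongrightarrow> 0" by blast
  have "AE t in lborel. \<forall>n. sl (X n - g) t = sl (X n) t - sl g t"
    by (subst AE_all_countable) (auto intro: sl_diff)
  with r(2) have "AE t in lborel. (\<lambda>n. sl (X (r n)) t) \<longlonglongrightarrow> sl g t"
  proof eventually_elim
    fix t assume h: "(\<lambda>n. (norm (sl (X (r n) - g) t))\<^sup>2) \<longlonglongrightarrow> 0" "\<forall>n. sl (X n - g) t = sl (X n) t - sl g t"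
    have "(\<lambda>n. sqrt ((norm (sl (X (r n) - g) t))\<^sup>2)) \<longlonglongrightarrow> sqrt 0"
      by (intro tendsto_real_sqrt h(1))
    then have "(\<lambda>n. sl (X (r n)) t - sl g t) \<longlonglongrightarrow> 0" using h(2) by (simp add: tendsto_norm_zero_iff)
    then show "(\<lambda>n. sl (X (r n)) t) \<longlonglongrightarrow> sl g t" by (simp add: LIM_zero_iff)
  qed
  then show ?thesis using r(1) by blast
qed

section \<open>Functions piecewise constant in time\<close>

definition ten :: "real set \<Rightarrow> ('a::euclidean_space, 'b::euclidean_space) l2 \<Rightarrow> ('a \<times> real, 'b) l2" where
  "ten A v = mk (\<lambda>z. indicator A (snd z) *\<^sub>R fn v (fst z))"

lemma sq_int_ten:
  fixes v :: "('a::euclidean_space, 'b::euclidean_space) l2" and A :: "real set"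
  assumes A: "A \<in> sets borel" "emeasure lborel A < \<infinity>"
  shows "sq_int (\<lambda>z. indicator A (snd z) *\<^sub>R fn v (fst z))"
proof -
  have "(\<lambda>z::'a \<times> real. indicator A (snd z) :: real) \<in> borel_measurable borel"
    by (rule measurable_compose[OF borel_measurable_continuous_onI[OF continuous_on_snd[OF continuous_on_id]] borel_measurable_indicator[OF A(1)]])
  moreover have "(\<lambda>z::'a \<times> real. fn v (fst z)) \<in> borel_measurable borel"
    by (rule measurable_compose[OF borel_measurable_continuous_onI[OF continuous_on_fst[OF continuous_on_id]] fn_borel])
  ultimately have m: "(\<lambda>z. indicator A (snd z) *\<^sub>R fn v (fst z)) \<in> borel_measurable borel"
    by (rule borel_measurable_scaleR)
  have "(\<integral>\<^sup>+z. ennreal ((norm (indicator A (snd z) *\<^sub>R fn v (fst z)))\<^sup>2) \<partial>(lborel \<Otimes>\<^sub>M lborel))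
     = (\<integral>\<^sup>+t. \<integral>\<^sup>+x. ennreal ((norm (indicator A t *\<^sub>R fn v x))\<^sup>2) \<partial>lborel \<partial>lborel)"
  proof -
    have "(\<lambda>z. (norm (indicator A (snd z) *\<^sub>R fn v (fst z)))\<^sup>2) \<in> borel_measurable borel"
      by (rule borel_measurable_power[OF measurable_compose[OF m borel_measurable_norm]])
    from measurable_compose[OF this measurable_ennreal]
    have "(\<lambda>z. ennreal ((norm (indicator A (snd z) *\<^sub>R fn v (fst z)))\<^sup>2)) \<in> borel_measurable (lborel \<Otimes>\<^sub>M lborel)"
      unfolding lborel_prod by simp
    from lborel_pair.nn_integral_snd[OF this] show ?thesis by simp
  qed
  also have "\<dots> = (\<integral>\<^sup>+t. ennreal ((norm v)\<^sup>2) * indicator A t \<partial>lborel)"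
    by (intro nn_integral_cong) (auto simp: indicator_def nn_norm_l2_sq)
  also have "\<dots> = ennreal ((norm v)\<^sup>2) * emeasure lborel A"
    using A(1) by (subst nn_integral_cmult_indicator) auto
  also have "\<dots> < \<infinity>" using A(2) by (simp add: ennreal_mult_less_top)
  finally have fin: "(\<integral>\<^sup>+z. ennreal ((norm (indicator A (snd z) *\<^sub>R fn v (fst z)))\<^sup>2) \<partial>lborel) < \<infinity>"
    by (simp only: lborel_prod)
  have "(\<lambda>z. (norm (indicator A (snd z) *\<^sub>R fn v (fst z)))\<^sup>2) \<in> borel_measurable lborel"
    using borel_measurable_power[OF measurable_compose[OF m borel_measurable_norm], of 2] by simp
  then show ?thesis unfolding sq_int_def using m fin by (simp add: integrable_iff_bounded)
qed

lemma sl_ten: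
  assumes A: "A \<in> sets borel" "emeasure lborel A < \<infinity>"
  shows "AE t in lborel. sl (ten A v) t = indicator A t *\<^sub>R v"
  unfolding ten_def by (rule sl_mk[OF sq_int_ten[OF A]]) (use fn_scaleR in auto)

lemma inner_ten_right:
  assumes A: "A \<in> sets borel" "emeasure lborel A < \<infinity>"
  shows "integrable lborel (\<lambda>t. inner (sl g t) v * indicator A t)"
    and "inner g (ten A v) = (LINT t|lborel. inner (sl g t) v * indicator A t)"
proof -
  have [measurable]: "(\<lambda>t. inner (sl g t) v) \<in> borel_measurable borel" by (rule measurable_inner_sl)
  have m: "(\<lambda>t. inner (sl g t) v * indicator A t) \<in> borel_measurable lborel" using A(1) by simp
  have eq: "AE t in lborel. inner (sl g t) (sl (ten A v) t) = inner (sl g t) v * indicator A t"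
    using sl_ten[OF A, of v] by eventually_elim simp
  show "integrable lborel (\<lambda>t. inner (sl g t) v * indicator A t)"
    by (rule integrable_cong_AE_imp[OF inner_slices(1)[of g "ten A v"] m]) (use eq in eventually_elim, simp)
  show "inner g (ten A v) = (LINT t|lborel. inner (sl g t) v * indicator A t)"
    unfolding inner_slices(2)[symmetric] using inner_slices(1)[of g "ten A v"] m eq by (intro integral_cong_AE) auto
qed

lemma inner_ten_ten:
  assumes A: "A \<in> sets borel" "emeasure lborel A < \<infinity>" and B: "B \<in> sets borel" "emeasure lborel B < \<infinity>"
  shows "inner (ten A v) (ten B w) = measure lborel (A \<inter> B) * inner v w"
proof -
  have "inner (ten A v) (ten B w) = (LINT t|lborel. inner (sl (ten A v) t) w * indicator B t)"
    by (rule inner_ten_right(2)[OF B])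
  also have "\<dots> = (LINT t|lborel. inner v w * indicator (A \<inter> B) t)"
  proof (rule integral_cong_AE)
    show "(\<lambda>t. inner (sl (ten A v) t) w * indicator B t) \<in> borel_measurable lborel"
      using inner_ten_right(1)[OF B] by blast
    show "AE t in lborel. inner (sl (ten A v) t) w * indicator B t = inner v w * indicator (A \<inter> B) t"
      using sl_ten[OF A, of v] by eventually_elim (simp add: indicator_def)
  qed (use A B in simp)
  also have "\<dots> = measure lborel (A \<inter> B) * inner v w" by simp
  finally show ?thesis .
qed

text \<open>Half-open, so that the cells of a grid partition [0, T) exactly and every cell of a
  refined grid lies in a single coarse cell.\<close>

definition cell :: "real \<Rightarrow> nat \<Rightarrow> nat \<Rightarrow> real set" where
  "cell T n k = {real k * T / real n ..< real (Suc k) * T / real n}"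

lemma cell_borel: "cell T n k \<in> sets borel" by (simp add: cell_def)

lemma cell_finite: "emeasure lborel (cell T n k) < \<infinity>"
proof -
  have "cell T n k \<subseteq> cbox (real k * T / real n) (real (Suc k) * T / real n)" by (auto simp: cell_def)
  then have "emeasure lborel (cell T n k) \<le> emeasure lborel (cbox (real k * T / real n) (real (Suc k) * T / real n))"
    by (rule emeasure_mono) simp
  also have "\<dots> < \<infinity>" by (rule emeasure_lborel_cbox_finite)
  finally show ?thesis .
qed

lemma cell_index:
  assumes "T > 0" "n > 0" "t \<in> cell T n k" shows "k = nat \<lfloor>t * real n / T\<rfloor>"
proof -
  have "real k \<le> t * real n / T" "t * real n / T < real k + 1"
    using assms by (auto simp: cell_def field_simps)
  then have "\<lfloor>t * real n / T\<rfloor> = int k" by (simp add: floor_eq_iff)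
  then show ?thesis by simp
qed

lemma cell_disjoint: "T > 0 \<Longrightarrow> n > 0 \<Longrightarrow> k \<noteq> l \<Longrightarrow> cell T n k \<inter> cell T n l = {}"
  using cell_index[of T n _ k] cell_index[of T n _ l] by blast

lemma cell_cover:
  assumes "T > 0" "n > 0" "0 \<le> t" "t < T" shows "\<exists>k<n. t \<in> cell T n k"
proof -
  define k where "k = nat \<lfloor>t * real n / T\<rfloor>"
  have nn: "0 \<le> t * real n / T" using assms by simp
  have "real k = of_int \<lfloor>t * real n / T\<rfloor>" using nn by (simp add: k_def)
  then have k: "real k \<le> t * real n / T" "t * real n / T < real k + 1"
    using of_int_floor_le[of "t * real n / T"] floor_correct[of "t * real n / T"] by linarith+
  have "t * real n / T < real n" using assms by (simp add: field_simps)
  then have "k < n" using k(1) by linarith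
  moreover have "t \<in> cell T n k" using k assms by (auto simp: cell_def field_simps)
  ultimately show ?thesis by blast
qed

lemma cell_subset:
  assumes "T > 0" "n > 0" "r > 0"
  shows "cell T (n * r) i \<subseteq> cell T n (i div r)"
proof
  fix t assume t: "t \<in> cell T (n * r) i"
  have "i div r * r \<le> i" "Suc i \<le> Suc (i div r) * r"
    using assms(3) by (simp_all add: Suc_le_eq div_times_less_eq_dividend dividend_less_div_times)
  then have 1: "real (i div r) * real r \<le> real i" "real (Suc i) \<le> real (Suc (i div r)) * real r"
    by (simp_all only: of_nat_mult[symmetric] of_nat_le_iff)
  have "real (i div r) * T / real n = (real (i div r) * real r) * T / (real n * real r)" using assms by simp
  also have "\<dots> \<le> real i * T / (real n * real r)" using 1(1) assms by (intro divide_right_mono mult_right_mono) auto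
  also have "\<dots> \<le> t" using t by (simp add: cell_def)
  finally have a: "real (i div r) * T / real n \<le> t" .
  have "t < real (Suc i) * T / (real n * real r)" using t by (simp add: cell_def)
  also have "\<dots> \<le> (real (Suc (i div r)) * real r) * T / (real n * real r)"
    using 1(2) assms by (intro divide_right_mono mult_right_mono) auto
  also have "\<dots> = real (Suc (i div r)) * T / real n" using assms by simp
  finally show "t \<in> cell T n (i div r)" using a by (simp add: cell_def)
qed

lemma measure_cell: "T > 0 \<Longrightarrow> n > 0 \<Longrightarrow> measure lborel (cell T n k) = T / real n"
  by (simp add: cell_def field_simps)

definition st :: "real \<Rightarrow> nat \<Rightarrow> (nat \<Rightarrow> ('a::euclidean_space, 'b::euclidean_space) l2) \<Rightarrow> ('a \<times> real, 'b) l2" where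
  "st T n h = (\<Sum>k<n. ten (cell T n k) (h k))"

lemma sl_sum: "finite I \<Longrightarrow> AE t in lborel. sl (\<Sum>i\<in>I. g i) t = (\<Sum>i\<in>I. sl (g i) t)"
proof (induction I rule: finite_induct)
  case empty show ?case using sl_zero by simp
next
  case (insert i I)
  show ?case using insert.IH sl_add[of "g i" "\<Sum>i\<in>I. g i"]
    by eventually_elim (simp add: insert.hyps)
qed

lemma sl_st:
  assumes "T > 0" "n > 0"
  shows "AE t in lborel. (\<forall>k<n. t \<in> cell T n k \<longrightarrow> sl (st T n h) t = h k) \<and> (t \<notin> {0..<T} \<longrightarrow> sl (st T n h) t = 0)"
proof -
  have "AE t in lborel. \<forall>k\<in>{..<n}. sl (ten (cell T n k) (h k)) t = indicator (cell T n k) t *\<^sub>R h k"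
    by (intro AE_finite_allI sl_ten cell_borel cell_finite) auto
  with sl_sum[of "{..<n}" "\<lambda>k. ten (cell T n k) (h k)", OF finite_lessThan]
  show ?thesis
  proof eventually_elim
    fix t assume a: "sl (\<Sum>k<n. ten (cell T n k) (h k)) t = (\<Sum>k<n. sl (ten (cell T n k) (h k)) t)"
      "\<forall>k\<in>{..<n}. sl (ten (cell T n k) (h k)) t = indicator (cell T n k) t *\<^sub>R h k"
    then have eq: "sl (st T n h) t = (\<Sum>k<n. indicator (cell T n k) t *\<^sub>R h k)" by (simp add: st_def)
    have "sl (st T n h) t = h k" if k: "k < n" "t \<in> cell T n k" for k
    proof -
      have "(\<Sum>l<n. indicator (cell T n l) t *\<^sub>R h l) = (\<Sum>l\<in>{k}. indicator (cell T n l) t *\<^sub>R h l)"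
      proof (rule sum.mono_neutral_right)
        show "\<forall>i\<in>{..<n} - {k}. indicator (cell T n i) t *\<^sub>R h i = 0"
        proof
          fix i assume "i \<in> {..<n} - {k}"
          then have "cell T n k \<inter> cell T n i = {}" using cell_disjoint[OF assms, of k i] by auto
          then show "indicator (cell T n i) t *\<^sub>R h i = 0" using k(2) by (auto simp: indicator_def)
        qed
      qed (use k in auto)
      then show ?thesis unfolding eq using k by simp
    qed
    moreover have "sl (st T n h) t = 0" if "t \<notin> {0..<T}"
    proof -
      have "t \<notin> cell T n k" if "k < n" for k
      proof
        assume "t \<in> cell T n k"
        then have t: "real k * T / real n \<le> t" "t < real (Suc k) * T / real n" by (auto simp: cell_def)
        have "real (Suc k) * T / real n \<le> real n * T / real n"
          using \<open>k < n\<close> assms by (intro divide_right_mono mult_right_mono) auto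
        then have "t < T" using t(2) assms by simp
        moreover have "0 \<le> real k * T / real n" using assms by simp
        ultimately show False using t(1) \<open>t \<notin> {0..<T}\<close> by auto
      qed
      then show ?thesis unfolding eq by (intro sum.neutral) auto
    qed
    ultimately show "(\<forall>k<n. t \<in> cell T n k \<longrightarrow> sl (st T n h) t = h k) \<and> (t \<notin> {0..<T} \<longrightarrow> sl (st T n h) t = 0)"
      by blast
  qed
qed

lemma inner_st:
  assumes "T > 0" "n > 0"
  shows "inner (st T n g) (st T n h) = T / real n * (\<Sum>k<n. inner (g k) (h k))"
proof -
  have "inner (ten (cell T n k) (g k)) (ten (cell T n l) (h l)) = (if l = k then T / real n * inner (g k) (h k) else 0)" for k l
    unfolding inner_ten_ten[OF cell_borel cell_finite cell_borel cell_finite]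
    using cell_disjoint[OF assms, of k l] by (auto simp: measure_cell[OF assms])
  then have "inner (st T n g) (st T n h) = (\<Sum>k<n. \<Sum>l<n. if l = k then T / real n * inner (g k) (h k) else 0)"
    unfolding st_def inner_sum_left inner_sum_right by (intro sum.cong refl) auto
  then show ?thesis by (simp add: sum_distrib_left)
qed

lemma norm_st_sq:
  assumes "T > 0" "n > 0"
  shows "(norm (st T n g))\<^sup>2 = T / real n * (\<Sum>k<n. (norm (g k))\<^sup>2)"
  using inner_st[OF assms, of g g] by (simp add: power2_norm_eq_inner)

text \<open>The cell \<open>i\<close> of the refined grid lies in the coarse cell
  \<open>i div r\<close>. This brings step functions of two levels onto one grid, where their
  difference is again a step function.\<close>

lemma st_refine:
  assumes "T > 0" "n > 0" "r > 0"
  shows "st T (n * r) (\<lambda>i. h (i div r)) = st T n h"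
proof (rule l2_eq_slicesI)
  have nr: "n * r > 0" using assms by simp
  show "AE t in lborel. sl (st T (n * r) (\<lambda>i. h (i div r))) t = sl (st T n h) t"
    using sl_st[OF assms(1) nr, of "\<lambda>i. h (i div r)"] sl_st[OF assms(1,2), of h]
  proof eventually_elim
    fix t assume a: "(\<forall>k<n * r. t \<in> cell T (n * r) k \<longrightarrow> sl (st T (n * r) (\<lambda>i. h (i div r))) t = h (k div r)) \<and>
         (t \<notin> {0..<T} \<longrightarrow> sl (st T (n * r) (\<lambda>i. h (i div r))) t = 0)"
      and b: "(\<forall>k<n. t \<in> cell T n k \<longrightarrow> sl (st T n h) t = h k) \<and> (t \<notin> {0..<T} \<longrightarrow> sl (st T n h) t = 0)"
    show "sl (st T (n * r) (\<lambda>i. h (i div r))) t = sl (st T n h) t"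
    proof (cases "t \<in> {0..<T}")
      case True
      then obtain i where i: "i < n * r" "t \<in> cell T (n * r) i" using cell_cover[OF assms(1) nr, of t] by auto
      have "i div r < n" using i(1) by (simp add: less_mult_imp_div_less)
      moreover have "t \<in> cell T n (i div r)" using cell_subset[OF assms] i(2) by blast
      ultimately show ?thesis using a b i by metis
    qed (use a b in simp)
  qed
qed

lemma st_add: "st T n (\<lambda>k. g k + h k) = st T n g + st T n h"
  and st_scaleR: "st T n (\<lambda>k. c *\<^sub>R g k) = c *\<^sub>R st T n g"
  if "T > 0" "n > 0"
proof -
  show "st T n (\<lambda>k. g k + h k) = st T n g + st T n h"
  proof (rule l2_eq_slicesI)
    show "AE t in lborel. sl (st T n (\<lambda>k. g k + h k)) t = sl (st T n g + st T n h) t"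
      using sl_st[OF that, of "\<lambda>k. g k + h k"] sl_st[OF that, of g] sl_st[OF that, of h] sl_add[of "st T n g" "st T n h"]
    proof eventually_elim
      case (elim t)
      then show ?case using cell_cover[OF that, of t] by (cases "t \<in> {0..<T}") auto
    qed
  qed
  show "st T n (\<lambda>k. c *\<^sub>R g k) = c *\<^sub>R st T n g"
  proof (rule l2_eq_slicesI)
    show "AE t in lborel. sl (st T n (\<lambda>k. c *\<^sub>R g k)) t = sl (c *\<^sub>R st T n g) t"
      using sl_st[OF that, of "\<lambda>k. c *\<^sub>R g k"] sl_st[OF that, of g] sl_scaleR[of c "st T n g"]
    proof eventually_elim
      case (elim t)
      then show ?case using cell_cover[OF that, of t] by (cases "t \<in> {0..<T}") auto
    qed
  qed
qed

lemma cell_within: assumes "T > 0" "n > 0" "k < n" shows "cell T n k \<subseteq> {0..<T}"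
proof
  fix t assume "t \<in> cell T n k"
  then have t: "real k * T / real n \<le> t" "t < real (Suc k) * T / real n" by (auto simp: cell_def)
  have "real (Suc k) * T / real n \<le> real n * T / real n"
    using assms by (intro divide_right_mono mult_right_mono) auto
  then have "t < T" using t(2) assms by simp
  moreover have "0 \<le> real k * T / real n" using assms by simp
  ultimately show "t \<in> {0..<T}" using t(1) by auto
qed

section \<open>Density of dyadic step functions\<close>

lemma sq_int_box_integrable:
  fixes h :: "'a::euclidean_space \<Rightarrow> real"
  assumes "sq_int h" shows "integrable lborel (\<lambda>x. h x * indicator (box a b) x)"
proof -
  have "sq_int (indicator (box a b) :: 'a \<Rightarrow> real)"
    by (rule sq_int_bounded_support[of _ 1 "box a b"]) (auto simp: indicator_def)
  from sq_int_inner[OF assms this] show ?thesis by simp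
qed

lemma sq_int_zero_if_box_integrals_zero:
  fixes h :: "'a::euclidean_space \<Rightarrow> real"
  assumes h: "sq_int h" and z: "\<And>a b. (LINT x|lborel. h x * indicator (box a b) x) = 0"
  shows "AE x in lborel. h x = 0"
proof -
  let ?B = "\<lambda>n::nat. box (- (real n *\<^sub>R One)) (real n *\<^sub>R One) :: 'a set"
  have "AE x in lborel. h x * indicator (?B n) x = 0" for n
  proof (rule AE_zero_if_box_integrals_zero[OF sq_int_box_integrable[OF h]])
    fix c d
    obtain e f where ef: "?B n \<inter> box c d = box e f" using box_Int_box by blast
    have "(LINT x|lborel. h x * indicator (?B n) x * indicator (box c d) x) = (LINT x|lborel. h x * indicator (box e f) x)"
      unfolding ef[symmetric] by (intro Bochner_Integration.integral_cong) (auto simp: indicator_def)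
    then show "(LINT x|lborel. h x * indicator (?B n) x * indicator (box c d) x) = 0" using z by simp
  qed
  then have "AE x in lborel. \<forall>n. h x * indicator (?B n) x = 0" by (subst AE_all_countable) (rule allI)
  then show ?thesis
  proof eventually_elim
    fix x assume a: "\<forall>n. h x * indicator (?B n) x = 0"
    obtain n where "x \<in> ?B n" using UN_box_eq_UNIV by blast
    then show "h x = 0" using a[rule_format, of n] by simp
  qed
qed

text \<open>For fixed \<open>v\<close> the function t -> <D(t), v> has zero integral over all dyadic
  cells, so its primitive vanishes at the dyadic points of [0, T] and, being continuous,
  everywhere.\<close>

lemma orthogonal_to_steps_zero:
  fixes D :: "('a::euclidean_space \<times> real, 'b::euclidean_space) l2"
  assumes T: "T > 0" and supp: "AE z in lborel. snd z \<notin> {0..<T} \<longrightarrow> fn D z = 0"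
    and orth: "\<And>j h. inner D (st T (2 ^ j) h) = 0"
  shows "D = 0"
proof -
  have cellz: "(LINT t|lborel. inner (sl D t) v * indicator (cell T (2 ^ j) m) t) = 0" if m: "m < 2 ^ j" for v j m
  proof -
    have z: "inner D (ten (cell T (2 ^ j) k) 0) = 0" for k
      using inner_ten_right(2)[OF cell_borel cell_finite, of D T "2^j" k 0] by simp
    have "0 = inner D (st T (2 ^ j) (\<lambda>i. if i = m then v else 0))" using orth by simp
    also have "\<dots> = (\<Sum>k<2 ^ j. inner D (ten (cell T (2 ^ j) k) (if k = m then v else 0)))"
      by (simp add: st_def inner_sum_right)
    also have "\<dots> = (\<Sum>k<2 ^ j. if k = m then inner D (ten (cell T (2 ^ j) m) v) else 0)"
      by (intro sum.cong refl) (simp add: z)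
    also have "\<dots> = inner D (ten (cell T (2 ^ j) m) v)" using m by simp
    finally show ?thesis using inner_ten_right(2)[OF cell_borel cell_finite, of D T "2^j" m v] by simp
  qed
  have slice: "AE t in lborel. inner (sl D t) v * indicator {0..<T} t = 0" for v
  proof (rule AE_zero_if_box_integrals_zero)
    have fin: "{0..<T} \<in> sets borel" "emeasure lborel {0..<T} < \<infinity>" using T by auto
    show int: "integrable lborel (\<lambda>t. inner (sl D t) v * indicator {0..<T} t)"
      by (rule inner_ten_right(1)[OF fin])
    define k where "k t = inner (sl D t) v * indicator {0..<T} t" for t
    have k: "integrable lborel k" unfolding k_def[abs_def] by (rule int)
    have kI: "integrable lborel (\<lambda>t. k t * indicator A t)" if "A \<in> sets borel" for A
      by (rule Bochner_Integration.integrable_bound[OF k]) (use that k in \<open>auto simp: indicator_def\<close>)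
    define G where "G s = (LINT t|lborel. k t * indicator {..<s} t)" for s
    have grid: "G (real m * T / 2 ^ j) = 0" if "m \<le> 2 ^ j" for m j
      using that
    proof (induction m)
      case 0
      have "(\<lambda>t. k t * indicator {..<0} t) = (\<lambda>_. 0)" by (rule ext) (simp add: k_def indicator_def)
      then show ?case by (simp add: G_def)
    next
      case (Suc m)
      have le: "real (Suc m) * T / 2 ^ j \<le> T"
      proof -
        have "real (Suc m) \<le> 2 ^ j" using Suc.prems by (metis of_nat_le_iff of_nat_numeral of_nat_power)
        then show ?thesis using T by (simp add: divide_le_eq mult.commute)
      qed
      have "k t * indicator {..<real (Suc m) * T / 2 ^ j} t
          = k t * indicator {..<real m * T / 2 ^ j} t + inner (sl D t) v * indicator (cell T (2 ^ j) m) t" for t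
      proof -
        have a: "real m * T / 2 ^ j \<le> real (Suc m) * T / 2 ^ j" "0 \<le> real m * T / 2 ^ j"
          using T by (auto intro!: divide_right_mono)
        show ?thesis using a le unfolding k_def cell_def by (auto simp: indicator_def)
      qed
      then have "G (real (Suc m) * T / 2 ^ j) = (LINT t|lborel. k t * indicator {..<real m * T / 2 ^ j} t
          + inner (sl D t) v * indicator (cell T (2 ^ j) m) t)" by (simp only: G_def)
      also have "\<dots> = G (real m * T / 2 ^ j) + 0"
        using cellz[of m j v] Suc.prems kI[of "{..<real m * T / 2 ^ j}"] inner_ten_right(1)[OF cell_borel cell_finite, of D v T "2^j" m]
        by (subst Bochner_Integration.integral_add) (auto simp: G_def)
      finally show ?case using Suc by simp
    qed
    have G0: "G s = 0" if s: "0 \<le> s" "s < T" for s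
    proof -
      \<comment> \<open>The last point of the dyadic grid of level \<open>j\<close> that does not
        exceed \<open>s\<close>.\<close>
      define c where "c j = of_int \<lfloor>s * 2 ^ j / T\<rfloor> * T / 2 ^ j" for j :: nat
      have c: "c j \<le> s" "s < c j + T / 2 ^ j" for j
      proof -
        have "of_int \<lfloor>s * 2 ^ j / T\<rfloor> * T \<le> s * 2 ^ j / T * T" using T by (intro mult_right_mono of_int_floor_le) auto
        then show "c j \<le> s" using T by (simp add: c_def divide_le_eq)
        have "s * 2 ^ j / T * T < (of_int \<lfloor>s * 2 ^ j / T\<rfloor> + 1) * T" using T by (intro mult_strict_right_mono) linarith+
        then show "s < c j + T / 2 ^ j" using T by (simp add: c_def field_simps)
      qed
      have Gc: "G (c j) = 0" for j
      proof -
        have nn: "0 \<le> \<lfloor>s * 2 ^ j / T\<rfloor>" using s T by simp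
        have eq: "c j = real (nat \<lfloor>s * 2 ^ j / T\<rfloor>) * T / 2 ^ j" using nn by (simp add: c_def)
        have "s * 2 ^ j / T < 2 ^ j" using s T by (simp add: field_simps)
        then have "of_int \<lfloor>s * 2 ^ j / T\<rfloor> < (2::real) ^ j" by (meson of_int_floor_le le_less_trans)
        then have "\<lfloor>s * 2 ^ j / T\<rfloor> < 2 ^ j" by (metis of_int_less_iff of_int_numeral of_int_power)
        then have "nat \<lfloor>s * 2 ^ j / T\<rfloor> < 2 ^ j" using nn by (simp add: nat_less_iff)
        then show ?thesis unfolding eq by (intro grid) simp
      qed
      have lim: "(\<lambda>j. T / 2 ^ j) \<longlonglongrightarrow> 0"
        using LIMSEQ_divide_realpow_zero[of 2 T] by simp
      have "(\<lambda>j. G (c j)) \<longlonglongrightarrow> G s"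
        unfolding G_def
      proof (rule integral_dominated_convergence[where w="\<lambda>t. \<bar>k t\<bar>"])
        show "AE t in lborel. (\<lambda>j. k t * indicator {..<c j} t) \<longlonglongrightarrow> k t * indicator {..<s} t"
        proof (intro AE_I2 tendsto_mult tendsto_const)
          fix t
          show "(\<lambda>j. indicator {..<c j} t) \<longlonglongrightarrow> (indicator {..<s} t :: real)"
          proof (cases "t < s")
            case True
            have "eventually (\<lambda>j. T / 2 ^ j < s - t) sequentially" using lim True by (intro order_tendstoD) auto
            then have "eventually (\<lambda>j. indicator {..<c j} t = (indicator {..<s} t :: real)) sequentially"
            proof eventually_elim
              fix j :: nat assume "T / 2 ^ j < s - t"
              then have "t < c j" using c(2)[of j] by linarith
              then show "indicator {..<c j} t = (indicator {..<s} t :: real)" using True by simp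
            qed
            then show ?thesis by (rule tendsto_eventually)
          next
            case False
            have "indicator {..<c j} t = (0::real)" for j using c(1)[of j] False by (simp add: indicator_def)
            then show ?thesis using False by simp
          qed
        qed
        show "integrable lborel (\<lambda>t. \<bar>k t\<bar>)" using k by simp
        show "(\<lambda>t. k t * indicator {..<s} t) \<in> borel_measurable lborel" using kI[of "{..<s}"] by auto
        show "(\<lambda>t. k t * indicator {..<c j} t) \<in> borel_measurable lborel" for j using kI[of "{..<c j}"] by auto
        show "AE t in lborel. norm (k t * indicator {..<c j} t) \<le> \<bar>k t\<bar>" for j by (auto simp: indicator_def)
      qed
      then show ?thesis using Gc by (simp add: LIMSEQ_const_iff)
    qed
    have Gall: "G s = 0" for s
    proof -
      consider "s < 0" | "0 \<le> s" "s < T" | "T \<le> s" by linarith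
      then show ?thesis
      proof cases
        case 1
        then have "(\<lambda>t. k t * indicator {..<s} t) = (\<lambda>_. 0)" by (intro ext) (auto simp: k_def indicator_def)
        then show ?thesis by (simp add: G_def)
      next
        case 2 then show ?thesis by (rule G0)
      next
        case 3
        then have "(\<lambda>t. k t * indicator {..<s} t) = (\<lambda>t. k t * indicator {..<T} t)"
          by (intro ext) (auto simp: k_def indicator_def)
        then have "G s = G T" by (simp add: G_def)
        then show ?thesis using grid[of 1 0] by simp
      qed
    qed
    fix a b :: real
    show "(LINT t|lborel. inner (sl D t) v * indicator {0..<T} t * indicator (box a b) t) = 0"
    proof (cases "a < b")
      case True
      have "AE t in lborel. t \<noteq> a" by (rule AE_lborel_singleton)
      then have "(LINT t|lborel. k t * indicator (box a b) t) = (LINT t|lborel. k t * indicator {..<b} t - k t * indicator {..<a} t)"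
        using True kI[of "{..<a}"] kI[of "{..<b}"] kI[of "box a b"]
        by (intro integral_cong_AE) (auto simp: indicator_def box_real elim!: eventually_mono)
      also have "\<dots> = G b - G a" unfolding G_def by (rule Bochner_Integration.integral_diff) (auto intro: kI)
      finally show ?thesis using Gall by (simp add: k_def)
    qed (simp add: box_real)
  qed
  have s0: "AE t in lborel. t \<notin> {0..<T} \<longrightarrow> sl D t = 0"
    using AE_lborel_slices[OF supp] fn_sl[of D]
  proof eventually_elim
    fix t assume a: "AE x in lborel. snd (x, t) \<notin> {0..<T} \<longrightarrow> fn D (x, t) = 0" "AE x in lborel. fn (sl D t) x = fn D (x, t)"
    show "t \<notin> {0..<T} \<longrightarrow> sl D t = 0"
    proof
      assume t: "t \<notin> {0..<T}"
      show "sl D t = 0"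
        by (rule l2_eqI) (use a fn_zero in eventually_elim, use t in simp)
    qed
  qed
  have slz: "AE t in lborel. inner (sl D t) v = 0" for v
    using slice[of v] s0 by eventually_elim (auto simp: indicator_def split: if_splits)
  \<comment> \<open>The exceptional times in \<open>slz\<close> depend on \<open>v\<close>, so the
    slices are not yet known to vanish. A product box needs a single \<open>v\<close>: the indicator
    of its spatial side times a basis vector.\<close>
  have "AE z in lborel. \<forall>e\<in>Basis. inner (fn D z) e = 0"
  proof (intro AE_finite_allI finite_Basis)
    fix e :: 'b assume e: "e \<in> Basis"
    have sqe: "sq_int (\<lambda>z. inner (fn D z) e)"
      by (rule sq_int_compose_linear[OF bounded_linear_inner_left sq_int_fn])
    show "AE z in lborel. inner (fn D z) e = 0"
    proof (rule sq_int_zero_if_box_integrals_zero[OF sqe])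
      fix a b :: "'a \<times> real"
      define w where "w = (\<lambda>x. indicator (box (fst a) (fst b)) x *\<^sub>R e)"
      have w: "sq_int w" unfolding w_def
        by (rule sq_int_bounded_support[of _ "norm e" "box (fst a) (fst b)"]) (auto simp: indicator_def)
      have ind: "indicator (box a b) (x, t) = (indicator (box (fst a) (fst b)) x * indicator (box (snd a) (snd b)) t :: real)" for x t
        by (cases a, cases b) (auto simp: box_prod indicator_def)
      have int: "integrable lborel (\<lambda>z. inner (fn D z) e * indicator (box a b) z)"
        by (rule sq_int_box_integrable[OF sqe])
      have "(LINT z|lborel. inner (fn D z) e * indicator (box a b) z)
          = (LINT t|lborel. LINT x|lborel. inner (fn D (x, t)) e * indicator (box a b) (x, t))"
        by (rule lborel_Fubini(3)[OF int, symmetric])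
      also have "\<dots> = 0"
      proof (rule integral_eq_zero_AE)
        show "AE t in lborel. (LINT x|lborel. inner (fn D (x, t)) e * indicator (box a b) (x, t)) = 0"
          using fn_sl[of D] slz[of "mk w"]
        proof eventually_elim
          fix t assume h: "AE x in lborel. fn (sl D t) x = fn D (x, t)" "inner (sl D t) (mk w) = 0"
          have [measurable]: "(\<lambda>x. fn D (x, t)) \<in> borel_measurable borel" "w \<in> borel_measurable borel"
            using slice_borel[OF fn_borel] w by (auto simp: sq_int_def)
          have "(LINT x|lborel. inner (fn D (x, t)) e * indicator (box a b) (x, t))
            = (LINT x|lborel. inner (fn D (x, t)) (w x) * indicator (box (snd a) (snd b)) t)"
            by (intro Bochner_Integration.integral_cong) (auto simp: w_def ind)
          also have "\<dots> = (LINT x|lborel. inner (fn (sl D t) x) (w x) * indicator (box (snd a) (snd b)) t)"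
          proof (rule integral_cong_AE)
            show "AE x in lborel. inner (fn D (x, t)) (w x) * indicator (box (snd a) (snd b)) t
                = inner (fn (sl D t) x) (w x) * indicator (box (snd a) (snd b)) t"
              using h(1) by eventually_elim simp
          qed auto
          also have "\<dots> = 0" using h(2) unfolding inner_mk_right[OF w] by simp
          finally show "(LINT x|lborel. inner (fn D (x, t)) e * indicator (box a b) (x, t)) = 0" .
        qed
      qed
      finally show "(LINT z|lborel. inner (fn D z) e * indicator (box a b) z) = 0" .
    qed
  qed
  then have "AE z in lborel. fn D z = fn 0 z"
    using fn_zero[where 'a="'a \<times> real" and 'b='b]
  proof eventually_elim
    fix z assume "\<forall>e\<in>Basis. inner (fn D z) e = 0" "fn (0 :: ('a \<times> real, 'b) l2) z = 0"
    then show "fn D z = fn 0 z" using euclidean_eqI[of "fn D z" 0] by simp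
  qed
  then show ?thesis by (rule l2_eqI)
qed

text \<open>Beyond density, one approximation is produced on every dyadic level; these are the
  right-hand sides of the Euler schemes. The spaces \<open>M j\<close> grow with \<open>j\<close>,
  so near-best approximations eventually do as well as any fixed step function.\<close>

lemma steps_dense:
  fixes F :: "('a::euclidean_space \<times> real, 'b::euclidean_space) l2"
  assumes T: "T > 0" and supp: "AE z in lborel. snd z \<notin> {0..<T} \<longrightarrow> fn F z = 0"
  shows "\<exists>f. (\<lambda>j. st T (2 ^ j) (f j)) \<longlonglongrightarrow> F"
proof -
  define M where "M j = range (\<lambda>h. st T (2 ^ j) h :: ('a \<times> real, 'b) l2)" for j :: nat
  have p2: "(2::nat) ^ j > 0" for j by simp
  have mono: "M j \<subseteq> M (j + d)" for j d
  proof
    fix g assume "g \<in> M j"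
    then obtain h where "g = st T (2 ^ j) h" by (auto simp: M_def)
    then have "g = st T (2 ^ j * 2 ^ d) (\<lambda>i. h (i div 2 ^ d))" using st_refine[OF T p2 p2, of j d h] by simp
    then show "g \<in> M (j + d)" by (auto simp: M_def power_add)
  qed
  have mono': "M j \<subseteq> M l" if "j \<le> l" for j l using mono[of j "l - j"] that by simp
  have sub: "subspace (\<Union>j. M j)"
  proof (rule subspaceI)
    have "(0 :: ('a \<times> real, 'b) l2) = st T (2 ^ 0) (\<lambda>k. 0 *\<^sub>R 0)" using st_scaleR[OF T p2, of 0 0 "\<lambda>_. 0"] by simp
    then have "(0 :: ('a \<times> real, 'b) l2) \<in> M 0" unfolding M_def by blast
    then show "0 \<in> (\<Union>j. M j)" by blast
    fix x y :: "('a \<times> real, 'b) l2" and c :: real assume x: "x \<in> (\<Union>j. M j)"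
    then obtain j where xj: "x \<in> M j" by blast
    then obtain h where "x = st T (2 ^ j) h" by (auto simp: M_def)
    then have "c *\<^sub>R x = st T (2 ^ j) (\<lambda>k. c *\<^sub>R h k)" using st_scaleR[OF T p2, of j c h] by (simp only:)
    then show "c *\<^sub>R x \<in> (\<Union>j. M j)" by (auto simp: M_def)
    assume "y \<in> (\<Union>j. M j)"
    then obtain l where "y \<in> M l" by blast
    then have "x \<in> M (max j l)" "y \<in> M (max j l)" using mono'[of j "max j l"] mono'[of l "max j l"] xj by auto
    then obtain g h where "x = st T (2 ^ max j l) g" "y = st T (2 ^ max j l) h" by (auto simp: M_def)
    then have "x + y = st T (2 ^ max j l) (\<lambda>k. g k + h k)" using st_add[OF T p2, of "max j l" g h] by (simp only:)
    then show "x + y \<in> (\<Union>j. M j)" by (auto simp: M_def)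
  qed
  have "\<exists>p\<in>closure (\<Union>j. M j). \<forall>y\<in>closure (\<Union>j. M j). inner (F - p) y = 0"
    by (rule subspace_projection[OF closed_closure subspace_closure_Hilbert[OF sub]])
  then obtain p where p: "p \<in> closure (\<Union>j. M j)" "\<And>y. y \<in> closure (\<Union>j. M j) \<Longrightarrow> inner (F - p) y = 0" by blast
  have "closed {w::('a \<times> real,'b) l2. AE z in lborel. fn w z \<in> (if snd z \<in> {0..<T} then UNIV else {0})}"
    by (rule closed_AE_l2) auto
  moreover have "(\<Union>j. M j) \<subseteq> {w. AE z in lborel. fn w z \<in> (if snd z \<in> {0..<T} then UNIV else {0})}"
  proof clarify
    fix g j assume "g \<in> M j"
    then obtain h where h: "g = st T (2 ^ j) h" by (auto simp: M_def)
    have "AE z in lborel. \<forall>k\<in>{..<2^j}. fn (ten (cell T (2 ^ j) k) (h k)) z = indicator (cell T (2 ^ j) k) (snd z) *\<^sub>R fn (h k) (fst z)"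
      unfolding ten_def by (intro AE_finite_allI fn_mk sq_int_ten cell_borel cell_finite) auto
    moreover have "AE z in lborel. fn (\<Sum>k\<in>K. u k) z = (\<Sum>k\<in>K. fn (u k) z)"
      if "finite K" for K and u :: "nat \<Rightarrow> ('a \<times> real, 'b) l2"
      using that
    proof (induction K)
      case empty show ?case using fn_zero by simp
    next
      case (insert i I)
      show ?case using insert.IH fn_add[of "u i" "\<Sum>i\<in>I. u i"] by eventually_elim (simp add: insert.hyps)
    qed
    from this[OF finite_lessThan, of "\<lambda>k. ten (cell T (2 ^ j) k) (h k)" "2^j"]
    have "AE z in lborel. fn g z = (\<Sum>k<2^j. fn (ten (cell T (2 ^ j) k) (h k)) z)" by (simp add: h st_def)
    ultimately show "AE z in lborel. fn g z \<in> (if snd z \<in> {0..<T} then UNIV else {0})"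
    proof eventually_elim
      case (elim z)
      have "snd z \<notin> cell T (2 ^ j) k" if "k < 2 ^ j" "snd z \<notin> {0..<T}" for k
        using cell_within[OF T p2 that(1)] that(2) by blast
      then show ?case using elim by (auto simp: indicator_def intro!: sum.neutral)
    qed
  qed
  ultimately have "closure (\<Union>j. M j) \<subseteq> {w. AE z in lborel. fn w z \<in> (if snd z \<in> {0..<T} then UNIV else {0})}"
    by (rule closure_minimal[rotated])
  then have ps: "AE z in lborel. fn p z \<in> (if snd z \<in> {0..<T} then UNIV else {0})" using p(1) by blast
  have "F - p = 0"
  proof (rule orthogonal_to_steps_zero[OF T])
    show "AE z in lborel. snd z \<notin> {0..<T} \<longrightarrow> fn (F - p) z = 0"
      using supp ps fn_diff[of F p] by eventually_elim auto
    show "inner (F - p) (st T (2 ^ j) h) = 0" for j h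
    proof (rule p(2))
      have "st T (2 ^ j) h \<in> (\<Union>j. M j)" by (auto simp: M_def)
      then show "st T (2 ^ j) h \<in> closure (\<Union>j. M j)" by (rule subsetD[OF closure_subset])
    qed
  qed
  then have FM: "F \<in> closure (\<Union>j. M j)" using p(1) by simp
  have ne: "M j \<noteq> {}" for j by (simp add: M_def)
  \<comment> \<open>The slack \<open>1 / real (Suc j)\<close> spares a proof that the distance is
    attained.\<close>
  have "\<exists>h. dist (st T (2 ^ j) h) F < infdist F (M j) + 1 / real (Suc j)" for j
  proof -
    have "(INF a\<in>M j. dist F a) < infdist F (M j) + 1 / real (Suc j)"
      unfolding infdist_notempty[OF ne] by simp
    then have "\<exists>d\<in>dist F ` M j. d < infdist F (M j) + 1 / real (Suc j)"
      using ne[of j] by (intro cInf_lessD) auto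
    then obtain g where "g \<in> M j" "dist F g < infdist F (M j) + 1 / real (Suc j)" by blast
    then show ?thesis by (auto simp: M_def dist_commute)
  qed
  then obtain f where f: "\<And>j. dist (st T (2 ^ j) (f j)) F < infdist F (M j) + 1 / real (Suc j)" by metis
  have "(\<lambda>j. st T (2 ^ j) (f j)) \<longlonglongrightarrow> F"
  proof (rule metric_LIMSEQ_I)
    fix e :: real assume e: "0 < e"
    obtain g where g: "g \<in> (\<Union>j. M j)" "dist g F < e / 2"
      using FM e unfolding closure_approachable by (meson half_gt_zero)
    then obtain J where J: "g \<in> M J" by blast
    obtain N where N: "1 / real (Suc N) < e / 2" using e by (meson half_gt_zero nat_approx_posE)
    have "dist (st T (2 ^ j) (f j)) F < e" if j: "j \<ge> max J N" for j
    proof -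
      have "g \<in> M j" using mono'[of J j] J j by auto
      then have "infdist F (M j) \<le> dist F g" by (rule infdist_le)
      moreover have "1 / real (Suc j) \<le> 1 / real (Suc N)" using j by (intro divide_left_mono) auto
      ultimately show ?thesis using f[of j] g(2) N by (simp add: dist_commute)
    qed
    then show "\<exists>no. \<forall>n\<ge>no. dist (st T (2 ^ n) (f n)) F < e" by blast
  qed
  then show ?thesis by blast
qed

section \<open>Implicit Euler approximation of the variational inequality\<close>

text \<open>The pair minimises |w - g|^2 + \<tau> |q|^2 over \<open>G\<close>, and the inequality is
  the first-order condition. Scaling the second component by \<open>sqrt \<tau>\<close> turns the
  functional into the squared distance from (g, 0), so the projection theorem applies.\<close>

lemma variational_resolvent:
  fixes G :: "('h::{real_inner,complete_space} \<times> 'k::{real_inner,complete_space}) set"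
  assumes G: "closed G" "convex G" "G \<noteq> {}" and \<tau>: "\<tau> > 0"
  shows "\<exists>u p. (u, p) \<in> G \<and> (\<forall>w q. (w, q) \<in> G \<longrightarrow> inner (g - u) (w - u) \<le> \<tau> * inner p (q - p))"
proof -
  define s where "s = sqrt \<tau>"
  have s: "s > 0" "s * s = \<tau>" using \<tau> by (auto simp: s_def)
  define G' where "G' = (\<lambda>z. (fst z, (1 / s) *\<^sub>R snd z)) -` G"
  have "closed G'" unfolding G'_def
    by (rule closed_vimage[OF G(1)]) (intro continuous_intros)
  moreover have "convex G'" unfolding G'_def
    by (rule convex_linear_vimage[OF _ G(2)]) (auto intro!: linearI simp: algebra_simps)
  moreover have "G' \<noteq> {}"
  proof -
    obtain a b where "(a, b) \<in> G" using G(3) by auto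
    then have "(a, s *\<^sub>R b) \<in> G'" using s by (simp add: G'_def)
    then show ?thesis by blast
  qed
  ultimately obtain u p' where up: "(u, p') \<in> G'" "\<And>y. y \<in> G' \<Longrightarrow> inner ((g, 0) - (u, p')) (y - (u, p')) \<le> 0"
    using hilbert_projection[of G' "(g, 0)"] by (metis surj_pair)
  define p where "p = (1 / s) *\<^sub>R p'"
  have p': "p' = s *\<^sub>R p" using s by (simp add: p_def)
  have "inner (g - u) (w - u) \<le> \<tau> * inner p (q - p)" if "(w, q) \<in> G" for w q
  proof -
    have "(w, s *\<^sub>R q) \<in> G'" using that s by (simp add: G'_def)
    from up(2)[OF this] have "inner (g - u) (w - u) - inner (s *\<^sub>R p) (s *\<^sub>R q - s *\<^sub>R p) \<le> 0"
      by (simp add: inner_prod_def p' inner_minus_left)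
    then show ?thesis using s(2) by (simp add: scaleR_diff_right[symmetric] mult.assoc[symmetric])
  qed
  moreover have "(u, p) \<in> G" using up(1) by (simp add: G'_def p_def)
  ultimately show ?thesis by blast
qed

text \<open>\<open>G\<close> stands for the set of pairs (v, grad v) with v in the convex set. The
  condition is the variational inequality at \<open>Suc k\<close> with the time derivative replaced
  by a backward quotient, and \<open>p k\<close> carries the gradient of \<open>u k\<close>.\<close>

definition euler_scheme ::
  "('h::{real_inner,complete_space} \<times> 'k::{real_inner,complete_space}) set \<Rightarrow> real \<Rightarrow> (nat \<Rightarrow> 'h) \<Rightarrow> (nat \<Rightarrow> 'h) \<Rightarrow> (nat \<Rightarrow> 'k) \<Rightarrow> bool" where
  "euler_scheme G \<tau> f u p \<longleftrightarrow> (\<forall>k. (u k, p k) \<in> G) \<and>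
     (\<forall>k w q. (w, q) \<in> G \<longrightarrow>
        inner (f k - (1 / \<tau>) *\<^sub>R (u (Suc k) - u k)) (w - u (Suc k)) \<le> inner (p (Suc k)) (q - p (Suc k)))"

lemma euler_scheme_exists:
  fixes G :: "('h::{real_inner,complete_space} \<times> 'k::{real_inner,complete_space}) set"
  assumes G: "closed G" "convex G" and \<tau>: "\<tau> > 0" and 0: "(u0, p0) \<in> G"
  shows "\<exists>u p. u 0 = u0 \<and> p 0 = p0 \<and> euler_scheme G \<tau> f u p"
proof -
  have ne: "G \<noteq> {}" using 0 by blast
  \<comment> \<open>\<open>A\<close> restricts the start at index 0 only, the form in which
    dependent choice delivers the sequence. \<open>Q\<close> is the resolvent inequality with datum
    \<open>u k + \<tau> *\<^sub>R f k\<close>; dividing it by \<tau> gives the scheme.\<close>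
  define A where "A = (\<lambda>(k::nat) x. x \<in> G \<and> (k = 0 \<longrightarrow> x = (u0, p0)))"
  define Q where "Q = (\<lambda>k (x :: 'h \<times> 'k) y. \<forall>w q. (w, q) \<in> G \<longrightarrow>
     inner (fst x + \<tau> *\<^sub>R f k - fst y) (w - fst y) \<le> \<tau> * inner (snd y) (q - snd y))"
  have "\<exists>y. A (Suc k) y \<and> Q k x y" for k x
  proof -
    obtain u p where "(u, p) \<in> G" "\<forall>w q. (w, q) \<in> G \<longrightarrow> inner (fst x + \<tau> *\<^sub>R f k - u) (w - u) \<le> \<tau> * inner p (q - p)"
      using variational_resolvent[OF G ne \<tau>] by blast
    then show ?thesis by (intro exI[of _ "(u, p)"]) (auto simp: A_def Q_def)
  qed
  moreover have "\<exists>x. A 0 x" using 0 by (auto simp: A_def)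
  ultimately obtain z where zz: "\<And>k. A k (z k)" "\<And>k. Q k (z k) (z (Suc k))"
    using dependent_nat_choice[of A Q] by blast
  have z: "\<And>k. z k \<in> G" "z 0 = (u0, p0)" "\<And>k w q. (w, q) \<in> G \<Longrightarrow>
       inner (fst (z k) + \<tau> *\<^sub>R f k - fst (z (Suc k))) (w - fst (z (Suc k))) \<le> \<tau> * inner (snd (z (Suc k))) (q - snd (z (Suc k)))"
    using zz by (auto simp: A_def Q_def)
  have "euler_scheme G \<tau> f (\<lambda>k. fst (z k)) (\<lambda>k. snd (z k))"
    unfolding euler_scheme_def
  proof (intro conjI allI impI)
    fix k w q assume wq: "(w, q) \<in> G"
    have "fst (z k) + \<tau> *\<^sub>R f k - fst (z (Suc k)) = \<tau> *\<^sub>R (f k - (1 / \<tau>) *\<^sub>R (fst (z (Suc k)) - fst (z k)))"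
      using \<tau> by (simp add: algebra_simps)
    then have "\<tau> * inner (f k - (1 / \<tau>) *\<^sub>R (fst (z (Suc k)) - fst (z k))) (w - fst (z (Suc k)))
        \<le> \<tau> * inner (snd (z (Suc k))) (q - snd (z (Suc k)))"
      using z(3)[OF wq, of k] by simp
    then show "inner (f k - (1 / \<tau>) *\<^sub>R (fst (z (Suc k)) - fst (z k))) (w - fst (z (Suc k)))
        \<le> inner (snd (z (Suc k))) (q - snd (z (Suc k)))" using \<tau> by simp
  qed (use z(1) in simp)
  then show ?thesis using z(2) by (intro exI[of _ "\<lambda>k. fst (z k)"] exI[of _ "\<lambda>k. snd (z k)"]) simp
qed

lemma inner_le_half_squares: "inner a b \<le> (norm a)\<^sup>2 / 2 + (norm b)\<^sup>2 / 2" for a b :: "'h::real_inner"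
proof -
  have "0 \<le> (norm (a - b))\<^sup>2" by simp
  then show ?thesis by (simp add: power2_norm_eq_inner inner_simps inner_commute)
qed

lemma euler_energy_step:
  assumes R: "euler_scheme G \<tau> f u p" and \<tau>: "\<tau> > 0"
  shows "\<tau> * (norm ((1 / \<tau>) *\<^sub>R (u (Suc k) - u k)))\<^sup>2 + (norm (p (Suc k)))\<^sup>2 \<le> (norm (p k))\<^sup>2 + \<tau> * (norm (f k))\<^sup>2"
proof -
  define d where "d = (1 / \<tau>) *\<^sub>R (u (Suc k) - u k)"
  have ud: "u k - u (Suc k) = - (\<tau> *\<^sub>R d)" using \<tau> by (simp add: d_def)
  have "inner (f k - d) (u k - u (Suc k)) \<le> inner (p (Suc k)) (p k - p (Suc k))"
    using R unfolding euler_scheme_def d_def by blast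
  then have "\<tau> * inner d d \<le> \<tau> * inner (f k) d + inner (p (Suc k)) (p k) - inner (p (Suc k)) (p (Suc k))"
    unfolding ud by (simp add: inner_simps algebra_simps)
  \<comment> \<open>Young's inequality absorbs half of each quadratic term on the left; doubling
    what remains gives the stated constants.\<close>
  moreover have "\<tau> * inner (f k) d \<le> \<tau> * ((norm (f k))\<^sup>2 / 2 + (norm d)\<^sup>2 / 2)"
    using \<tau> inner_le_half_squares by (intro mult_left_mono) auto
  moreover have "inner (p (Suc k)) (p k) \<le> (norm (p (Suc k)))\<^sup>2 / 2 + (norm (p k))\<^sup>2 / 2"
    by (rule inner_le_half_squares)
  ultimately show ?thesis unfolding d_def[symmetric] by (simp add: power2_norm_eq_inner algebra_simps)
qed

lemma euler_energy:
  assumes R: "euler_scheme G \<tau> f u p" and \<tau>: "\<tau> > 0"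
  shows "\<tau> * (\<Sum>k<n. (norm ((1 / \<tau>) *\<^sub>R (u (Suc k) - u k)))\<^sup>2) + (norm (p n))\<^sup>2
     \<le> (norm (p 0))\<^sup>2 + \<tau> * (\<Sum>k<n. (norm (f k))\<^sup>2)"
proof (induction n)
  case (Suc n)
  then show ?case using euler_energy_step[OF assms, of n] by (simp add: distrib_left)
qed simp

text \<open>Two schemes on nested grids are compared through the piecewise affine interpolation of
  the coarse one, whose increment over each fine step is \<open>\<sigma>\<close> times the coarse difference quotient.\<close>
lemma euler_compare_step:
  fixes U :: "nat \<Rightarrow> 'h::{real_inner,complete_space}"
  assumes C: "euler_scheme G (real r * \<sigma>) F U P" and E: "euler_scheme G \<sigma> \<phi> v q" and \<sigma>: "\<sigma> > 0" and r: "r > 0"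
  defines "D \<equiv> \<lambda>i. U (i div r) + (real (i mod r) / real r) *\<^sub>R (U (Suc (i div r)) - U (i div r)) - v i"
  defines "dc \<equiv> \<lambda>k. (1 / (real r * \<sigma>)) *\<^sub>R (U (Suc k) - U k)"
  defines "df \<equiv> \<lambda>i. (1 / \<sigma>) *\<^sub>R (v (Suc i) - v i)"
  shows "(norm (D (Suc i)))\<^sup>2 + 2 * \<sigma> * (norm (P (Suc (i div r)) - q (Suc i)))\<^sup>2
     \<le> (norm (D i))\<^sup>2 + 2 * \<sigma> * inner (F (i div r) - \<phi> i) (U (Suc (i div r)) - v (Suc i))
        + \<sigma> * (real r * \<sigma>) * (3 * (norm (dc (i div r)))\<^sup>2 + (norm (df i))\<^sup>2)"
    and "norm (U (Suc (i div r)) - v (Suc i)) \<le> norm (D (Suc i)) + real r * \<sigma> * norm (dc (i div r))"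
proof -
  define k where "k = i div r"
  define \<tau> where "\<tau> = real r * \<sigma>"
  have \<tau>: "\<tau> > 0" using \<sigma> r by (simp add: \<tau>_def)
  have Ud: "U (Suc k) - U k = \<tau> *\<^sub>R dc k" using r \<sigma> by (simp add: dc_def \<tau>_def)
  have vd: "v (Suc i) = v i + \<sigma> *\<^sub>R df i" using \<sigma> by (simp add: df_def)
  \<comment> \<open>The formula also holds when \<open>Suc i\<close> opens the next coarse cell:
    there the weight equals 1 and the interpolation has reached \<open>U (Suc k)\<close>.\<close>
  have DS: "D (Suc i) = U k + ((real (i mod r) + 1) / real r) *\<^sub>R (U (Suc k) - U k) - v (Suc i)"
  proof (cases "Suc (i mod r) = r")
    case True
    then have "Suc i div r = Suc k" "Suc i mod r = 0" by (simp_all add: div_Suc mod_Suc k_def)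
    moreover have "(real (i mod r) + 1) / real r = 1"
      using True r by (metis add.commute div_self of_nat_Suc of_nat_eq_0_iff order_less_irrefl)
    ultimately show ?thesis by (simp add: D_def)
  next
    case False
    then have "Suc i div r = k" "Suc i mod r = Suc (i mod r)" by (simp_all add: div_Suc mod_Suc k_def)
    then show ?thesis by (simp add: D_def add.commute)
  qed
  \<comment> \<open>The inequalities are available at the nodes \<open>U (Suc k)\<close> and
    \<open>v (Suc i)\<close>, whereas the increments belong to the interpolation. \<open>c\<close>
    measures by which fraction of a coarse step the interpolation lags behind its node.\<close>
  define c where "c = (real (i mod r) + 1) / real r - 1"
  have c: "-1 \<le> c" "c \<le> 0"
  proof -
    have "real (i mod r) + 1 \<le> real r" using mod_less_divisor[OF r, of i] by linarith
    then show "c \<le> 0" "-1 \<le> c" using r by (auto simp: c_def divide_le_eq)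
  qed
  have DS': "D (Suc i) = (U (Suc k) - v (Suc i)) + (c * \<tau>) *\<^sub>R dc k"
  proof -
    have "D (Suc i) = (U (Suc k) - v (Suc i)) + c *\<^sub>R (U (Suc k) - U k)"
      unfolding DS c_def by (simp add: algebra_simps)
    then show ?thesis unfolding Ud by simp
  qed
  have inc: "D (Suc i) - D i = \<sigma> *\<^sub>R (dc k - df i)"
  proof -
    have "D (Suc i) - D i = (1 / real r) *\<^sub>R (U (Suc k) - U k) - (v (Suc i) - v i)"
      unfolding DS unfolding D_def k_def[symmetric] by (simp add: algebra_simps add_divide_distrib)
    then show ?thesis unfolding Ud vd using r by (simp add: \<tau>_def algebra_simps)
  qed
  \<comment> \<open>Each scheme is tested with the current value of the other one; in the sum the
    gradient terms combine to a negative square.\<close>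
  have "inner (F k - dc k) (v (Suc i) - U (Suc k)) \<le> inner (P (Suc k)) (q (Suc i) - P (Suc k))"
    using C E unfolding euler_scheme_def dc_def by blast
  moreover have "inner (\<phi> i - df i) (U (Suc k) - v (Suc i)) \<le> inner (q (Suc i)) (P (Suc k) - q (Suc i))"
    using C E unfolding euler_scheme_def df_def by blast
  ultimately have vi: "inner (dc k - df i) (U (Suc k) - v (Suc i)) + (norm (P (Suc k) - q (Suc i)))\<^sup>2
      \<le> inner (F k - \<phi> i) (U (Suc k) - v (Suc i))"
    by (simp add: power2_norm_eq_inner inner_simps algebra_simps inner_commute)
  have sq: "(norm (D (Suc i)))\<^sup>2 - (norm (D i))\<^sup>2 \<le> 2 * inner (D (Suc i)) (D (Suc i) - D i)"
  proof -
    have "0 \<le> (norm (D (Suc i) - D i))\<^sup>2" by simp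
    then show ?thesis by (simp add: power2_norm_eq_inner inner_simps inner_commute)
  qed
  \<comment> \<open>As \<open>c\<close> has modulus at most 1, Young's inequality bounds the term by
    2 (|dc|^2 + |dc|^2 / 2 + |df|^2 / 2).\<close>
  have err: "2 * (c * inner (dc k) (dc k - df i)) \<le> 3 * (norm (dc k))\<^sup>2 + (norm (df i))\<^sup>2"
  proof -
    have a: "\<bar>inner (dc k) (dc k - df i)\<bar> \<le> (norm (dc k))\<^sup>2 + \<bar>inner (dc k) (df i)\<bar>"
      by (simp add: inner_diff_right power2_norm_eq_inner[symmetric])
        (smt (verit) zero_le_power2)
    have b: "\<bar>inner (dc k) (df i)\<bar> \<le> (norm (dc k))\<^sup>2 / 2 + (norm (df i))\<^sup>2 / 2"
      using inner_le_half_squares[of "dc k" "df i"] inner_le_half_squares[of "dc k" "- df i"] by (simp add: abs_le_iff)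
    have "c * inner (dc k) (dc k - df i) \<le> \<bar>c\<bar> * \<bar>inner (dc k) (dc k - df i)\<bar>" by (simp add: abs_mult[symmetric])
    also have "\<dots> \<le> 1 * \<bar>inner (dc k) (dc k - df i)\<bar>" using c by (intro mult_right_mono) auto
    finally show ?thesis using a b by linarith
  qed
  have "inner (D (Suc i)) (D (Suc i) - D i) = \<sigma> * inner (dc k - df i) (U (Suc k) - v (Suc i)) + \<sigma> * \<tau> * (c * inner (dc k) (dc k - df i))"
    unfolding inc unfolding DS'
    using inner_commute[of "U (Suc k) - v (Suc i)" "dc k - df i"] by (simp add: inner_add_left distrib_left mult_ac)
  moreover have "2 * (\<sigma> * \<tau> * (c * inner (dc k) (dc k - df i))) \<le> \<sigma> * \<tau> * (3 * (norm (dc k))\<^sup>2 + (norm (df i))\<^sup>2)"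
    using mult_left_mono[OF err, of "\<sigma> * \<tau>"] \<sigma> \<tau> by simp
  moreover have "2 * \<sigma> * (inner (dc k - df i) (U (Suc k) - v (Suc i)) + (norm (P (Suc k) - q (Suc i)))\<^sup>2)
      \<le> 2 * \<sigma> * inner (F k - \<phi> i) (U (Suc k) - v (Suc i))"
    using mult_left_mono[OF vi, of "2 * \<sigma>"] \<sigma> by simp
  ultimately show "(norm (D (Suc i)))\<^sup>2 + 2 * \<sigma> * (norm (P (Suc (i div r)) - q (Suc i)))\<^sup>2
     \<le> (norm (D i))\<^sup>2 + 2 * \<sigma> * inner (F (i div r) - \<phi> i) (U (Suc (i div r)) - v (Suc i))
        + \<sigma> * (real r * \<sigma>) * (3 * (norm (dc (i div r)))\<^sup>2 + (norm (df i))\<^sup>2)"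
    using sq unfolding k_def[symmetric] \<tau>_def[symmetric] by (simp add: distrib_left)
  have "norm (U (Suc k) - v (Suc i)) = norm (D (Suc i) - (c * \<tau>) *\<^sub>R dc k)" unfolding DS' by simp
  also have "\<dots> \<le> norm (D (Suc i)) + norm ((c * \<tau>) *\<^sub>R dc k)" by (rule norm_triangle_ineq4)
  also have "norm ((c * \<tau>) *\<^sub>R dc k) \<le> 1 * \<tau> * norm (dc k)"
  proof -
    have "norm ((c * \<tau>) *\<^sub>R dc k) = \<bar>c\<bar> * (\<tau> * norm (dc k))" using \<tau> by (simp add: abs_mult)
    also have "\<dots> \<le> 1 * (\<tau> * norm (dc k))" using c \<tau> by (intro mult_right_mono) auto
    finally show ?thesis by simp
  qed
  finally show "norm (U (Suc (i div r)) - v (Suc i)) \<le> norm (D (Suc i)) + real r * \<sigma> * norm (dc (i div r))"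
    by (simp add: k_def \<tau>_def)
qed

lemma sum_div_index: "r > 0 \<Longrightarrow> (\<Sum>i<n * r. g (i div r)) = real r * (\<Sum>k<n. g k)" for g :: "nat \<Rightarrow> real"
proof (induction n)
  case (Suc n)
  have "(\<Sum>i<Suc n * r. g (i div r)) = (\<Sum>i<n * r + r. g (i div r))" by (simp add: add.commute)
  also have "\<dots> = (\<Sum>i<n * r. g (i div r)) + (\<Sum>i<r. g ((n * r + i) div r))"
    using sum.atLeastLessThan_concat[of 0 "n * r" "n * r + r" "\<lambda>i. g (i div r)"] sum.shift_bounds_nat_ivl[of "\<lambda>i. g (i div r)" 0 "n * r" r]
    by (simp add: atLeast0LessThan add.commute)
  also have "(\<Sum>i<r. g ((n * r + i) div r)) = (\<Sum>i<r. g n)"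
    using Suc.prems by (intro sum.cong refl) simp
  finally show ?case using Suc by (simp add: algebra_simps)
qed simp

text \<open>The first term of \<rho> comes from |U - v| \<le> 2 B and Cauchy-Schwarz in time, the
  second from the lag of the interpolation, which contributes a coarse step times the energies
  \<open>3 * M + M\<close>. The two schemes thus differ by the error of the data and a term
  proportional to the coarse step; the bound on the functions adds the distance from the
  interpolation back to the nodes.\<close>

lemma euler_compare:
  fixes U :: "nat \<Rightarrow> 'h::{real_inner,complete_space}"
  assumes C: "euler_scheme G (T / real n) F U P" and E: "euler_scheme G (T / real (n * r)) \<phi> v q"
    and T: "T > 0" and r: "r > 0" and n: "n > 0" and start: "U 0 = v 0"
    and bound: "\<forall>z\<in>G. norm (fst z) \<le> B"
    and Mc: "T / real n * (\<Sum>k<n. (norm ((real n / T) *\<^sub>R (U (Suc k) - U k)))\<^sup>2) \<le> M"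
    and Mf: "T / real (n * r) * (\<Sum>i<n * r. (norm ((real (n * r) / T) *\<^sub>R (v (Suc i) - v i)))\<^sup>2) \<le> M"
    and m: "m \<le> n * r"
  defines "\<rho> \<equiv> 4 * B * sqrt T * sqrt (T / real (n * r) * (\<Sum>i<n * r. (norm (F (i div r) - \<phi> i))\<^sup>2)) + T / real n * (4 * M)"
  shows "2 * (T / real (n * r)) * (\<Sum>i<m. (norm (P (Suc (i div r)) - q (Suc i)))\<^sup>2) \<le> \<rho>"
    and "m < n * r \<Longrightarrow> (norm (U (Suc (m div r)) - v (Suc m)))\<^sup>2 \<le> 2 * \<rho> + 2 * (T / real n) * M"
proof -
  have B: "norm w \<le> B" if "(w, p) \<in> G" for w p using bspec[OF bound that] by simp
  define \<sigma> where "\<sigma> = T / real (n * r)"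
  have \<sigma>: "\<sigma> > 0" "real r * \<sigma> = T / real n" using T r n by (auto simp: \<sigma>_def)
  define D where "D = (\<lambda>i. U (i div r) + (real (i mod r) / real r) *\<^sub>R (U (Suc (i div r)) - U (i div r)) - v i)"
  define dc where "dc = (\<lambda>k. (1 / (real r * \<sigma>)) *\<^sub>R (U (Suc k) - U k))"
  define df where "df = (\<lambda>i. (1 / \<sigma>) *\<^sub>R (v (Suc i) - v i))"
  have step: "(norm (D (Suc i)))\<^sup>2 + 2 * \<sigma> * (norm (P (Suc (i div r)) - q (Suc i)))\<^sup>2
     \<le> (norm (D i))\<^sup>2 + 2 * \<sigma> * inner (F (i div r) - \<phi> i) (U (Suc (i div r)) - v (Suc i))
        + \<sigma> * (real r * \<sigma>) * (3 * (norm (dc (i div r)))\<^sup>2 + (norm (df i))\<^sup>2)"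
    "norm (U (Suc (i div r)) - v (Suc i)) \<le> norm (D (Suc i)) + real r * \<sigma> * norm (dc (i div r))" for i
    unfolding D_def dc_def df_def
    by (rule euler_compare_step[OF C[folded \<sigma>(2)] E[folded \<sigma>_def] \<sigma>(1) r])+
  have dcM: "\<sigma> * (\<Sum>i<n * r. (norm (dc (i div r)))\<^sup>2) \<le> M"
  proof -
    have "\<sigma> * (\<Sum>i<n * r. (norm (dc (i div r)))\<^sup>2) = T / real n * (\<Sum>k<n. (norm (dc k))\<^sup>2)"
      using sum_div_index[OF r, of "\<lambda>k. (norm (dc k))\<^sup>2" n] \<sigma>(2) by (simp add: mult.assoc[symmetric] mult.commute)
    then show ?thesis using Mc by (simp add: dc_def \<sigma>(2))
  qed
  have dfM: "\<sigma> * (\<Sum>i<n * r. (norm (df i))\<^sup>2) \<le> M"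
    using Mf by (simp add: df_def \<sigma>_def)
  define a where "a i = 2 * \<sigma> * inner (F (i div r) - \<phi> i) (U (Suc (i div r)) - v (Suc i))" for i
  define b where "b i = \<sigma> * (real r * \<sigma>) * (3 * (norm (dc (i div r)))\<^sup>2 + (norm (df i))\<^sup>2)" for i
  have tele: "(norm (D j))\<^sup>2 + 2 * \<sigma> * (\<Sum>i<j. (norm (P (Suc (i div r)) - q (Suc i)))\<^sup>2) \<le> (\<Sum>i<j. a i + b i)" for j
  proof (induction j)
    case 0 show ?case using start by (simp add: D_def)
  next
    case (Suc j)
    then show ?case using step(1)[of j] by (simp add: a_def b_def distrib_left)
  qed
  have B0: "B \<ge> 0"
  proof -
    have "(U 0, P 0) \<in> G" using C by (simp add: euler_scheme_def)
    from B[OF this] show ?thesis by (rule order_trans[OF norm_ge_zero])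
  qed
  have aB: "a i \<le> 4 * B * (\<sigma> * norm (F (i div r) - \<phi> i))" for i
  proof -
    have "(U (Suc (i div r)), P (Suc (i div r))) \<in> G" "(v (Suc i), q (Suc i)) \<in> G"
      using C E by (simp_all add: euler_scheme_def)
    then have "norm (U (Suc (i div r)) - v (Suc i)) \<le> 2 * B"
      using B norm_triangle_ineq4[of "U (Suc (i div r))" "v (Suc i)"] by (smt (verit))
    then have "inner (F (i div r) - \<phi> i) (U (Suc (i div r)) - v (Suc i)) \<le> norm (F (i div r) - \<phi> i) * (2 * B)"
      using norm_cauchy_schwarz[of "F (i div r) - \<phi> i" "U (Suc (i div r)) - v (Suc i)"]
      by (meson mult_left_mono norm_ge_zero order_trans)
    from mult_left_mono[OF this, of "2 * \<sigma>"] \<sigma>(1) show ?thesis by (simp add: a_def mult_ac)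
  qed
  have sumle: "(\<Sum>i<j. a i + b i) \<le> \<rho>" if "j \<le> n * r" for j
  proof -
    have "(\<Sum>i<j. a i + b i) \<le> (\<Sum>i<j. 4 * B * (\<sigma> * norm (F (i div r) - \<phi> i)) + b i)"
      using aB by (intro sum_mono) auto
    also have "\<dots> \<le> (\<Sum>i<n * r. 4 * B * (\<sigma> * norm (F (i div r) - \<phi> i)) + b i)"
      using that B0 \<sigma>(1) by (intro sum_mono2) (auto simp: b_def)
    also have "\<dots> = 4 * B * (\<sigma> * (\<Sum>i<n * r. norm (F (i div r) - \<phi> i))) + (\<Sum>i<n * r. b i)"
      by (simp add: sum.distrib sum_distrib_left)
    also have "\<sigma> * (\<Sum>i<n * r. norm (F (i div r) - \<phi> i)) \<le> sqrt T * sqrt (T / real (n * r) * (\<Sum>i<n * r. (norm (F (i div r) - \<phi> i))\<^sup>2))"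
    proof -
      have "(\<sigma> * (\<Sum>i<n * r. norm (F (i div r) - \<phi> i)))\<^sup>2 \<le> \<sigma>\<^sup>2 * ((\<Sum>i<n * r. (norm (F (i div r) - \<phi> i))\<^sup>2) * real (n * r))"
        unfolding power_mult_distrib
        using sum_squared_le_sum_of_squares[of "\<lambda>i. norm (F (i div r) - \<phi> i)" "{..<n * r}"] by (intro mult_left_mono) auto
      also have "\<dots> = T * (T / real (n * r) * (\<Sum>i<n * r. (norm (F (i div r) - \<phi> i))\<^sup>2))"
        using n r by (simp add: \<sigma>_def power2_eq_square)
      finally have "\<sigma> * (\<Sum>i<n * r. norm (F (i div r) - \<phi> i)) \<le> sqrt (T * (T / real (n * r) * (\<Sum>i<n * r. (norm (F (i div r) - \<phi> i))\<^sup>2)))"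
        by (rule real_le_rsqrt)
      then show ?thesis by (simp only: real_sqrt_mult)
    qed
    also have "(\<Sum>i<n * r. b i) \<le> T / real n * (4 * M)"
    proof -
      have "(\<Sum>i<n * r. b i) = (real r * \<sigma>) * (3 * (\<sigma> * (\<Sum>i<n * r. (norm (dc (i div r)))\<^sup>2)) + \<sigma> * (\<Sum>i<n * r. (norm (df i))\<^sup>2))"
        by (simp add: b_def sum.distrib sum_distrib_left algebra_simps)
      also have "\<dots> \<le> (real r * \<sigma>) * (3 * M + M)"
        using dcM dfM \<sigma>(1) by (intro mult_left_mono) auto
      finally show ?thesis by (simp add: \<sigma>(2))
    qed
    finally show ?thesis using B0 by (simp add: \<rho>_def mult_left_mono mult.assoc)
  qed
  show "2 * (T / real (n * r)) * (\<Sum>i<m. (norm (P (Suc (i div r)) - q (Suc i)))\<^sup>2) \<le> \<rho>"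
    using tele[of m] sumle[OF m] zero_le_power2[of "norm (D m)"] unfolding \<sigma>_def[symmetric] by linarith
  assume m': "m < n * r"
  have "(norm (D (Suc m)))\<^sup>2 \<le> \<rho>"
  proof -
    have "0 \<le> 2 * \<sigma> * (\<Sum>i<Suc m. (norm (P (Suc (i div r)) - q (Suc i)))\<^sup>2)"
      using \<sigma>(1) by (intro mult_nonneg_nonneg sum_nonneg) auto
    moreover have "Suc m \<le> n * r" using m' by simp
    ultimately show ?thesis using tele[of "Suc m"] sumle[of "Suc m"] by linarith
  qed
  \<comment> \<open>A single quotient is at most the whole sum, so one factor
    \<open>T / real n\<close> is consumed by the energy bound and the other one remains as the small
    factor.\<close>
  moreover have "(real r * \<sigma> * norm (dc (m div r)))\<^sup>2 \<le> T / real n * M"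
  proof -
    have "(norm (dc (m div r)))\<^sup>2 \<le> (\<Sum>k<n. (norm (dc k))\<^sup>2)"
      using m' by (intro member_le_sum) (auto simp: less_mult_imp_div_less)
    then have "T / real n * (norm (dc (m div r)))\<^sup>2 \<le> T / real n * (\<Sum>k<n. (norm (dc k))\<^sup>2)"
      using T by (intro mult_left_mono) auto
    also have "\<dots> \<le> M" using Mc by (simp add: dc_def \<sigma>(2))
    finally have "T / real n * (T / real n * (norm (dc (m div r)))\<^sup>2) \<le> T / real n * M"
      using T by (intro mult_left_mono) auto
    then show ?thesis unfolding \<sigma>(2) by (simp add: power_mult_distrib power2_eq_square mult_ac)
  qed
  moreover have "(norm (U (Suc (m div r)) - v (Suc m)))\<^sup>2 \<le> (norm (D (Suc m)) + real r * \<sigma> * norm (dc (m div r)))\<^sup>2"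
    by (rule power_mono[OF step(2)]) simp
  moreover have "(norm (D (Suc m)) + real r * \<sigma> * norm (dc (m div r)))\<^sup>2
      \<le> 2 * (norm (D (Suc m)))\<^sup>2 + 2 * (real r * \<sigma> * norm (dc (m div r)))\<^sup>2"
    using zero_le_power2[of "norm (D (Suc m)) - real r * \<sigma> * norm (dc (m div r))"]
    unfolding power2_sum power2_diff by linarith
  ultimately show "(norm (U (Suc (m div r)) - v (Suc m)))\<^sup>2 \<le> 2 * \<rho> + 2 * (T / real n) * M"
    unfolding mult.assoc by linarith
qed

section \<open>Passage to the limit in the time step\<close>

lemma st_diff: assumes "T > 0" "n > 0" shows "st T n g - st T n h = st T n (\<lambda>k. g k - h k)"
  using st_add[OF assms, of g "\<lambda>k. (-1) *\<^sub>R h k"] st_scaleR[OF assms, of "-1" h] by simp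

lemma sl_time_shift: "AE t in lborel. sl (tr (0, h) g) t = sl g (t + h)"
proof (rule sl_AE_eqI)
  show "AE t in lborel. AE x in lborel. fn (tr (0, h) g) (x, t) = fn (sl g (t + h)) x"
    using AE_lborel_slices[OF fn_tr[of "(0, h)" g]] AE_shift[OF fn_sl[of g], of h]
  proof eventually_elim
    fix t assume "AE x in lborel. fn (tr (0, h) g) (x, t) = fn g ((x, t) + (0, h))"
      "AE x in lborel. fn (sl g (t + h)) x = fn g (x, t + h)"
    then show "AE x in lborel. fn (tr (0, h) g) (x, t) = fn (sl g (t + h)) x" by eventually_elim simp
  qed
qed

text \<open>Mean value theorem for the scalar function that pairs the translates with the increment
  itself; one factor of the norm of the increment then cancels.\<close>

lemma norm_test_increment_le:
  assumes t: "vtest S \<Phi>" and h: "0 < h"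
  shows "norm (tr (- (h *\<^sub>R d)) (mk \<Phi>) - mk \<Phi>) \<le> h * norm (mk (vpd \<Phi> d))"
proof -
  define w where "w = tr (- (h *\<^sub>R d)) (mk \<Phi>) - mk \<Phi>"
  define F where "F s = inner w (tr (- (s *\<^sub>R d)) (mk \<Phi>))" for s
  have "(F has_real_derivative - inner w (tr (- (s *\<^sub>R d)) (mk (vpd \<Phi> d)))) (at s)" for s
    unfolding F_def by (rule inner_tr_test_derivative[OF t])
  then obtain s where s: "F h - F 0 = (h - 0) * (- inner w (tr (- (s *\<^sub>R d)) (mk (vpd \<Phi> d))))"
    using MVT2[OF h, of F "\<lambda>s. - inner w (tr (- (s *\<^sub>R d)) (mk (vpd \<Phi> d)))"] by blast
  have "norm w * norm w = F h - F 0"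
    by (simp add: F_def tr_0 w_def[symmetric] inner_diff_right[symmetric] power2_norm_eq_inner[symmetric] power2_eq_square[symmetric])
  also have "\<dots> = h * (- inner w (tr (- (s *\<^sub>R d)) (mk (vpd \<Phi> d))))" unfolding s by simp
  also have "\<dots> \<le> h * (norm w * norm (mk (vpd \<Phi> d)))"
    using h Cauchy_Schwarz_ineq2[of w "tr (- (s *\<^sub>R d)) (mk (vpd \<Phi> d))"]
    by (intro mult_left_mono) (auto simp: norm_tr abs_le_iff)
  finally have "norm w * norm w \<le> norm w * (h * norm (mk (vpd \<Phi> d)))" by (simp add: mult_ac)
  then show ?thesis unfolding w_def[symmetric] using h by (cases "norm w = 0") auto
qed

lemma vtest_time_gap:
  fixes \<Phi> :: "'a::euclidean_space \<times> real \<Rightarrow> 'b::euclidean_space"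
  assumes t: "vtest (S \<times> {0<..<T}) \<Phi>"
  shows "\<exists>\<delta>>0. \<forall>x s. s < \<delta> \<longrightarrow> \<Phi> (x, s) = 0"
proof -
  define K where "K = (\<Union>e\<in>Basis. tsupp (\<lambda>z. inner (\<Phi> z) e))"
  have K: "compact K" "K \<subseteq> S \<times> {0<..<T}" using t unfolding K_def vtest_def test_fun_def by auto
  have zero: "\<Phi> z = 0" if "z \<notin> K" for z
  proof (rule euclidean_eqI)
    fix e :: 'b assume "e \<in> Basis"
    then have "z \<notin> tsupp (\<lambda>z. inner (\<Phi> z) e)" using that by (auto simp: K_def)
    then show "inner (\<Phi> z) e = inner 0 e" using tsupp_outside[of z "\<lambda>z. inner (\<Phi> z) e"] by simp
  qed
  show ?thesis
  proof (cases "K = {}")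
    case True then show ?thesis using zero by (intro exI[of _ 1]) auto
  next
    case False
    have "compact (snd ` K)" by (intro compact_continuous_image K continuous_intros)
    then obtain s where s: "s \<in> snd ` K" "\<And>y. y \<in> snd ` K \<Longrightarrow> s \<le> y"
      using compact_attains_inf[of "snd ` K"] False by auto
    have "s > 0" using s(1) K(2) by auto
    moreover have "\<Phi> (x, r) = 0" if "r < s" for x r
      using s(2)[of r] that by (intro zero) (force simp: image_iff)
    ultimately show ?thesis by blast
  qed
qed

lemma vpd_neg: "vtest S \<Phi> \<Longrightarrow> vpd \<Phi> (- d) x = - vpd \<Phi> d x"
proof -
  assume t: "vtest S \<Phi>"
  have "pd (\<lambda>x. inner (\<Phi> x) e) (- d) x = - pd (\<lambda>x. inner (\<Phi> x) e) d x" if "e \<in> Basis" for e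
  proof -
    have "(\<lambda>x. inner (\<Phi> x) e) differentiable (at x)" using t that test_fun_differentiable by (auto simp: vtest_def)
    from linear_neg[OF has_derivative_linear[OF pd_has_derivative[OF this]]] show ?thesis by blast
  qed
  then show ?thesis by (simp add: vpd_def sum_negf[symmetric])
qed

text \<open>Summation by parts moves the backward quotient of \<open>X j\<close> onto \<Phi> as the
  quotient \<open>q j\<close>. The latter is bounded and converges when paired with the fixed
  \<open>U\<close>; strong convergence of \<open>X j\<close> disposes of the remainder.\<close>

lemma discrete_time_derivative:
  fixes X :: "nat \<Rightarrow> ('a::euclidean_space \<times> real, 'b::euclidean_space) l2"
  assumes X: "X \<longlonglongrightarrow> U" and \<tau>: "\<And>j. \<tau> j > 0" "\<tau> \<longlonglongrightarrow> 0"
    and D: "\<And>j. AE t in lborel. \<tau> j \<le> t \<and> t < T \<longrightarrow> sl (X j) t - sl (X j) (t - \<tau> j) = \<tau> j *\<^sub>R sl (D j) t"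
    and t: "vtest (S \<times> {0<..<T}) \<Phi>"
  shows "(\<lambda>j. inner (D j) (mk \<Phi>)) \<longlonglongrightarrow> - inner U (mk (vpd \<Phi> (0, 1)))"
proof -
  obtain \<delta> where \<delta>: "\<delta> > 0" "\<And>x s. s < \<delta> \<Longrightarrow> \<Phi> (x, s) = 0" using vtest_time_gap[OF t] by blast
  define q where "q j = (1 / \<tau> j) *\<^sub>R (mk \<Phi> - tr (0, \<tau> j) (mk \<Phi>))" for j
  have eq: "inner (D j) (mk \<Phi>) = inner (X j) (q j)" if j: "\<tau> j < \<delta>" for j
  proof -
    define Z where "Z = X j - tr (0, - \<tau> j) (X j) - \<tau> j *\<^sub>R D j"
    have slt: "AE t in lborel. \<not> (\<tau> j \<le> t \<and> t < T) \<longrightarrow> sl (mk \<Phi>) t = 0"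
      using AE_lborel_slices[OF fn_mk[OF vtest_sq_int[OF t]]] fn_sl[of "mk \<Phi>"]
    proof eventually_elim
      fix s assume a: "AE x in lborel. fn (mk \<Phi>) (x, s) = \<Phi> (x, s)" "AE x in lborel. fn (sl (mk \<Phi>) s) x = fn (mk \<Phi>) (x, s)"
      show "\<not> (\<tau> j \<le> s \<and> s < T) \<longrightarrow> sl (mk \<Phi>) s = 0"
      proof
        assume s: "\<not> (\<tau> j \<le> s \<and> s < T)"
        have z: "\<Phi> (x, s) = 0" for x
        proof (cases "s < \<delta>")
          case True then show ?thesis by (rule \<delta>(2))
        next
          case False
          then have "(x, s) \<notin> S \<times> {0<..<T}" using s j by auto
          then show ?thesis by (rule vtest_outside[OF t])
        qed
        show "sl (mk \<Phi>) s = 0" by (rule l2_eqI) (use a fn_zero in eventually_elim, simp add: z)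
      qed
    qed
    have "AE t in lborel. inner (sl Z t) (sl (mk \<Phi>) t) = 0"
      using slt D[of j] sl_time_shift[of "- \<tau> j" "X j"] sl_diff[of "X j" "tr (0, - \<tau> j) (X j)"]
        sl_diff[of "X j - tr (0, - \<tau> j) (X j)" "\<tau> j *\<^sub>R D j"] sl_scaleR[of "\<tau> j" "D j"]
    proof eventually_elim
      case (elim t)
      then show ?case by (cases "\<tau> j \<le> t \<and> t < T") (auto simp: Z_def)
    qed
    then have "inner Z (mk \<Phi>) = 0" unfolding inner_slices(2)[symmetric] by (rule integral_eq_zero_AE)
    then have "\<tau> j * inner (D j) (mk \<Phi>) = inner (X j) (mk \<Phi>) - inner (tr (0, - \<tau> j) (X j)) (mk \<Phi>)"
      by (simp add: Z_def inner_diff_left)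
    also have "inner (tr (0, - \<tau> j) (X j)) (mk \<Phi>) = inner (X j) (tr (0, \<tau> j) (mk \<Phi>))"
      by (simp add: inner_tr_left)
    finally show ?thesis using \<tau>(1)[of j] by (simp add: q_def inner_diff_right field_simps)
  qed
  have tr00: "tr (0, 0) u = u" for u :: "('a \<times> real, 'b) l2" using tr_0[of u] by (simp add: zero_prod_def)
  \<comment> \<open>Derivatives of translates are taken along \<open>- (s *\<^sub>R d)\<close>, so
    evaluation at a later time t + s corresponds to the direction (0, -1).\<close>
  have shift: "- (s *\<^sub>R (0, -1)) = ((0::'a), s::real)" for s by simp
  have qb: "norm (q j) \<le> norm (mk (vpd \<Phi> (0, -1)))" for j
  proof -
    have "norm (tr (0, \<tau> j) (mk \<Phi>) - mk \<Phi>) \<le> \<tau> j * norm (mk (vpd \<Phi> (0, -1)))"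
      using norm_test_increment_le[OF t \<tau>(1), of j "(0, -1)"] unfolding shift .
    then have "norm (mk \<Phi> - tr (0, \<tau> j) (mk \<Phi>)) / \<tau> j \<le> norm (mk (vpd \<Phi> (0, -1)))"
      using \<tau>(1)[of j] by (simp add: norm_minus_commute divide_le_eq mult.commute)
    then show ?thesis using \<tau>(1)[of j] unfolding q_def norm_scaleR by simp
  qed
  have "((\<lambda>h. (inner U (tr (0, 0 + h) (mk \<Phi>)) - inner U (tr (0, 0) (mk \<Phi>))) / h)
      \<longlongrightarrow> - inner U (tr (0, 0) (mk (vpd \<Phi> (0, -1))))) (at 0)"
    using inner_tr_test_derivative[OF t, of U "(0, -1)" 0] unfolding shift DERIV_def .
  then have "(\<lambda>j. (inner U (tr (0, 0 + \<tau> j) (mk \<Phi>)) - inner U (tr (0, 0) (mk \<Phi>))) / \<tau> j)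
      \<longlonglongrightarrow> - inner U (tr (0, 0) (mk (vpd \<Phi> (0, -1))))"
    using \<tau> by (subst (asm) tendsto_at_iff_sequentially) (auto simp: comp_def less_imp_neq[symmetric])
  from tendsto_minus[OF this]
  have "(\<lambda>j. inner U (q j)) \<longlonglongrightarrow> inner U (mk (vpd \<Phi> (0, -1)))"
    by (simp add: q_def inner_diff_right tr00 minus_divide_left)
  moreover have "(\<lambda>j. inner (X j - U) (q j)) \<longlonglongrightarrow> 0"
  proof (rule Lim_null_comparison)
    show "eventually (\<lambda>j. norm (inner (X j - U) (q j)) \<le> norm (X j - U) * norm (mk (vpd \<Phi> (0, -1)))) sequentially"
    proof (intro always_eventually allI)
      fix j
      have "norm (inner (X j - U) (q j)) \<le> norm (X j - U) * norm (q j)" by (simp add: Cauchy_Schwarz_ineq2)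
      also have "\<dots> \<le> norm (X j - U) * norm (mk (vpd \<Phi> (0, -1)))" by (intro mult_left_mono qb) simp
      finally show "norm (inner (X j - U) (q j)) \<le> norm (X j - U) * norm (mk (vpd \<Phi> (0, -1)))" .
    qed
    have "(\<lambda>j. norm (X j - U)) \<longlonglongrightarrow> 0" using X by (simp add: tendsto_norm_zero_iff LIM_zero_iff)
    then show "(\<lambda>j. norm (X j - U) * norm (mk (vpd \<Phi> (0, -1)))) \<longlonglongrightarrow> 0" by (rule tendsto_mult_left_zero)
  qed
  ultimately have "(\<lambda>j. inner U (q j) + inner (X j - U) (q j)) \<longlonglongrightarrow> inner U (mk (vpd \<Phi> (0, -1))) + 0"
    by (rule tendsto_add)
  then have lim: "(\<lambda>j. inner (X j) (q j)) \<longlonglongrightarrow> inner U (mk (vpd \<Phi> (0, -1)))" by (simp add: inner_diff_left)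
  have "eventually (\<lambda>j. inner (X j) (q j) = inner (D j) (mk \<Phi>)) sequentially"
    using order_tendstoD(2)[OF \<tau>(2) \<delta>(1)] by eventually_elim (simp add: eq)
  from Lim_transform_eventually[OF lim this]
  have "(\<lambda>j. inner (D j) (mk \<Phi>)) \<longlonglongrightarrow> inner U (mk (vpd \<Phi> (0, -1)))" .
  moreover have "mk (vpd \<Phi> (0, -1)) = - mk (vpd \<Phi> (0, 1))"
  proof -
    have "vpd \<Phi> (0, -1) = (\<lambda>x. (-1) *\<^sub>R vpd \<Phi> (0, 1) x)" using vpd_neg[OF t, of "(0, 1)"] by auto
    then show ?thesis using mk_scaleR[OF vtest_sq_int[OF vtest_vpd[OF t]], of "-1" "(0, 1)"] by simp
  qed
  ultimately show ?thesis by simp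
qed

text \<open>Slicing is linear outside a null set, so the functions whose slices lie in the pointwise
  hulls form a convex set, and this set contains every \<open>X i\<close> with i in
  \<open>I\<close>.\<close>

lemma sl_convex_hull:
  assumes "y \<in> convex hull (X ` I)"
  shows "AE t in lborel. sl y t \<in> convex hull ((\<lambda>i. sl (X i) t) ` I)"
proof -
  let ?C = "{y. AE t in lborel. sl y t \<in> convex hull ((\<lambda>i. sl (X i) t) ` I)}"
  have "convex hull (X ` I) \<subseteq> ?C"
  proof (rule hull_minimal)
    show "X ` I \<subseteq> ?C" by (auto intro!: hull_inc)
    show "convex ?C"
    proof (rule convexI)
      fix x y and a b :: real assume h: "x \<in> ?C" "y \<in> ?C" "0 \<le> a" "0 \<le> b" "a + b = 1"
      have x: "AE t in lborel. sl x t \<in> convex hull ((\<lambda>i. sl (X i) t) ` I)"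
        and y: "AE t in lborel. sl y t \<in> convex hull ((\<lambda>i. sl (X i) t) ` I)" using h by auto
      have "AE t in lborel. sl (a *\<^sub>R x + b *\<^sub>R y) t \<in> convex hull ((\<lambda>i. sl (X i) t) ` I)"
        using x y sl_add[of "a *\<^sub>R x" "b *\<^sub>R y"] sl_scaleR[of a x] sl_scaleR[of b y]
      proof eventually_elim
        case (elim t)
        then show ?case using h(3-5) convexD[OF convex_convex_hull elim(1,2) h(3-5)] by simp
      qed
      then show "a *\<^sub>R x + b *\<^sub>R y \<in> ?C" by simp
    qed
  qed
  then show ?thesis using assms by blast
qed

text \<open>The hypothesis orders the two indices, coarse before fine. Two arbitrary late indices
  are therefore both compared with one fixed coarser index.\<close>

lemma Cauchy_by_comparison:
  fixes X :: "nat \<Rightarrow> 'h::real_normed_vector" and Y :: "nat \<Rightarrow> 'k::real_normed_vector"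
  assumes le: "\<And>j d. (norm (X j - X (j + d)))\<^sup>2 \<le> C * norm (Y j - Y (j + d)) + E / 2 ^ j"
    and Y: "Cauchy Y" and C: "C \<ge> 0"
  shows "Cauchy X"
proof (rule metric_CauchyI)
  fix e :: real assume e: "0 < e"
  \<comment> \<open>Chosen so that \<open>C * c\<close> is at most half of
    \<open>(e/2)\<^sup>2\<close>; the summand 1 covers the case \<open>C = 0\<close>.\<close>
  define c where "c = (e/2)\<^sup>2 / 2 / (C + 1)"
  have c: "c > 0" using e C by (simp add: c_def)
  obtain N1 where N1: "\<And>i j. i \<ge> N1 \<Longrightarrow> j \<ge> N1 \<Longrightarrow> norm (Y i - Y j) < c"
    using Y c unfolding Cauchy_def dist_norm by blast
  have "(\<lambda>j. E / 2 ^ j) \<longlonglongrightarrow> 0" using LIMSEQ_divide_realpow_zero[of 2 E] by simp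
  then have "eventually (\<lambda>j. E / 2 ^ j < (e/2)\<^sup>2 / 2) sequentially" using e by (intro order_tendstoD) auto
  then obtain N2 where N2: "\<And>j. j \<ge> N2 \<Longrightarrow> E / 2 ^ j < (e/2)\<^sup>2 / 2" by (auto simp: eventually_sequentially)
  define N where "N = max N1 N2"
  have half: "norm (X N - X j) < e / 2" if "j \<ge> N" for j
  proof -
    have "C * norm (Y N - Y j) \<le> C * c" using N1[of N j] that C by (intro mult_left_mono) (auto simp: N_def)
    also have "\<dots> \<le> (C + 1) * c" using c by (intro mult_right_mono) auto
    also have "\<dots> = (e/2)\<^sup>2 / 2"
    proof -
      have "c * (C + 1) = (e/2)\<^sup>2 / 2"
        by (rule nonzero_eq_divide_eq[THEN iffD1, OF _ c_def]) (use C in simp)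
      then show ?thesis by (simp only: mult.commute)
    qed
    finally have "C * norm (Y N - Y j) \<le> (e/2)\<^sup>2 / 2" .
    moreover have "(norm (X N - X j))\<^sup>2 \<le> C * norm (Y N - Y j) + E / 2 ^ N" using le[of N "j - N"] that by simp
    moreover have "E / 2 ^ N < (e/2)\<^sup>2 / 2" by (rule N2) (simp add: N_def)
    ultimately have "(norm (X N - X j))\<^sup>2 < (e/2)\<^sup>2" by linarith
    then show ?thesis by (rule power_less_imp_less_base) (use e in simp)
  qed
  have "dist (X i) (X j) < e" if "i \<ge> N" "j \<ge> N" for i j
    using half[OF that(1)] half[OF that(2)] dist_triangle_half_r[of "X N" "X i" e "X j"] by (simp add: dist_norm norm_minus_commute)
  then show "\<exists>M. \<forall>i\<ge>M. \<forall>j\<ge>M. dist (X i) (X j) < e" by blast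
qed

text \<open>The quotients \<open>D n\<close> are bounded over space-time, which says nothing about a
  single time. Their products with the vanishing \<open>W n\<close> still tend to 0 in L1 over time,
  and hence almost everywhere along a subsequence.\<close>

lemma product_slices_tendsto_0:
  fixes D W :: "nat \<Rightarrow> ('a::euclidean_space \<times> real, 'b::euclidean_space) l2"
  assumes M: "\<And>n. norm (D n) \<le> M" and W: "W \<longlonglongrightarrow> 0"
  shows "\<exists>r. strict_mono r \<and> (AE t in lborel. (\<lambda>n. norm (sl (D (r n)) t) * norm (sl (W (r n)) t)) \<longlonglongrightarrow> 0)"
proof -
  \<comment> \<open>The weight for Young's inequality: it dominates the norm of \<open>W n\<close>,
    tends to 0, and is kept strictly positive by the second summand, since it also occurs as a
    divisor.\<close>
  define e where "e n = norm (W n) + 1 / real (Suc n)" for n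
  have e0: "e n > 0" for n by (simp add: e_def add_nonneg_pos)
  have el: "e \<longlonglongrightarrow> 0"
    using tendsto_add[OF tendsto_norm_zero[OF W] LIMSEQ_Suc[OF lim_1_over_n]] by (simp add: e_def[abs_def])
  have young: "norm a * norm b \<le> e n / 2 * (norm a)\<^sup>2 + 1 / (2 * e n) * (norm b)\<^sup>2" for a :: "('a,'b) l2" and b :: "('a,'b) l2" and n
  proof -
    have "0 \<le> (e n * norm a - norm b)\<^sup>2 / (2 * e n)" using e0[of n] by simp
    then show ?thesis using e0[of n] by (simp add: power2_eq_square field_simps)
  qed
  have nm: "(\<lambda>t. norm (sl g t)) \<in> borel_measurable borel" for g :: "('a \<times> real,'b) l2"
  proof -
    have "(\<lambda>t. (norm (sl g t))\<^sup>2) \<in> borel_measurable borel" using norm_slices(1)[of g] by auto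
    then have "(\<lambda>t. sqrt ((norm (sl g t))\<^sup>2)) \<in> borel_measurable borel" by measurable
    then show ?thesis by simp
  qed
  have maj: "integrable lborel (\<lambda>t. e n / 2 * (norm (sl (D n) t))\<^sup>2 + 1 / (2 * e n) * (norm (sl (W n) t))\<^sup>2)" for n
    using norm_slices(1) by (intro Bochner_Integration.integrable_add integrable_mult_right) auto
  have int: "integrable lborel (\<lambda>t. norm (sl (D n) t) * norm (sl (W n) t))" for n
  proof (rule Bochner_Integration.integrable_bound[OF maj[of n]])
    show "(\<lambda>t. norm (sl (D n) t) * norm (sl (W n) t)) \<in> borel_measurable lborel" using nm by simp
    show "AE t in lborel. norm (norm (sl (D n) t) * norm (sl (W n) t))
        \<le> norm (e n / 2 * (norm (sl (D n) t))\<^sup>2 + 1 / (2 * e n) * (norm (sl (W n) t))\<^sup>2)"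
      using young by (intro AE_I2) (simp add: abs_mult order_trans[OF _ abs_ge_self])
  qed
  have bound: "(LINT t|lborel. norm (sl (D n) t) * norm (sl (W n) t)) \<le> e n / 2 * (M\<^sup>2 + 1)" for n
  proof -
    have "(LINT t|lborel. norm (sl (D n) t) * norm (sl (W n) t))
      \<le> (LINT t|lborel. e n / 2 * (norm (sl (D n) t))\<^sup>2 + 1 / (2 * e n) * (norm (sl (W n) t))\<^sup>2)"
      by (intro integral_mono int maj young)
    also have "\<dots> = e n / 2 * (norm (D n))\<^sup>2 + 1 / (2 * e n) * (norm (W n))\<^sup>2"
      by (simp only: Bochner_Integration.integral_add[OF integrable_mult_right integrable_mult_right, OF norm_slices(1) norm_slices(1)]
          integral_mult_right_zero norm_slices(2))
    also have "\<dots> \<le> e n / 2 * M\<^sup>2 + 1 / (2 * e n) * (e n)\<^sup>2"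
      using M[of n] e0[of n] by (intro add_mono mult_left_mono power_mono) (auto simp: e_def)
    also have "\<dots> = e n / 2 * (M\<^sup>2 + 1)" using e0[of n] by (simp add: power2_eq_square field_simps)
    finally show ?thesis .
  qed
  have "(\<lambda>n. LINT t|lborel. norm (norm (sl (D n) t) * norm (sl (W n) t))) \<longlonglongrightarrow> 0"
  proof (rule Lim_null_comparison)
    have "(\<lambda>n. e n / 2 * (M\<^sup>2 + 1)) \<longlonglongrightarrow> 0 / 2 * (M\<^sup>2 + 1)" by (intro tendsto_intros el) simp
    then show "(\<lambda>n. e n / 2 * (M\<^sup>2 + 1)) \<longlonglongrightarrow> 0" by simp
    have "0 \<le> (LINT t|lborel. norm (sl (D n) t) * norm (sl (W n) t))" for n by (intro integral_nonneg_AE) auto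
    then show "eventually (\<lambda>n. norm (LINT t|lborel. norm (norm (sl (D n) t) * norm (sl (W n) t))) \<le> e n / 2 * (M\<^sup>2 + 1)) sequentially"
      using bound by (simp add: abs_mult)
  qed
  from tendsto_L1_AE_subseq[OF int this] show ?thesis by blast
qed

text \<open>The delicate term is <D_n(t), w - U_n(t)>, in which both factors vary. Replacing U_n(t)
  by its limit costs |D_n(t)| |U_n(t) - U(t)|, which vanishes almost everywhere along a subsequence.
  Afterwards the inequality confines the quotients to half-spaces and so passes to convex
  combinations.\<close>

theorem euler_limit:
  fixes G :: "(('a::euclidean_space, 'b::euclidean_space) l2 \<times> ('a, 'c::euclidean_space) l2) set"
    and F :: "('a \<times> real, 'b) l2"
  assumes G: "closed G" "convex G" and init: "(u0, p0) \<in> G"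
    and bound: "\<forall>z\<in>G. norm (fst z) \<le> B"
    and T: "T > 0" and F: "AE z in lborel. snd z \<notin> {0..<T} \<longrightarrow> fn F z = 0"
  shows "\<exists>U P D M.
    (AE t in lborel. t \<in> {0<..<T} \<longrightarrow> (sl U t, sl P t) \<in> G \<and> (norm (sl P t))\<^sup>2 \<le> M \<and>
        (norm (sl U t - u0))\<^sup>2 \<le> M * t \<and>
        (\<forall>w q. (w, q) \<in> G \<longrightarrow> inner (sl F t - sl D t) (w - sl U t) \<le> inner (sl P t) (q - sl P t))) \<and>
    (\<forall>S. weakd (S \<times> {0<..<T}) (0, 1) U D)"
proof -
  define n where "n j = (2::nat) ^ j" for j :: nat
  have n: "n j > 0" "n (j + d) = n j * 2 ^ d" "real (n j) = 2 ^ j" for j d by (auto simp: n_def power_add)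
  obtain f where f: "(\<lambda>j. st T (n j) (f j)) \<longlonglongrightarrow> F" using steps_dense[OF T F] unfolding n_def by blast
  have "\<exists>u p. u 0 = u0 \<and> p 0 = p0 \<and> euler_scheme G (T / real (n j)) (f j) u p" for j
    by (rule euler_scheme_exists[OF G _ init]) (use T n in simp)
  then obtain u p where up: "\<And>j. u j 0 = u0" "\<And>j. p j 0 = p0" "\<And>j. euler_scheme G (T / real (n j)) (f j) (u j) (p j)"
    by metis
  define dq where "dq j k = (real (n j) / T) *\<^sub>R (u j (Suc k) - u j k)" for j k
  obtain S where S: "\<And>j. norm (st T (n j) (f j)) \<le> S"
    using convergent_imp_Bseq[of "\<lambda>j. st T (n j) (f j)"] f by (auto simp: convergent_def Bseq_def)
  \<comment> \<open>Initial energy plus a bound on the data. It controls the quotients over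
    space-time and all gradients and, by Cauchy-Schwarz in time, the growth of the squared distance
    from \<open>u0\<close>.\<close>
  define M where "M = (norm p0)\<^sup>2 + S\<^sup>2"
  have M0: "M \<ge> 0" by (simp add: M_def)
  have energy: "T / real (n j) * (\<Sum>k<m. (norm (dq j k))\<^sup>2) + (norm (p j m))\<^sup>2 \<le> M" if m: "m \<le> n j" for j m
  proof -
    have "T / real (n j) * (\<Sum>k<m. (norm (dq j k))\<^sup>2) + (norm (p j m))\<^sup>2
        \<le> (norm p0)\<^sup>2 + T / real (n j) * (\<Sum>k<m. (norm (f j k))\<^sup>2)"
      using euler_energy[OF up(3)[of j], of m] T n(1)[of j] up(2)[of j] by (simp add: dq_def)
    also have "T / real (n j) * (\<Sum>k<m. (norm (f j k))\<^sup>2) \<le> T / real (n j) * (\<Sum>k<n j. (norm (f j k))\<^sup>2)"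
      using T m by (intro mult_left_mono sum_mono2) auto
    also have "\<dots> = (norm (st T (n j) (f j)))\<^sup>2" by (rule norm_st_sq[OF T n(1), symmetric])
    also have "\<dots> \<le> S\<^sup>2" by (intro power_mono S) simp
    finally show ?thesis by (simp add: M_def)
  qed
  have energy': "T / real (n j) * (\<Sum>k<m. (norm (dq j k))\<^sup>2) \<le> M" "(norm (p j m))\<^sup>2 \<le> M" if m: "m \<le> n j" for j m
  proof -
    have "0 \<le> T / real (n j) * (\<Sum>k<m. (norm (dq j k))\<^sup>2)" using T by (intro mult_nonneg_nonneg sum_nonneg) auto
    then show "T / real (n j) * (\<Sum>k<m. (norm (dq j k))\<^sup>2) \<le> M" "(norm (p j m))\<^sup>2 \<le> M"
      using energy[OF m] zero_le_power2[of "norm (p j m)"] by linarith+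
  qed
  define SU where "SU j = st T (n j) (\<lambda>k. u j (Suc k))" for j
  define SP where "SP j = st T (n j) (\<lambda>k. p j (Suc k))" for j
  define SD where "SD j = st T (n j) (dq j)" for j
  define SF where "SF j = st T (n j) (f j)" for j
  have B0: "B \<ge> 0" using order_trans[OF norm_ge_zero bspec[OF bound init]] by simp
  \<comment> \<open>Both approximations are rewritten on the finer grid, where the sums in the
    comparison of nested schemes become norms of differences of step functions.\<close>
  have cmp: "(norm (SP j - SP (j + d)))\<^sup>2 \<le> 4 * B * sqrt T * norm (SF j - SF (j + d)) + T * (4 * M) / 2 ^ j"
    "(norm (SU j - SU (j + d)))\<^sup>2 \<le> 8 * B * sqrt T * T * norm (SF j - SF (j + d)) + 10 * T * T * M / 2 ^ j" for j d
  proof -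
    define r where "r = (2::nat) ^ d"
    have r: "r > 0" "n (j + d) = n j * r" by (auto simp: r_def n)
    have nr: "n j * r > 0" using r n(1)[of j] by simp
    define \<rho> where "\<rho> = 4 * B * sqrt T * norm (SF j - SF (j + d)) + T / real (n j) * (4 * M)"
    have ref: "st T (n j) h = st T (n j * r) (\<lambda>i. h (i div r))" for h :: "nat \<Rightarrow> ('a, 'b) l2"
      by (rule st_refine[OF T n(1) r(1), symmetric])
    have ref': "st T (n j) h = st T (n j * r) (\<lambda>i. h (i div r))" for h :: "nat \<Rightarrow> ('a, 'c) l2"
      by (rule st_refine[OF T n(1) r(1), symmetric])
    have SFd: "sqrt (T / real (n j * r) * (\<Sum>i<n j * r. (norm (f j (i div r) - f (j + d) i))\<^sup>2)) = norm (SF j - SF (j + d))"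
    proof -
      have "(norm (SF j - SF (j + d)))\<^sup>2 = T / real (n j * r) * (\<Sum>i<n j * r. (norm (f j (i div r) - f (j + d) i))\<^sup>2)"
        unfolding SF_def r(2) ref st_diff[OF T nr] by (rule norm_st_sq[OF T nr])
      then show ?thesis by (metis norm_ge_zero real_sqrt_abs abs_of_nonneg)
    qed
    have Mc: "T / real (n j) * (\<Sum>k<n j. (norm ((real (n j) / T) *\<^sub>R (u j (Suc k) - u j k)))\<^sup>2) \<le> M"
      using energy'(1)[of "n j" j] by (simp add: dq_def)
    have Mf: "T / real (n j * r) * (\<Sum>i<n j * r. (norm ((real (n j * r) / T) *\<^sub>R (u (j + d) (Suc i) - u (j + d) i)))\<^sup>2) \<le> M"
      using energy'(1)[of "n (j + d)" "j + d"] by (simp add: dq_def r(2))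
    have E: "euler_scheme G (T / real (n j * r)) (f (j + d)) (u (j + d)) (p (j + d))"
      using up(3)[of "j + d"] by (simp only: r(2))
    have start: "u j 0 = u (j + d) 0" by (simp add: up(1))
    note ec = euler_compare[OF up(3)[of j] E T r(1) n(1) start bound Mc Mf, unfolded SFd, folded \<rho>_def]
    have "(norm (SP j - SP (j + d)))\<^sup>2 = T / real (n j * r) * (\<Sum>i<n j * r. (norm (p j (Suc (i div r)) - p (j + d) (Suc i)))\<^sup>2)"
      unfolding SP_def r(2) ref' st_diff[OF T nr] by (rule norm_st_sq[OF T nr])
    moreover have "0 \<le> T / real (n j * r) * (\<Sum>i<n j * r. (norm (p j (Suc (i div r)) - p (j + d) (Suc i)))\<^sup>2)"
      using T by (intro mult_nonneg_nonneg sum_nonneg) auto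
    ultimately have "(norm (SP j - SP (j + d)))\<^sup>2 \<le> \<rho>" using ec(1)[OF order_refl] by simp
    then show "(norm (SP j - SP (j + d)))\<^sup>2 \<le> 4 * B * sqrt T * norm (SF j - SF (j + d)) + T * (4 * M) / 2 ^ j"
      by (simp add: \<rho>_def n(3))
    have "(norm (SU j - SU (j + d)))\<^sup>2 = T / real (n j * r) * (\<Sum>i<n j * r. (norm (u j (Suc (i div r)) - u (j + d) (Suc i)))\<^sup>2)"
      unfolding SU_def r(2) ref st_diff[OF T nr] by (rule norm_st_sq[OF T nr])
    also have "\<dots> \<le> T / real (n j * r) * (\<Sum>i<n j * r. 2 * \<rho> + 2 * (T / real (n j)) * M)"
      using T ec(2)[OF less_imp_le] by (intro mult_left_mono sum_mono) auto
    also have "\<dots> = T * (2 * \<rho> + 2 * (T / real (n j)) * M)" using nr by simp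
    also have "\<dots> = 8 * B * sqrt T * T * norm (SF j - SF (j + d)) + 10 * T * T * M / 2 ^ j"
      by (simp add: \<rho>_def n(3) algebra_simps add_divide_distrib)
    finally show "(norm (SU j - SU (j + d)))\<^sup>2 \<le> 8 * B * sqrt T * T * norm (SF j - SF (j + d)) + 10 * T * T * M / 2 ^ j" .
  qed
  have SFc: "Cauchy SF" using f LIMSEQ_imp_Cauchy unfolding SF_def[abs_def] by blast
  have "Cauchy SP" by (rule Cauchy_by_comparison[OF cmp(1) SFc]) (use B0 T in simp)
  then obtain P where P: "SP \<longlonglongrightarrow> P" using Cauchy_convergent convergent_def by blast
  have "Cauchy SU" by (rule Cauchy_by_comparison[OF cmp(2) SFc]) (use B0 T in simp)
  then obtain U where U: "SU \<longlonglongrightarrow> U" using Cauchy_convergent convergent_def by blast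
  have SFl: "SF \<longlonglongrightarrow> F" using f by (simp add: SF_def[abs_def])
  have SDb: "norm (SD j) \<le> sqrt M" for j
    using energy'(1)[of "n j" j] by (intro real_le_rsqrt) (simp add: SD_def norm_st_sq[OF T n(1)])
  \<comment> \<open>Every almost everywhere convergence costs a further subsequence; the four
    selections are composed into \<open>r\<close> below.\<close>
  obtain r1 where r1: "strict_mono r1" "AE t in lborel. (\<lambda>i. sl (SU (r1 i)) t) \<longlonglongrightarrow> sl U t"
    using sl_tendsto_subseq[OF U] by blast
  obtain r2 where r2: "strict_mono r2" "AE t in lborel. (\<lambda>i. sl (SP (r1 (r2 i))) t) \<longlonglongrightarrow> sl P t"
    using sl_tendsto_subseq[OF LIMSEQ_subseq_LIMSEQ[OF P r1(1)]] by (auto simp: comp_def)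
  have r12: "strict_mono (r1 \<circ> r2)" using r1(1) r2(1) by (rule strict_mono_o)
  obtain r3 where r3: "strict_mono r3" "AE t in lborel. (\<lambda>i. sl (SF (r1 (r2 (r3 i)))) t) \<longlonglongrightarrow> sl F t"
    using sl_tendsto_subseq[OF LIMSEQ_subseq_LIMSEQ[OF SFl r12]] by (auto simp: comp_def)
  have r123: "strict_mono (r1 \<circ> r2 \<circ> r3)" using r12 r3(1) by (rule strict_mono_o)
  have "(\<lambda>i. SU ((r1 \<circ> r2 \<circ> r3) i) - U) \<longlonglongrightarrow> 0"
    using LIMSEQ_subseq_LIMSEQ[OF U r123] by (simp add: comp_def LIM_zero)
  from product_slices_tendsto_0[OF SDb this]
  obtain r4 where r4: "strict_mono r4" "AE t in lborel. (\<lambda>i. norm (sl (SD ((r1 \<circ> r2 \<circ> r3) (r4 i))) t) *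
      norm (sl (SU ((r1 \<circ> r2 \<circ> r3) (r4 i)) - U) t)) \<longlonglongrightarrow> 0"
    using product_slices_tendsto_0[of "\<lambda>i. SD ((r1 \<circ> r2 \<circ> r3) i)" "sqrt M" "\<lambda>i. SU ((r1 \<circ> r2 \<circ> r3) i) - U"] SDb
      \<open>(\<lambda>i. SU ((r1 \<circ> r2 \<circ> r3) i) - U) \<longlonglongrightarrow> 0\<close> by blast
  define r where "r i = r1 (r2 (r3 (r4 i)))" for i
  have r: "strict_mono r" using strict_mono_o[OF r123 r4(1)] by (simp add: r_def[abs_def] comp_def)
  have conv: "AE t in lborel. (\<lambda>i. sl (SU (r i)) t) \<longlonglongrightarrow> sl U t \<and> (\<lambda>i. sl (SP (r i)) t) \<longlonglongrightarrow> sl P t \<and>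
      (\<lambda>i. sl (SF (r i)) t) \<longlonglongrightarrow> sl F t \<and> (\<lambda>i. norm (sl (SD (r i)) t) * norm (sl (SU (r i)) t - sl U t)) \<longlonglongrightarrow> 0"
  proof -
    have "AE t in lborel. \<forall>i. sl (SU (r i) - U) t = sl (SU (r i)) t - sl U t"
      by (subst AE_all_countable) (auto intro: sl_diff)
    with r1(2) r2(2) r3(2) r4(2) show ?thesis
    proof eventually_elim
      case (elim t)
      have "strict_mono (r2 \<circ> r3 \<circ> r4)" "strict_mono (r3 \<circ> r4)"
        using r2(1) r3(1) r4(1) by (auto intro: strict_mono_o)
      from LIMSEQ_subseq_LIMSEQ[OF elim(1) this(1)] LIMSEQ_subseq_LIMSEQ[OF elim(2) this(2)]
        LIMSEQ_subseq_LIMSEQ[OF elim(3) r4(1)] elim(4,5)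
      show ?case by (simp add: comp_def r_def)
    qed
  qed
  obtain Y D where Y: "\<And>i. Y i \<in> convex hull ((\<lambda>i. SD (r i)) ` {i..})" "Y \<longlonglongrightarrow> D"
    using bounded_convex_combinations_converge[of "\<lambda>i. SD (r i)" "sqrt M"] SDb by blast
  obtain s where s: "strict_mono s" "AE t in lborel. (\<lambda>i. sl (Y (s i)) t) \<longlonglongrightarrow> sl D t"
    using sl_tendsto_subseq[OF Y(2)] by blast
  have hull: "AE t in lborel. \<forall>i. sl (Y i) t \<in> convex hull ((\<lambda>i. sl (SD (r i)) t) ` {i..})"
    by (subst AE_all_countable) (use sl_convex_hull[OF Y(1)] in blast)
  have grid: "AE t in lborel. \<forall>j. t \<in> {0<..<T} \<longrightarrow> (\<exists>k<n j. t \<in> cell T (n j) k \<and> sl (SU j) t = u j (Suc k) \<and>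
      sl (SP j) t = p j (Suc k) \<and> sl (SD j) t = dq j k \<and> sl (SF j) t = f j k)"
  proof (subst AE_all_countable, intro allI)
    fix j
    show "AE t in lborel. t \<in> {0<..<T} \<longrightarrow> (\<exists>k<n j. t \<in> cell T (n j) k \<and> sl (SU j) t = u j (Suc k) \<and>
      sl (SP j) t = p j (Suc k) \<and> sl (SD j) t = dq j k \<and> sl (SF j) t = f j k)"
      using sl_st[OF T n(1)[of j], of "\<lambda>k. u j (Suc k)"] sl_st[OF T n(1)[of j], of "\<lambda>k. p j (Suc k)"]
        sl_st[OF T n(1)[of j], of "dq j"] sl_st[OF T n(1)[of j], of "f j"]
    proof eventually_elim
      case (elim t)
      show ?case
      proof
        assume "t \<in> {0<..<T}"
        then obtain k where k: "k < n j" "t \<in> cell T (n j) k" using cell_cover[OF T n(1), of t j] by auto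
        then show "\<exists>k<n j. t \<in> cell T (n j) k \<and> sl (SU j) t = u j (Suc k) \<and>
          sl (SP j) t = p j (Suc k) \<and> sl (SD j) t = dq j k \<and> sl (SF j) t = f j k"
          using elim by (intro exI[of _ k]) (simp add: SU_def SP_def SD_def SF_def)
      qed
    qed
  qed
  \<comment> \<open>Cauchy-Schwarz over the steps made so far gives Hoelder continuity at time 0
    with exponent 1/2. The extra \<open>T / 2 ^ j\<close> is the overshoot from t to the right end
    of its cell.\<close>
  have dist0: "(norm (u j (Suc k) - u0))\<^sup>2 \<le> (t + T / 2 ^ j) * M" if k: "k < n j" "t \<in> cell T (n j) k" for j k t
  proof -
    have "u j (Suc k) - u0 = (\<Sum>i<Suc k. u j (Suc i) - u j i)" by (simp only: sum_lessThan_telescope up(1))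
    also have "\<dots> = (\<Sum>i<Suc k. (T / real (n j)) *\<^sub>R dq j i)" using T n(1)[of j] by (intro sum.cong refl) (simp add: dq_def)
    finally have "norm (u j (Suc k) - u0) \<le> (\<Sum>i<Suc k. T / real (n j) * norm (dq j i))"
      using norm_sum[of "\<lambda>i. (T / real (n j)) *\<^sub>R dq j i" "{..<Suc k}"] T by (simp del: sum.lessThan_Suc)
    then have "(norm (u j (Suc k) - u0))\<^sup>2 \<le> (\<Sum>i<Suc k. T / real (n j) * norm (dq j i))\<^sup>2"
      by (intro power_mono) auto
    also have "\<dots> = (T / real (n j))\<^sup>2 * (\<Sum>i<Suc k. norm (dq j i))\<^sup>2"
      by (simp only: sum_distrib_left[symmetric] power_mult_distrib)
    also have "\<dots> \<le> (T / real (n j))\<^sup>2 * ((\<Sum>i<Suc k. (norm (dq j i))\<^sup>2) * real (card {..<Suc k}))"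
      by (intro mult_left_mono sum_squared_le_sum_of_squares) simp
    also have "\<dots> = (real (Suc k) * T / real (n j)) * (T / real (n j) * (\<Sum>i<Suc k. (norm (dq j i))\<^sup>2))"
      by (simp only: power2_eq_square card_lessThan) (simp only: mult_ac times_divide_eq_right times_divide_eq_left)
    also have "\<dots> \<le> (real (Suc k) * T / real (n j)) * M"
      using energy'(1)[of "Suc k" j] k(1) T by (intro mult_left_mono) auto
    also have "\<dots> \<le> (t + T / 2 ^ j) * M"
    proof (rule mult_right_mono[OF _ M0])
      have "real (Suc k) * T / real (n j) = real k * T / real (n j) + T / 2 ^ j"
        by (simp add: n(3)[symmetric] add_divide_distrib distrib_right)
      then show "real (Suc k) * T / real (n j) \<le> t + T / 2 ^ j" using k(2) by (simp add: cell_def)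
    qed
    finally show ?thesis .
  qed
  have r_ge: "i \<le> r i" for i using strict_mono_imp_increasing[OF r] by blast
  have small: "(\<lambda>i. T / 2 ^ r i) \<longlonglongrightarrow> 0"
    using LIMSEQ_subseq_LIMSEQ[OF LIMSEQ_divide_realpow_zero[of 2 T] r] by (simp add: comp_def)
  have main: "AE t in lborel. t \<in> {0<..<T} \<longrightarrow> (sl U t, sl P t) \<in> G \<and> (norm (sl P t))\<^sup>2 \<le> M \<and>
        (norm (sl U t - u0))\<^sup>2 \<le> M * t \<and>
        (\<forall>w q. (w, q) \<in> G \<longrightarrow> inner (sl F t - sl D t) (w - sl U t) \<le> inner (sl P t) (q - sl P t))"
    using conv s(2) hull grid
  proof eventually_elim
    case (elim t)
    show ?case
    proof (intro impI)
      assume t: "t \<in> {0<..<T}"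
      have cU: "(\<lambda>i. sl (SU (r i)) t) \<longlonglongrightarrow> sl U t" and cP: "(\<lambda>i. sl (SP (r i)) t) \<longlonglongrightarrow> sl P t"
        and cF: "(\<lambda>i. sl (SF (r i)) t) \<longlonglongrightarrow> sl F t"
        and cE: "(\<lambda>i. norm (sl (SD (r i)) t) * norm (sl (SU (r i)) t - sl U t)) \<longlonglongrightarrow> 0" using elim(1) by auto
      have lev: "(sl (SU j) t, sl (SP j) t) \<in> G \<and> (norm (sl (SP j) t))\<^sup>2 \<le> M \<and> (norm (sl (SU j) t - u0))\<^sup>2 \<le> (t + T / 2 ^ j) * M \<and>
         (\<forall>w q. (w, q) \<in> G \<longrightarrow> inner (sl (SF j) t - sl (SD j) t) (w - sl (SU j) t) \<le> inner (sl (SP j) t) (q - sl (SP j) t))" for j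
      proof -
        obtain k where k: "k < n j" "t \<in> cell T (n j) k" "sl (SU j) t = u j (Suc k)"
          "sl (SP j) t = p j (Suc k)" "sl (SD j) t = dq j k" "sl (SF j) t = f j k" using elim(4) t by blast
        have dqe: "dq j k = (1 / (T / real (n j))) *\<^sub>R (u j (Suc k) - u j k)" by (simp add: dq_def)
        show ?thesis unfolding k(3-6)
          using up(3)[of j] energy'(2)[of "Suc k" j] dist0[OF k(1,2)] k(1) unfolding euler_scheme_def dqe by auto
      qed
      have "(sl U t, sl P t) \<in> G"
        by (rule closed_sequentially[OF G(1), of "\<lambda>i. (sl (SU (r i)) t, sl (SP (r i)) t)"]) (use lev in \<open>auto intro: tendsto_Pair cU cP\<close>)
      moreover have "(norm (sl P t))\<^sup>2 \<le> M"
        by (rule LIMSEQ_le_const2[OF tendsto_power[OF tendsto_norm[OF cP]]]) (use lev in blast)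
      moreover have "(norm (sl U t - u0))\<^sup>2 \<le> M * t"
      proof (rule LIMSEQ_le)
        show "(\<lambda>i. (norm (sl (SU (r i)) t - u0))\<^sup>2) \<longlonglongrightarrow> (norm (sl U t - u0))\<^sup>2" by (intro tendsto_intros cU)
        have "(\<lambda>i. (t + T / 2 ^ r i) * M) \<longlonglongrightarrow> (t + 0) * M" by (intro tendsto_intros small)
        then show "(\<lambda>i. (t + T / 2 ^ r i) * M) \<longlonglongrightarrow> M * t" by (simp add: mult.commute)
      qed (use lev in blast)
      moreover have "inner (sl F t - sl D t) (w - sl U t) \<le> inner (sl P t) (q - sl P t)" if wq: "(w, q) \<in> G" for w q
      proof -
        \<comment> \<open>Everything except the quotient paired with the fixed vector
          \<open>w - sl U t\<close>; the last product is the price for replacing the approximation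
          by its limit in that pairing. What is left is a lower bound linear in the
          quotient.\<close>
        define c where "c i = inner (sl (SF (r i)) t) (w - sl (SU (r i)) t) - inner (sl (SP (r i)) t) (q - sl (SP (r i)) t)
            - norm (sl (SD (r i)) t) * norm (sl (SU (r i)) t - sl U t)" for i
        have "c \<longlonglongrightarrow> inner (sl F t) (w - sl U t) - inner (sl P t) (q - sl P t) - 0"
          unfolding c_def[abs_def] by (intro tendsto_intros cU cP cF cE)
        moreover have "c i \<le> inner (sl (SD (r i)) t) (w - sl U t)" for i
        proof -
          have "inner (sl (SF (r i)) t - sl (SD (r i)) t) (w - sl (SU (r i)) t) \<le> inner (sl (SP (r i)) t) (q - sl (SP (r i)) t)"
            using lev wq by blast
          moreover have "- inner (sl (SD (r i)) t) (sl (SU (r i)) t - sl U t) \<le> norm (sl (SD (r i)) t) * norm (sl (SU (r i)) t - sl U t)"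
            using Cauchy_Schwarz_ineq2[of "sl (SD (r i)) t" "sl (SU (r i)) t - sl U t"] by (simp add: abs_le_iff)
          ultimately show ?thesis unfolding c_def by (simp add: inner_simps)
        qed
        moreover have "sl (Y (s i)) t \<in> convex hull ((\<lambda>i. sl (SD (r i)) t) ` {i..})" for i
        proof -
          have "i \<le> s i" using strict_mono_imp_increasing[OF s(1)] by blast
          then have "convex hull ((\<lambda>i. sl (SD (r i)) t) ` {s i..}) \<subseteq> convex hull ((\<lambda>i. sl (SD (r i)) t) ` {i..})"
            by (intro hull_mono image_mono) auto
          then show ?thesis using elim(3) by blast
        qed
        ultimately have "inner (sl F t) (w - sl U t) - inner (sl P t) (q - sl P t) - 0 \<le> inner (sl D t) (w - sl U t)"
          by (intro convex_combinations_inner_ge[OF _ elim(2), of "\<lambda>i. sl (SD (r i)) t" c])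
        then show ?thesis by (simp add: inner_diff_left)
      qed
      ultimately show "(sl U t, sl P t) \<in> G \<and> (norm (sl P t))\<^sup>2 \<le> M \<and>
        (norm (sl U t - u0))\<^sup>2 \<le> M * t \<and>
        (\<forall>w q. (w, q) \<in> G \<longrightarrow> inner (sl F t - sl D t) (w - sl U t) \<le> inner (sl P t) (q - sl P t))" by blast
    qed
  qed
  have step: "AE t in lborel. T / real (n j) \<le> t \<and> t < T \<longrightarrow> sl (SU j) t - sl (SU j) (t - T / real (n j)) = (T / real (n j)) *\<^sub>R sl (SD j) t" for j
    using sl_st[OF T n(1)[of j], of "\<lambda>k. u j (Suc k)"] AE_shift[OF sl_st[OF T n(1)[of j], of "\<lambda>k. u j (Suc k)"], of "- (T / real (n j))"]
      sl_st[OF T n(1)[of j], of "dq j"]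
  proof eventually_elim
    case (elim t)
    show ?case
    proof
      assume t: "T / real (n j) \<le> t \<and> t < T"
      have tp: "0 < T / real (n j)" using T n(1)[of j] by simp
      have "0 \<le> t" "t < T" using t tp by linarith+
      then obtain k where k: "k < n j" "t \<in> cell T (n j) k" using cell_cover[OF T n(1), of t j] by blast
      have "k \<noteq> 0"
      proof
        assume "k = 0"
        then have "t < T / real (n j)" using k(2) by (simp add: cell_def)
        then show False using t by simp
      qed
      then obtain k' where k': "k = Suc k'" using not0_implies_Suc by blast
      have "t + - (T / real (n j)) \<in> cell T (n j) k'"
        using k(2) by (auto simp: cell_def k' add_divide_distrib distrib_right)
      then have "sl (SU j) (t - T / real (n j)) = u j (Suc k')" using elim(2) k(1) k' by (simp add: SU_def)
      then show "sl (SU j) t - sl (SU j) (t - T / real (n j)) = (T / real (n j)) *\<^sub>R sl (SD j) t"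
        using elim(1,3) k T n(1)[of j] by (simp add: SU_def SD_def k' dq_def)
    qed
  qed
  have "weakd (A \<times> {0<..<T}) (0, 1) U D" for A
    unfolding weakd_def
  proof (intro allI impI)
    fix \<Phi> :: "'a \<times> real \<Rightarrow> 'b" assume vt: "vtest (A \<times> {0<..<T}) \<Phi>"
    have lim: "(\<lambda>i. inner (SD (r i)) (mk \<Phi>)) \<longlonglongrightarrow> - inner U (mk (vpd \<Phi> (0, 1)))"
    proof (rule discrete_time_derivative[OF _ _ _ _ vt])
      show "(\<lambda>i. SU (r i)) \<longlonglongrightarrow> U" using LIMSEQ_subseq_LIMSEQ[OF U r] by (simp add: comp_def)
      show "0 < T / real (n (r j))" for j using T n(1)[of "r j"] by simp
      show "(\<lambda>i. T / real (n (r i))) \<longlonglongrightarrow> 0" using small by (simp add: n(3))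
      show "AE t in lborel. T / real (n (r j)) \<le> t \<and> t < T \<longrightarrow> sl (SU (r j)) t - sl (SU (r j)) (t - T / real (n (r j))) = (T / real (n (r j))) *\<^sub>R sl (SD (r j)) t" for j
        by (rule step)
    qed
    \<comment> \<open>The transfer to convex combinations is one-sided, so the equality is obtained
      from \<Phi> and from its negative.\<close>
    have "- inner U (mk (vpd \<Phi> (0, 1))) \<le> inner D (mk \<Phi>)"
      by (rule convex_combinations_inner_ge[OF Y(1) Y(2) order_refl lim])
    moreover have "- (- inner U (mk (vpd \<Phi> (0, 1)))) \<le> inner D (- mk \<Phi>)"
      by (rule convex_combinations_inner_ge[OF Y(1) Y(2), of "\<lambda>i. - inner (SD (r i)) (mk \<Phi>)"])
        (use tendsto_minus[OF lim] in auto)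
    ultimately show "inner U (mk (vpd \<Phi> (0, 1))) = - inner D (mk \<Phi>)" by simp
  qed
  then show ?thesis using main by blast
qed

section \<open>Weak gradients and regularity\<close>

lemma vtest_support_gap:
  fixes \<Phi> :: "'a::euclidean_space \<Rightarrow> 'b::euclidean_space"
  assumes S: "open S" and t: "vtest S \<Phi>"
  shows "\<exists>U h. open U \<and> 0 < h \<and> (\<forall>x. x \<notin> U \<longrightarrow> \<Phi> x = 0) \<and> (\<forall>x\<in>U. \<forall>s. 0 \<le> s \<longrightarrow> s \<le> h \<longrightarrow> x + s *\<^sub>R d \<in> S)"
proof -
  define K where "K = (\<Union>e\<in>Basis. tsupp (\<lambda>z. inner (\<Phi> z) e))"
  have K: "compact K" "K \<subseteq> S" using t unfolding K_def vtest_def test_fun_def by auto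
  have zero: "\<Phi> z = 0" if "z \<notin> K" for z
  proof (rule euclidean_eqI)
    fix e :: 'b assume "e \<in> Basis"
    then have "z \<notin> tsupp (\<lambda>z. inner (\<Phi> z) e)" using that by (auto simp: K_def)
    then show "inner (\<Phi> z) e = inner 0 e" using tsupp_outside[of z "\<lambda>z. inner (\<Phi> z) e"] by simp
  qed
  have "closed (- S)" "K \<inter> - S = {}" using S K(2) by (auto simp: closed_def)
  from separate_compact_closed[OF K(1) this]
  obtain e where e: "e > 0" "\<And>x y. x \<in> K \<Longrightarrow> y \<in> - S \<Longrightarrow> e \<le> dist x y" by blast
  \<comment> \<open>Points of \<open>U\<close> are within e / 2 of the support, and moving along
    \<open>d\<close> with parameter at most \<open>h\<close> costs at most e / 2 more. The summand 1
    in \<open>h\<close> covers \<open>d = 0\<close>.\<close>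
  define U where "U = (\<Union>x\<in>K. ball x (e / 2))"
  define h where "h = e / (2 * (norm d + 1))"
  have h: "0 < h" using e(1) by (simp add: h_def add_nonneg_pos)
  have hd: "h * norm d \<le> e / 2"
  proof -
    have "h * norm d \<le> h * (norm d + 1)" using h by (intro mult_left_mono) auto
    also have "h * (norm d + 1) = e / 2"
    proof -
      have "norm d + 1 \<noteq> 0" using norm_ge_zero[of d] by linarith
      then show ?thesis by (simp add: h_def field_simps)
    qed
    finally show ?thesis .
  qed
  have "x + s *\<^sub>R d \<in> S" if x: "x \<in> U" "0 \<le> s" "s \<le> h" for x s
  proof (rule ccontr)
    assume n: "x + s *\<^sub>R d \<notin> S"
    obtain k where k: "k \<in> K" "dist k x < e / 2" using x(1) by (auto simp: U_def)
    have "dist x (x + s *\<^sub>R d) = s * norm d" using x(2) by (simp add: dist_norm)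
    also have "\<dots> \<le> h * norm d" using x(3) by (intro mult_right_mono) auto
    finally have "dist x (x + s *\<^sub>R d) \<le> e / 2" using hd by linarith
    moreover have "dist k (x + s *\<^sub>R d) \<le> dist k x + dist x (x + s *\<^sub>R d)" by (rule dist_triangle)
    moreover have "e \<le> dist k (x + s *\<^sub>R d)" using e(2)[OF k(1)] n by simp
    ultimately show False using k(2) by linarith
  qed
  moreover have "\<Phi> x = 0" if "x \<notin> U" for x
  proof (rule zero, rule notI)
    assume "x \<in> K"
    then have "x \<in> U" unfolding U_def using e(1) by (intro UN_I[of x]) auto
    then show False using that by simp
  qed
  moreover have "open U" unfolding U_def by auto
  ultimately show ?thesis using h by blast
qed

section \<open>Weak derivatives under contractions\<close>

definition post :: "('b \<Rightarrow> 'b) \<Rightarrow> ('a::euclidean_space, 'b::euclidean_space) l2 \<Rightarrow> ('a, 'b) l2" where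
  "post P u = mk (\<lambda>x. P (fn u x))"

lemma fn_post:
  assumes lip: "\<And>x y. norm (P x - P y) \<le> norm (x - y)" and P0: "P 0 = 0"
  shows "AE x in lborel. fn (post P u) x = P (fn u x)"
  unfolding post_def
proof (rule fn_mk)
  have "1-lipschitz_on UNIV P" using lip by (auto simp: lipschitz_on_def dist_norm)
  then have "continuous_on UNIV P" by (rule lipschitz_on_continuous_on)
  then have "P \<in> borel_measurable borel" by (rule borel_measurable_continuous_onI)
  from measurable_compose[OF fn_borel this] have "(\<lambda>x. P (fn u x)) \<in> borel_measurable borel" .
  then show "sq_int (\<lambda>x. P (fn u x))"
    by (rule sq_int_bound[OF _ sq_int_fn[of u]]) (use lip[of _ 0] P0 in simp)
qed

text \<open>Instead of a chain rule, difference quotients are used: \<open>P\<close> shrinks them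
  pointwise, so the functional that should be the weak derivative of the composition obeys the bound
  valid for \<open>w\<close>. The Riesz theorem then provides the derivative together with its norm
  bound.\<close>

lemma weakd_contraction:
  fixes w :: "('a::euclidean_space, 'b::euclidean_space) l2"
  assumes S: "open S" and w: "weakd S d w W"
    and lip: "\<And>x y. norm (P x - P y) \<le> norm (x - y)" and P0: "P 0 = 0"
  shows "\<exists>V. weakd S d (post P w) V \<and> norm V \<le> norm W"
proof -
  define v where "v = post P w"
  have v: "AE x in lborel. fn v x = P (fn w x)" unfolding v_def by (rule fn_post[OF lip P0])
  have bound: "\<bar>inner v (mk (vpd \<Phi> d))\<bar> \<le> norm W * norm (mk \<Phi>)" if t: "vtest S \<Phi>" for \<Phi>
  proof -
    obtain U h where U: "open U" "0 < h" "\<And>x. x \<notin> U \<Longrightarrow> \<Phi> x = 0"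
      "\<And>x s. x \<in> U \<Longrightarrow> 0 \<le> s \<Longrightarrow> s \<le> h \<Longrightarrow> x + s *\<^sub>R d \<in> S"
      using vtest_support_gap[OF S t, of d] by blast
    have Ub: "U \<in> sets borel" using U(1) by simp
    have cutU: "cut U (mk \<Phi>) = mk \<Phi>"
      by (rule cut_eq_self[OF Ub]) (use fn_mk[OF vtest_sq_int[OF t]] in eventually_elim, use U(3) in simp)
    define F where "F s = inner v (tr (- (s *\<^sub>R d)) (mk \<Phi>))" for s
    have quot: "\<bar>(F k - F 0) / k\<bar> \<le> norm W * norm (mk \<Phi>)" if k: "0 < k" "k \<le> h" for k
    proof -
      have "F k - F 0 = inner (tr (k *\<^sub>R d) v - v) (mk \<Phi>)"
        by (simp add: F_def tr_0 inner_tr_left inner_diff_left)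
      also have "\<dots> = inner (cut U (tr (k *\<^sub>R d) v - v)) (mk \<Phi>)"
        using inner_cut_commute[OF Ub, of "tr (k *\<^sub>R d) v - v" "mk \<Phi>"] cutU by simp
      finally have "\<bar>F k - F 0\<bar> \<le> norm (cut U (tr (k *\<^sub>R d) v - v)) * norm (mk \<Phi>)"
        using Cauchy_Schwarz_ineq2 by simp
      also have "norm (cut U (tr (k *\<^sub>R d) v - v)) \<le> norm (cut U (tr (k *\<^sub>R d) w - w))"
        unfolding cut_def[of U "tr (k *\<^sub>R d) v - v"]
      proof (rule norm_mk_le[OF sq_int_indicator[OF sq_int_fn Ub]])
        show "AE x in lborel. norm (indicator U x *\<^sub>R fn (tr (k *\<^sub>R d) v - v) x) \<le> norm (fn (cut U (tr (k *\<^sub>R d) w - w)) x)"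
          using fn_cut[OF Ub, of "tr (k *\<^sub>R d) w - w"] fn_diff[of "tr (k *\<^sub>R d) v" v] fn_diff[of "tr (k *\<^sub>R d) w" w]
            fn_tr[of "k *\<^sub>R d" v] fn_tr[of "k *\<^sub>R d" w] v AE_shift[OF v, of "k *\<^sub>R d"]
          by eventually_elim (simp add: indicator_def lip)
      qed
      also have "\<dots> \<le> k * norm W"
        by (rule norm_translation_increment_le[OF w k(1) U(1)]) (use U(4) k(2) in auto)
      finally have "\<bar>F k - F 0\<bar> \<le> k * (norm W * norm (mk \<Phi>))" by (simp add: mult_right_mono mult.assoc)
      then show ?thesis using k(1) by (simp add: abs_divide divide_le_eq mult.commute)
    qed
    have "(F has_real_derivative - inner v (mk (vpd \<Phi> d))) (at 0)"
      using inner_tr_test_derivative[OF t, of v d 0] by (simp add: F_def[abs_def] tr_0)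
    then have lim: "((\<lambda>k. (F k - F 0) / k) \<longlongrightarrow> - inner v (mk (vpd \<Phi> d))) (at 0)"
      by (simp add: DERIV_def)
    have seq: "(\<lambda>n. h * (1 / real (Suc n))) \<longlonglongrightarrow> h * 0" by (intro tendsto_intros LIMSEQ_Suc[OF lim_1_over_n])
    have "(\<lambda>n. (F (h * (1 / real (Suc n))) - F 0) / (h * (1 / real (Suc n)))) \<longlonglongrightarrow> - inner v (mk (vpd \<Phi> d))"
      using lim[unfolded tendsto_at_iff_sequentially, rule_format, of "\<lambda>n. h * (1 / real (Suc n))"] seq U(2) by (simp add: comp_def)
    from tendsto_rabs[OF this] have "\<bar>- inner v (mk (vpd \<Phi> d))\<bar> \<le> norm W * norm (mk \<Phi>)"
    proof (rule LIMSEQ_le_const2, intro exI[of _ 0] allI impI)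
      fix n :: nat
      have "h * (1 / real (Suc n)) \<le> h * 1" using U(2) by (intro mult_left_mono) auto
      then show "\<bar>(F (h * (1 / real (Suc n))) - F 0) / (h * (1 / real (Suc n)))\<bar> \<le> norm W * norm (mk \<Phi>)"
        using U(2) by (intro quot) auto
    qed
    then show ?thesis by simp
  qed
  define R where "R = {(mk \<Phi>, - inner v (mk (vpd \<Phi> d))) |\<Phi>. vtest S \<Phi>}"
  have "subspace R"
  proof (rule subspaceI)
    have "vpd (\<lambda>_. 0 :: 'b) d = (\<lambda>_ :: 'a. 0)" by (rule ext) (simp add: vpd_def pd_const)
    then have "(0, 0) = (mk (\<lambda>_. 0 :: 'b), - inner v (mk (vpd (\<lambda>_. 0) d)))"
      by (simp add: zero_l2_def[symmetric])
    then show "0 \<in> R" unfolding R_def zero_prod_def using vtest_0 by blast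
    show "x + y \<in> R" if xy: "x \<in> R" "y \<in> R" for x y
    proof -
      obtain \<Phi> \<Psi> where P: "vtest S \<Phi>" "vtest S \<Psi>" "x = (mk \<Phi>, - inner v (mk (vpd \<Phi> d)))" "y = (mk \<Psi>, - inner v (mk (vpd \<Psi> d)))"
        using xy unfolding R_def by blast
      have "x + y = (mk (\<lambda>x. \<Phi> x + \<Psi> x), - inner v (mk (vpd (\<lambda>x. \<Phi> x + \<Psi> x) d)))"
        using P(3,4) mk_add[OF vtest_sq_int[OF P(1)] vtest_sq_int[OF P(2)]] vpd_add[OF P(1,2)]
          mk_add[OF vtest_sq_int[OF vtest_vpd[OF P(1)]] vtest_sq_int[OF vtest_vpd[OF P(2)]]]
        by (simp add: inner_add_right)
      then show ?thesis unfolding R_def using vtest_add[OF P(1,2)] by blast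
    qed
    show "c *\<^sub>R x \<in> R" if x: "x \<in> R" for c x
    proof -
      obtain \<Phi> where P: "vtest S \<Phi>" "x = (mk \<Phi>, - inner v (mk (vpd \<Phi> d)))" using x unfolding R_def by blast
      have "c *\<^sub>R x = (mk (\<lambda>x. c *\<^sub>R \<Phi> x), - inner v (mk (vpd (\<lambda>x. c *\<^sub>R \<Phi> x) d)))"
        using P(2) mk_scaleR[OF vtest_sq_int[OF P(1)]] vpd_scaleR[OF P(1)] mk_scaleR[OF vtest_sq_int[OF vtest_vpd[OF P(1)]]]
        by simp
      then show ?thesis unfolding R_def using vtest_scaleR[OF P(1)] by blast
    qed
  qed
  moreover have "\<bar>y\<bar> \<le> norm W * norm x" if "(x, y) \<in> R" for x y using that bound by (auto simp: R_def)
  ultimately obtain V where V: "norm V \<le> norm W" "\<forall>(x, y)\<in>R. y = inner V x"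
    using riesz_graph[of R "norm W"] by auto
  have "weakd S d v V" unfolding weakd_def
  proof (intro allI impI)
    fix \<Phi> :: "'a \<Rightarrow> 'b" assume "vtest S \<Phi>"
    then have "(mk \<Phi>, - inner v (mk (vpd \<Phi> d))) \<in> R" unfolding R_def by blast
    from bspec[OF V(2) this] show "inner v (mk (vpd \<Phi> d)) = - inner V (mk \<Phi>)" by simp
  qed
  then show ?thesis using V(1) v_def by blast
qed

section \<open>Gradients of vector-valued functions as single fields\<close>

definition dirL :: "'a::euclidean_space \<Rightarrow> 'a^'m \<Rightarrow> real^'m" where
  "dirL b p = (\<chi> i. inner (p $ i) b)"

text \<open>The transpose of \<open>dirL b\<close>. Over the basis the two split a gradient field
  into its directional derivatives, whose squared norms add up to that of the field.\<close>

definition emb :: "'a::euclidean_space \<Rightarrow> real^'m \<Rightarrow> 'a^'m" where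
  "emb b y = (\<chi> i. (y $ i) *\<^sub>R b)"

lemma bounded_linear_dirL: "bounded_linear (dirL b)"
  by (rule linear_conv_bounded_linear[THEN iffD1], rule linearI) (simp_all add: dirL_def vec_eq_iff inner_add_left)

lemma bounded_linear_emb: "bounded_linear (emb b)"
  by (rule linear_conv_bounded_linear[THEN iffD1], rule linearI) (simp_all add: emb_def vec_eq_iff scaleR_add_left)

lemma dirL_emb: "dirL b (emb b' y) = inner b' b *\<^sub>R y"
  by (simp add: dirL_def emb_def vec_eq_iff mult.commute)

lemma inner_emb: "inner (emb b y) p = inner y (dirL b p)"
  by (simp add: inner_vec_def emb_def dirL_def inner_commute)

lemma sum_emb_dirL: "(\<Sum>b\<in>Basis. emb b (dirL b p)) = p"
  by (simp add: vec_eq_iff emb_def dirL_def euclidean_representation)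

lemma inner_app_emb: "inner (app (emb b) v) p = inner v (app (dirL b) p)"
  unfolding inner_l2_def
proof (rule integral_cong_AE)
  show "AE x in lborel. inner (fn (app (emb b) v) x) (fn p x) = inner (fn v x) (fn (app (dirL b) p) x)"
    using fn_app[OF bounded_linear_emb, of b v] fn_app[OF bounded_linear_dirL, of b p]
    by eventually_elim (simp add: inner_emb)
qed simp_all

lemma fn_sum: "finite I \<Longrightarrow> AE z in lborel. fn (\<Sum>k\<in>I. u k) z = (\<Sum>k\<in>I. fn (u k) z)"
proof (induction I rule: finite_induct)
  case empty show ?case using fn_zero by simp
next
  case (insert i I)
  show ?case using insert.IH fn_add[of "u i" "\<Sum>i\<in>I. u i"] by eventually_elim (simp add: insert.hyps)
qed

lemma app_dirL_emb: "app (dirL b) (app (emb b') v) = inner b' b *\<^sub>R v"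
  by (rule l2_eqI)
    (use fn_app[OF bounded_linear_dirL, of b "app (emb b') v"] fn_app[OF bounded_linear_emb, of b' v] fn_scaleR[of "inner b' b" v]
     in eventually_elim, simp add: dirL_emb)

lemma l2_gradient_decomposition: "(\<Sum>b\<in>Basis. app (emb b) (app (dirL b) p)) = p"
proof (rule l2_eqI)
  have "AE x in lborel. \<forall>b\<in>Basis. fn (app (emb b) (app (dirL b) p)) x = emb b (dirL b (fn p x))"
  proof (intro AE_finite_allI finite_Basis)
    fix b show "AE x in lborel. fn (app (emb b) (app (dirL b) p)) x = emb b (dirL b (fn p x))"
      using fn_app[OF bounded_linear_emb, of b "app (dirL b) p"] fn_app[OF bounded_linear_dirL, of b p]
      by eventually_elim simp
  qed
  with fn_sum[OF finite_Basis, of "\<lambda>b. app (emb b) (app (dirL b) p)"]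
  show "AE x in lborel. fn (\<Sum>b\<in>Basis. app (emb b) (app (dirL b) p)) x = fn p x"
    by eventually_elim (simp add: sum_emb_dirL)
qed

lemma app_dirL_sum:
  assumes "b \<in> Basis" shows "app (dirL b) (\<Sum>b'\<in>Basis. app (emb b') (V b')) = V b"
proof -
  have "app (dirL b) (\<Sum>b'\<in>Basis. app (emb b') (V b')) = (\<Sum>b'\<in>Basis. inner b' b *\<^sub>R V b')"
    using linear_sum[OF bounded_linear.linear[OF bounded_linear_app[OF bounded_linear_dirL]], of b "\<lambda>b'. app (emb b') (V b')" Basis]
    by (simp add: app_dirL_emb)
  also have "\<dots> = (\<Sum>b'\<in>Basis. if b' = b then V b else 0)"
    by (intro sum.cong refl) (auto simp: inner_Basis assms)
  finally show ?thesis using assms by simp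
qed

lemma norm_sum_emb_sq: "(norm (\<Sum>b\<in>Basis. app (emb b) (V b)))\<^sup>2 = (\<Sum>b\<in>Basis. (norm (V b))\<^sup>2)"
proof -
  have "(norm (\<Sum>b\<in>Basis. app (emb b) (V b)))\<^sup>2 = (\<Sum>b\<in>Basis. inner (V b) (app (dirL b) (\<Sum>b\<in>Basis. app (emb b) (V b))))"
    by (simp add: power2_norm_eq_inner inner_sum_left inner_app_emb)
  also have "\<dots> = (\<Sum>b\<in>Basis. inner (V b) (V b))" by (intro sum.cong refl) (simp add: app_dirL_sum)
  finally show ?thesis by (simp add: power2_norm_eq_inner)
qed

text \<open>Extension by zero imposes no boundary condition, since derivatives are tested on
  \<open>S\<close> alone. It merely fixes both entries off \<open>S\<close>, which for open
  \<open>S\<close> makes the gradient unique as a class.\<close>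

definition weak_gradients :: "'a::euclidean_space set \<Rightarrow> (('a, real^'m) l2 \<times> ('a, 'a^'m) l2) set" where
  "weak_gradients S = {(v, p). (AE x in lborel. x \<notin> S \<longrightarrow> fn v x = 0) \<and> (AE x in lborel. x \<notin> S \<longrightarrow> fn p x = 0) \<and>
      (\<forall>b\<in>Basis. weakd S b v (app (dirL b) p))}"

lemma closed_weak_gradients: "closed (weak_gradients S :: (('a::euclidean_space, real^'m) l2 \<times> ('a, 'a^'m) l2) set)"
proof -
  let ?A = "fst -` {v :: ('a, real^'m) l2. AE x in lborel. fn v x \<in> (if x \<in> S then UNIV else {0})}
      :: (('a, real^'m) l2 \<times> ('a, 'a^'m) l2) set"
  let ?B = "snd -` {p :: ('a, 'a^'m) l2. AE x in lborel. fn p x \<in> (if x \<in> S then UNIV else {0})}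
      :: (('a, real^'m) l2 \<times> ('a, 'a^'m) l2) set"
  let ?C = "\<Inter>b\<in>Basis. \<Inter>\<Phi>\<in>{\<Phi>. vtest S \<Phi>}. {z :: ('a, real^'m) l2 \<times> ('a, 'a^'m) l2.
      inner (fst z) (mk (vpd \<Phi> b)) = - inner (app (dirL b) (snd z)) (mk \<Phi>)}"
  have "closed ?A" by (rule closed_vimage[OF closed_AE_l2]) (auto intro: continuous_intros)
  moreover have "closed ?B" by (rule closed_vimage[OF closed_AE_l2]) (auto intro: continuous_intros)
  moreover have "closed ?C"
    by (intro closed_INT ballI closed_Collect_eq continuous_intros
        bounded_linear.continuous_on[OF bounded_linear_app[OF bounded_linear_dirL]])
  moreover have "weak_gradients S = ?A \<inter> ?B \<inter> ?C"
  proof -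
    have e: "(y \<in> (if x \<in> S then UNIV else {0})) = (x \<notin> S \<longrightarrow> y = 0)" for x and y :: "'d::zero" by auto
    show ?thesis unfolding weak_gradients_def weakd_def e by auto
  qed
  ultimately show ?thesis by (simp only: closed_Int)
qed

lemma subspace_weak_gradients: "subspace (weak_gradients S :: (('a::euclidean_space, real^'m) l2 \<times> ('a, 'a^'m) l2) set)"
proof (rule subspaceI)
  have lin: "linear (app (dirL b) :: ('a, 'a^'m) l2 \<Rightarrow> ('a, real^'m) l2)" for b
    by (rule bounded_linear.linear[OF bounded_linear_app[OF bounded_linear_dirL]])
  have "AE x in lborel. x \<notin> S \<longrightarrow> fn (0 :: ('a, real^'m) l2) x = 0"
    by (rule eventually_mono[OF fn_zero[where 'a='a and 'b="real^'m"]]) simp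
  moreover have "AE x in lborel. x \<notin> S \<longrightarrow> fn (0 :: ('a, 'a^'m) l2) x = 0"
    by (rule eventually_mono[OF fn_zero[where 'a='a and 'b="'a^'m"]]) simp
  ultimately show "0 \<in> (weak_gradients S :: (('a, real^'m) l2 \<times> ('a, 'a^'m) l2) set)"
    using linear_0[OF lin] by (simp add: weak_gradients_def zero_prod_def weakd_def)
  fix x y :: "('a, real^'m) l2 \<times> ('a, 'a^'m) l2" and c :: real assume x: "x \<in> weak_gradients S"
  obtain v p where vp: "x = (v, p)" by (cases x)
  have xs: "AE x in lborel. x \<notin> S \<longrightarrow> fn v x = 0" "AE x in lborel. x \<notin> S \<longrightarrow> fn p x = 0"
    using x by (auto simp: weak_gradients_def vp)
  have "AE x in lborel. x \<notin> S \<longrightarrow> fn (c *\<^sub>R v) x = 0" using xs(1) fn_scaleR[of c v] by eventually_elim simp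
  moreover have "AE x in lborel. x \<notin> S \<longrightarrow> fn (c *\<^sub>R p) x = 0" using xs(2) fn_scaleR[of c p] by eventually_elim simp
  ultimately show "c *\<^sub>R x \<in> weak_gradients S"
    using x linear_cmul[OF lin] by (auto simp: weak_gradients_def vp weakd_def)
  assume y: "y \<in> weak_gradients S"
  obtain w q where wq: "y = (w, q)" by (cases y)
  have ys: "AE x in lborel. x \<notin> S \<longrightarrow> fn w x = 0" "AE x in lborel. x \<notin> S \<longrightarrow> fn q x = 0"
    using y by (auto simp: weak_gradients_def wq)
  have "AE x in lborel. x \<notin> S \<longrightarrow> fn (v + w) x = 0" using xs(1) ys(1) fn_add[of v w] by eventually_elim simp
  moreover have "AE x in lborel. x \<notin> S \<longrightarrow> fn (p + q) x = 0" using xs(2) ys(2) fn_add[of p q] by eventually_elim simp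
  ultimately show "x + y \<in> weak_gradients S"
    using x y linear_add[OF lin] by (auto simp: weak_gradients_def vp wq weakd_def inner_add_left)
qed

lemma weakd_cut:
  assumes S: "open S" and w: "weakd S d v V" shows "weakd S d v (cut S V)"
  unfolding weakd_def
proof (intro allI impI)
  fix \<Phi> :: "'a \<Rightarrow> 'b" assume t: "vtest S \<Phi>"
  have Sb: "S \<in> sets borel" using S by simp
  have "cut S (mk \<Phi>) = mk \<Phi>"
    by (rule cut_eq_self[OF Sb]) (use fn_mk[OF vtest_sq_int[OF t]] in eventually_elim, use vtest_outside[OF t] in simp)
  then show "inner v (mk (vpd \<Phi> d)) = - inner (cut S V) (mk \<Phi>)"
    using w t inner_cut_commute[OF Sb, of V "mk \<Phi>"] by (simp add: weakd_def)
qed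

text \<open>The contraction bound is available in each basis direction, and summing the squares
  bounds the whole gradient. Cutting the derivatives to \<open>S\<close> restores the normalisation
  off \<open>S\<close>.\<close>

lemma weak_gradient_contraction:
  assumes S: "open S" and w: "(w, q) \<in> weak_gradients S"
    and lip: "\<And>x y. norm (P x - P y) \<le> norm (x - y)" and P0: "P 0 = 0"
  shows "\<exists>q'. (post P w, q') \<in> weak_gradients S \<and> norm q' \<le> norm q"
proof -
  have Sb: "S \<in> sets borel" using S by simp
  have "\<exists>V. weakd S b (post P w) V \<and> norm V \<le> norm (app (dirL b) q)" if "b \<in> Basis" for b
    using weakd_contraction[OF S _ lip P0, of b w "app (dirL b) q"] w that by (auto simp: weak_gradients_def)
  then obtain V where V: "\<And>b. b \<in> Basis \<Longrightarrow> weakd S b (post P w) (V b)" "\<And>b. b \<in> Basis \<Longrightarrow> norm (V b) \<le> norm (app (dirL b) q)"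
    by metis
  define q' where "q' = (\<Sum>b\<in>Basis. app (emb b) (cut S (V b)))"
  have "AE x in lborel. x \<notin> S \<longrightarrow> fn (post P w) x = 0"
  proof -
    have "AE x in lborel. x \<notin> S \<longrightarrow> fn w x = 0" using w by (simp add: weak_gradients_def)
    with fn_post[OF lip P0, of w] show ?thesis by eventually_elim (simp add: P0)
  qed
  moreover have "AE x in lborel. x \<notin> S \<longrightarrow> fn q' x = 0"
  proof -
    have "AE x in lborel. \<forall>b\<in>Basis. x \<notin> S \<longrightarrow> fn (app (emb b) (cut S (V b))) x = 0"
    proof (intro AE_finite_allI finite_Basis)
      fix b show "AE x in lborel. x \<notin> S \<longrightarrow> fn (app (emb b) (cut S (V b))) x = 0"
        using fn_app[OF bounded_linear_emb, of b "cut S (V b)"] cut_support[OF Sb, of "V b"]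
        by eventually_elim (simp add: emb_def vec_eq_iff)
    qed
    with fn_sum[OF finite_Basis, of "\<lambda>b. app (emb b) (cut S (V b))"]
    show ?thesis unfolding q'_def by eventually_elim simp
  qed
  moreover have "weakd S b (post P w) (app (dirL b) q')" if "b \<in> Basis" for b
    unfolding q'_def app_dirL_sum[OF that] by (rule weakd_cut[OF S V(1)[OF that]])
  ultimately have "(post P w, q') \<in> weak_gradients S" by (simp add: weak_gradients_def)
  moreover have "(norm q')\<^sup>2 \<le> (norm q)\<^sup>2"
  proof -
    have "(norm q')\<^sup>2 = (\<Sum>b\<in>Basis. (norm (cut S (V b)))\<^sup>2)" unfolding q'_def by (rule norm_sum_emb_sq)
    also have "\<dots> \<le> (\<Sum>b\<in>Basis. (norm (app (dirL b) q))\<^sup>2)"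
      using order_trans[OF norm_cut_le[OF Sb] V(2)] by (intro sum_mono power_mono) auto
    also have "\<dots> = (norm q)\<^sup>2"
      using norm_sum_emb_sq[of "\<lambda>b. app (dirL b) q"] by (simp add: l2_gradient_decomposition)
    finally show ?thesis .
  qed
  then have "norm q' \<le> norm q" by (rule power2_le_imp_le) simp
  ultimately show ?thesis by blast
qed

section \<open>The Neumann resolvent and the bound on the Laplacian\<close>

definition constrained :: "'a::euclidean_space set \<Rightarrow> 'b set \<Rightarrow> ('a, 'b::euclidean_space) l2 set" where
  "constrained S C = {v. AE x in lborel. x \<in> S \<longrightarrow> fn v x \<in> C}"

text \<open>The unconstrained resolvent of the Neumann Laplacian maps the constrained set to itself, since
  composing with the projection onto \<open>C\<close> does not increase the energy. Testing the variational
  inequality with the resolvent of \<open>u\<close> therefore bounds the distributional Laplacian of \<open>u\<close> by \<open>g\<close>.\<close>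
lemma gradient_functional_bound:
  fixes u :: "('a::euclidean_space, real^'m) l2"
  assumes S: "open S" and C: "closed C" "convex C" "0 \<in> C"
    and up: "(u, p) \<in> weak_gradients S" "u \<in> constrained S C"
    and vi: "\<And>w q. (w, q) \<in> weak_gradients S \<Longrightarrow> w \<in> constrained S C \<Longrightarrow> inner g (w - u) \<le> inner p (q - p)"
    and test: "(\<phi>, \<psi>) \<in> weak_gradients S"
  shows "\<bar>inner p \<psi>\<bar> \<le> norm g * norm \<phi>"
proof -
  let ?G = "weak_gradients S :: (('a, real^'m) l2 \<times> ('a, 'a^'m) l2) set"
  have Cne: "C \<noteq> {}" using C(3) by blast
  define P where "P = closest_point C"
  have lip: "norm (P x - P y) \<le> norm (x - y)" for x y
    using closest_point_lipschitz[OF C(2,1) Cne, of x y] by (simp add: P_def dist_norm)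
  have P0: "P 0 = 0" using closest_point_self[OF C(3)] by (simp add: P_def)
  have PC: "P x \<in> C" for x unfolding P_def by (rule closest_point_in_set[OF C(1) Cne])
  have Pid: "P x = x" if "x \<in> C" for x unfolding P_def using that by (rule closest_point_self)
  have main: "\<bar>inner p \<psi>\<bar> \<le> norm g * norm \<phi> + sqrt l * norm g * norm \<psi>" if l: "l > 0" for l
  proof -
    have Gne: "?G \<noteq> {}" using up(1) by blast
    obtain w q where wq: "(w, q) \<in> ?G" "\<And>a b. (a, b) \<in> ?G \<Longrightarrow> inner (u - w) (a - w) \<le> l * inner q (b - q)"
      using variational_resolvent[OF closed_weak_gradients subspace_imp_convex[OF subspace_weak_gradients] Gne l, of u] by blast
    \<comment> \<open>On a subspace the inequality can be tested in both directions and becomes the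
      weak form of w - l Laplace w = u.\<close>
    have eq: "inner (u - w) a = l * inner q b" if ab: "(a, b) \<in> ?G" for a b
    proof -
      have "(w + a, q + b) \<in> ?G" using subspace_add[OF subspace_weak_gradients wq(1) ab] by simp
      moreover have "(w - a, q - b) \<in> ?G" using subspace_diff[OF subspace_weak_gradients wq(1) ab] by simp
      ultimately show ?thesis using wq(2)[of "w + a" "q + b"] wq(2)[of "w - a" "q - b"] by simp
    qed
    \<comment> \<open>Projecting w raises neither its distance from u, which P leaves fixed, nor the
      norm of its gradient; strict convexity leaves no second minimiser.\<close>
    have "w = post P w"
    proof -
      obtain q' where q': "(post P w, q') \<in> ?G" "norm q' \<le> norm q"
        using weak_gradient_contraction[OF S wq(1) lip P0] by blast
      have "norm (post P w - u) \<le> norm (w - u)"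
      proof -
        have "norm (mk (fn (post P w - u))) \<le> norm (w - u)"
        proof (rule norm_mk_le[OF sq_int_fn])
          have "AE x in lborel. x \<notin> S \<longrightarrow> fn u x = 0" "AE x in lborel. x \<in> S \<longrightarrow> fn u x \<in> C"
            using up by (auto simp: weak_gradients_def constrained_def)
          \<comment> \<open>On \<open>S\<close> because the values of u lie in \<open>C\<close>; off
            \<open>S\<close> because u is 0 there and P fixes 0.\<close>
          then have "AE x in lborel. fn u x = P (fn u x)"
            by eventually_elim (use Pid P0 in metis)
          then show "AE x in lborel. norm (fn (post P w - u) x) \<le> norm (fn (w - u) x)"
            using fn_diff[of "post P w" u] fn_diff[of w u] fn_post[OF lip P0, of w]
          proof eventually_elim
            case (elim x)
            then show ?case using lip[of "fn w x" "fn u x"] by simp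
          qed
        qed
        then show ?thesis by simp
      qed
      then have 1: "(norm (post P w - u))\<^sup>2 \<le> (norm (w - u))\<^sup>2" by (simp add: power_mono)
      have 2: "l * (norm q')\<^sup>2 \<le> l * (norm q)\<^sup>2" using l q'(2) by (intro mult_left_mono power_mono) auto
      have "(post P w - w, q' - q) \<in> ?G" using subspace_diff[OF subspace_weak_gradients q'(1) wq(1)] by simp
      from eq[OF this] have 3: "inner (u - w) (post P w - w) = l * inner q (q' - q)" .
      have "(norm (post P w - u))\<^sup>2 = (norm (w - u))\<^sup>2 + (norm (post P w - w))\<^sup>2 - 2 * inner (u - w) (post P w - w)"
        by (simp add: power2_norm_eq_inner inner_simps inner_commute)
      moreover have "l * (norm q')\<^sup>2 = l * (norm q)\<^sup>2 + l * (norm (q' - q))\<^sup>2 + 2 * (l * inner q (q' - q))"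
        by (simp add: power2_norm_eq_inner inner_simps inner_commute algebra_simps)
      moreover have "0 \<le> l * (norm (q' - q))\<^sup>2" using l by simp
      ultimately have "(norm (post P w - w))\<^sup>2 \<le> 0" using 1 2 3 by linarith
      then show ?thesis by simp
    qed
    have "w \<in> constrained S C" unfolding constrained_def
    proof (rule CollectI)
      have "AE x in lborel. fn (post P w) x = P (fn w x)" by (rule fn_post[OF lip P0])
      then have "AE x in lborel. fn w x = P (fn w x)" using \<open>w = post P w\<close> by simp
      then show "AE x in lborel. x \<in> S \<longrightarrow> fn w x \<in> C" by eventually_elim (metis PC)
    qed
    from vi[OF wq(1) this] have v: "inner p (p - q) \<le> inner g (u - w)" by (simp add: inner_simps)
    have uw: "(norm (u - w))\<^sup>2 = l * inner q (p - q)"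
      using eq[of "u - w" "p - q"] subspace_diff[OF subspace_weak_gradients up(1) wq(1)] by (simp add: power2_norm_eq_inner)
    have pq: "(norm (p - q))\<^sup>2 = inner p (p - q) - inner q (p - q)" by (simp add: power2_norm_eq_inner inner_diff_left)
    \<comment> \<open>The resolvent equation gives <q, p - q> = |u - w|^2 / l, so the tested
      inequality bounds both squares at once. It follows that |u - w| \<le> l |g| and that q
      approaches p at the rate \<open>sqrt l\<close>.\<close>
    have key: "(norm (p - q))\<^sup>2 + (norm (u - w))\<^sup>2 / l \<le> norm g * norm (u - w)"
      using v uw pq l norm_cauchy_schwarz[of g "u - w"] by simp
    have d: "norm (u - w) \<le> l * norm g"
    proof (cases "norm (u - w) = 0")
      case False
      have "(norm (u - w))\<^sup>2 / l \<le> norm g * norm (u - w)" using key zero_le_power2[of "norm (p - q)"] by linarith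
      then have "norm (u - w) * norm (u - w) \<le> (l * norm g) * norm (u - w)" using l by (simp add: power2_eq_square divide_le_eq mult_ac)
      then show ?thesis using False by simp
    qed (use l in simp)
    have "(norm (p - q))\<^sup>2 \<le> norm g * norm (u - w)" using key l by (smt (verit) zero_le_power2 divide_nonneg_pos)
    also have "\<dots> \<le> norm g * (l * norm g)" using d by (intro mult_left_mono) auto
    also have "\<dots> = (sqrt l * norm g)\<^sup>2" using l by (simp add: power_mult_distrib power2_eq_square)
    finally have pqb: "norm (p - q) \<le> sqrt l * norm g" by (rule power2_le_imp_le) (use l in simp)
    \<comment> \<open>Here l cancels: the gradient functional of w is represented by (u - w) / l,
      whose norm does not exceed that of g.\<close>
    have "l * \<bar>inner q \<psi>\<bar> = \<bar>inner (u - w) \<phi>\<bar>" using eq[OF test] l by (simp add: abs_mult)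
    also have "\<dots> \<le> norm (u - w) * norm \<phi>" by (rule Cauchy_Schwarz_ineq2)
    also have "\<dots> \<le> l * norm g * norm \<phi>" using d by (intro mult_right_mono) auto
    finally have "\<bar>inner q \<psi>\<bar> \<le> norm g * norm \<phi>" using l by (simp add: mult.assoc)
    moreover have "\<bar>inner (p - q) \<psi>\<bar> \<le> norm (p - q) * norm \<psi>" by (rule Cauchy_Schwarz_ineq2)
    moreover have "norm (p - q) * norm \<psi> \<le> sqrt l * norm g * norm \<psi>" using pqb by (intro mult_right_mono) auto
    moreover have "inner p \<psi> = inner q \<psi> + inner (p - q) \<psi>" by (simp add: inner_diff_left)
    ultimately show ?thesis by linarith
  qed
  have "(\<lambda>n. norm g * norm \<phi> + sqrt (1 / real (Suc n)) * norm g * norm \<psi>) \<longlonglongrightarrow> norm g * norm \<phi> + sqrt 0 * norm g * norm \<psi>"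
    by (intro tendsto_intros LIMSEQ_Suc[OF lim_1_over_n])
  then have "\<bar>inner p \<psi>\<bar> \<le> norm g * norm \<phi> + sqrt 0 * norm g * norm \<psi>"
    by (rule LIMSEQ_le_const) (use main in auto)
  then show ?thesis by simp
qed

section \<open>Uniqueness and the heat operator\<close>

lemma borel_Times: "A \<in> sets borel \<Longrightarrow> B \<in> sets borel \<Longrightarrow> (A :: 'a::euclidean_space set) \<times> (B :: real set) \<in> sets borel"
  unfolding borel_prod[symmetric] by (rule pair_measureI)

lemma sl_cut:
  assumes A: "A \<in> sets borel" and I: "I \<in> sets borel"
  shows "AE t in lborel. sl (cut (A \<times> I) g) t = indicator I t *\<^sub>R cut A (sl g t)"
proof (rule sl_AE_eqI)
  show "AE t in lborel. AE x in lborel. fn (cut (A \<times> I) g) (x, t) = fn (indicator I t *\<^sub>R cut A (sl g t)) x"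
    using AE_lborel_slices[OF fn_cut[OF borel_Times[OF A I], of g]] fn_sl[of g]
  proof eventually_elim
    fix t assume "AE x in lborel. fn (cut (A \<times> I) g) (x, t) = indicator (A \<times> I) (x, t) *\<^sub>R fn g (x, t)"
      "AE x in lborel. fn (sl g t) x = fn g (x, t)"
    with fn_cut[OF A, of "sl g t"] fn_scaleR[of "indicator I t" "cut A (sl g t)"]
    show "AE x in lborel. fn (cut (A \<times> I) g) (x, t) = fn (indicator I t *\<^sub>R cut A (sl g t)) x"
      by eventually_elim (auto simp: indicator_def)
  qed
qed

lemma weakd_neg: assumes "weakd S d g G" shows "weakd S (- d) g (- G)"
  unfolding weakd_def
proof (intro allI impI)
  fix \<Phi> :: "'a \<Rightarrow> 'b" assume t: "vtest S \<Phi>"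
  have "vpd \<Phi> (- d) = (\<lambda>x. (-1) *\<^sub>R vpd \<Phi> d x)" using vpd_neg[OF t, of d] by auto
  then have "mk (vpd \<Phi> (- d)) = - mk (vpd \<Phi> d)" using mk_scaleR[OF vtest_sq_int[OF vtest_vpd[OF t]], of "-1" d] by simp
  then show "inner g (mk (vpd \<Phi> (- d))) = - inner (- G) (mk \<Phi>)" using assms t by (simp add: weakd_def)
qed

text \<open>Going back in time by h changes \<open>D\<close> by h times a translate of
  \<open>D'\<close>, in the sense of the mean value theorem. Paired with \<open>D\<close> at the
  same translated time this derivative has the good sign, and replacing \<open>D\<close> by its
  translate costs another factor h. The result is an error of order h^2, small enough to be summed
  over about 1 / h windows.\<close>

lemma energy_increment_le:
  fixes D :: "('a::euclidean_space \<times> real, 'b::euclidean_space) l2"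
  assumes S: "open S" and D: "weakd (S \<times> {0<..<T}) (0, 1) D D'"
    and supp: "AE t in lborel. cut S (sl D t) = sl D t"
    and diss: "AE t in lborel. t \<in> {0<..<T} \<longrightarrow> inner (sl D t) (sl D' t) \<le> 0"
    and h: "0 < h" "h \<le> a" "a < b" "b \<le> T"
  shows "(LINT t|lborel. (norm (sl D t))\<^sup>2 * indicator {a<..<b} t) - (LINT t|lborel. (norm (sl D t))\<^sup>2 * indicator {a - h<..<b - h} t)
     \<le> 2 * h\<^sup>2 * (norm D')\<^sup>2"
proof -
  \<comment> \<open>Backward in time: with \<open>h \<le> a\<close> and \<open>b \<le> T\<close> all
    shifted windows stay inside the cylinder.\<close>
  let ?d = "(0 :: 'a, -1 :: real)"
  define U where "U = S \<times> {a<..<b}"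
  have U: "open U" unfolding U_def by (intro open_Times S) simp
  have Sb: "S \<in> sets borel" "{a<..<b} \<in> sets borel" "U \<in> sets borel" using S U by auto
  have sub: "x + s *\<^sub>R ?d \<in> S \<times> {0<..<T}" if "x \<in> U" "0 \<le> s" "s \<le> h" for x s
    using that h by (auto simp: U_def)
  have W: "weakd (S \<times> {0<..<T}) ?d D (- D')" using weakd_neg[OF D] by simp
  have shiftsupp: "AE t in lborel. cut S (sl (tr (s *\<^sub>R ?d) D) t) = sl (tr (s *\<^sub>R ?d) D) t" for s
    using sl_time_shift[of "- s" D] AE_shift[OF supp, of "- s"] by eventually_elim simp
  have tr00: "tr (0, 0) D = D" using tr_0[of D] by (simp add: zero_prod_def)
  define Z where "Z = cut U D"
  have slZ: "AE t in lborel. sl (cut U (tr (s *\<^sub>R ?d) D)) t = indicator {a<..<b} t *\<^sub>R sl D (t - s)" for s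
    using sl_cut[OF Sb(1,2), of "tr (s *\<^sub>R ?d) D"] shiftsupp[of s] sl_time_shift[of "- s" D]
    unfolding U_def by eventually_elim simp
  have neg: "inner (tr (s *\<^sub>R ?d) D') (cut U (tr (s *\<^sub>R ?d) D)) \<le> 0" if s: "0 < s" "s < h" for s
  proof -
    have "AE t in lborel. 0 \<le> - inner (sl (tr (s *\<^sub>R ?d) D') t) (sl (cut U (tr (s *\<^sub>R ?d) D)) t)"
      using slZ[of s] sl_time_shift[of "- s" D'] AE_shift[OF diss, of "- s"]
    proof eventually_elim
      case (elim t)
      then show ?case using s h by (cases "t \<in> {a<..<b}") (auto simp: inner_commute)
    qed
    then have "0 \<le> (LINT t|lborel. - inner (sl (tr (s *\<^sub>R ?d) D') t) (sl (cut U (tr (s *\<^sub>R ?d) D)) t))"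
      by (rule integral_nonneg_AE)
    then show ?thesis by (simp add: inner_slices)
  qed
  \<comment> \<open>The mean value theorem applies to test functions only, so \<open>Z\<close> is
    approximated by them. The intermediate time changes along the approximation, which is why the
    estimate below is uniform in it.\<close>
  have "Z \<in> closure {mk \<Phi> |\<Phi>. vtest U \<Phi>}"
    unfolding Z_def by (rule vtests_dense[OF U cut_support[OF Sb(3)]])
  then obtain X where X: "\<And>n. X n \<in> {mk \<Phi> |\<Phi>. vtest U \<Phi>}" "X \<longlonglongrightarrow> Z"
    unfolding closure_sequential by blast
  have est: "inner (D - tr (h *\<^sub>R ?d) D) (X n) \<le> h * (h * (norm D')\<^sup>2 + norm D' * norm (X n - Z))" for n
  proof -
    obtain \<Phi> where \<Phi>: "X n = mk \<Phi>" "vtest U \<Phi>" using X(1) by blast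
    obtain s where s: "0 < s" "s < h" "inner (tr (h *\<^sub>R ?d) D - D) (mk \<Phi>) = h * inner (tr (s *\<^sub>R ?d) (- D')) (mk \<Phi>)"
      using weakd_mean_value[OF W h(1) sub \<Phi>(2)] by blast
    have trneg: "tr (s *\<^sub>R ?d) (- D') = - tr (s *\<^sub>R ?d) D'" using tr_diff[of "s *\<^sub>R ?d" 0 D'] tr_diff[of "s *\<^sub>R ?d" 0 0] by simp
    have "inner (D - tr (h *\<^sub>R ?d) D) (X n) = h * inner (tr (s *\<^sub>R ?d) D') (X n)"
      using s(3) unfolding \<Phi>(1) trneg inner_diff_left inner_minus_left by linarith
    also have "inner (tr (s *\<^sub>R ?d) D') (X n) = inner (tr (s *\<^sub>R ?d) D') (cut U (tr (s *\<^sub>R ?d) D))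
        - inner (tr (s *\<^sub>R ?d) D') (cut U (tr (s *\<^sub>R ?d) D - D)) + inner (tr (s *\<^sub>R ?d) D') (X n - Z)"
      by (simp add: Z_def linear_diff[OF bounded_linear.linear[OF bounded_linear_cut[OF Sb(3)]]] inner_diff_right)
    also have "\<dots> \<le> 0 + h * (norm D')\<^sup>2 + norm D' * norm (X n - Z)"
    proof (intro add_mono)
      have "\<bar>inner (tr (s *\<^sub>R ?d) D') (cut U (tr (s *\<^sub>R ?d) D - D))\<bar> \<le> norm D' * norm (cut U (tr (s *\<^sub>R ?d) D - D))"
        using Cauchy_Schwarz_ineq2 norm_tr by metis
      also have "\<dots> \<le> norm D' * (s * norm D')"
        using norm_translation_increment_le[OF W s(1) U] sub s(2) by (intro mult_left_mono) auto
      also have "\<dots> \<le> norm D' * (h * norm D')" using s by (intro mult_left_mono mult_right_mono) auto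
      finally show "inner (tr (s *\<^sub>R ?d) D') (cut U (tr (s *\<^sub>R ?d) D)) - inner (tr (s *\<^sub>R ?d) D') (cut U (tr (s *\<^sub>R ?d) D - D))
          \<le> 0 + h * (norm D')\<^sup>2"
        using neg[OF s(1,2)] by (simp add: power2_eq_square mult_ac abs_le_iff)
      show "inner (tr (s *\<^sub>R ?d) D') (X n - Z) \<le> norm D' * norm (X n - Z)"
        using norm_cauchy_schwarz[of "tr (s *\<^sub>R ?d) D'" "X n - Z"] by (simp add: norm_tr)
    qed
    finally show ?thesis using h(1) by (simp add: mult_left_mono)
  qed
  have "(\<lambda>n. inner (D - tr (h *\<^sub>R ?d) D) (X n)) \<longlonglongrightarrow> inner (D - tr (h *\<^sub>R ?d) D) Z" by (intro tendsto_intros X(2))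
  moreover have "(\<lambda>n. h * (h * (norm D')\<^sup>2 + norm D' * norm (X n - Z))) \<longlonglongrightarrow> h * (h * (norm D')\<^sup>2 + norm D' * norm (Z - Z))"
    by (intro tendsto_intros X(2))
  ultimately have key: "inner (D - tr (h *\<^sub>R ?d) D) Z \<le> h\<^sup>2 * (norm D')\<^sup>2"
    using LIMSEQ_le[of _ _ "\<lambda>n. h * (h * (norm D')\<^sup>2 + norm D' * norm (X n - Z))"] est by (fastforce simp: power2_eq_square mult.assoc)
  define Y where "Y = cut U (tr (h *\<^sub>R ?d) D)"
  have "inner (D - tr (h *\<^sub>R ?d) D) Z = inner (Z - Y) Z"
  proof -
    have "inner (D - tr (h *\<^sub>R ?d) D) (cut U Z) = inner (cut U (D - tr (h *\<^sub>R ?d) D)) Z"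
      by (rule inner_cut_commute[OF Sb(3), symmetric])
    then show ?thesis
      by (simp add: Z_def Y_def cut_cut[OF Sb(3)] linear_diff[OF bounded_linear.linear[OF bounded_linear_cut[OF Sb(3)]]])
  qed
  moreover have "(norm Z)\<^sup>2 - (norm Y)\<^sup>2 \<le> 2 * inner (Z - Y) Z"
  proof -
    have "0 \<le> (norm (Z - Y))\<^sup>2" by simp
    then show ?thesis by (simp add: power2_norm_eq_inner inner_simps inner_commute)
  qed
  ultimately have "(norm Z)\<^sup>2 - (norm Y)\<^sup>2 \<le> 2 * h\<^sup>2 * (norm D')\<^sup>2" using key by simp
  have nm: "(\<lambda>t. (norm (sl D t))\<^sup>2) \<in> borel_measurable borel" using norm_slices(1)[of D] by auto
  have nZ: "(norm Z)\<^sup>2 = (LINT t|lborel. (norm (sl D t))\<^sup>2 * indicator {a<..<b} t)"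
    unfolding norm_slices(2)[symmetric]
  proof (rule integral_cong_AE)
    show "(\<lambda>t. (norm (sl Z t))\<^sup>2) \<in> borel_measurable lborel" using norm_slices(1) by blast
    show "(\<lambda>t. (norm (sl D t))\<^sup>2 * indicator {a<..<b} t) \<in> borel_measurable lborel" using nm by simp
    show "AE t in lborel. (norm (sl Z t))\<^sup>2 = (norm (sl D t))\<^sup>2 * indicator {a<..<b} t"
      using slZ[of 0] unfolding Z_def by eventually_elim (simp add: tr00 indicator_def)
  qed
  have nY: "(norm Y)\<^sup>2 = (LINT t|lborel. (norm (sl D (t + - h)))\<^sup>2 * indicator {a - h<..<b - h} (t + - h))"
    unfolding norm_slices(2)[symmetric]
  proof (rule integral_cong_AE)
    show "(\<lambda>t. (norm (sl Y t))\<^sup>2) \<in> borel_measurable lborel" using norm_slices(1) by blast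
    have "(\<lambda>t. (norm (sl D t))\<^sup>2 * indicator {a - h<..<b - h} t) \<in> borel_measurable borel" using nm by simp
    from measurable_compose[OF _ this, of "\<lambda>t. t + - h" lborel]
    show "(\<lambda>t. (norm (sl D (t + - h)))\<^sup>2 * indicator {a - h<..<b - h} (t + - h)) \<in> borel_measurable lborel" by simp
    show "AE t in lborel. (norm (sl Y t))\<^sup>2 = (norm (sl D (t + - h)))\<^sup>2 * indicator {a - h<..<b - h} (t + - h)"
      using slZ[of h] unfolding Y_def by eventually_elim (simp add: indicator_def)
  qed
  have "(LINT t|lborel. (norm (sl D (t + - h)))\<^sup>2 * indicator {a - h<..<b - h} (t + - h)) = (LINT t|lborel. (norm (sl D t))\<^sup>2 * indicator {a - h<..<b - h} t)"
    by (rule lborel_integral_shift[of "\<lambda>t. (norm (sl D t))\<^sup>2 * indicator {a - h<..<b - h} t"]) (use nm in simp)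
  then show ?thesis using \<open>(norm Z)\<^sup>2 - (norm Y)\<^sup>2 \<le> 2 * h\<^sup>2 * (norm D')\<^sup>2\<close> nZ nY by simp
qed

text \<open>Each of n shifts by h = (b - a) / n adds an error of order h^2 to the energy, and the
  total, of order 1 / n, disappears in the limit. What remains is the energy near time 0, which the
  initial condition makes arbitrarily small.\<close>

lemma dissipative_zero:
  fixes D :: "('a::euclidean_space \<times> real, 'b::euclidean_space) l2"
  assumes S: "open S" and D: "weakd (S \<times> {0<..<T}) (0, 1) D D'"
    and supp: "AE t in lborel. cut S (sl D t) = sl D t"
    and diss: "AE t in lborel. t \<in> {0<..<T} \<longrightarrow> inner (sl D t) (sl D' t) \<le> 0"
    and init: "\<And>e. e > 0 \<Longrightarrow> \<exists>\<delta>>0. AE t in lborel. 0 < t \<and> t < \<delta> \<and> t < T \<longrightarrow> (norm (sl D t))\<^sup>2 \<le> e"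
  shows "AE t in lborel. t \<in> {0<..<T} \<longrightarrow> sl D t = 0"
proof -
  define E where "E t = (norm (sl D t))\<^sup>2" for t
  have E: "integrable lborel E" unfolding E_def[abs_def] by (rule norm_slices(1))
  have EI: "integrable lborel (\<lambda>t. E t * indicator A t)" if "A \<in> sets borel" for A
    by (rule Bochner_Integration.integrable_bound[OF E]) (use that E in \<open>auto simp: indicator_def\<close>)
  define g where "g x y = (LINT t|lborel. E t * indicator {x<..<y} t)" for x y
  have split: "g x z = g x y + g y z" if "x \<le> y" "y \<le> z" for x y z
  proof -
    have "g x z = (LINT t|lborel. E t * indicator {x<..<y} t + E t * indicator {y<..<z} t)"
      unfolding g_def
    proof (rule integral_cong_AE)
      have "AE t in lborel. t \<noteq> y" by (rule AE_lborel_singleton)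
      then show "AE t in lborel. E t * indicator {x<..<z} t = E t * indicator {x<..<y} t + E t * indicator {y<..<z} t"
        by eventually_elim (use that in \<open>auto simp: indicator_def\<close>)
    qed (use EI[of "{x<..<z}"] EI[of "{x<..<y}"] EI[of "{y<..<z}"] in auto)
    then show ?thesis unfolding g_def by (subst (asm) Bochner_Integration.integral_add) (auto intro: EI)
  qed
  have gnn: "0 \<le> g x y" for x y unfolding g_def by (intro integral_nonneg_AE) (auto simp: E_def)
  have inc: "g a b - g (a - h) (b - h) \<le> 2 * h\<^sup>2 * (norm D')\<^sup>2" if "0 < h" "h \<le> a" "a < b" "b \<le> T" for a b h
    unfolding g_def E_def by (rule energy_increment_le[OF S D supp diss that])
  have g0: "g 0 b = 0" if b: "0 < b" "b < T" for b
  proof -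
    have "g 0 b \<le> 0 + e" if e: "e > 0" for e
    proof -
      \<comment> \<open>The constant density whose integral over (0, b) is \<open>e\<close>.\<close>
      define e' where "e' = e / b"
      have e': "e' > 0" using e b by (simp add: e'_def)
      obtain \<delta> where \<delta>: "\<delta> > 0" "AE t in lborel. 0 < t \<and> t < \<delta> \<and> t < T \<longrightarrow> E t \<le> e'"
        using init[OF e'] unfolding E_def by blast
      define a where "a = min \<delta> b / 2"
      have a: "0 < a" "a < \<delta>" "a < b" using \<delta>(1) b by (auto simp: a_def min_def)
      have gs: "g x y \<le> (y - x) * e'" if "0 \<le> x" "x \<le> y" "y \<le> a" for x y
      proof -
        have "g x y \<le> (LINT t|lborel. e' * indicator {x<..<y} t)"
          unfolding g_def
        proof (rule integral_mono_AE)
          show "integrable lborel (\<lambda>t. e' * indicator {x<..<y} t)" using that by simp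
          show "AE t in lborel. E t * indicator {x<..<y} t \<le> e' * indicator {x<..<y} t"
            using \<delta>(2) by eventually_elim (use that a b in \<open>auto simp: indicator_def\<close>)
        qed (auto intro: EI)
        also have "\<dots> = (y - x) * e'" using that by simp
        finally show ?thesis .
      qed
      have chain: "g a b \<le> (b - a) * e' + 2 * (norm D')\<^sup>2 * (b - a)\<^sup>2 / real n" if n: "n > 0" "(b - a) / real n \<le> a" for n :: nat
      proof -
        define h where "h = (b - a) / real n"
        have h: "0 < h" "h \<le> a" "real n * h = b - a" using a n by (auto simp: h_def)
        \<comment> \<open>Induction on the number of windows. Shifting (a, a + (j + 1) h) back by h
          yields the preceding interval together with (a - h, a), which lies where the initial
          condition controls the energy.\<close>
        have "g a (a + real j * h) \<le> real j * (h * e' + 2 * h\<^sup>2 * (norm D')\<^sup>2)" if "j \<le> n" for j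
          using that
        proof (induction j)
          case 0 then show ?case by (simp add: g_def)
        next
          case (Suc j)
          have jn: "real (Suc j) * h \<le> b - a" unfolding h(3)[symmetric] using Suc.prems h(1) by (intro mult_right_mono) auto
          have Sj: "a + real (Suc j) * h - h = a + real j * h" by (simp add: algebra_simps)
          have jh: "0 \<le> real j * h" using h(1) by simp
          have "g a (a + real (Suc j) * h) - g (a - h) (a + real j * h) \<le> 2 * h\<^sup>2 * (norm D')\<^sup>2"
            unfolding Sj[symmetric] using h(1,2) jn b by (intro inc) auto
          moreover have "g (a - h) (a + real j * h) = g (a - h) a + g a (a + real j * h)"
            using h(1) jh by (intro split) auto
          moreover have "g (a - h) a \<le> h * e'" using gs[of "a - h" a] h by simp
          moreover have "g a (a + real j * h) \<le> real j * (h * e' + 2 * h\<^sup>2 * (norm D')\<^sup>2)" using Suc by simp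
          ultimately show ?case by (simp add: algebra_simps)
        qed
        from this[of n] have "g a b \<le> real n * (h * e' + 2 * h\<^sup>2 * (norm D')\<^sup>2)" unfolding h(3) by simp
        also have "\<dots> = (real n * h) * e' + 2 * (norm D')\<^sup>2 * ((real n * h) * h)" by (simp add: algebra_simps power2_eq_square)
        also have "\<dots> = (b - a) * e' + 2 * (norm D')\<^sup>2 * (b - a)\<^sup>2 / real n" unfolding h(3) by (simp add: h_def power2_eq_square)
        finally show ?thesis .
      qed
      have "g a b \<le> (b - a) * e'"
      proof (rule LIMSEQ_le_const)
        have "(\<lambda>n. (b - a) * e' + (2 * (norm D')\<^sup>2 * (b - a)\<^sup>2) * (1 / real n)) \<longlonglongrightarrow> (b - a) * e' + (2 * (norm D')\<^sup>2 * (b - a)\<^sup>2) * 0"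
          by (intro tendsto_intros lim_1_over_n)
        then show "(\<lambda>n. (b - a) * e' + 2 * (norm D')\<^sup>2 * (b - a)\<^sup>2 / real n) \<longlonglongrightarrow> (b - a) * e'" by simp
        obtain N :: nat where N: "(b - a) / a < real N" using reals_Archimedean2 by blast
        show "\<exists>N. \<forall>n\<ge>N. g a b \<le> (b - a) * e' + 2 * (norm D')\<^sup>2 * (b - a)\<^sup>2 / real n"
        proof (intro exI[of _ "max 1 N"] allI impI chain)
          fix n assume n: "max 1 N \<le> n"
          then show "n > 0" by simp
          have "(b - a) / a \<le> real n" using N n by linarith
          then show "(b - a) / real n \<le> a" using a n by (simp add: divide_le_eq mult.commute)
        qed
      qed
      moreover have "g 0 a \<le> a * e'" using gs[of 0 a] a by simp
      moreover have "g 0 b = g 0 a + g a b" using a by (intro split) auto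
      ultimately have "g 0 b \<le> b * e'" by (simp add: algebra_simps)
      then show ?thesis using b by (simp add: e'_def)
    qed
    then have "g 0 b \<le> 0" by (rule field_le_epsilon)
    then show ?thesis using gnn[of 0 b] by simp
  qed
  have "AE t in lborel. t \<in> {0<..<b} \<longrightarrow> sl D t = 0" if b: "0 < b" "b < T" for b
  proof -
    have "AE t in lborel. E t * indicator {0<..<b} t = 0"
      using g0[OF b] integral_nonneg_eq_0_iff_AE[OF EI[of "{0<..<b}"]] unfolding g_def by (auto simp: E_def)
    then show ?thesis by eventually_elim (auto simp: E_def indicator_def)
  qed
  \<comment> \<open>For T > 0 these right ends increase to T; the offset 2 keeps the first one
    positive.\<close>
  then have "AE t in lborel. t \<in> {0<..<T - T / real (Suc (Suc n))} \<longrightarrow> sl D t = 0" for n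
  proof (cases "T > 0")
    case True
    have "T / real (Suc (Suc n)) < T / 1" using True by (intro divide_strict_left_mono) auto
    moreover have "0 < T / real (Suc (Suc n))" using True by simp
    ultimately have "0 < T - T / real (Suc (Suc n))" "T - T / real (Suc (Suc n)) < T" by linarith+
    then show ?thesis by (rule \<open>\<And>b. 0 < b \<Longrightarrow> b < T \<Longrightarrow> AE t in lborel. t \<in> {0<..<b} \<longrightarrow> sl D t = 0\<close>)
  next
    case False
    then have "T - T / real (Suc (Suc n)) \<le> 0" 
      by (simp add: field_simps add_nonpos_nonpos mult_nonpos_nonneg)
    then show ?thesis by (intro AE_I2) auto
  qed
  then have "AE t in lborel. \<forall>n. t \<in> {0<..<T - T / real (Suc (Suc n))} \<longrightarrow> sl D t = 0" by (subst AE_all_countable) (rule allI)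
  then show ?thesis
  proof eventually_elim
    fix t assume h: "\<forall>n. t \<in> {0<..<T - T / real (Suc (Suc n))} \<longrightarrow> sl D t = 0"
    show "t \<in> {0<..<T} \<longrightarrow> sl D t = 0"
    proof
      assume t: "t \<in> {0<..<T}"
      obtain n where n: "T / (T - t) < real n" using reals_Archimedean2 by blast
      then have "T / (T - t) < real (Suc (Suc n))" by simp
      then have "T / real (Suc (Suc n)) < T - t" using t by (simp add: divide_less_eq mult.commute)
      then have "t \<in> {0<..<T - T / real (Suc (Suc n))}" using t by simp
      then show "sl D t = 0" using h by blast
    qed
  qed
qed

section \<open>Slices of test functions and of weak derivatives\<close>

lemma test_fun_slice:
  fixes \<phi> :: "'a::euclidean_space \<times> real \<Rightarrow> real"
  assumes t: "test_fun (S \<times> I) \<phi>"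
  shows "test_fun S (\<lambda>x. \<phi> (x, s))" "pd (\<lambda>x. \<phi> (x, s)) b x = pd \<phi> (b, 0) (x, s)"
proof -
  have lin: "linear (\<lambda>x::'a. (x, 0::real))" by (intro linearI) auto
  have eq: "(\<lambda>x. \<phi> (x, s)) = (\<lambda>x. \<phi> ((0, s) + (x, 0)))" by simp
  have sm: "smooth (\<lambda>x. \<phi> (x, s))" unfolding eq using t by (intro smooth_affine[OF lin]) (simp add: test_fun_def)
  have K: "compact (tsupp \<phi>)" "tsupp \<phi> \<subseteq> S \<times> I" using t by (auto simp: test_fun_def)
  have cl: "closed ((\<lambda>x. (x, s)) -` tsupp \<phi>)"
    by (rule closed_vimage) (auto simp: tsupp_def intro!: continuous_intros)
  have sub: "tsupp (\<lambda>x. \<phi> (x, s)) \<subseteq> (\<lambda>x. (x, s)) -` tsupp \<phi>"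
    unfolding tsupp_def[of "\<lambda>x. \<phi> (x, s)"]
  proof (rule closure_minimal[OF _ cl])
    show "{x. \<phi> (x, s) \<noteq> 0} \<subseteq> (\<lambda>x. (x, s)) -` tsupp \<phi>" using tsupp_outside by blast
  qed
  have cK: "compact (fst ` tsupp \<phi>)" by (intro compact_continuous_image K continuous_intros)
  have "tsupp (\<lambda>x. \<phi> (x, s)) \<subseteq> fst ` tsupp \<phi>" using sub by (force simp: image_iff)
  from compact_closed_subset[OF cK _ this] have "compact (tsupp (\<lambda>x. \<phi> (x, s)))" by (simp add: tsupp_def)
  moreover have "tsupp (\<lambda>x. \<phi> (x, s)) \<subseteq> S" using sub K(2) by auto
  ultimately show "test_fun S (\<lambda>x. \<phi> (x, s))" using sm by (simp add: test_fun_def)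
  show "pd (\<lambda>x. \<phi> (x, s)) b x = pd \<phi> (b, 0) (x, s)"
    unfolding eq using pd_affine(1)[OF test_fun_differentiable[OF t] lin, where c="(0, s)" and x=x and d=b] by simp
qed

lemma vtest_slice:
  fixes \<Phi> :: "'a::euclidean_space \<times> real \<Rightarrow> 'b::euclidean_space"
  assumes t: "vtest (S \<times> I) \<Phi>"
  shows "vtest S (\<lambda>x. \<Phi> (x, s))" "vpd (\<lambda>x. \<Phi> (x, s)) b x = vpd \<Phi> (b, 0) (x, s)"
proof -
  have e: "test_fun (S \<times> I) (\<lambda>z. inner (\<Phi> z) e)" if "e \<in> Basis" for e using t that by (simp add: vtest_def)
  show "vtest S (\<lambda>x. \<Phi> (x, s))" unfolding vtest_def using test_fun_slice(1)[OF e] by simp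
  show "vpd (\<lambda>x. \<Phi> (x, s)) b x = vpd \<Phi> (b, 0) (x, s)"
    unfolding vpd_def using test_fun_slice(2)[OF e, of _ s b x] by (intro sum.cong refl) simp
qed

lemma sl_mk_vtest:
  assumes "vtest (S \<times> I) \<Phi>" shows "AE t in lborel. sl (mk \<Phi>) t = mk (\<lambda>x. \<Phi> (x, t))"
  by (rule sl_mk[OF vtest_sq_int[OF assms]]) (rule fn_mk[OF vtest_sq_int[OF vtest_slice(1)[OF assms]]])

text \<open>Slices of a test function on the product are test functions on \<open>S\<close>, so the
  identity can be integrated over time. Outside \<open>I\<close> the test function is zero, and
  nothing is required of the slices there.\<close>

lemma weakd_from_slices:
  fixes U :: "('a::euclidean_space \<times> real, 'b::euclidean_space) l2"
  assumes "AE t in lborel. t \<in> I \<longrightarrow> weakd S b (sl U t) (sl V t)"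
  shows "weakd (S \<times> I) (b, 0) U V"
  unfolding weakd_def
proof (intro allI impI)
  fix \<Phi> :: "'a \<times> real \<Rightarrow> 'b" assume t: "vtest (S \<times> I) \<Phi>"
  have "(LINT t|lborel. inner (sl U t) (sl (mk (vpd \<Phi> (b, 0))) t)) = (LINT t|lborel. - inner (sl V t) (sl (mk \<Phi>) t))"
  proof (rule integral_cong_AE)
    show "AE s in lborel. inner (sl U s) (sl (mk (vpd \<Phi> (b, 0))) s) = - inner (sl V s) (sl (mk \<Phi>) s)"
      using assms sl_mk_vtest[OF t] sl_mk_vtest[OF vtest_vpd[OF t], of "(b, 0)"]
    proof eventually_elim
      case (elim s)
      show ?case
      proof (cases "s \<in> I")
        case True
        then show ?thesis using elim vtest_slice[OF t, of s] by (simp add: weakd_def) (metis (no_types, lifting) ext)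
      next
        case False
        then have "\<Phi> (x, s) = 0" "vpd \<Phi> (b, 0) (x, s) = 0" for x
          using vtest_outside[OF t, of "(x, s)"] vtest_outside[OF vtest_vpd[OF t], of "(x, s)"] by auto
        then show ?thesis using elim by (simp add: zero_l2_def[symmetric])
      qed
    qed
    show "(\<lambda>t. inner (sl U t) (sl (mk (vpd \<Phi> (b, 0))) t)) \<in> borel_measurable lborel"
      by (rule borel_measurable_integrable[OF inner_slices(1)])
    show "(\<lambda>t. - inner (sl V t) (sl (mk \<Phi>) t)) \<in> borel_measurable lborel"
      by (rule borel_measurable_uminus[OF borel_measurable_integrable[OF inner_slices(1)]])
  qed
  then show "inner U (mk (vpd \<Phi> (b, 0))) = - inner V (mk \<Phi>)" by (simp add: inner_slices)
qed

text \<open>Young's inequality with weight \<open>norm H\<close> keeps the bound linear in the norm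
  of \<open>H\<close>, as the Riesz theorem demands, while the majorant is a sum of two functions
  already known to be integrable. The other factor only has to be finite.\<close>

lemma slices_inner_bound:
  fixes G H :: "('a::euclidean_space \<times> real, 'b::euclidean_space) l2"
    and P R :: "('a \<times> real, 'c::euclidean_space) l2"
  assumes "AE t in lborel. \<bar>inner (sl P t) (sl R t)\<bar> \<le> norm (sl G t) * norm (sl H t)"
  shows "\<bar>inner P R\<bar> \<le> ((norm G)\<^sup>2 + 1) / 2 * norm H"
proof (cases "H = 0")
  case True
  have "AE t in lborel. inner (sl P t) (sl R t) = 0"
    using assms sl_zero[where 'a='a and 'b='b] unfolding True by eventually_elim simp
  then have "inner P R = 0" unfolding inner_slices(2)[symmetric] by (rule integral_eq_zero_AE)
  then show ?thesis by simp
next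
  case False
  define c where "c = norm H"
  have c: "c > 0" using False by (simp add: c_def)
  have young: "x * y \<le> c / 2 * x\<^sup>2 + 1 / (2 * c) * y\<^sup>2" for x y :: real
  proof -
    have "0 \<le> (c * x - y)\<^sup>2 / (2 * c)" using c by simp
    then show ?thesis using c by (simp add: power2_eq_square field_simps)
  qed
  have "\<bar>inner P R\<bar> \<le> (LINT t|lborel. \<bar>inner (sl P t) (sl R t)\<bar>)"
    unfolding inner_slices(2)[symmetric] by (rule integral_abs_bound)
  also have "\<dots> \<le> (LINT t|lborel. c / 2 * (norm (sl G t))\<^sup>2 + 1 / (2 * c) * (norm (sl H t))\<^sup>2)"
  proof (rule integral_mono_AE)
    show "integrable lborel (\<lambda>t. \<bar>inner (sl P t) (sl R t)\<bar>)" using inner_slices(1) by (rule integrable_abs)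
    show "integrable lborel (\<lambda>t. c / 2 * (norm (sl G t))\<^sup>2 + 1 / (2 * c) * (norm (sl H t))\<^sup>2)"
      using norm_slices(1) by (intro Bochner_Integration.integrable_add integrable_mult_right) auto
    show "AE t in lborel. \<bar>inner (sl P t) (sl R t)\<bar> \<le> c / 2 * (norm (sl G t))\<^sup>2 + 1 / (2 * c) * (norm (sl H t))\<^sup>2"
      using assms by eventually_elim (rule order_trans[OF _ young])
  qed
  also have "\<dots> = c / 2 * (norm G)\<^sup>2 + 1 / (2 * c) * (norm H)\<^sup>2"
    by (simp only: Bochner_Integration.integral_add[OF integrable_mult_right integrable_mult_right, OF norm_slices(1) norm_slices(1)]
        integral_mult_right_zero norm_slices(2))
  also have "\<dots> = ((norm G)\<^sup>2 + 1) / 2 * norm H" using c by (simp add: c_def power2_eq_square field_simps)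
  finally show ?thesis .
qed

section \<open>Representing functions on a domain\<close>

text \<open>The bridge between functions on \<open>S\<close> with Lebesgue measure and classes on
  the whole space: \<open>h\<close> is unrestricted off \<open>S\<close> and fixed on
  \<open>S\<close> up to a null set, while \<open>a\<close> is unique.\<close>

definition represents :: "'a::euclidean_space set \<Rightarrow> ('a, 'b::euclidean_space) l2 \<Rightarrow> ('a \<Rightarrow> 'b) \<Rightarrow> bool" where
  "represents S a h \<longleftrightarrow> (AE x in lborel. x \<in> S \<longrightarrow> fn a x = h x) \<and> (AE x in lborel. x \<notin> S \<longrightarrow> fn a x = 0)"

lemma AE_lebesgue_on_iff:
  assumes "open S" shows "(AE x in lebesgue_on S. P x) \<longleftrightarrow> (AE x in lborel. x \<in> S \<longrightarrow> P x)"
  using assms by (subst AE_restrict_space_iff) (auto simp: AE_completion_iff)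

lemma lebesgue_on_measurable_if_AE_eq:
  fixes h :: "'a::euclidean_space \<Rightarrow> 'b::euclidean_space"
  assumes S: "open S" and g: "g \<in> borel_measurable borel" and eq: "AE x in lborel. x \<in> S \<longrightarrow> h x = g x"
  shows "h \<in> borel_measurable (lebesgue_on S)"
proof -
  \<comment> \<open>Off \<open>S\<close> nothing is known about \<open>h\<close>. Replacing it there
    by \<open>g\<close> gives equality almost everywhere on the whole space, and completeness of
    Lebesgue measure yields measurability.\<close>
  define h' where "h' x = (if x \<in> S then h x else g x)" for x
  have ae: "AE x in lborel. h' x = g x" using eq by eventually_elim (simp add: h'_def)
  have gm: "g \<in> borel_measurable lebesgue" using g by (simp add: measurable_completion)
  have "h' \<in> borel_measurable lebesgue"
  proof (rule measurableI)
    fix A :: "'b set" assume A: "A \<in> sets borel"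
    have "AE x in lborel. \<not> (h' x \<in> A \<and> h' x \<noteq> g x)" using ae by eventually_elim simp
    from sets_completion_AE[OF this] have 1: "{x. h' x \<in> A \<and> h' x \<noteq> g x} \<in> sets lebesgue" by (simp add: pred_def)
    have "AE x in lborel. \<not> (g x \<in> A \<and> h' x \<noteq> g x)" using ae by eventually_elim simp
    from sets_completion_AE[OF this] have 2: "{x. g x \<in> A \<and> h' x \<noteq> g x} \<in> sets lebesgue" by (simp add: pred_def)
    have 3: "g -` A \<in> sets lebesgue" using measurable_sets[OF gm A] by simp
    have "h' -` A \<inter> space lebesgue = (g -` A - {x. g x \<in> A \<and> h' x \<noteq> g x}) \<union> {x. h' x \<in> A \<and> h' x \<noteq> g x}" by auto
    then show "h' -` A \<inter> space lebesgue \<in> sets lebesgue" using 1 2 3 by auto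
  qed simp
  then have "h' \<in> borel_measurable (lebesgue_on S)" by (rule measurable_restrict_space1)
  moreover have "h' \<in> borel_measurable (lebesgue_on S) \<longleftrightarrow> h \<in> borel_measurable (lebesgue_on S)"
    by (rule measurable_cong) (simp add: h'_def space_restrict_space)
  ultimately show ?thesis by simp
qed

lemma lebesgue_on_integral_if_AE_eq:
  fixes h :: "'a::euclidean_space \<Rightarrow> real"
  assumes S: "open S" and k: "k \<in> borel_measurable borel" and eq: "AE x in lborel. x \<in> S \<longrightarrow> h x = k x"
  shows "(LINT x|lebesgue_on S. h x) = (LINT x|lborel. indicator S x * k x)"
    and "integrable (lebesgue_on S) h \<longleftrightarrow> integrable lborel (\<lambda>x. indicator S x * k x)"
proof -
  have hm: "h \<in> borel_measurable (lebesgue_on S)" by (rule lebesgue_on_measurable_if_AE_eq[OF S k eq])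
  have km: "k \<in> borel_measurable (lebesgue_on S)" by (rule lebesgue_on_measurable_if_AE_eq[OF S k]) simp
  have ae: "AE x in lebesgue_on S. h x = k x" using eq by (simp add: AE_lebesgue_on_iff[OF S])
  have Sl: "S \<inter> space lebesgue \<in> sets lebesgue" using S by simp
  have bm: "(\<lambda>x. indicator S x *\<^sub>R k x) \<in> borel_measurable lborel" using S k by simp
  have "(LINT x|lebesgue_on S. h x) = (LINT x|lebesgue_on S. k x)" by (rule integral_cong_AE[OF hm km ae])
  also have "\<dots> = (LINT x|lborel. indicator S x *\<^sub>R k x)"
    unfolding integral_restrict_space[OF Sl] by (rule integral_completion[OF bm])
  finally show "(LINT x|lebesgue_on S. h x) = (LINT x|lborel. indicator S x * k x)" by simp
  have "integrable (lebesgue_on S) h \<longleftrightarrow> integrable (lebesgue_on S) k" by (rule integrable_cong_AE[OF hm km ae])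
  also have "\<dots> \<longleftrightarrow> integrable lborel (\<lambda>x. indicator S x *\<^sub>R k x)"
    unfolding integrable_restrict_space[OF Sl] by (rule integrable_completion[OF bm])
  finally show "integrable (lebesgue_on S) h \<longleftrightarrow> integrable lborel (\<lambda>x. indicator S x * k x)" by simp
qed

lemma represents_inner:
  assumes S: "open S" and a: "represents S a h" and b: "represents S b k"
  shows "(LINT x|lebesgue_on S. inner (h x) (k x)) = inner a b"
proof -
  have "(LINT x|lebesgue_on S. inner (h x) (k x)) = (LINT x|lborel. indicator S x * inner (fn a x) (fn b x))"
  proof (rule lebesgue_on_integral_if_AE_eq(1)[OF S])
    show "AE x in lborel. x \<in> S \<longrightarrow> inner (h x) (k x) = inner (fn a x) (fn b x)"
      using conjunct1[OF a[unfolded represents_def]] conjunct1[OF b[unfolded represents_def]] by eventually_elim simp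
  qed simp
  also have "\<dots> = (LINT x|lborel. inner (fn a x) (fn b x))"
  proof (rule integral_cong_AE)
    show "AE x in lborel. indicator S x * inner (fn a x) (fn b x) = inner (fn a x) (fn b x)"
      using conjunct2[OF a[unfolded represents_def]] by eventually_elim (auto simp: indicator_def)
  qed (use S in simp_all)
  finally show ?thesis by (simp add: inner_l2_def)
qed

lemma represents_unique: "represents S a h \<Longrightarrow> represents S b h \<Longrightarrow> a = b"
proof (rule l2_eqI)
  assume a: "represents S a h" and b: "represents S b h"
  show "AE x in lborel. fn a x = fn b x"
    using conjunct1[OF a[unfolded represents_def]] conjunct2[OF a[unfolded represents_def]]
      conjunct1[OF b[unfolded represents_def]] conjunct2[OF b[unfolded represents_def]]
    by eventually_elim auto
qed

lemma represents_cut: "open S \<Longrightarrow> represents S (cut S a) (fn a)"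
  unfolding represents_def
proof
  assume "open S"
  then have Sb: "S \<in> sets borel" by simp
  show "AE x in lborel. x \<in> S \<longrightarrow> fn (cut S a) x = fn a x" using fn_cut[OF Sb, of a] by eventually_elim simp
  show "AE x in lborel. x \<notin> S \<longrightarrow> fn (cut S a) x = 0" by (rule cut_support[OF Sb])
qed

lemma represents_cut_self: "open S \<Longrightarrow> represents S a h \<Longrightarrow> cut S a = a"
  by (rule cut_eq_self) (auto simp: represents_def)

lemma represents_fn: "AE x in lborel. x \<notin> S \<longrightarrow> fn a x = 0 \<Longrightarrow> represents S a (fn a)"
  by (simp add: represents_def)

lemma represents_app:
  assumes L: "bounded_linear L" and a: "represents S a h" shows "represents S (app L a) (\<lambda>x. L (h x))"
proof -
  have L0: "L 0 = 0" by (rule linear_0[OF bounded_linear.linear[OF L]])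
  show ?thesis unfolding represents_def
  proof
    show "AE x in lborel. x \<in> S \<longrightarrow> fn (app L a) x = L (h x)"
      using fn_app[OF L, of a] conjunct1[OF a[unfolded represents_def]] by eventually_elim simp
    show "AE x in lborel. x \<notin> S \<longrightarrow> fn (app L a) x = 0"
      using fn_app[OF L, of a] conjunct2[OF a[unfolded represents_def]] by eventually_elim (simp add: L0)
  qed
qed

lemma represents_diff:
  assumes a: "represents S a h" and b: "represents S b k" shows "represents S (a - b) (\<lambda>x. h x - k x)"
  unfolding represents_def
proof
  show "AE x in lborel. x \<in> S \<longrightarrow> fn (a - b) x = h x - k x"
    using fn_diff[of a b] conjunct1[OF a[unfolded represents_def]] conjunct1[OF b[unfolded represents_def]] by eventually_elim simp
  show "AE x in lborel. x \<notin> S \<longrightarrow> fn (a - b) x = 0"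
    using fn_diff[of a b] conjunct2[OF a[unfolded represents_def]] conjunct2[OF b[unfolded represents_def]] by eventually_elim simp
qed

lemma L2_iff_represents:
  fixes h :: "'a::euclidean_space \<Rightarrow> real"
  assumes S: "open S" shows "L2 S h \<longleftrightarrow> (\<exists>a. represents S a h)"
proof
  assume "\<exists>a. represents S a h"
  then obtain a where a: "AE x in lborel. x \<in> S \<longrightarrow> fn a x = h x" by (auto simp: represents_def)
  have a': "AE x in lborel. x \<in> S \<longrightarrow> h x = fn a x" using a by eventually_elim simp
  have "AE x in lborel. x \<in> S \<longrightarrow> (h x)\<^sup>2 = (fn a x)\<^sup>2" using a by eventually_elim simp
  from lebesgue_on_integral_if_AE_eq(2)[OF S _ this]
  have "integrable (lebesgue_on S) (\<lambda>x. (h x)\<^sup>2) \<longleftrightarrow> integrable lborel (\<lambda>x. indicator S x * (fn a x)\<^sup>2)" by simp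
  moreover have "integrable lborel (\<lambda>x. indicator S x * (fn a x)\<^sup>2)"
  proof (rule Bochner_Integration.integrable_bound[OF sq_int_integrable[OF sq_int_fn[of a]]])
    show "(\<lambda>x. indicator S x * (fn a x)\<^sup>2) \<in> borel_measurable lborel" using S by simp
  qed (auto simp: indicator_def)
  ultimately show "L2 S h" unfolding L2_def using lebesgue_on_measurable_if_AE_eq[OF S fn_borel a'] by blast
next
  assume h: "L2 S h"
  have Sl: "S \<inter> space lebesgue \<in> sets lebesgue" using S by simp
  have "(\<lambda>x. indicator S x *\<^sub>R h x) \<in> borel_measurable lebesgue"
    using h borel_measurable_restrict_space_iff[OF Sl, of h] by (simp add: L2_def)
  then obtain g where g: "g \<in> borel_measurable lborel" "AE x in lborel. indicator S x *\<^sub>R h x = g x"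
    using completion_ex_borel_measurable_real by blast
  define k where "k x = indicator S x * g x" for x
  have k: "k \<in> borel_measurable borel" unfolding k_def[abs_def] using g(1) S by simp
  have hk: "AE x in lborel. x \<in> S \<longrightarrow> (h x)\<^sup>2 = (k x)\<^sup>2" using g(2) by eventually_elim (auto simp: k_def)
  have "integrable lborel (\<lambda>x. indicator S x * (k x)\<^sup>2)"
    using h lebesgue_on_integral_if_AE_eq(2)[OF S _ hk] k by (simp add: L2_def)
  moreover have "(\<lambda>x. indicator S x * (k x)\<^sup>2) = (\<lambda>x. (norm (k x))\<^sup>2)" by (auto simp: k_def indicator_def)
  ultimately have sk: "sq_int k" using k by (simp add: sq_int_def)
  have "represents S (mk k) h" unfolding represents_def
  proof
    show "AE x in lborel. x \<in> S \<longrightarrow> fn (mk k) x = h x" using fn_mk[OF sk] g(2) by eventually_elim (auto simp: k_def)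
    show "AE x in lborel. x \<notin> S \<longrightarrow> fn (mk k) x = 0" using fn_mk[OF sk] by eventually_elim (simp add: k_def)
  qed
  then show "\<exists>a. represents S a h" by blast
qed

section \<open>Coordinates of vector-valued functions and chosen weak derivatives\<close>

definition coord :: "'m \<Rightarrow> ('a::euclidean_space, real^'m) l2 \<Rightarrow> ('a, real) l2" where
  "coord i = app (\<lambda>v. v $ i)"

lemma represents_coord: "represents S a h \<Longrightarrow> represents S (coord i a) (\<lambda>x. h x $ i)"
  unfolding coord_def by (rule represents_app[OF bounded_linear_vec_nth])

lemma fn_coord: "AE x in lborel. fn (coord i a) x = fn a x $ i"
  unfolding coord_def by (rule fn_app[OF bounded_linear_vec_nth])

lemma L2_vec_iff_represents:
  fixes h :: "'a::euclidean_space \<Rightarrow> real^'m"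
  assumes S: "open S" shows "(\<forall>i. L2 S (\<lambda>x. h x $ i)) \<longleftrightarrow> (\<exists>a. represents S a h)"
proof
  assume "\<exists>a. represents S a h"
  then show "\<forall>i. L2 S (\<lambda>x. h x $ i)" using represents_coord L2_iff_represents[OF S] by blast
next
  assume "\<forall>i. L2 S (\<lambda>x. h x $ i)"
  then have "\<forall>i. \<exists>a. represents S a (\<lambda>x. h x $ i)" by (simp add: L2_iff_represents[OF S])
  from choice[OF this] obtain b where b: "\<And>i. represents S (b i) (\<lambda>x. h x $ i)" by blast
  have "sq_int (\<lambda>x. \<Sum>i\<in>UNIV. fn (b i) x *\<^sub>R axis i (1::real))"
    by (rule sq_int_sum) (rule sq_int_compose_linear[OF bounded_linear_scaleR_left sq_int_fn])
  moreover have "(\<Sum>i\<in>UNIV. fn (b i) x *\<^sub>R axis i (1::real)) = (\<chi> i. fn (b i) x)" for x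
    by (simp add: vec_eq_iff axis_def if_distrib[of "\<lambda>y. _ * y"] cong: if_cong)
  ultimately have s: "sq_int (\<lambda>x. \<chi> i. fn (b i) x)" by simp
  have "represents S (mk (\<lambda>x. \<chi> i. fn (b i) x)) h" unfolding represents_def
  proof
    have "AE x in lborel. \<forall>i\<in>UNIV. x \<in> S \<longrightarrow> fn (b i) x = h x $ i"
      using b by (intro AE_finite_allI) (auto simp: represents_def)
    with fn_mk[OF s] show "AE x in lborel. x \<in> S \<longrightarrow> fn (mk (\<lambda>x. \<chi> i. fn (b i) x)) x = h x"
      by eventually_elim (simp add: vec_eq_iff)
    have "AE x in lborel. \<forall>i\<in>UNIV. x \<notin> S \<longrightarrow> fn (b i) x = 0"
      using b by (intro AE_finite_allI) (auto simp: represents_def)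
    with fn_mk[OF s] show "AE x in lborel. x \<notin> S \<longrightarrow> fn (mk (\<lambda>x. \<chi> i. fn (b i) x)) x = 0"
      by eventually_elim (simp add: vec_eq_iff)
  qed
  then show "\<exists>a. represents S a h" by blast
qed

lemma inner_sum_coord: "inner a b = (\<Sum>i\<in>UNIV. inner (coord i a) (coord i b))" for a b :: "('a::euclidean_space, real^'m) l2"
proof -
  have i: "integrable lborel (\<lambda>x. fn a x $ i * fn b x $ i)" for i
  proof -
    have "sq_int (\<lambda>x. fn a x $ i)" "sq_int (\<lambda>x. fn b x $ i)"
      by (rule sq_int_compose_linear[OF bounded_linear_vec_nth sq_int_fn])+
    from sq_int_inner[OF this] show ?thesis by simp
  qed
  have "inner a b = (LINT x|lborel. (\<Sum>i\<in>UNIV. fn a x $ i * fn b x $ i))" by (simp add: inner_l2_def inner_vec_def)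
  also have "\<dots> = (\<Sum>i\<in>UNIV. LINT x|lborel. fn a x $ i * fn b x $ i)"
    by (rule Bochner_Integration.integral_sum) (rule i)
  also have "\<dots> = (\<Sum>i\<in>UNIV. inner (coord i a) (coord i b))"
  proof (intro sum.cong refl)
    fix i
    show "(LINT x|lborel. fn a x $ i * fn b x $ i) = inner (coord i a) (coord i b)"
      unfolding inner_l2_def
    proof (rule integral_cong_AE)
      show "AE x in lborel. fn a x $ i * fn b x $ i = inner (fn (coord i a) x) (fn (coord i b) x)"
        using fn_coord[of i a] fn_coord[of i b] by eventually_elim simp
      show "(\<lambda>x. fn a x $ i * fn b x $ i) \<in> borel_measurable lborel" using i by blast
    qed simp
  qed
  finally show ?thesis .
qed

lemma represents_test_fun:
  assumes "test_fun S \<phi>" shows "represents S (mk \<phi>) \<phi>"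
  unfolding represents_def using fn_mk[OF test_fun_sq_int[OF assms]] test_fun_outside[OF assms]
  by (auto elim!: eventually_mono)

lemma weak_pd_iff_weakd:
  fixes g G :: "'a::euclidean_space \<Rightarrow> real"
  assumes S: "open S" and a: "represents S a g" and A: "represents S A G"
  shows "weak_pd S d g G \<longleftrightarrow> weakd S d a A"
proof -
  have 1: "(LINT x|lebesgue_on S. g x * pd \<phi> d x) = (LINT x|lborel. inner (fn a x) 1 * pd \<phi> d x)" if t: "test_fun S \<phi>" for \<phi>
    using represents_inner[OF S a represents_test_fun[OF test_fun_pd[OF t, of d]]] inner_mk_right[OF test_fun_sq_int[OF test_fun_pd[OF t]], of a d] by simp
  have 2: "(LINT x|lebesgue_on S. G x * \<phi> x) = (LINT x|lborel. inner (fn A x) 1 * \<phi> x)" if t: "test_fun S \<phi>" for \<phi>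
    using represents_inner[OF S A represents_test_fun[OF t]] inner_mk_right[OF test_fun_sq_int[OF t], of A] by simp
  show ?thesis unfolding weak_pd_def weakd_components using 1 2 by simp
qed

lemma weakd_iff_coord:
  fixes a A :: "('a::euclidean_space, real^'m) l2"
  shows "weakd S d a A \<longleftrightarrow> (\<forall>i. weakd S d (coord i a) (coord i A))"
proof -
  have B: "(Basis :: (real^'m) set) = range (\<lambda>i. axis i 1)" by (auto simp: Basis_vec_def)
  have eq: "(LINT x|lborel. inner (fn (coord i v) x) 1 * \<phi> x) = (LINT x|lborel. inner (fn v x) (axis i 1) * \<phi> x)"
    if "\<phi> \<in> borel_measurable borel" for i \<phi> and v :: "('a, real^'m) l2"
  proof (rule integral_cong_AE)
    show "AE x in lborel. inner (fn (coord i v) x) 1 * \<phi> x = inner (fn v x) (axis i 1) * \<phi> x"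
      using fn_coord[of i v] by eventually_elim (simp add: inner_axis)
  qed (use that in simp_all)
  show ?thesis unfolding weakd_components B
    using eq[OF test_fun_measurable] eq[OF test_fun_measurable[OF test_fun_pd]] by (simp cong: imp_cong)
qed

lemma weakd_cut_left:
  assumes S: "open S" and w: "weakd S d v V" shows "weakd S d (cut S v) V"
  unfolding weakd_def
proof (intro allI impI)
  fix \<Phi> :: "'a \<Rightarrow> 'b" assume t: "vtest S \<Phi>"
  have Sb: "S \<in> sets borel" using S by simp
  have "cut S (mk (vpd \<Phi> d)) = mk (vpd \<Phi> d)"
    by (rule cut_eq_self[OF Sb]) (use fn_mk[OF vtest_sq_int[OF vtest_vpd[OF t, of d]]] in eventually_elim, use vtest_outside[OF vtest_vpd[OF t, of d]] in simp)
  then show "inner (cut S v) (mk (vpd \<Phi> d)) = - inner V (mk \<Phi>)"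
    using w t inner_cut_commute[OF Sb, of v "mk (vpd \<Phi> d)"] by (simp add: weakd_def)
qed

text \<open>\<open>wpd\<close> is a choice among candidates. The class \<open>A\<close> shows that a
  candidate exists, and any two candidates belong to the same class because weak derivatives are
  unique on open sets.\<close>

lemma represents_wpd:
  fixes g :: "'a::euclidean_space \<Rightarrow> real"
  assumes S: "open S" and a: "represents S a g" and w: "weakd S d a A" and A: "cut S A = A"
  shows "represents S A (wpd S d g)"
proof -
  have rA: "represents S A (fn A)" using represents_cut[OF S, of A] A by simp
  then have "L2 S (fn A) \<and> weak_pd S d g (fn A)"
    using L2_iff_represents[OF S] weak_pd_iff_weakd[OF S a rA] w by blast
  then have "L2 S (wpd S d g) \<and> weak_pd S d g (wpd S d g)" unfolding wpd_def
    by (rule someI[where P="\<lambda>G. L2 S G \<and> weak_pd S d g G"])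
  then obtain B where B: "represents S B (wpd S d g)" "weak_pd S d g (wpd S d g)" using L2_iff_represents[OF S] by blast
  then have "weakd S d a B" using weak_pd_iff_weakd[OF S a B(1)] by simp
  from weakd_unique[OF S this w] have "B = A" using represents_cut_self[OF S B(1)] A by simp
  then show ?thesis using B(1) by simp
qed

lemma H1_weakd:
  fixes g :: "'a::euclidean_space \<Rightarrow> real"
  assumes S: "open S" and a: "represents S a g" and g: "H1 S g" and b: "b \<in> Basis"
  shows "\<exists>A. weakd S b a A \<and> represents S A (wpd S b g)"
proof -
  obtain G where G: "L2 S G" "weak_pd S b g G" using g b by (auto simp: H1_def)
  then obtain A where A: "represents S A G" using L2_iff_represents[OF S] by blast
  have w: "weakd S b a A" using weak_pd_iff_weakd[OF S a A] G(2) by simp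
  from represents_wpd[OF S a w represents_cut_self[OF S A]] w show ?thesis by blast
qed

section \<open>The variational inequality in Hilbert space form\<close>

lemma weak_gradient_supports:
  assumes "(a, p) \<in> weak_gradients S" "open S"
  shows "cut S a = a" "cut S (app (dirL b) p) = app (dirL b) p"
proof -
  have Sb: "S \<in> sets borel" using assms(2) by simp
  show "cut S a = a" by (rule cut_eq_self[OF Sb]) (use assms(1) in \<open>simp add: weak_gradients_def\<close>)
  show "cut S (app (dirL b) p) = app (dirL b) p"
  proof (rule cut_eq_self[OF Sb])
    have "AE x in lborel. x \<notin> S \<longrightarrow> fn p x = 0" using assms(1) by (simp add: weak_gradients_def)
    with fn_app[OF bounded_linear_dirL, of b p]
    show "AE x in lborel. x \<notin> S \<longrightarrow> fn (app (dirL b) p) x = 0" by eventually_elim (simp add: dirL_def vec_eq_iff)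
  qed
qed

lemma cut_coord: "open S \<Longrightarrow> cut S a = a \<Longrightarrow> cut S (coord i a) = coord i a"
proof (rule cut_eq_self)
  assume S: "open S" "cut S a = a"
  then have Sb: "S \<in> sets borel" by simp
  show "AE x in lborel. x \<notin> S \<longrightarrow> fn (coord i a) x = 0"
    using fn_coord[of i a] cut_support[OF Sb, of a] unfolding S(2) by eventually_elim simp
qed simp

lemma weak_gradient_wpd:
  fixes p :: "('a::euclidean_space, 'a^'m) l2"
  assumes S: "open S" and ap: "(a, p) \<in> weak_gradients S" and a: "represents S a v" and b: "b \<in> Basis"
  shows "represents S (coord i (app (dirL b) p)) (wpd S b (\<lambda>x. v x $ i))"
proof (rule represents_wpd[OF S represents_coord[OF a]])
  have "weakd S b a (app (dirL b) p)" using ap b by (simp add: weak_gradients_def)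
  then show "weakd S b (coord i a) (coord i (app (dirL b) p))" by (simp add: weakd_iff_coord)
  show "cut S (coord i (app (dirL b) p)) = coord i (app (dirL b) p)"
    by (rule cut_coord[OF S weak_gradient_supports(2)[OF ap S]])
qed

lemma weak_gradient_H1:
  fixes p :: "('a::euclidean_space, 'a^'m) l2"
  assumes S: "open S" and ap: "(a, p) \<in> weak_gradients S" and a: "represents S a v"
  shows "H1 S (\<lambda>x. v x $ i)" and "H1norm2 S (\<lambda>x. v x $ i) \<le> (norm a)\<^sup>2 + (norm p)\<^sup>2"
proof -
  have ra: "represents S (coord i a) (\<lambda>x. v x $ i)" by (rule represents_coord[OF a])
  have rb: "represents S (coord i (app (dirL b) p)) (wpd S b (\<lambda>x. v x $ i))" if "b \<in> Basis" for b
    by (rule weak_gradient_wpd[OF S ap a that])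
  have "\<exists>G. L2 S G \<and> weak_pd S b (\<lambda>x. v x $ i) G" if b: "b \<in> Basis" for b
  proof -
    have "weakd S b a (app (dirL b) p)" using ap b by (simp add: weak_gradients_def)
    then have "weakd S b (coord i a) (coord i (app (dirL b) p))" by (simp add: weakd_iff_coord)
    then show ?thesis using weak_pd_iff_weakd[OF S ra rb[OF b]] rb[OF b] L2_iff_represents[OF S] by blast
  qed
  then show "H1 S (\<lambda>x. v x $ i)" unfolding H1_def using ra L2_iff_represents[OF S] by blast
  have le: "(norm (coord i c))\<^sup>2 \<le> (norm c)\<^sup>2" for c :: "('a, real^'m) l2"
  proof -
    have "(norm (coord i c))\<^sup>2 \<le> (\<Sum>i\<in>UNIV. (norm (coord i c))\<^sup>2)" by (intro member_le_sum) auto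
    then show ?thesis using inner_sum_coord[of c c] by (simp add: power2_norm_eq_inner)
  qed
  have "H1norm2 S (\<lambda>x. v x $ i) = (norm (coord i a))\<^sup>2 + (\<Sum>b\<in>Basis. (norm (coord i (app (dirL b) p)))\<^sup>2)"
  proof -
    have "(LINT x|lebesgue_on S. (v x $ i)\<^sup>2) = (norm (coord i a))\<^sup>2"
      using represents_inner[OF S ra ra] unfolding power2_norm_eq_inner by (simp only: power2_eq_square inner_real_def)
    moreover have "(LINT x|lebesgue_on S. (wpd S b (\<lambda>x. v x $ i) x)\<^sup>2) = (norm (coord i (app (dirL b) p)))\<^sup>2" if "b \<in> Basis" for b
      using represents_inner[OF S rb[OF that] rb[OF that]] unfolding power2_norm_eq_inner by (simp only: power2_eq_square inner_real_def)
    ultimately show ?thesis unfolding H1norm2_def by simp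
  qed
  also have "\<dots> \<le> (norm a)\<^sup>2 + (\<Sum>b\<in>Basis. (norm (app (dirL b) p))\<^sup>2)"
    by (intro add_mono sum_mono le)
  also have "(\<Sum>b\<in>Basis. (norm (app (dirL b) p))\<^sup>2) = (norm p)\<^sup>2"
    using norm_sum_emb_sq[of "\<lambda>b. app (dirL b) p"] by (simp add: l2_gradient_decomposition)
  finally show "H1norm2 S (\<lambda>x. v x $ i) \<le> (norm a)\<^sup>2 + (norm p)\<^sup>2" .
qed

lemma H1_weak_gradient:
  fixes v :: "'a::euclidean_space \<Rightarrow> real^'m"
  assumes S: "open S" and v: "\<And>i. H1 S (\<lambda>x. v x $ i)"
  shows "\<exists>a p. represents S a v \<and> (a, p) \<in> weak_gradients S"
proof -
  obtain a where a: "represents S a v" using v L2_vec_iff_represents[OF S, of v] by (auto simp: H1_def)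
  have "\<exists>V. cut S V = V \<and> weakd S b a V" if b: "b \<in> Basis" for b
  proof -
    have h: "\<exists>A. weakd S b (coord i a) A \<and> represents S A (wpd S b (\<lambda>x. v x $ i))" for i
      by (rule H1_weakd[OF S represents_coord[OF a] v b])
    then obtain A where A: "\<And>i. weakd S b (coord i a) (A i)" "\<And>i. represents S (A i) (wpd S b (\<lambda>x. v x $ i))" by metis
    have "\<forall>i. L2 S (\<lambda>x. (\<chi> i. wpd S b (\<lambda>x. v x $ i) x) $ i)" using A(2) L2_iff_represents[OF S] by auto
    then obtain V where V: "represents S V (\<lambda>x. \<chi> i. wpd S b (\<lambda>x. v x $ i) x)" using L2_vec_iff_represents[OF S] by blast
    have "coord i V = A i" for i using represents_unique[OF represents_coord[OF V, of i]] A(2)[of i] by simp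
    then have "weakd S b a V" using A(1) by (simp add: weakd_iff_coord)
    then show ?thesis using represents_cut_self[OF S V] by blast
  qed
  then obtain V where V: "\<And>b. b \<in> Basis \<Longrightarrow> cut S (V b) = V b" "\<And>b. b \<in> Basis \<Longrightarrow> weakd S b a (V b)" by metis
  define p where "p = (\<Sum>b\<in>Basis. app (emb b) (V b))"
  have Sb: "S \<in> sets borel" using S by simp
  have "AE x in lborel. \<forall>b\<in>Basis. x \<notin> S \<longrightarrow> fn (app (emb b) (V b)) x = 0"
  proof (intro AE_finite_allI finite_Basis)
    fix b :: 'a assume b: "b \<in> Basis"
    show "AE x in lborel. x \<notin> S \<longrightarrow> fn (app (emb b) (V b)) x = 0"
      using fn_app[OF bounded_linear_emb, of b "V b"] cut_support[OF Sb, of "V b"] unfolding V(1)[OF b]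
      by eventually_elim (simp add: emb_def vec_eq_iff)
  qed
  with fn_sum[OF finite_Basis, of "\<lambda>b. app (emb b) (V b)"]
  have "AE x in lborel. x \<notin> S \<longrightarrow> fn p x = 0" unfolding p_def by eventually_elim simp
  moreover have "weakd S b a (app (dirL b) p)" if "b \<in> Basis" for b
    unfolding p_def app_dirL_sum[OF that] by (rule V(2)[OF that])
  moreover have "AE x in lborel. x \<notin> S \<longrightarrow> fn a x = 0" using a by (simp add: represents_def)
  ultimately have "(a, p) \<in> weak_gradients S" by (simp add: weak_gradients_def)
  then show ?thesis using a by blast
qed

lemma dirichlet_eq_inner:
  fixes p q :: "('a::euclidean_space, 'a^'m) l2"
  assumes S: "open S" and a: "(a, p) \<in> weak_gradients S" "represents S a v" and b: "(b, q) \<in> weak_gradients S" "represents S b w"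
  shows "dirichlet S v w = inner p q"
proof -
  have "dirichlet S v w = (\<Sum>i\<in>UNIV. \<Sum>e\<in>Basis. inner (coord i (app (dirL e) p)) (coord i (app (dirL e) q)))"
    unfolding dirichlet_def
    using represents_inner[OF S weak_gradient_wpd[OF S a] weak_gradient_wpd[OF S b]] by (intro sum.cong refl) simp
  also have "\<dots> = (\<Sum>e\<in>Basis. \<Sum>i\<in>UNIV. inner (coord i (app (dirL e) p)) (coord i (app (dirL e) q)))" by (rule sum.swap)
  also have "\<dots> = (\<Sum>e\<in>Basis. inner (app (dirL e) p) (app (dirL e) q))" by (simp only: inner_sum_coord[symmetric])
  also have "\<dots> = inner (\<Sum>e\<in>Basis. app (emb e) (app (dirL e) p)) q" by (simp add: inner_sum_left inner_app_emb)
  finally show ?thesis by (simp add: l2_gradient_decomposition)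
qed

lemma represents_slice:
  assumes "represents (S \<times> I) A h"
  shows "AE t in lborel. t \<in> I \<longrightarrow> represents S (sl A t) (\<lambda>x. h (x, t))"
  using AE_lborel_slices[OF conjunct1[OF assms[unfolded represents_def]]]
    AE_lborel_slices[OF conjunct2[OF assms[unfolded represents_def]]] fn_sl[of A]
proof eventually_elim
  fix t assume h: "AE x in lborel. (x, t) \<in> S \<times> I \<longrightarrow> fn A (x, t) = h (x, t)"
    "AE x in lborel. (x, t) \<notin> S \<times> I \<longrightarrow> fn A (x, t) = 0" "AE x in lborel. fn (sl A t) x = fn A (x, t)"
  show "t \<in> I \<longrightarrow> represents S (sl A t) (\<lambda>x. h (x, t))"
    unfolding represents_def
  proof (intro impI conjI)
    assume t: "t \<in> I"
    show "AE x in lborel. x \<in> S \<longrightarrow> fn (sl A t) x = h (x, t)" using h(1,3) by eventually_elim (use t in simp)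
    show "AE x in lborel. x \<notin> S \<longrightarrow> fn (sl A t) x = 0" using h(2,3) by eventually_elim simp
  qed
qed

section \<open>The constraint set as a set of pairs of function and gradient\<close>

definition unit_simplex :: "(real^'m) set" where
  "unit_simplex = {x. (\<Sum>i\<in>UNIV. x $ i) \<le> 1 \<and> (\<forall>i. 0 \<le> x $ i)}"

definition admissible :: "'a::euclidean_space set \<Rightarrow> (('a, real^'m) l2 \<times> ('a, 'a^'m) l2) set" where
  "admissible S = {z \<in> weak_gradients S. fst z \<in> constrained S unit_simplex}"

lemma closed_unit_simplex: "closed (unit_simplex :: (real^'m) set)"
proof -
  have eq: "(unit_simplex :: (real^'m) set) = {x. (\<Sum>i\<in>UNIV. x $ i) \<le> 1} \<inter> (\<Inter>i. {x. 0 \<le> x $ i})" by (auto simp: unit_simplex_def)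
  show ?thesis unfolding eq by (intro closed_Int closed_INT ballI closed_Collect_le continuous_intros)
qed

lemma convex_unit_simplex: "convex (unit_simplex :: (real^'m) set)"
proof (rule convexI)
  fix x y :: "real^'m" and u v :: real
  assume h: "x \<in> unit_simplex" "y \<in> unit_simplex" "0 \<le> u" "0 \<le> v" "u + v = 1"
  have "(\<Sum>i\<in>UNIV. (u *\<^sub>R x + v *\<^sub>R y) $ i) = u * (\<Sum>i\<in>UNIV. x $ i) + v * (\<Sum>i\<in>UNIV. y $ i)"
    by (simp add: sum.distrib sum_distrib_left)
  also have "\<dots> \<le> u * 1 + v * 1" using h by (intro add_mono mult_left_mono) (auto simp: unit_simplex_def)
  finally show "u *\<^sub>R x + v *\<^sub>R y \<in> unit_simplex" using h by (auto simp: unit_simplex_def)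
qed

lemma zero_unit_simplex: "0 \<in> unit_simplex" by (simp add: unit_simplex_def)

lemma norm_unit_simplex: "x \<in> unit_simplex \<Longrightarrow> norm x \<le> 1"
proof -
  assume x: "x \<in> unit_simplex"
  have "norm x \<le> (\<Sum>i\<in>UNIV. \<bar>x $ i\<bar>)" by (rule norm_le_l1_cart)
  also have "\<dots> = (\<Sum>i\<in>UNIV. x $ i)" using x by (simp add: unit_simplex_def)
  finally show ?thesis using x by (simp add: unit_simplex_def)
qed

lemma closed_admissible: "closed (admissible S :: (('a::euclidean_space, real^'m) l2 \<times> ('a, 'a^'m) l2) set)"
proof -
  have eq: "(admissible S :: (('a, real^'m) l2 \<times> ('a, 'a^'m) l2) set) =
      weak_gradients S \<inter> fst -` {v. AE x in lborel. fn v x \<in> (if x \<in> S then unit_simplex else UNIV)}"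
  proof -
    have "(y \<in> (if x \<in> S then unit_simplex else UNIV)) = (x \<in> S \<longrightarrow> y \<in> unit_simplex)" for x and y :: "real^'m" by auto
    then show ?thesis by (auto simp: admissible_def constrained_def)
  qed
  show ?thesis unfolding eq
    by (intro closed_Int closed_weak_gradients closed_vimage closed_AE_l2) (auto intro: closed_unit_simplex continuous_intros)
qed

lemma convex_admissible: "convex (admissible S :: (('a::euclidean_space, real^'m) l2 \<times> ('a, 'a^'m) l2) set)"
proof (rule convexI)
  fix x y :: "('a, real^'m) l2 \<times> ('a, 'a^'m) l2" and u v :: real
  assume h: "x \<in> admissible S" "y \<in> admissible S" "0 \<le> u" "0 \<le> v" "u + v = 1"
  have xs: "AE z in lborel. z \<in> S \<longrightarrow> fn (fst x) z \<in> unit_simplex" and ys: "AE z in lborel. z \<in> S \<longrightarrow> fn (fst y) z \<in> unit_simplex"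
    using h by (auto simp: admissible_def constrained_def)
  have "AE z in lborel. z \<in> S \<longrightarrow> fn (u *\<^sub>R fst x + v *\<^sub>R fst y) z \<in> unit_simplex"
    using xs ys fn_add[of "u *\<^sub>R fst x" "v *\<^sub>R fst y"] fn_scaleR[of u "fst x"] fn_scaleR[of v "fst y"]
    by eventually_elim (use convexD[OF convex_unit_simplex _ _ h(3-5)] in auto)
  moreover have "u *\<^sub>R x + v *\<^sub>R y \<in> weak_gradients S"
    using h convexD[OF subspace_imp_convex[OF subspace_weak_gradients], of x S y u v] by (simp add: admissible_def)
  ultimately show "u *\<^sub>R x + v *\<^sub>R y \<in> admissible S" by (simp add: admissible_def constrained_def)
qed

text \<open>Points of the simplex have Euclidean norm at most 1. The resulting uniform bound is the
  constant \<open>B\<close> in the comparison of grids.\<close>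

lemma norm_admissible_le:
  assumes S: "open S" "bounded S" and z: "z \<in> admissible S"
  shows "norm (fst z) \<le> sqrt (measure lborel S)"
proof -
  have fin: "emeasure lborel S < \<infinity>" by (rule emeasure_bounded_finite[OF S(2)])
  have Sb: "S \<in> sets borel" using S by simp
  obtain v p where vp: "z = (v, p)" by (cases z)
  have a: "AE x in lborel. x \<notin> S \<longrightarrow> fn v x = 0" "AE x in lborel. x \<in> S \<longrightarrow> fn v x \<in> unit_simplex"
    using z by (auto simp: vp admissible_def weak_gradients_def constrained_def)
  have "(norm v)\<^sup>2 \<le> (LINT x|lborel. indicator S x)"
    unfolding norm_l2_sq
  proof (rule integral_mono_AE)
    show "AE x in lborel. (norm (fn v x))\<^sup>2 \<le> indicator S x"
      using a by eventually_elim (auto simp: indicator_def norm_unit_simplex intro!: power_le_one)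
  qed (use fin Sb in \<open>auto intro: sq_int_integrable\<close>)
  also have "\<dots> = measure lborel S" by simp
  finally show ?thesis by (simp add: vp real_le_rsqrt)
qed

lemma simplexK_iff_admissible:
  assumes S: "open S" shows "v \<in> simplexK S \<longleftrightarrow> (\<exists>a p. (a, p) \<in> admissible S \<and> represents S a v)"
proof
  assume v: "v \<in> simplexK S"
  obtain a p where a: "represents S a v" "(a, p) \<in> weak_gradients S"
    using H1_weak_gradient[OF S, of v] v by (auto simp: simplexK_def)
  have "AE x in lborel. x \<in> S \<longrightarrow> v x \<in> unit_simplex"
    using v unfolding simplexK_def AE_lebesgue_on_iff[OF S] unit_simplex_def mem_Collect_eq by (rule conjunct2)
  with conjunct1[OF a(1)[unfolded represents_def]] have "AE x in lborel. x \<in> S \<longrightarrow> fn a x \<in> unit_simplex"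
    by eventually_elim simp
  then show "\<exists>a p. (a, p) \<in> admissible S \<and> represents S a v" using a by (auto simp: admissible_def constrained_def)
next
  assume "\<exists>a p. (a, p) \<in> admissible S \<and> represents S a v"
  then obtain a p where a: "(a, p) \<in> weak_gradients S" "AE x in lborel. x \<in> S \<longrightarrow> fn a x \<in> unit_simplex" "represents S a v"
    by (auto simp: admissible_def constrained_def)
  have "AE x in lborel. x \<in> S \<longrightarrow> v x \<in> unit_simplex"
    using a(2) conjunct1[OF a(3)[unfolded represents_def]] by eventually_elim simp
  then have "AE x in lebesgue_on S. (\<Sum>i\<in>UNIV. v x $ i) \<le> 1 \<and> (\<forall>i. 0 \<le> v x $ i)"
    unfolding AE_lebesgue_on_iff[OF S] unit_simplex_def mem_Collect_eq .
  then show "v \<in> simplexK S" using weak_gradient_H1(1)[OF S a(1,3)] unfolding simplexK_def mem_Collect_eq by blast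
qed

text \<open>The gradient is existential at each time: a solution in the original sense provides it
  slice by slice, without a jointly measurable choice. The derivative \<open>D\<close> is pinned
  down on the cylinder only.\<close>

definition hilbert_solution ::
  "'a::euclidean_space set \<Rightarrow> real \<Rightarrow> ('a \<times> real, real^'m) l2 \<Rightarrow> ('a, real^'m) l2 \<Rightarrow> ('a \<times> real, real^'m) l2 \<Rightarrow> ('a \<times> real, real^'m) l2 \<Rightarrow> bool" where
  "hilbert_solution S T F a0 U D \<longleftrightarrow>
     cut (S \<times> {0<..<T}) U = U \<and> weakd (S \<times> {0<..<T}) (0, 1) U D \<and>
     (\<forall>e>0. \<exists>\<delta>>0. AE t in lborel. t \<in> {0<..<T} \<longrightarrow> t < \<delta> \<longrightarrow> (norm (sl U t - a0))\<^sup>2 < e) \<and>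
     (AE t in lborel. t \<in> {0<..<T} \<longrightarrow> (\<exists>p. (sl U t, p) \<in> admissible S \<and>
        (\<forall>w q. (w, q) \<in> admissible S \<longrightarrow> inner (sl F t - sl D t) (w - sl U t) \<le> inner p (q - p))))"

lemma represents_coordI:
  assumes "\<And>i. represents S (coord i a) (\<lambda>x. h x $ i)" shows "represents S a h"
proof -
  have "AE x in lborel. \<forall>i\<in>UNIV. fn (coord i a) x = fn a x $ i" by (intro AE_finite_allI fn_coord) simp
  moreover have "AE x in lborel. \<forall>i\<in>UNIV. x \<in> S \<longrightarrow> fn (coord i a) x = h x $ i"
    using assms by (intro AE_finite_allI) (auto simp: represents_def)
  moreover have "AE x in lborel. \<forall>i\<in>UNIV. x \<notin> S \<longrightarrow> fn (coord i a) x = 0"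
    using assms by (intro AE_finite_allI) (auto simp: represents_def)
  ultimately have "AE x in lborel. (x \<in> S \<longrightarrow> fn a x = h x) \<and> (x \<notin> S \<longrightarrow> fn a x = 0)"
    by eventually_elim (simp add: vec_eq_iff)
  then show ?thesis unfolding represents_def by (auto elim!: eventually_mono)
qed

lemma represents_dt:
  assumes Q: "open (S \<times> {0<..<T})" and U: "represents (S \<times> {0<..<T}) U u"
    and w: "weakd (S \<times> {0<..<T}) (0, 1) U D" and D: "cut (S \<times> {0<..<T}) D = D"
  shows "represents (S \<times> {0<..<T}) D (dt S T u)"
proof (rule represents_coordI)
  fix i
  have "weakd (S \<times> {0<..<T}) (0, 1) (coord i U) (coord i D)" using w by (simp add: weakd_iff_coord)
  from represents_wpd[OF Q represents_coord[OF U] this cut_coord[OF Q D]]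
  show "represents (S \<times> {0<..<T}) (coord i D) (\<lambda>x. dt S T u x $ i)" by (simp add: dt_def cyl_def)
qed

lemma slice_inequality_iff:
  fixes a d f :: "('a::euclidean_space, real^'m) l2" and u u' g :: "'a \<Rightarrow> real^'m"
  assumes S: "open S" and a: "represents S a u" "(a, p) \<in> admissible S" and d: "represents S d u'" and f: "represents S f g"
  shows "(\<forall>v\<in>simplexK S. (LINT x|lebesgue_on S. u' x \<bullet> (v x - u x)) + dirichlet S u (\<lambda>x. v x - u x)
            \<ge> (LINT x|lebesgue_on S. g x \<bullet> (v x - u x)))
     \<longleftrightarrow> (\<forall>w q. (w, q) \<in> admissible S \<longrightarrow> inner (f - d) (w - a) \<le> inner p (q - p))"
proof -
  have ap: "(a, p) \<in> weak_gradients S" using a(2) by (simp add: admissible_def)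
  have eq: "(LINT x|lebesgue_on S. u' x \<bullet> (v x - u x)) = inner d (w - a)"
    "(LINT x|lebesgue_on S. g x \<bullet> (v x - u x)) = inner f (w - a)"
    "dirichlet S u (\<lambda>x. v x - u x) = inner p (q - p)"
    if wq: "(w, q) \<in> admissible S" and w: "represents S w v" for w q v
  proof -
    have r: "represents S (w - a) (\<lambda>x. v x - u x)" by (rule represents_diff[OF w a(1)])
    show "(LINT x|lebesgue_on S. u' x \<bullet> (v x - u x)) = inner d (w - a)" by (rule represents_inner[OF S d r])
    show "(LINT x|lebesgue_on S. g x \<bullet> (v x - u x)) = inner f (w - a)" by (rule represents_inner[OF S f r])
    have "(w, q) \<in> weak_gradients S" using wq by (simp add: admissible_def)
    from subspace_diff[OF subspace_weak_gradients this ap]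
    have "(w - a, q - p) \<in> weak_gradients S" by simp
    from dirichlet_eq_inner[OF S ap a(1) this r] show "dirichlet S u (\<lambda>x. v x - u x) = inner p (q - p)" .
  qed
  show ?thesis
  proof (intro iffI ballI allI impI)
    fix w :: "('a, real^'m) l2" and q assume h: "\<forall>v\<in>simplexK S. (LINT x|lebesgue_on S. u' x \<bullet> (v x - u x)) + dirichlet S u (\<lambda>x. v x - u x)
            \<ge> (LINT x|lebesgue_on S. g x \<bullet> (v x - u x))" and wq: "(w, q) \<in> admissible S"
    have r: "represents S w (fn w)"
      by (rule represents_fn) (use wq in \<open>simp add: admissible_def weak_gradients_def\<close>)
    have "fn w \<in> simplexK S" using simplexK_iff_admissible[OF S] wq r by blast
    from bspec[OF h this] show "inner (f - d) (w - a) \<le> inner p (q - p)"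
      unfolding eq[OF wq r] by (simp add: inner_diff_left)
  next
    fix v :: "'a \<Rightarrow> real^'m" assume h: "\<forall>w q. (w, q) \<in> admissible S \<longrightarrow> inner (f - d) (w - a) \<le> inner p (q - p)" and v: "v \<in> simplexK S"
    obtain w q where wq: "(w, q) \<in> admissible S" "represents S w v" using simplexK_iff_admissible[OF S] v by blast
    show "(LINT x|lebesgue_on S. u' x \<bullet> (v x - u x)) + dirichlet S u (\<lambda>x. v x - u x) \<ge> (LINT x|lebesgue_on S. g x \<bullet> (v x - u x))"
      unfolding eq[OF wq] using h[rule_format, OF wq(1)] by (simp add: inner_diff_left)
  qed
qed

text \<open>At a fixed time both formulations run over the same competitors, described once as
  functions and once as admissible pairs. The equivalence is therefore pointwise in t, and one null
  set of times serves all competitors.\<close>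

lemma vi_solution_iff:
  fixes f u :: "'a::euclidean_space \<times> real \<Rightarrow> real^'m"
  assumes S: "open S" and F: "represents (S \<times> {0<..<T}) F f" and a0: "represents S a0 u0"
    and U: "represents (S \<times> {0<..<T}) U u" and D: "represents (S \<times> {0<..<T}) D (dt S T u)"
    and w: "weakd (S \<times> {0<..<T}) (0, 1) U D"
  shows "vi_solution S T f u0 u \<longleftrightarrow> hilbert_solution S T F a0 U D"
proof -
  have Q: "open (S \<times> {0<..<T})" by (intro open_Times S) simp
  have I: "open {0<..<T}" by simp
  have H: "H1_L2 S T u"
  proof -
    have "L2 (S \<times> {0<..<T}) (\<lambda>z. u z $ i)" for i using L2_iff_represents[OF Q] represents_coord[OF U] by blast
    moreover have "\<exists>G. L2 (S \<times> {0<..<T}) G \<and> weak_pd (S \<times> {0<..<T}) (0, 1) (\<lambda>z. u z $ i) G" for i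
    proof -
      have "weakd (S \<times> {0<..<T}) (0, 1) (coord i U) (coord i D)" using w by (simp add: weakd_iff_coord)
      then have "weak_pd (S \<times> {0<..<T}) (0, 1) (\<lambda>z. u z $ i) (\<lambda>z. dt S T u z $ i)"
        using weak_pd_iff_weakd[OF Q represents_coord[OF U] represents_coord[OF D]] by simp
      then show ?thesis using L2_iff_represents[OF Q] represents_coord[OF D] by blast
    qed
    ultimately show ?thesis unfolding H1_L2_def cyl_def by blast
  qed
  have sU: "AE t in lborel. t \<in> {0<..<T} \<longrightarrow> represents S (sl U t) (\<lambda>x. u (x, t))" by (rule represents_slice[OF U])
  have sD: "AE t in lborel. t \<in> {0<..<T} \<longrightarrow> represents S (sl D t) (\<lambda>x. dt S T u (x, t))" by (rule represents_slice[OF D])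
  have sF: "AE t in lborel. t \<in> {0<..<T} \<longrightarrow> represents S (sl F t) (\<lambda>x. f (x, t))" by (rule represents_slice[OF F])
  have init: "(AE t in lebesgue_on {0<..<T}. t < \<delta> \<longrightarrow> (LINT x|lebesgue_on S. (norm (u (x, t) - u0 x))\<^sup>2) < e)
     \<longleftrightarrow> (AE t in lborel. t \<in> {0<..<T} \<longrightarrow> t < \<delta> \<longrightarrow> (norm (sl U t - a0))\<^sup>2 < e)" for \<delta> e
    unfolding AE_lebesgue_on_iff[OF I]
  proof -
    have "AE t in lborel. t \<in> {0<..<T} \<longrightarrow> (LINT x|lebesgue_on S. (norm (u (x, t) - u0 x))\<^sup>2) = (norm (sl U t - a0))\<^sup>2"
      using sU
    proof eventually_elim
      case (elim t)
      then show ?case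
        using represents_inner[OF S represents_diff[OF _ a0] represents_diff[OF _ a0], of "sl U t" "\<lambda>x. u (x, t)" "sl U t" "\<lambda>x. u (x, t)"]
        by (simp add: power2_norm_eq_inner)
    qed
    then show "(AE t in lborel. t \<in> {0<..<T} \<longrightarrow> t < \<delta> \<longrightarrow> (LINT x|lebesgue_on S. (norm (u (x, t) - u0 x))\<^sup>2) < e)
       \<longleftrightarrow> (AE t in lborel. t \<in> {0<..<T} \<longrightarrow> t < \<delta> \<longrightarrow> (norm (sl U t - a0))\<^sup>2 < e)"
      by (rule eventually_cong[OF _]) (auto elim: eventually_mono)
  qed
  have main: "((AE t in lebesgue_on {0<..<T}. (\<lambda>x. u (x, t)) \<in> simplexK S) \<and>
     (AE t in lebesgue_on {0<..<T}. \<forall>v\<in>simplexK S.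
        (LINT x|lebesgue_on S. dt S T u (x, t) \<bullet> (v x - u (x, t)))
          + dirichlet S (\<lambda>x. u (x, t)) (\<lambda>x. v x - u (x, t))
        \<ge> (LINT x|lebesgue_on S. f (x, t) \<bullet> (v x - u (x, t)))))
    \<longleftrightarrow> (AE t in lborel. t \<in> {0<..<T} \<longrightarrow> (\<exists>p. (sl U t, p) \<in> admissible S \<and>
        (\<forall>w q. (w, q) \<in> admissible S \<longrightarrow> inner (sl F t - sl D t) (w - sl U t) \<le> inner p (q - p))))"
    unfolding AE_lebesgue_on_iff[OF I] AE_conj_iff[symmetric]
  proof (rule eventually_cong)
    show "AE t in lborel. t \<in> {0<..<T} \<longrightarrow> represents S (sl U t) (\<lambda>x. u (x, t)) \<and> represents S (sl D t) (\<lambda>x. dt S T u (x, t))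
        \<and> represents S (sl F t) (\<lambda>x. f (x, t))"
      using sU sD sF by eventually_elim blast
    fix t assume r: "t \<in> {0<..<T} \<longrightarrow> represents S (sl U t) (\<lambda>x. u (x, t)) \<and> represents S (sl D t) (\<lambda>x. dt S T u (x, t))
        \<and> represents S (sl F t) (\<lambda>x. f (x, t))"
    show "((t \<in> {0<..<T} \<longrightarrow> (\<lambda>x. u (x, t)) \<in> simplexK S) \<and> (t \<in> {0<..<T} \<longrightarrow> (\<forall>v\<in>simplexK S.
        (LINT x|lebesgue_on S. dt S T u (x, t) \<bullet> (v x - u (x, t)))
          + dirichlet S (\<lambda>x. u (x, t)) (\<lambda>x. v x - u (x, t))
        \<ge> (LINT x|lebesgue_on S. f (x, t) \<bullet> (v x - u (x, t)))))) =
       (t \<in> {0<..<T} \<longrightarrow> (\<exists>p. (sl U t, p) \<in> admissible S \<and>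
        (\<forall>w q. (w, q) \<in> admissible S \<longrightarrow> inner (sl F t - sl D t) (w - sl U t) \<le> inner p (q - p))))"
    proof (cases "t \<in> {0<..<T}")
      case True
      then have rr: "represents S (sl U t) (\<lambda>x. u (x, t))" "represents S (sl D t) (\<lambda>x. dt S T u (x, t))"
        "represents S (sl F t) (\<lambda>x. f (x, t))" using r by auto
      have K: "(\<lambda>x. u (x, t)) \<in> simplexK S \<longleftrightarrow> (\<exists>p. (sl U t, p) \<in> admissible S)"
        unfolding simplexK_iff_admissible[OF S] using rr(1) represents_unique by metis
      show ?thesis using True K slice_inequality_iff[OF S rr(1) _ rr(2,3)] by blast
    next
      case False then show ?thesis by blast
    qed
  qed
  show ?thesis
    unfolding vi_solution_def hilbert_solution_def init using H main represents_cut_self[OF Q U] w by blast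
qed

lemma vi_solution_represented:
  fixes f u :: "'a::euclidean_space \<times> real \<Rightarrow> real^'m"
  assumes S: "open S" and F: "represents (S \<times> {0<..<T}) F f" and a0: "represents S a0 u0" and u: "vi_solution S T f u0 u"
  shows "\<exists>U D. represents (S \<times> {0<..<T}) U u \<and> hilbert_solution S T F a0 U D"
proof -
  have Q: "open (S \<times> {0<..<T})" by (intro open_Times S) simp
  have H: "H1_L2 S T u" using u by (simp add: vi_solution_def)
  then obtain U where U: "represents (S \<times> {0<..<T}) U u"
    using L2_vec_iff_represents[OF Q, of u] by (auto simp: H1_L2_def cyl_def)
  have "\<exists>A. weakd (S \<times> {0<..<T}) (0, 1) (coord i U) A \<and> represents (S \<times> {0<..<T}) A (\<lambda>z. dt S T u z $ i)" for i
  proof -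
    obtain G where G: "L2 (S \<times> {0<..<T}) G" "weak_pd (S \<times> {0<..<T}) (0, 1) (\<lambda>z. u z $ i) G"
      using H by (auto simp: H1_L2_def cyl_def)
    then obtain A where A: "represents (S \<times> {0<..<T}) A G" using L2_iff_represents[OF Q] by blast
    have wA: "weakd (S \<times> {0<..<T}) (0, 1) (coord i U) A"
      using weak_pd_iff_weakd[OF Q represents_coord[OF U] A] G(2) by simp
    from represents_wpd[OF Q represents_coord[OF U] wA represents_cut_self[OF Q A]] wA
    show ?thesis by (auto simp: dt_def cyl_def)
  qed
  then obtain A where A: "\<And>i. weakd (S \<times> {0<..<T}) (0, 1) (coord i U) (A i)" "\<And>i. represents (S \<times> {0<..<T}) (A i) (\<lambda>z. dt S T u z $ i)"
    by metis
  obtain D where D: "represents (S \<times> {0<..<T}) D (dt S T u)"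
    using L2_vec_iff_represents[OF Q, of "dt S T u"] A(2) L2_iff_represents[OF Q] by blast
  have "coord i D = A i" for i by (rule represents_unique[OF represents_coord[OF D] A(2)])
  then have "weakd (S \<times> {0<..<T}) (0, 1) U D" using A(1) by (simp add: weakd_iff_coord)
  then show ?thesis using vi_solution_iff[OF S F a0 U D] u U by blast
qed

lemma hilbert_solution_unique:
  fixes F :: "('a::euclidean_space \<times> real, real^'m) l2"
  assumes S: "open S" and 1: "hilbert_solution S T F a0 U D" and 2: "hilbert_solution S T F a0 V E"
  shows "U = V"
proof -
  have Sb: "S \<in> sets borel" using S by simp
  have Ib: "{0<..<T} \<in> sets borel" by simp
  have cutsl: "AE t in lborel. cut S (sl W t) = sl W t \<and> (t \<notin> {0<..<T} \<longrightarrow> sl W t = 0)"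
    if "cut (S \<times> {0<..<T}) W = W" for W :: "('a \<times> real, real^'m) l2"
    using sl_cut[OF Sb Ib, of W] unfolding that
  proof eventually_elim
    case (elim t)
    have "cut S (sl W t) = indicator {0<..<T} t *\<^sub>R cut S (cut S (sl W t))"
      using elim linear_cmul[OF bounded_linear.linear[OF bounded_linear_cut[OF Sb]]] by metis
    then show ?case using elim by (auto simp: cut_cut[OF Sb] indicator_def)
  qed
  have cU: "cut (S \<times> {0<..<T}) U = U" and cV: "cut (S \<times> {0<..<T}) V = V"
    using 1 2 by (auto simp: hilbert_solution_def)
  have "AE t in lborel. t \<in> {0<..<T} \<longrightarrow> sl (U - V) t = 0"
  proof (rule dissipative_zero[OF S, of T "U - V" "D - E"])
    show "weakd (S \<times> {0<..<T}) (0, 1) (U - V) (D - E)"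
      using 1 2 by (auto simp: hilbert_solution_def weakd_def inner_diff_left)
    show "AE t in lborel. cut S (sl (U - V) t) = sl (U - V) t"
      using cutsl[OF cU] cutsl[OF cV] sl_diff[of U V]
      by eventually_elim (simp add: linear_diff[OF bounded_linear.linear[OF bounded_linear_cut[OF Sb]]])
    have v1: "AE t in lborel. t \<in> {0<..<T} \<longrightarrow> (\<exists>p. (sl U t, p) \<in> admissible S \<and>
        (\<forall>w q. (w, q) \<in> admissible S \<longrightarrow> inner (sl F t - sl D t) (w - sl U t) \<le> inner p (q - p)))"
      and v2: "AE t in lborel. t \<in> {0<..<T} \<longrightarrow> (\<exists>p. (sl V t, p) \<in> admissible S \<and>
        (\<forall>w q. (w, q) \<in> admissible S \<longrightarrow> inner (sl F t - sl E t) (w - sl V t) \<le> inner p (q - p)))"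
      using 1 2 by (auto simp: hilbert_solution_def)
    show "AE t in lborel. t \<in> {0<..<T} \<longrightarrow> inner (sl (U - V) t) (sl (D - E) t) \<le> 0"
      using v1 v2 sl_diff[of U V] sl_diff[of D E]
    proof eventually_elim
      case (elim t)
      show ?case
      proof
        assume t: "t \<in> {0<..<T}"
        obtain p q where p: "(sl U t, p) \<in> admissible S" "\<And>w q. (w, q) \<in> admissible S \<Longrightarrow> inner (sl F t - sl D t) (w - sl U t) \<le> inner p (q - p)"
          and q: "(sl V t, q) \<in> admissible S" "\<And>w r. (w, r) \<in> admissible S \<Longrightarrow> inner (sl F t - sl E t) (w - sl V t) \<le> inner q (r - q)"
          using elim(1,2) t by blast
        have "inner (sl U t - sl V t) (sl D t - sl E t) + (norm (p - q))\<^sup>2 \<le> 0"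
          using p(2)[OF q(1)] q(2)[OF p(1)] by (simp add: power2_norm_eq_inner inner_simps inner_commute)
        then have "inner (sl U t - sl V t) (sl D t - sl E t) \<le> 0" using zero_le_power2[of "norm (p - q)"] by linarith
        then show "inner (sl (U - V) t) (sl (D - E) t) \<le> 0" using elim(3,4) by simp
      qed
    qed
    fix e :: real assume e: "e > 0"
    \<comment> \<open>A quarter of e for each solution, since |x - y|^2 \<le> 2 |x - a0|^2 + 2 |y -
      a0|^2.\<close>
    obtain d1 where d1: "d1 > 0" "AE t in lborel. t \<in> {0<..<T} \<longrightarrow> t < d1 \<longrightarrow> (norm (sl U t - a0))\<^sup>2 < e / 4"
      using 1 e unfolding hilbert_solution_def by (meson zero_less_divide_iff zero_less_numeral)
    obtain d2 where d2: "d2 > 0" "AE t in lborel. t \<in> {0<..<T} \<longrightarrow> t < d2 \<longrightarrow> (norm (sl V t - a0))\<^sup>2 < e / 4"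
      using 2 e unfolding hilbert_solution_def by (meson zero_less_divide_iff zero_less_numeral)
    have "AE t in lborel. 0 < t \<and> t < min d1 d2 \<and> t < T \<longrightarrow> (norm (sl (U - V) t))\<^sup>2 \<le> e"
      using d1(2) d2(2) sl_diff[of U V]
    proof eventually_elim
      case (elim t)
      have "(norm (x - y))\<^sup>2 \<le> 2 * (norm (x - a0))\<^sup>2 + 2 * (norm (y - a0))\<^sup>2" for x y :: "('a, real^'m) l2"
      proof -
        have "0 \<le> (norm ((x - a0) + (y - a0)))\<^sup>2" by simp
        then show ?thesis by (simp add: power2_norm_eq_inner inner_simps inner_commute)
      qed
      from this[of "sl U t" "sl V t"] show ?case using elim by auto
    qed
    then show "\<exists>\<delta>>0. AE t in lborel. 0 < t \<and> t < \<delta> \<and> t < T \<longrightarrow> (norm (sl (U - V) t))\<^sup>2 \<le> e"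
      using d1(1) d2(1) by (intro exI[of _ "min d1 d2"]) simp
  qed
  then have "AE t in lborel. sl U t = sl V t"
    using cutsl[OF cU] cutsl[OF cV] sl_diff[of U V]
  proof eventually_elim
    case (elim t)
    then show ?case by (cases "t \<in> {0<..<T}") auto
  qed
  then show ?thesis by (rule l2_eq_slicesI)
qed

text \<open>Translating one factor by s d or the other by - s d gives the same pairing.
  Differentiating it at s = 0 in both ways yields integration by parts without any integration in
  coordinates.\<close>

lemma weakd_test_function:
  assumes t: "vtest S \<Phi>" shows "weakd S d (mk \<Phi>) (mk (vpd \<Phi> d))"
  unfolding weakd_def
proof (intro allI impI)
  fix \<Psi> :: "'a \<Rightarrow> 'b" assume t': "vtest S \<Psi>"
  define F where "F s = inner (mk \<Psi>) (tr (- (s *\<^sub>R d)) (mk \<Phi>))" for s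
  define G where "G s = inner (mk \<Phi>) (tr (- (s *\<^sub>R d)) (mk \<Psi>))" for s
  have 1: "(F has_real_derivative - inner (mk \<Psi>) (mk (vpd \<Phi> d))) (at 0)"
    using inner_tr_test_derivative[OF t, of "mk \<Psi>" d 0] by (simp add: F_def[abs_def] tr_0)
  have "(G has_real_derivative - inner (mk \<Phi>) (mk (vpd \<Psi> d))) (at (- 0))"
    using inner_tr_test_derivative[OF t', of "mk \<Phi>" d 0] by (simp add: G_def[abs_def] tr_0)
  from DERIV_mirror[of G "- inner (mk \<Phi>) (mk (vpd \<Psi> d))" 0] this
  have "((\<lambda>s. G (- s)) has_real_derivative inner (mk \<Phi>) (mk (vpd \<Psi> d))) (at 0)" by simp
  moreover have "G (- s) = F s" for s
    unfolding G_def F_def using inner_tr_left[of "- (s *\<^sub>R d)" "mk \<Phi>" "mk \<Psi>"] by (simp add: inner_commute)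
  ultimately have 2: "(F has_real_derivative inner (mk \<Phi>) (mk (vpd \<Psi> d))) (at 0)" by simp
  from DERIV_unique[OF 1 2] show "inner (mk \<Phi>) (mk (vpd \<Psi> d)) = - inner (mk (vpd \<Phi> d)) (mk \<Psi>)"
    by (simp add: inner_commute)
qed

lemma mk_vtest_support: "vtest S \<Phi> \<Longrightarrow> AE x in lborel. x \<notin> S \<longrightarrow> fn (mk \<Phi>) x = 0"
  using fn_mk[OF vtest_sq_int, of S \<Phi>] vtest_outside[of S \<Phi>] by (auto elim: eventually_mono)

lemma vtest_weak_gradient:
  fixes \<Phi> :: "'a::euclidean_space \<Rightarrow> real^'m"
  assumes t: "vtest S \<Phi>"
  shows "(mk \<Phi>, \<Sum>b\<in>Basis. app (emb b) (mk (vpd \<Phi> b))) \<in> weak_gradients S"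
proof -
  have "AE x in lborel. \<forall>b\<in>Basis. x \<notin> S \<longrightarrow> fn (app (emb b) (mk (vpd \<Phi> b))) x = 0"
  proof (intro AE_finite_allI finite_Basis)
    fix b :: 'a
    show "AE x in lborel. x \<notin> S \<longrightarrow> fn (app (emb b) (mk (vpd \<Phi> b))) x = 0"
      using fn_app[OF bounded_linear_emb, of b "mk (vpd \<Phi> b)"] mk_vtest_support[OF vtest_vpd[OF t, of b]]
      by eventually_elim (simp add: emb_def vec_eq_iff)
  qed
  with fn_sum[OF finite_Basis, of "\<lambda>b. app (emb b) (mk (vpd \<Phi> b))"]
  have "AE x in lborel. x \<notin> S \<longrightarrow> fn (\<Sum>b\<in>Basis. app (emb b) (mk (vpd \<Phi> b))) x = 0" by eventually_elim simp
  moreover have "weakd S b (mk \<Phi>) (app (dirL b) (\<Sum>b\<in>Basis. app (emb b) (mk (vpd \<Phi> b))))" if "b \<in> Basis" for b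
    unfolding app_dirL_sum[OF that] by (rule weakd_test_function[OF t])
  ultimately show ?thesis using mk_vtest_support[OF t] by (simp add: weak_gradients_def)
qed

text \<open>The functional is the weak form of D - Laplace U. At almost every time the resolvent
  argument bounds its gradient part by the slice of \<open>F - D\<close>; integrating over time
  makes it bounded in L2, and the Riesz theorem gives \<open>H\<close>.\<close>

lemma heat_functional_represented:
  fixes U :: "('a::euclidean_space \<times> real, real^'m) l2"
  assumes S: "open S" and vi: "AE t in lborel. t \<in> {0<..<T} \<longrightarrow> (sl U t, sl P t) \<in> admissible S \<and>
        (\<forall>w q. (w, q) \<in> admissible S \<longrightarrow> inner (sl F t - sl D t) (w - sl U t) \<le> inner (sl P t) (q - sl P t))"
  shows "\<exists>H. \<forall>\<Phi>. vtest (S \<times> {0<..<T}) \<Phi> \<longrightarrow>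
     inner D (mk \<Phi>) + (\<Sum>b\<in>Basis. inner (app (dirL b) P) (mk (vpd \<Phi> (b, 0)))) = inner H (mk \<Phi>)"
proof -
  define L where "L \<Phi> = inner D (mk \<Phi>) + (\<Sum>b\<in>Basis. inner (app (dirL b) P) (mk (vpd \<Phi> (b, 0))))" for \<Phi>
  define C where "C = norm D + ((norm (F - D))\<^sup>2 + 1) / 2"
  let ?Q = "S \<times> {0<..<T}"
  have bound: "\<bar>L \<Phi>\<bar> \<le> C * norm (mk \<Phi>)" if t: "vtest ?Q \<Phi>" for \<Phi>
  proof -
    \<comment> \<open>The spatial gradient of \<Phi> as a single field, so that the sum over
      directions becomes one inner product with \<open>P\<close>.\<close>
    define R where "R = (\<Sum>b\<in>Basis. app (emb b) (mk (vpd \<Phi> (b, 0))))"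
    have RP: "(\<Sum>b\<in>Basis. inner (app (dirL b) P) (mk (vpd \<Phi> (b, 0)))) = inner P R"
      unfolding R_def inner_sum_right by (intro sum.cong refl) (metis inner_app_emb inner_commute)
    have slR: "AE t in lborel. sl R t = (\<Sum>b\<in>Basis. app (emb b) (mk (vpd (\<lambda>x. \<Phi> (x, t)) b)))"
    proof -
      have "AE t in lborel. \<forall>b\<in>Basis. sl (app (emb b) (mk (vpd \<Phi> (b, 0)))) t = app (emb b) (mk (vpd (\<lambda>x. \<Phi> (x, t)) b))"
      proof (intro AE_finite_allI finite_Basis)
        fix b :: 'a
        show "AE t in lborel. sl (app (emb b) (mk (vpd \<Phi> (b, 0)))) t = app (emb b) (mk (vpd (\<lambda>x. \<Phi> (x, t)) b))"
          using sl_app[OF bounded_linear_emb, of b "mk (vpd \<Phi> (b, 0))"] sl_mk_vtest[OF vtest_vpd[OF t], of "(b, 0)"]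
        proof eventually_elim
          case (elim s)
          have "vpd (\<lambda>x. \<Phi> (x, s)) b = (\<lambda>x. vpd \<Phi> (b, 0) (x, s))" by (rule ext) (rule vtest_slice(2)[OF t])
          then show ?case using elim by simp
        qed
      qed
      with sl_sum[OF finite_Basis, of "\<lambda>b. app (emb b) (mk (vpd \<Phi> (b, 0)))"]
      show ?thesis unfolding R_def by eventually_elim simp
    qed
    have "AE t in lborel. \<bar>inner (sl P t) (sl R t)\<bar> \<le> norm (sl (F - D) t) * norm (sl (mk \<Phi>) t)"
      using vi slR sl_mk_vtest[OF t] sl_diff[of F D]
    proof eventually_elim
      case (elim s)
      show ?case
      proof (cases "s \<in> {0<..<T}")
        case True
        have w: "(sl (mk \<Phi>) s, sl R s) \<in> weak_gradients S"
          unfolding elim(2,3) by (rule vtest_weak_gradient[OF vtest_slice(1)[OF t]])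
        have ad: "(sl U s, sl P s) \<in> weak_gradients S" "sl U s \<in> constrained S unit_simplex"
          using elim(1) True by (auto simp: admissible_def)
        have "inner (sl F s - sl D s) (w - sl U s) \<le> inner (sl P s) (q - sl P s)"
          if "(w, q) \<in> weak_gradients S" "w \<in> constrained S unit_simplex" for w q
          using elim(1) True that by (simp add: admissible_def)
        from gradient_functional_bound[OF S closed_unit_simplex convex_unit_simplex zero_unit_simplex ad this w]
        show ?thesis using elim(4) by simp
      next
        case False
        have z: "\<Phi> (x, s) = 0" "vpd (\<lambda>x. \<Phi> (x, s)) b x = 0" for x b
          using vtest_outside[OF t, of "(x, s)"] vtest_outside[OF vtest_vpd[OF t, of "(b, 0)"], of "(x, s)"] False vtest_slice(2)[OF t] by auto
        have "vpd (\<lambda>x. \<Phi> (x, s)) b = (\<lambda>_. 0)" for b by (rule ext) (rule z(2))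
        moreover have "app (emb b) (mk (\<lambda>_. 0 :: real^'m)) = 0" for b :: 'a
          using linear_0[OF bounded_linear.linear[OF bounded_linear_app[OF bounded_linear_emb]]] by (simp add: zero_l2_def[symmetric])
        ultimately have "sl R s = 0" unfolding elim(2) by (intro sum.neutral ballI) simp
        then show ?thesis by simp
      qed
    qed
    from slices_inner_bound[OF this] have "\<bar>inner P R\<bar> \<le> ((norm (F - D))\<^sup>2 + 1) / 2 * norm (mk \<Phi>)" .
    moreover have "\<bar>inner D (mk \<Phi>)\<bar> \<le> norm D * norm (mk \<Phi>)" by (rule Cauchy_Schwarz_ineq2)
    ultimately show ?thesis unfolding L_def RP C_def distrib_right by linarith
  qed
  define R where "R = {(mk \<Phi>, L \<Phi>) |\<Phi>. vtest ?Q \<Phi>}"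
  have "subspace R"
  proof (rule subspaceI)
    have "L (\<lambda>_. 0) = 0" using bound[OF vtest_0] by (simp add: zero_l2_def[symmetric])
    then have "(0, 0) = (mk (\<lambda>_. 0), L (\<lambda>_. 0))" by (simp add: zero_l2_def[symmetric])
    then show "0 \<in> R" unfolding R_def zero_prod_def using vtest_0 by blast
    show "x + y \<in> R" if xy: "x \<in> R" "y \<in> R" for x y
    proof -
      obtain \<Phi> \<Psi> where P: "vtest ?Q \<Phi>" "vtest ?Q \<Psi>" "x = (mk \<Phi>, L \<Phi>)" "y = (mk \<Psi>, L \<Psi>)"
        using xy unfolding R_def by blast
      have "mk (vpd (\<lambda>x. \<Phi> x + \<Psi> x) d) = mk (vpd \<Phi> d) + mk (vpd \<Psi> d)" for d
        unfolding vpd_add[OF P(1,2)] by (rule mk_add[OF vtest_sq_int[OF vtest_vpd[OF P(1)]] vtest_sq_int[OF vtest_vpd[OF P(2)]]])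
      then have "x + y = (mk (\<lambda>x. \<Phi> x + \<Psi> x), L (\<lambda>x. \<Phi> x + \<Psi> x))"
        using P(3,4) mk_add[OF vtest_sq_int[OF P(1)] vtest_sq_int[OF P(2)]] by (simp add: L_def inner_add_right sum.distrib)
      then show ?thesis unfolding R_def using vtest_add[OF P(1,2)] by blast
    qed
    show "c *\<^sub>R x \<in> R" if x: "x \<in> R" for c x
    proof -
      obtain \<Phi> where P: "vtest ?Q \<Phi>" "x = (mk \<Phi>, L \<Phi>)" using x unfolding R_def by blast
      have "mk (vpd (\<lambda>x. c *\<^sub>R \<Phi> x) d) = c *\<^sub>R mk (vpd \<Phi> d)" for d
        unfolding vpd_scaleR[OF P(1)] by (rule mk_scaleR[OF vtest_sq_int[OF vtest_vpd[OF P(1)]]])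
      then have "c *\<^sub>R x = (mk (\<lambda>x. c *\<^sub>R \<Phi> x), L (\<lambda>x. c *\<^sub>R \<Phi> x))"
        using P(2) mk_scaleR[OF vtest_sq_int[OF P(1)]] by (simp add: L_def sum_distrib_left distrib_left)
      then show ?thesis unfolding R_def using vtest_scaleR[OF P(1)] by blast
    qed
  qed
  moreover have "\<bar>y\<bar> \<le> C * norm x" if "(x, y) \<in> R" for x y using that bound by (auto simp: R_def)
  moreover have "C \<ge> 0" by (simp add: C_def)
  ultimately obtain H where H: "\<forall>(x, y)\<in>R. y = inner H x" using riesz_graph[of R C] by blast
  have "L \<Phi> = inner H (mk \<Phi>)" if "vtest ?Q \<Phi>" for \<Phi>
    using bspec[OF H, of "(mk \<Phi>, L \<Phi>)"] that by (auto simp: R_def)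
  then show ?thesis unfolding L_def by blast
qed

theorem theorem2p3:
  fixes \<Omega> :: "'a::euclidean_space set" and T :: real
    and f :: "'a \<times> real \<Rightarrow> real^'m" and u0 :: "'a \<Rightarrow> real^'m"
  assumes "open \<Omega>" "connected \<Omega>" "bounded \<Omega>" "\<Omega> \<noteq> {}"
    and "T > 0"
    and "\<forall>i. L2 (cyl \<Omega> T) (\<lambda>z. f z $ i)"
    and "u0 \<in> simplexK \<Omega>"
  shows "\<exists>u. vi_solution \<Omega> T f u0 u
           \<and> (\<forall>w. vi_solution \<Omega> T f u0 w \<longrightarrow> (AE z in lebesgue_on (cyl \<Omega> T). w z = u z))
           \<and> H1_L2 \<Omega> T u \<and> Linf_H1 \<Omega> T u \<and> heat_L2 \<Omega> T u"
proof -
  let ?Q = "\<Omega> \<times> {0<..<T}"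
  let ?K = "admissible \<Omega> :: (('a, real^'m) l2 \<times> ('a, 'a^'m) l2) set"
  have S: "open \<Omega>" and T: "T > 0" using assms by auto
  have Q: "open ?Q" by (intro open_Times S) simp
  have Sb: "\<Omega> \<in> sets borel" "{0<..<T} \<in> sets borel" "?Q \<in> sets borel" using S Q by auto
  obtain F where F: "represents ?Q F f" using L2_vec_iff_represents[OF Q, of f] assms(6) by (auto simp: cyl_def)
  obtain a0 p0 where a0: "(a0, p0) \<in> ?K" "represents \<Omega> a0 u0" using simplexK_iff_admissible[OF S] assms(7) by blast
  have bd: "norm w \<le> sqrt (measure lborel \<Omega>)" if "(w, p) \<in> ?K" for w p
    using norm_admissible_le[OF S assms(3) that] by simp
  have bd': "\<forall>z\<in>?K. norm (fst z) \<le> sqrt (measure lborel \<Omega>)"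
    using bd by auto
  have "AE z in lborel. snd z \<notin> {0..<T} \<longrightarrow> fn F z = 0"
    using conjunct2[OF F[unfolded represents_def]] by eventually_elim auto
  from euler_limit[OF closed_admissible convex_admissible a0(1) bd' T this]
  obtain U' P D' M where ex:
    "AE t in lborel. t \<in> {0<..<T} \<longrightarrow> (sl U' t, sl P t) \<in> ?K \<and> (norm (sl P t))\<^sup>2 \<le> M \<and>
        (norm (sl U' t - a0))\<^sup>2 \<le> M * t \<and>
        (\<forall>w q. (w, q) \<in> ?K \<longrightarrow> inner (sl F t - sl D' t) (w - sl U' t) \<le> inner (sl P t) (q - sl P t))"
    and wd: "weakd ?Q (0, 1) U' D'" by blast
  \<comment> \<open>The limits live on all of space-time. Cut to the cylinder they represent
    functions on it, and \<open>D\<close> becomes the class of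
    \<open>dt \<Omega> T u\<close>.\<close>
  define U where "U = cut ?Q U'"
  define D where "D = cut ?Q D'"
  define u where "u = fn U"
  have cU: "cut ?Q U = U" and cD: "cut ?Q D = D" by (simp_all add: U_def D_def cut_cut[OF Sb(3)])
  have wUD: "weakd ?Q (0, 1) U D" unfolding U_def D_def by (rule weakd_cut_left[OF Q weakd_cut[OF Q wd]])
  have ru: "represents ?Q U u" unfolding u_def using represents_cut[OF Q, of U] cU by simp
  have rd: "represents ?Q D (dt \<Omega> T u)" by (rule represents_dt[OF Q ru wUD cD])
  have sol: "AE t in lborel. t \<in> {0<..<T} \<longrightarrow> (sl U t, sl P t) \<in> ?K \<and> (norm (sl P t))\<^sup>2 \<le> M \<and>
        (norm (sl U t - a0))\<^sup>2 \<le> M * t \<and>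
        (\<forall>w q. (w, q) \<in> ?K \<longrightarrow> inner (sl F t - sl D t) (w - sl U t) \<le> inner (sl P t) (q - sl P t))"
    using ex sl_cut[OF Sb(1,2), of U'] sl_cut[OF Sb(1,2), of D']
  proof eventually_elim
    case (elim t)
    show ?case
    proof
      assume t: "t \<in> {0<..<T}"
      have K: "(sl U' t, sl P t) \<in> ?K" using elim(1) t by blast
      have wg: "cut \<Omega> w = w" if "(w, q) \<in> ?K" for w q
        using that weak_gradient_supports(1)[OF _ S] by (auto simp: admissible_def)
      have eU: "sl U t = sl U' t" unfolding U_def using elim(2) t wg[OF K] by simp
      have eD: "sl D t = cut \<Omega> (sl D' t)" unfolding D_def using elim(3) t by simp
      \<comment> \<open>At such a time the slices of \<open>D\<close> and \<open>D'\<close> differ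
        only off \<Omega>, where \<open>w - sl U t\<close> vanishes.\<close>
      have "inner (sl D t) (w - sl U t) = inner (sl D' t) (w - sl U' t)" if "(w, q) \<in> ?K" for w q
        unfolding eU eD inner_cut_commute[OF Sb(1)]
        using wg[OF that] wg[OF K] by (simp add: linear_diff[OF bounded_linear.linear[OF bounded_linear_cut[OF Sb(1)]]])
      then show "(sl U t, sl P t) \<in> ?K \<and> (norm (sl P t))\<^sup>2 \<le> M \<and> (norm (sl U t - a0))\<^sup>2 \<le> M * t \<and>
        (\<forall>w q. (w, q) \<in> ?K \<longrightarrow> inner (sl F t - sl D t) (w - sl U t) \<le> inner (sl P t) (q - sl P t))"
        using elim(1) t unfolding eU by (simp add: inner_diff_left)
    qed
  qed
  have "hilbert_solution \<Omega> T F a0 U D"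
    unfolding hilbert_solution_def
  proof (intro conjI cU wUD allI impI)
    fix e :: real assume e: "e > 0"
    \<comment> \<open>From the Hoelder bound \<open>M * t\<close>; the summand 1 keeps the divisor
      positive and makes the final inequality strict.\<close>
    define \<delta> where "\<delta> = e / (\<bar>M\<bar> + 1)"
    have \<delta>: "\<delta> > 0" using e by (simp add: \<delta>_def)
    have "AE t in lborel. t \<in> {0<..<T} \<longrightarrow> t < \<delta> \<longrightarrow> (norm (sl U t - a0))\<^sup>2 < e"
      using sol
    proof eventually_elim
      case (elim t)
      show ?case
      proof (intro impI)
        assume t: "t \<in> {0<..<T}" "t < \<delta>"
        have "(norm (sl U t - a0))\<^sup>2 \<le> M * t" using elim t(1) by blast
        also have "\<dots> \<le> (\<bar>M\<bar> + 1) * t" using t(1) by (intro mult_right_mono) auto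
        also have "\<dots> < (\<bar>M\<bar> + 1) * \<delta>" using t(2) by (intro mult_strict_left_mono) auto
        also have "\<dots> = e" by (simp add: \<delta>_def)
        finally show "(norm (sl U t - a0))\<^sup>2 < e" .
      qed
    qed
    then show "\<exists>\<delta>>0. AE t in lborel. t \<in> {0<..<T} \<longrightarrow> t < \<delta> \<longrightarrow> (norm (sl U t - a0))\<^sup>2 < e" using \<delta> by blast
  next
    show "AE t in lborel. t \<in> {0<..<T} \<longrightarrow> (\<exists>p. (sl U t, p) \<in> ?K \<and>
        (\<forall>w q. (w, q) \<in> ?K \<longrightarrow> inner (sl F t - sl D t) (w - sl U t) \<le> inner p (q - p)))"
      using sol by eventually_elim blast
  qed
  then have hs: "hilbert_solution \<Omega> T F a0 U D" and vi: "vi_solution \<Omega> T f u0 u"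
    using vi_solution_iff[OF S F a0(2) ru rd wUD] by auto
  have uniq: "AE z in lebesgue_on (cyl \<Omega> T). w z = u z" if w: "vi_solution \<Omega> T f u0 w" for w
  proof -
    obtain W E where W: "represents ?Q W w" "hilbert_solution \<Omega> T F a0 W E"
      using vi_solution_represented[OF S F a0(2) w] by blast
    have "W = U" by (rule hilbert_solution_unique[OF S W(2) hs])
    then show ?thesis
      unfolding cyl_def AE_lebesgue_on_iff[OF Q] using conjunct1[OF W(1)[unfolded represents_def]]
      by (auto simp: u_def elim!: eventually_mono)
  qed
  have H1: "H1_L2 \<Omega> T u" using vi by (simp add: vi_solution_def)
  have wsp: "weakd ?Q (b, 0) U (cut ?Q (app (dirL b) P))" if b: "b \<in> Basis" for b
  proof (rule weakd_cut[OF Q weakd_from_slices])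
    show "AE t in lborel. t \<in> {0<..<T} \<longrightarrow> weakd \<Omega> b (sl U t) (sl (app (dirL b) P) t)"
      using sol sl_app[OF bounded_linear_dirL, of b P]
      by eventually_elim (use b in \<open>auto simp: admissible_def weak_gradients_def\<close>)
  qed
  have Linf: "Linf_H1 \<Omega> T u"
    unfolding Linf_H1_def cyl_def
  proof (intro conjI allI ballI)
    fix i show "L2 ?Q (\<lambda>z. u z $ i)" using L2_iff_represents[OF Q] represents_coord[OF ru] by blast
    fix b :: 'a assume b: "b \<in> Basis"
    let ?V = "coord i (cut ?Q (app (dirL b) P))"
    have "cut ?Q ?V = ?V" by (rule cut_coord[OF Q cut_cut[OF Sb(3)]])
    then have rV: "represents ?Q ?V (fn ?V)" using represents_cut[OF Q, of ?V] by simp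
    have "weakd ?Q (b, 0) (coord i U) ?V" using wsp[OF b] by (simp add: weakd_iff_coord)
    then have "weak_pd ?Q (b, 0) (\<lambda>z. u z $ i) (fn ?V)" using weak_pd_iff_weakd[OF Q represents_coord[OF ru] rV] by simp
    then show "\<exists>G. L2 ?Q G \<and> weak_pd ?Q (b, 0) (\<lambda>z. u z $ i) G" using L2_iff_represents[OF Q] rV by blast
  next
    \<comment> \<open>The function contributes at most the measure of \<Omega>, its values having
      norm at most 1, and the gradient at most the energy bound \<open>M\<close>.\<close>
    have "AE t in lborel. t \<in> {0<..<T} \<longrightarrow> (\<forall>i. H1 \<Omega> (\<lambda>x. u (x, t) $ i) \<and> H1norm2 \<Omega> (\<lambda>x. u (x, t) $ i) \<le> measure lborel \<Omega> + M)"
      using sol represents_slice[OF ru]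
    proof eventually_elim
      case (elim t)
      show ?case
      proof (intro impI allI conjI)
        fix i assume t: "t \<in> {0<..<T}"
        have K: "(sl U t, sl P t) \<in> ?K" "(norm (sl P t))\<^sup>2 \<le> M" and r: "represents \<Omega> (sl U t) (\<lambda>x. u (x, t))"
          using elim t by auto
        have wg: "(sl U t, sl P t) \<in> weak_gradients \<Omega>" using K(1) by (simp add: admissible_def)
        show "H1 \<Omega> (\<lambda>x. u (x, t) $ i)" by (rule weak_gradient_H1(1)[OF S wg r])
        have "(norm (sl U t))\<^sup>2 \<le> (sqrt (measure lborel \<Omega>))\<^sup>2" using bd[OF K(1)] by (intro power_mono) auto
        then have "(norm (sl U t))\<^sup>2 \<le> measure lborel \<Omega>" by simp
        then show "H1norm2 \<Omega> (\<lambda>x. u (x, t) $ i) \<le> measure lborel \<Omega> + M"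
          using weak_gradient_H1(2)[OF S wg r, of i] K(2) by linarith
      qed
    qed
    moreover have I: "open {0<..<T}" by simp
    ultimately show "\<exists>C. AE t in lebesgue_on {0<..<T}. \<forall>i. H1 \<Omega> (\<lambda>x. u (x, t) $ i) \<and> H1norm2 \<Omega> (\<lambda>x. u (x, t) $ i) \<le> C"
      unfolding AE_lebesgue_on_iff[OF I] by blast
  qed
  have vi': "AE t in lborel. t \<in> {0<..<T} \<longrightarrow> (sl U t, sl P t) \<in> ?K \<and>
        (\<forall>w q. (w, q) \<in> ?K \<longrightarrow> inner (sl F t - sl D t) (w - sl U t) \<le> inner (sl P t) (q - sl P t))"
    using sol by eventually_elim blast
  obtain H where H: "\<And>\<Phi>. vtest ?Q \<Phi> \<Longrightarrow>
     inner D (mk \<Phi>) + (\<Sum>b\<in>Basis. inner (app (dirL b) P) (mk (vpd \<Phi> (b, 0)))) = inner H (mk \<Phi>)"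
    using heat_functional_represented[OF S vi'] by blast
  have heat: "heat_L2 \<Omega> T u"
    unfolding heat_L2_def cyl_def
  proof
    fix i
    let ?e = "axis i 1 :: real^'m"
    let ?H = "coord i (cut ?Q H)"
    have e: "?e \<in> Basis" by (simp add: axis_in_Basis_iff)
    have "cut ?Q ?H = ?H" by (rule cut_coord[OF Q cut_cut[OF Sb(3)]])
    then have rH: "represents ?Q ?H (fn ?H)" using represents_cut[OF Q, of ?H] by simp
    have cf: "(LINT z|lebesgue_on ?Q. h z * \<phi> z) = inner W (mk (\<lambda>z. \<phi> z *\<^sub>R ?e))"
      if h: "represents ?Q (coord i W) h" and t: "test_fun ?Q \<phi>" for W h \<phi>
    proof -
      have "(LINT z|lebesgue_on ?Q. h z * \<phi> z) = inner (coord i W) (mk \<phi>)"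
        using represents_inner[OF Q h represents_test_fun[OF t]] by simp
      also have "\<dots> = (LINT z|lborel. fn (coord i W) z * \<phi> z)" using inner_mk_right[OF test_fun_sq_int[OF t], of "coord i W"] by simp
      also have "\<dots> = (LINT z|lborel. inner (fn W z) (\<phi> z *\<^sub>R ?e))"
      proof (rule integral_cong_AE)
        show "AE z in lborel. fn (coord i W) z * \<phi> z = inner (fn W z) (\<phi> z *\<^sub>R ?e)"
          using fn_coord[of i W] by eventually_elim (simp add: inner_axis mult.commute)
      qed (use test_fun_measurable[OF t] in simp_all)
      also have "\<dots> = inner W (mk (\<lambda>z. \<phi> z *\<^sub>R ?e))"
        by (rule inner_mk_right[OF vtest_sq_int[OF vtest_axis(1)[OF t e]], symmetric])
      finally show ?thesis .
    qed
    have "(LINT z|lebesgue_on ?Q. u z $ i * (- pd \<phi> (0, 1) z - (\<Sum>b\<in>Basis. pd (\<lambda>w. pd \<phi> (b, 0) w) (b, 0) z)))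
         = (LINT z|lebesgue_on ?Q. fn ?H z * \<phi> z)" if t: "test_fun ?Q \<phi>" for \<phi>
    proof -
      \<comment> \<open>The scalar test function is placed in the i-th component, which reduces the
        componentwise claim to the vector-valued functional represented by \<open>H\<close>.\<close>
      define \<Phi> where "\<Phi> = (\<lambda>z. \<phi> z *\<^sub>R ?e)"
      have vt: "vtest ?Q \<Phi>" unfolding \<Phi>_def by (rule vtest_axis(1)[OF t e])
      have v1: "vpd \<Phi> d = (\<lambda>z. pd \<phi> d z *\<^sub>R ?e)" for d unfolding \<Phi>_def by (rule vtest_axis(2)[OF t e])
      have v2: "vpd (vpd \<Phi> d) d = (\<lambda>z. pd (pd \<phi> d) d z *\<^sub>R ?e)" for d unfolding v1 by (rule vtest_axis(2)[OF test_fun_pd[OF t] e])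
      define \<psi> where "\<psi> = (\<lambda>z. - pd \<phi> (0, 1) z - (\<Sum>b\<in>Basis. pd (pd \<phi> (b, 0)) (b, 0) z))"
      have t1: "test_fun ?Q (\<lambda>z. \<Sum>b\<in>B. pd (pd \<phi> (b, 0)) (b, 0) z)" if "finite B" for B
        using that by (induction B) (auto intro!: test_fun_add test_fun_pd t test_fun_const0)
      have t\<psi>: "test_fun ?Q \<psi>"
        using test_fun_add[OF test_fun_cmult[OF test_fun_pd[OF t, of "(0, 1)"], of "-1"] test_fun_cmult[OF t1[OF finite_Basis], of "-1"]]
        by (simp add: \<psi>_def)
      have sq: "sq_int (vpd \<Phi> d)" "sq_int (vpd (vpd \<Phi> d) d)" for d
        using vtest_sq_int[OF vtest_vpd[OF vt]] vtest_sq_int[OF vtest_vpd[OF vtest_vpd[OF vt]]] by auto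
      have sqs: "sq_int (\<lambda>z. \<Sum>b\<in>Basis. vpd (vpd \<Phi> (b, 0)) (b, 0) z)" by (rule sq_int_sum) (rule sq(2))
      have "(\<lambda>z. \<psi> z *\<^sub>R ?e) = (\<lambda>z. (-1) *\<^sub>R vpd \<Phi> (0, 1) z - (\<Sum>b\<in>Basis. vpd (vpd \<Phi> (b, 0)) (b, 0) z))"
        by (rule ext) (simp only: v1 v2[unfolded v1] \<psi>_def scaleR_diff_left scaleR_sum_left scaleR_minus_left scaleR_one)
      then have "mk (\<lambda>z. \<psi> z *\<^sub>R ?e) = - mk (vpd \<Phi> (0, 1)) - (\<Sum>b\<in>Basis. mk (vpd (vpd \<Phi> (b, 0)) (b, 0)))"
        using mk_diff[OF sq_int_scaleR[OF sq(1), of "-1"] sqs] mk_scaleR[OF sq(1), of "-1"] mk_sum[OF finite_Basis sq(2)] by simp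
      \<comment> \<open>The time derivative and one of the two spatial derivatives move from \<Phi>
        onto \<open>U\<close>; what remains is precisely the weak form of D - Laplace U.\<close>
      then have "inner U (mk (\<lambda>z. \<psi> z *\<^sub>R ?e)) = - inner U (mk (vpd \<Phi> (0, 1))) - (\<Sum>b\<in>Basis. inner U (mk (vpd (vpd \<Phi> (b, 0)) (b, 0))))"
        by (simp add: inner_diff_right inner_sum_right)
      also have "\<dots> = inner D (mk \<Phi>) + (\<Sum>b\<in>Basis. inner (app (dirL b) P) (mk (vpd \<Phi> (b, 0))))"
      proof -
        have "inner U (mk (vpd (vpd \<Phi> (b, 0)) (b, 0))) = - inner (app (dirL b) P) (mk (vpd \<Phi> (b, 0)))" if b: "b \<in> Basis" for b
        proof -
          have vb: "vtest ?Q (vpd \<Phi> (b, 0))" by (rule vtest_vpd[OF vt])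
          have "inner U (mk (vpd (vpd \<Phi> (b, 0)) (b, 0))) = - inner (cut ?Q (app (dirL b) P)) (mk (vpd \<Phi> (b, 0)))"
            using wsp[OF b] vb by (simp add: weakd_def)
          also have "inner (cut ?Q (app (dirL b) P)) (mk (vpd \<Phi> (b, 0))) = inner (app (dirL b) P) (cut ?Q (mk (vpd \<Phi> (b, 0))))"
            by (rule inner_cut_commute[OF Sb(3)])
          also have "cut ?Q (mk (vpd \<Phi> (b, 0))) = mk (vpd \<Phi> (b, 0))" by (rule cut_eq_self[OF Sb(3) mk_vtest_support[OF vb]])
          finally show ?thesis .
        qed
        then show ?thesis using wUD vt by (simp add: weakd_def sum_negf)
      qed
      also have "\<dots> = inner H (mk \<Phi>)" by (rule H[OF vt])
      also have "\<dots> = inner (cut ?Q H) (mk \<Phi>)"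
        using inner_cut_commute[OF Sb(3), of H "mk \<Phi>"] cut_eq_self[OF Sb(3) mk_vtest_support[OF vt]] by simp
      finally have "inner U (mk (\<lambda>z. \<psi> z *\<^sub>R ?e)) = inner (cut ?Q H) (mk (\<lambda>z. \<phi> z *\<^sub>R ?e))" by (simp add: \<Phi>_def)
      then show ?thesis using cf[OF represents_coord[OF ru] t\<psi>] cf[OF rH t] by (simp add: \<psi>_def)
    qed
    then show "\<exists>G. L2 ?Q G \<and> (\<forall>\<phi>. test_fun ?Q \<phi> \<longrightarrow>
         (LINT z|lebesgue_on ?Q. u z $ i * (- pd \<phi> (0, 1) z - (\<Sum>b\<in>Basis. pd (\<lambda>w. pd \<phi> (b, 0) w) (b, 0) z)))
         = (LINT z|lebesgue_on ?Q. G z * \<phi> z))"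
      using L2_iff_represents[OF Q] rH by blast
  qed
  show ?thesis using vi uniq H1 Linf heat by blast
qed

end
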